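(* Let $n\ge2$, let $M=S^n$ be the unit sphere with the round metric, let $0<\theta<|M|$, and let $0<\gamma<\gamma_{\mathrm{crit}}$. Let $\mathfrak{A}=\{\Omega\subset M:\chi_\Omega\in BV(M),\ |\Omega|=\theta\}$. Then, as $\varepsilon\to0$, the (volume-constrained) energies $E_{\gamma,\varepsilon}$ $\Gamma$-converge in the $L^1$ topology to $$E_{\gamma,0}(\Omega)=\begin{cases}\left(1-\frac{\gamma}{\gamma_{\mathrm{crit}}}\right)\operatorname{Per}(\Omega)&\text{if }\Omega\in\mathfrak{A},\\+\infty&\text{else.}\end{cases}$$ More precisely: (Liminf inequality) For every measurable $\Omega\subset M$ and every sequence of measurable sets $\Omega_\varepsilon\subset M$ such that $|\Omega\bigtriangleup\Omega_\varepsilon|\to0$ we have $E_{\gamma,0}(\Omega)\le\liminf_{\varepsilon\to0}E_{\gamma,\varepsilon}(\Omega_\varepsilon)$. (Limsup inequality) For every measurable $\Omega\subset M$ there exists a sequence of measurable sets $\Omega_\varepsilon\subset M$ such that $|\Omega\bigtriangleup\Omega_\varepsilon|\to0$ and $E_{\gamma,0}(\Omega)\ge\limsup_{\varepsilon\to0}E_{\gamma,\varepsilon}(\Omega_\varepsilon)$.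
   Context: $M=S^n$ has geodesic distance $d$, Riemannian volume $dx$ (also written $|\cdot|$), and Laplace–Beltrami operator $\Delta$; $\bigtriangleup$ between sets is the symmetric difference. For $f\in L^1(M)$, $V[f]=\sup\{\int_M f\operatorname{div}(X)\,dx: X$ a smooth vector field with $\|X(x)\|_{g_x}\le1$ for all $x\in M\}$; $BV(M)=\{f\in L^1(M):V[f]<\infty\}$, and $\operatorname{Per}(\Omega)=V[\chi_\Omega]$ if $\chi_\Omega\in BV(M)$. For $\varepsilon>0$, $K_\varepsilon:M\times M\to\mathbb{R}$ is the Helmholtz kernel, i.e. the unique distributional solution of $K_\varepsilon(\cdot,y)-\varepsilon^2\Delta K_\varepsilon(\cdot,y)=\delta_y$ in $M$ for each $y\in M$; it is smooth outside the diagonal. For $\gamma,\varepsilon>0$, $$E_{\gamma,\varepsilon}(\Omega)=\begin{cases}\operatorname{Per}(\Omega)-\frac{\gamma}{\varepsilon}\int_{M\times M}K_\varepsilon(x,y)|\chi_\Omega(x)-\chi_\Omega(y)|\,dx\,dy&\text{if }\Omega\in\mathfrak{A},\\+\infty&\text{otherwise.}\end{cases}$$ Let $\sigma_k$ be the $k$-dimensional volume of the Euclidean unit sphere $S^k$ and $k_n=\frac{2}{n-1}\frac{\sigma_{n-2}}{\sigma_{n-1}}$. Set $\frac1{\gamma_\varepsilon}=k_n\int_M\frac{d(x,y)}{\varepsilon}K_\varepsilon(x,y)\,dx$ (for some $y\in M$; the value does not depend on $y$) and $\gamma_{\mathrm{crit}}=\lim_{\varepsilon\to0}\gamma_\varepsilon$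 (this limit exists and lies in $(0,\infty)$). *)

theory Defs
  imports "HOL-Analysis.Analysis"
begin

text \<open>
  The manifold is the unit sphere \<open>S\<^sup>n = sphere 0 1\<close> of \<open>\<real>\<^sup>n \<times> \<real>\<close>, \<open>n = CARD('n)\<close>, with the metric
  induced by the inner product.  Functions and vector fields on it are total functions on the
  ambient space; only their values on the sphere matter.
\<close>

subsection \<open>Riemannian volume\<close>

definition gram :: "(real^'n \<Rightarrow> 'a::euclidean_space) \<Rightarrow> real^'n \<Rightarrow> real^'n^'n" where
  "gram \<phi> u = (\<chi> i j. frechet_derivative \<phi> (at u) (axis i 1) \<bullet> frechet_derivative \<phi> (at u) (axis j 1))"

definition stereo :: "real^'n \<Rightarrow> (real^'n) \<times> real" where
  "stereo u = ((2 / (1 + u \<bullet> u)) *\<^sub>R u, (u \<bullet> u - 1) / (1 + u \<bullet> u))"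

lemma range_stereo: "range stereo = sphere (0 :: (real^'n) \<times> real) 1 - {(0, 1)}"
proof (intro equalityI subsetI)
  fix p :: "(real^'n) \<times> real" assume "p \<in> range stereo"
  then obtain u :: "real^'n" where p: "p = stereo u" by auto
  have pos: "1 + u \<bullet> u > 0" by (simp add: add_pos_nonneg)
  have "p \<bullet> p = (4 * (u \<bullet> u) + (u \<bullet> u - 1)\<^sup>2) / (1 + u \<bullet> u)\<^sup>2"
    by (simp add: p stereo_def inner_prod_def power2_eq_square add_divide_distrib)
  also have "4 * (u \<bullet> u) + (u \<bullet> u - 1)\<^sup>2 = (1 + u \<bullet> u)\<^sup>2"
    by (simp add: power2_eq_square algebra_simps)
  finally have "p \<bullet> p = 1" using pos by simp
  moreover have "p \<noteq> (0, 1)" using pos by (auto simp: p stereo_def field_simps)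
  ultimately show "p \<in> sphere 0 1 - {(0, 1)}" by (simp add: norm_eq_1)
next
  fix p :: "(real^'n) \<times> real" assume "p \<in> sphere 0 1 - {(0, 1)}"
  then obtain v s where p: "p = (v, s)" and vs: "v \<bullet> v + s\<^sup>2 = 1" and ne: "(v, s) \<noteq> (0, 1)"
    by (cases p) (auto simp: norm_eq_1 inner_prod_def power2_eq_square)
  have s: "s \<noteq> 1" using vs ne by auto
  define u where "u = (1 / (1 - s)) *\<^sub>R v"
  have "u \<bullet> u = (1 - s\<^sup>2) / (1 - s)\<^sup>2"
    using vs by (simp add: u_def power2_eq_square eq_diff_eq)
  also have "1 - s\<^sup>2 = (1 + s) * (1 - s)"
    by (simp add: power2_eq_square algebra_simps)
  also have "(1 + s) * (1 - s) / (1 - s)\<^sup>2 = (1 + s) / (1 - s)"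
    using s by (simp add: power2_eq_square)
  finally have uu: "u \<bullet> u = (1 + s) / (1 - s)" .
  have "1 + u \<bullet> u = 2 / (1 - s)" "u \<bullet> u - 1 = 2 * s / (1 - s)"
    using s by (simp_all add: uu field_simps)
  then have "stereo u = p" using s by (simp add: stereo_def p u_def)
  then show "p \<in> range stereo" by (metis rangeI)
qed

lemma gram_stereo:
  fixes u :: "real^'n"
  shows "gram stereo u = mat ((2 / (1 + u \<bullet> u))\<^sup>2)"
proof -
  define c where "c = 1 + u \<bullet> u"
  have "c > 0" by (simp add: c_def add_pos_nonneg)
  then have c: "c \<noteq> 0" "1 + u \<bullet> u \<noteq> 0" by (auto simp: c_def)
  define D :: "real^'n \<Rightarrow> (real^'n) \<times> real" where
    "D h = ((2 / c) *\<^sub>R h - (4 * (u \<bullet> h) / c\<^sup>2) *\<^sub>R u, 4 * (u \<bullet> h) / c\<^sup>2)" for h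
  have "(stereo has_derivative
      (\<lambda>h. ((2 / c) *\<^sub>R h + (- (2 * (u \<bullet> h + h \<bullet> u)) / c\<^sup>2) *\<^sub>R u,
           ((u \<bullet> h + h \<bullet> u) * c - (u \<bullet> u - 1) * (u \<bullet> h + h \<bullet> u)) / c\<^sup>2))) (at u)"
    unfolding stereo_def[abs_def] c_def
    by (rule has_derivative_eq_rhs)
      (use c in \<open>auto intro!: derivative_eq_intros simp: fun_eq_iff power2_eq_square field_simps\<close>)
  also have "(\<lambda>h. ((2 / c) *\<^sub>R h + (- (2 * (u \<bullet> h + h \<bullet> u)) / c\<^sup>2) *\<^sub>R u,
           ((u \<bullet> h + h \<bullet> u) * c - (u \<bullet> u - 1) * (u \<bullet> h + h \<bullet> u)) / c\<^sup>2)) = D"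
    by (simp add: D_def fun_eq_iff inner_commute c_def algebra_simps)
  finally have fd: "frechet_derivative stereo (at u) = D"
    by (metis frechet_derivative_at)
  have "D h \<bullet> D k = (2 / c)\<^sup>2 * (h \<bullet> k)" for h k
  proof -
    have "D h \<bullet> D k = (2 / c)\<^sup>2 * (h \<bullet> k)
        + 16 * (u \<bullet> h) * (u \<bullet> k) / c ^ 4 * (1 + u \<bullet> u - c)"
      using c(1) unfolding D_def
      by (simp add: inner_diff_left inner_diff_right inner_commute field_simps eval_nat_numeral)
    then show ?thesis by (simp add: c_def)
  qed
  then show ?thesis
    by (simp add: gram_def fd c_def mat_def vec_eq_iff inner_axis_axis)
qed

text \<open>
  The chart \<^const>\<open>stereo\<close> covers the sphere up to one point, so the Riemannian volume is the image
  of \<open>\<surd>det (g\<^sub>i\<^sub>j) du\<close> under it.  The completion makes the measurable sets the Lebesgue ones.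
\<close>

definition sphere_vol :: "((real^'n) \<times> real) measure" where
  "sphere_vol = completion
     (distr (density lborel (\<lambda>u. ennreal (sqrt (det (gram stereo u)))))
            (restrict_space borel (sphere 0 1)) stereo)"

subsection \<open>Geodesic distance\<close>

text \<open>
  Infimum of the lengths of \<open>C\<^sup>1\<close> curves.  The curves are \<open>C\<^sup>1\<close> up to the end points:
  \<open>piecewise_C1_differentiable_on\<close> does not bound the derivative near break points, and the integral
  of a non-integrable speed is \<open>0\<close> by convention.
\<close>

definition geod_dist :: "'a::euclidean_space \<Rightarrow> 'a \<Rightarrow> real" where
  "geod_dist x y = Inf {integral {0..1} (\<lambda>t. norm (vector_derivative c (at t))) | c.
     c C1_differentiable_on {0..1} \<and> path_image c \<subseteq> sphere 0 1 \<and> pathstart c = x \<and> pathfinish c = y}"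

subsection \<open>Differential calculus on the sphere\<close>

fun Ck_on :: "nat \<Rightarrow> 'a::real_normed_vector set \<Rightarrow> ('a \<Rightarrow> 'b::real_normed_vector) \<Rightarrow> bool" where
  "Ck_on 0 S f \<longleftrightarrow> continuous_on S f"
| "Ck_on (Suc k) S f \<longleftrightarrow> (\<forall>x\<in>S. f differentiable (at x)) \<and>
     (\<forall>v. Ck_on k S (\<lambda>x. frechet_derivative f (at x) v))"

definition smooth_on :: "'a::real_normed_vector set \<Rightarrow> ('a \<Rightarrow> 'b::real_normed_vector) \<Rightarrow> bool" where
  "smooth_on S f \<longleftrightarrow> (\<forall>k. Ck_on k S f)"

text \<open>
  A function on the sphere is differentiated through its extension constant along rays: for tangent
  \<open>v\<close>, \<open>sphere_deriv f x v\<close> is the derivative at \<open>t = 0\<close> of \<open>f\<close> along the curve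
  \<open>(x + t v) / |x + t v|\<close> on the sphere, which has velocity \<open>v\<close>; for radial \<open>v\<close> it is \<open>0\<close>.
\<close>

definition radial_ext :: "('a::euclidean_space \<Rightarrow> 'b) \<Rightarrow> 'a \<Rightarrow> 'b" where
  "radial_ext f z = f (z /\<^sub>R norm z)"

definition smooth_sphere :: "('a::euclidean_space \<Rightarrow> 'b::real_normed_vector) \<Rightarrow> bool" where
  "smooth_sphere f \<longleftrightarrow> smooth_on (- {0}) (radial_ext f)"

definition sphere_deriv :: "('a::euclidean_space \<Rightarrow> 'b::real_normed_vector) \<Rightarrow> 'a \<Rightarrow> 'a \<Rightarrow> 'b" where
  "sphere_deriv f x = frechet_derivative (radial_ext f) (at x)"

definition smooth_vector_field :: "('a::euclidean_space \<Rightarrow> 'a) \<Rightarrow> bool" where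
  "smooth_vector_field X \<longleftrightarrow> smooth_sphere X \<and> (\<forall>x\<in>sphere 0 1. X x \<bullet> x = 0)"

text \<open>The gradient is the tangent vector representing the differential.\<close>

definition sphere_grad :: "('a::euclidean_space \<Rightarrow> real) \<Rightarrow> 'a \<Rightarrow> 'a" where
  "sphere_grad f x = (\<Sum>b\<in>Basis. sphere_deriv f x b *\<^sub>R b)"

text \<open>
  The Levi-Civita connection of the induced metric: tangential part of the ambient derivative.
  The divergence is the trace of \<open>v \<mapsto> \<nabla>\<^sub>v X\<close> on the tangent space; the radial direction
  contributes \<open>0\<close>, so the trace may be taken over the ambient space.
\<close>

definition cov_deriv :: "('a::euclidean_space \<Rightarrow> 'a) \<Rightarrow> 'a \<Rightarrow> 'a \<Rightarrow> 'a" where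
  "cov_deriv X x v = sphere_deriv X x v - (sphere_deriv X x v \<bullet> x) *\<^sub>R x"

definition sphere_div :: "('a::euclidean_space \<Rightarrow> 'a) \<Rightarrow> 'a \<Rightarrow> real" where
  "sphere_div X x = (\<Sum>b\<in>Basis. cov_deriv X x b \<bullet> b)"

definition laplace_beltrami :: "('a::euclidean_space \<Rightarrow> real) \<Rightarrow> 'a \<Rightarrow> real" where
  "laplace_beltrami f = sphere_div (sphere_grad f)"

subsection \<open>Functions of bounded variation and perimeter\<close>

definition variation :: "((real^'n) \<times> real \<Rightarrow> real) \<Rightarrow> ereal" where
  "variation f = (SUP X \<in> {X. smooth_vector_field X \<and> (\<forall>x\<in>sphere 0 1. norm (X x) \<le> 1)}.
     ereal (\<integral>x. f x * sphere_div X x \<partial>sphere_vol))"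

definition BV :: "((real^'n) \<times> real \<Rightarrow> real) set" where
  "BV = {f. integrable sphere_vol f \<and> variation f < \<infinity>}"

definition Per :: "((real^'n) \<times> real) set \<Rightarrow> ereal" where
  "Per \<Omega> = variation (indicator \<Omega>)"

definition admissible :: "real \<Rightarrow> ((real^'n) \<times> real) set set" where
  "admissible \<theta> = {\<Omega>. \<Omega> \<subseteq> sphere 0 1 \<and> indicator \<Omega> \<in> BV \<and> measure sphere_vol \<Omega> = \<theta>}"

subsection \<open>Helmholtz kernel and energies\<close>

text \<open>
  The distributional equation in \<open>x\<close>, tested against smooth functions.  It determines \<open>k\<close> up to null
  sets in \<open>x\<close>; smoothness off the diagonal fixes the values there.  The values on the diagonal, a null
  set, are left open.
\<close>

definition helmholtz_kernel ::
    "real \<Rightarrow> ((real^'n) \<times> real \<Rightarrow> (real^'n) \<times> real \<Rightarrow> real) \<Rightarrow> bool" where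
  "helmholtz_kernel \<epsilon> k \<longleftrightarrow>
     (\<forall>y\<in>sphere 0 1. integrable sphere_vol (\<lambda>x. k x y) \<and>
        (\<forall>\<phi>. smooth_sphere \<phi> \<longrightarrow>
           (\<integral>x. k x y * (\<phi> x - \<epsilon>\<^sup>2 * laplace_beltrami \<phi> x) \<partial>sphere_vol) = \<phi> y)) \<and>
     smooth_on {(x, y). x \<noteq> 0 \<and> y \<noteq> 0 \<and> x /\<^sub>R norm x \<noteq> y /\<^sub>R norm y}
       (\<lambda>(x, y). k (x /\<^sub>R norm x) (y /\<^sub>R norm y))"

definition energy ::
    "(real \<Rightarrow> (real^'n) \<times> real \<Rightarrow> (real^'n) \<times> real \<Rightarrow> real) \<Rightarrow> real \<Rightarrow> real \<Rightarrow> real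
      \<Rightarrow> ((real^'n) \<times> real) set \<Rightarrow> ereal" where
  "energy K \<theta> \<gamma> \<epsilon> \<Omega> =
     (if \<Omega> \<in> admissible \<theta> then
        Per \<Omega> - ereal (\<gamma> / \<epsilon> * (\<integral>(x, y). K \<epsilon> x y * \<bar>indicator \<Omega> x - indicator \<Omega> y\<bar>
                                   \<partial>(sphere_vol \<Otimes>\<^sub>M sphere_vol)))
      else \<infinity>)"

text \<open>\<open>\<sigma>\<^sub>k\<close>: the area of the unit sphere of \<open>\<real>\<^sup>m\<close> is \<open>m\<close> times the volume of its unit ball, \<open>m = k + 1\<close>.\<close>

definition sphere_area :: "nat \<Rightarrow> real" where
  "sphere_area k = real (k + 1) * unit_ball_vol (real (k + 1))"

definition k_const :: "nat \<Rightarrow> real" where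
  "k_const n = 2 / (real n - 1) * (sphere_area (n - 2) / sphere_area (n - 1))"

definition gamma_eps ::
    "(real \<Rightarrow> (real^'n) \<times> real \<Rightarrow> (real^'n) \<times> real \<Rightarrow> real) \<Rightarrow> real \<Rightarrow> real" where
  "gamma_eps K \<epsilon> = 1 / (k_const CARD('n) *
     (\<integral>x. geod_dist x (SOME y. y \<in> sphere 0 1) / \<epsilon> * K \<epsilon> x (SOME y. y \<in> sphere 0 1) \<partial>sphere_vol))"

definition gamma_crit ::
    "(real \<Rightarrow> (real^'n) \<times> real \<Rightarrow> (real^'n) \<times> real \<Rightarrow> real) \<Rightarrow> real" where
  "gamma_crit K = Lim (at_right 0) (gamma_eps K)"

definition limit_energy ::
    "(real \<Rightarrow> (real^'n) \<times> real \<Rightarrow> (real^'n) \<times> real \<Rightarrow> real) \<Rightarrow> real \<Rightarrow> real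
      \<Rightarrow> ((real^'n) \<times> real) set \<Rightarrow> ereal" where
  "limit_energy K \<theta> \<gamma> \<Omega> =
     (if \<Omega> \<in> admissible \<theta> then ereal (1 - \<gamma> / gamma_crit K) * Per \<Omega> else \<infinity>)"

end

theory Submission
 imports Defs "HOL-Probability.Probability" "HOL-Real_Asymp.Real_Asymp"
begin

text \<open>
 Averaging over the rotation group turns the nonlocal term into an average over \<open>r\<close> of the chord
 variation of \<open>\<Omega>\<close>: the mean of \<open>\<bar>\<chi>(x) - \<chi>(y)\<bar>\<close> over the pairs at geodesic distance \<open>r\<close>, weighted by the
 kernel, which is zonal and nonnegative. Integrating along geodesics, the chord variation is at most
 \<open>\<kappa> r V[\<chi>]\<close>, where \<open>\<kappa>\<close> is the mean of \<open>\<bar>\<theta> \<bullet> a\<bar>\<close> over unit tangent vectors and equals \<open>k_n\<close>; testing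
 with polynomial fields shows that the quotient by \<open>r\<close> tends to \<open>\<kappa> V[\<chi>]\<close> as \<open>r \<rightarrow> 0\<close>.
 Hence \<open>Per\<close> minus the nonlocal term is at least \<open>(1 - \<gamma>/\<gamma>\<^sub>\<epsilon>) Per\<close> for every \<open>\<epsilon>\<close>, so the liminf
 inequality follows from lower semicontinuity of the perimeter, and the constant sequence recovers the
 limit because the first moment of the kernel is of order \<open>\<epsilon>\<close> and concentrates at distance \<open>0\<close>.
\<close>

text \<open>The kernel is known only through its weak equation. Tested with polynomials in x
  \<bullet> z, the equation becomes a triangular system for moments: solvability gives uniqueness,
  hence rotation invariance, and a one-dimensional maximum principle gives the sign. The limit of
  \<open>gamma_eps\<close> needs the moment of order 1/2 of 1 - x \<bullet> y, which the equation
  does not yield; log-convexity squeezes it between integer moments, as in the Bohr-Mollerup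
  theorem. The variation sees only divergences of smooth tangent fields, so chord variations must be
  turned into divergences. A weight \<open>\<zeta>\<close> on the unit tangent bundle has a tangent
  field as its conditional mean. If \<open>\<zeta>\<close> is polynomial so is the field, and
  differentiating an integral of \<open>\<zeta>\<close> along the geodesic flow gives the divergence
  integral of that field. A weight bounded by 1 gives a field bounded by \<open>\<kappa>\<close>,
  and a weight near the sign of X \<bullet> v, v the direction, gives nearly \<kappa> X for unit X;
  hence the constant is sharp. Fields need to be approximated only in sup norm, since the variation
  bound controls divergence integrals by it.\<close>

abbreviation borel2 :: "('a::topological_space \<times> 'b::topological_space) measure" where
 "borel2 \<equiv> borel \<Otimes>\<^sub>M borel"

section \<open>Reflections and transitivity of the orthogonal group on pairs\<close>

definition reflect :: "'a::euclidean_space => 'a => 'a" where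
 "reflect a x = x - (2 * (x \<bullet> a) / (a \<bullet> a)) *\<^sub>R a"

lemma orthogonal_transformation_reflect: "orthogonal_transformation (reflect a)"
proof -
 have "linear (reflect a)"
  by (rule linearI) (simp_all add: reflect_def inner_add_left algebra_simps add_divide_distrib)
 moreover have "reflect a v \<bullet> reflect a w = v \<bullet> w" for v w
  by (cases "a = 0") (simp_all add: reflect_def inner_diff_left inner_diff_right inner_commute field_simps)
 ultimately show ?thesis by (simp add: orthogonal_transformation_def)
qed

lemma reflect_fixes: "x \<bullet> a = 0 ==> reflect a x = x"
 by (simp add: reflect_def)

lemma reflect_diff:
 assumes "norm x = norm y" shows "reflect (x - y) x = y"
proof (cases "x = y")
 case False
 have n: "x \<bullet> x = y \<bullet> y" using assms by (simp add: norm_eq)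
 have "2 * (x \<bullet> (x - y)) = (x - y) \<bullet> (x - y)"
  using n by (simp add: inner_diff_left inner_diff_right inner_commute)
 moreover have "(x - y) \<bullet> (x - y) \<noteq> 0" using False by simp
 ultimately have "2 * (x \<bullet> (x - y)) / ((x - y) \<bullet> (x - y)) = 1"
  by (metis divide_self)
 from this show ?thesis unfolding reflect_def by (simp only: scaleR_one) simp
qed (simp add: reflect_def)

text \<open>Two reflections suffice: one carries \<open>x\<close> to \<open>x'\<close>, the next
  swaps the image of \<open>y\<close> with \<open>y'\<close>. The second fixes \<open>x'\<close>,
  because equal inner products make \<open>x'\<close> orthogonal to the mirror normal.\<close>

lemma orthogonal_transformation_pair:
 fixes x y x' y' :: "'a::euclidean_space"
 assumes "norm x = norm x'" "norm y = norm y'" "x \<bullet> y = x' \<bullet> y'"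
 obtains h where "orthogonal_transformation h" "h x = x'" "h y = y'"
proof -
 define h1 where "h1 = reflect (x - x')"
 have h1: "orthogonal_transformation h1" "h1 x = x'"
  by (simp_all add: h1_def orthogonal_transformation_reflect reflect_diff assms(1))
 define z where "z = h1 y"
 have nz: "norm z = norm y'" using h1 assms(2) by (simp add: z_def orthogonal_transformation_norm)
 have "x' \<bullet> z = x' \<bullet> y'"
  using h1 assms(3) by (metis z_def orthogonal_transformation_def)
 then have "x' \<bullet> (z - y') = 0" by (simp add: inner_diff_right)
 then have "reflect (z - y') x' = x'" by (rule reflect_fixes)
 moreover have "reflect (z - y') z = y'" using nz by (rule reflect_diff)
 ultimately show ?thesis
  using h1 by (intro that[of "reflect (z - y') \<circ> h1"])
   (auto simp: z_def orthogonal_transformation_compose orthogonal_transformation_reflect)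
qed

lemma orthogonal_transformation_measurable:
 "orthogonal_transformation (h::'a::euclidean_space => 'a) ==> h \<in> borel_measurable borel"
 by (intro borel_measurable_continuous_onI linear_continuous_on linear_conv_bounded_linear[THEN iffD1]
   orthogonal_transformation_linear)

section \<open>Gram-Schmidt frames\<close>

text \<open>\<open>sgn\<close> normalises and sends 0 to 0, so the recursion is total on dependent
  tuples; those are excluded afterwards by \<open>gs_regular\<close>.\<close>

fun gram_schmidt :: "(nat => 'a::real_inner) => nat => 'a" where
 "gram_schmidt w k = sgn (w k - (\<Sum>i<k. (w k \<bullet> gram_schmidt w i) *\<^sub>R gram_schmidt w i))"

declare gram_schmidt.simps[simp del]

definition gs_residual :: "(nat => 'a::real_inner) => nat => 'a" where
 "gs_residual w k = w k - (\<Sum>i<k. (w k \<bullet> gram_schmidt w i) *\<^sub>R gram_schmidt w i)"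

lemma gram_schmidt_eq: "gram_schmidt w k = sgn (gs_residual w k)"
 by (subst gram_schmidt.simps) (simp add: gs_residual_def)

lemma gram_schmidt_cong:
 "(\<And>i. i \<le> k ==> w i = w' i) ==> gram_schmidt w k = gram_schmidt w' k"
proof (induction k rule: less_induct)
 case (less k)
 then have "gram_schmidt w i = gram_schmidt w' i" if "i < k" for i using that by auto
 then show ?case using less.prems[of k] by (subst (1 2) gram_schmidt.simps) simp
qed

lemma gram_schmidt_orthogonal_transformation:
 assumes h: "orthogonal_transformation h"
 shows "gram_schmidt (\<lambda>i. h (w i)) k = h (gram_schmidt w k)"
proof (induction k rule: less_induct)
 case (less k)
 have lin: "linear h" using h by (rule orthogonal_transformation_linear)
 have ip: "h a \<bullet> h b = a \<bullet> b" for a b using h by (simp add: orthogonal_transformation_def)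
 have sg: "sgn (h a) = h (sgn a)" for a
  using h by (simp add: sgn_div_norm orthogonal_transformation linear_scale)
 have "(\<Sum>i<k. (h (w k) \<bullet> gram_schmidt (\<lambda>i. h (w i)) i) *\<^sub>R gram_schmidt (\<lambda>i. h (w i)) i)
   = h (\<Sum>i<k. (w k \<bullet> gram_schmidt w i) *\<^sub>R gram_schmidt w i)"
  using less by (simp add: linear_sum[OF lin] ip linear_scale[OF lin])
 then show ?case
  by (subst (1 2) gram_schmidt.simps) (simp add: sg linear_diff[OF lin, symmetric])
qed

lemma gs_residual_orthogonal_transformation:
 assumes h: "orthogonal_transformation h"
 shows "gs_residual (\<lambda>i. h (w i)) k = h (gs_residual w k)"
 using h orthogonal_transformation_linear[OF h]
 by (simp add: gs_residual_def gram_schmidt_orthogonal_transformation linear_sum linear_diff linear_scale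
    orthogonal_transformation_def)

lemma gram_schmidt_orthonormal:
 assumes "\<And>i. i < n ==> gs_residual w i \<noteq> 0" "k < n"
 shows "\<forall>j\<le>k. gram_schmidt w k \<bullet> gram_schmidt w j = (if j = k then 1 else 0)"
 using assms(2)
proof (induction k rule: less_induct)
 case (less k)
 have *: "gram_schmidt w k \<bullet> gram_schmidt w j = 0" if "j < k" for j
 proof -
  have "gram_schmidt w i \<bullet> gram_schmidt w j = (if i = j then 1 else 0)" if "i < k" for i
  proof (cases "j \<le> i")
   case True then show ?thesis using less \<open>i < k\<close> by auto
  next
   case False then show ?thesis using less \<open>j < k\<close> by (subst inner_commute) auto
  qed
  then have "(\<Sum>i<k. (w k \<bullet> gram_schmidt w i) * (gram_schmidt w i \<bullet> gram_schmidt w j))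
    = (\<Sum>i<k. if i = j then w k \<bullet> gram_schmidt w j else 0)"
   by (intro sum.cong) auto
  also have "\<dots> = w k \<bullet> gram_schmidt w j" using that by simp
  finally have "gs_residual w k \<bullet> gram_schmidt w j = 0"
   by (simp add: gs_residual_def inner_diff_left inner_sum_left)
  then show ?thesis by (simp add: gram_schmidt_eq[of w k] sgn_div_norm)
 qed
 moreover have "norm (gram_schmidt w k) = 1"
  using assms(1) less.prems by (simp add: gram_schmidt_eq norm_sgn)
 ultimately show ?case by (auto simp: norm_eq_1 le_less)
qed

lemma gram_schmidt_in_span: "gram_schmidt w k \<in> span (w ` {..k})"
proof (induction k rule: less_induct)
 case (less k)
 have "gram_schmidt w i \<in> span (w ` {..k})" if "i < k" for i
  using less[OF that] that by (meson atMost_subset_iff image_mono less_imp_le span_mono subsetD)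
 then show ?case
  by (subst gram_schmidt.simps, simp add: sgn_div_norm)
    (auto intro!: span_scale span_diff span_sum intro: span_base)
qed

lemma gram_schmidt_measurable:
 assumes "n \<le> m" "\<And>i. i < n ==> (\<lambda>x. w x i) \<in> borel_measurable M"
 shows "k < n ==> (\<lambda>x. gram_schmidt (w x) k :: 'a::euclidean_space) \<in> borel_measurable M"
proof (induction k rule: less_induct)
 case (less k)
 have "(\<lambda>x. gs_residual (w x) k) \<in> borel_measurable M"
  using less assms unfolding gs_residual_def
  by (intro borel_measurable_diff borel_measurable_sum borel_measurable_scaleR borel_measurable_inner) auto
 then show ?case unfolding gram_schmidt_eq sgn_div_norm
  by measurable
qed

definition basis_enum :: "nat => 'a::euclidean_space" where
 "basis_enum = (SOME b. bij_betw b {..<DIM('a)} Basis)"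

lemma basis_enum: "bij_betw (basis_enum :: nat => 'a::euclidean_space) {..<DIM('a)} Basis"
proof -
 obtain b :: "nat => 'a" where "bij_betw b {0..<DIM('a)} Basis"
  using ex_bij_betw_nat_finite[OF finite_Basis[where 'a='a]] by blast
 then have "bij_betw b {..<DIM('a)} Basis" by (simp only: atLeast0LessThan)
 then show ?thesis unfolding basis_enum_def
  by (rule someI[where P = "\<lambda>b. bij_betw b {..<DIM('a)} (Basis :: 'a set)"])
qed

lemma basis_enum_inner:
 assumes "i < DIM('a)" "j < DIM('a)"
 shows "(basis_enum i :: 'a::euclidean_space) \<bullet> basis_enum j = (if i = j then 1 else 0)"
proof -
 have "basis_enum i \<in> (Basis :: 'a set)" "basis_enum j \<in> (Basis :: 'a set)"
  using basis_enum[where 'a='a] assms by (auto simp: bij_betw_def)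
 moreover have "(basis_enum i :: 'a) = basis_enum j \<longleftrightarrow> i = j"
  using basis_enum[where 'a='a] assms by (auto simp: bij_betw_def inj_on_def)
 ultimately show ?thesis by (simp add: inner_Basis)
qed

lemma sum_basis_enum:
 "(\<Sum>i<DIM('a). f (basis_enum i :: 'a::euclidean_space)) = (\<Sum>b\<in>Basis. f b)"
 by (rule sum.reindex_bij_betw[OF basis_enum])

text \<open>For a regular tuple this is the inverse, that is the transpose, of the matrix with
  columns \<open>gram_schmidt w i\<close>. With the inverse, moving the whole tuple by
  \<open>h\<close> acts on the frame map from the right, which is the invariance needed for
  functions of the images of fixed vectors.\<close>

definition gs_frame :: "(nat => 'a::euclidean_space) => 'a => 'a" where
 "gs_frame w x = (\<Sum>i<DIM('a). (gram_schmidt w i \<bullet> x) *\<^sub>R basis_enum i)"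

definition gs_regular :: "(nat => 'a::euclidean_space) => bool" where
 "gs_regular w \<longleftrightarrow> (\<forall>i<DIM('a). gs_residual w i \<noteq> 0)"

lemma orthogonal_transformation_gs_frame:
 fixes w :: "nat => 'a::euclidean_space"
 assumes "gs_regular w"
 shows "orthogonal_transformation (gs_frame w)"
proof -
 let ?n = "DIM('a)"
 \<comment> \<open>The transpose is an isometry directly by orthonormality. Being onto, it passes
   this property to its left inverse \<open>gs_frame w\<close>.\<close>
 define T where "T x = (\<Sum>i<?n. ((basis_enum i :: 'a) \<bullet> x) *\<^sub>R gram_schmidt w i)" for x
 have on: "gram_schmidt w i \<bullet> gram_schmidt w j = (if i = j then 1 else 0)" if "i < ?n" "j < ?n" for i j
  using gram_schmidt_orthonormal[of ?n w i] gram_schmidt_orthonormal[of ?n w j] that assms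
  by (cases "j \<le> i") (auto simp: gs_regular_def inner_commute)
 have gT: "gram_schmidt w i \<bullet> T x = basis_enum i \<bullet> x" if "i < ?n" for i x
  using that by (simp add: T_def inner_sum_right on if_distrib cong: if_cong)
 have "T x \<bullet> T y = x \<bullet> y" for x y
 proof -
  have "T x \<bullet> T y = (\<Sum>i<?n. (basis_enum i \<bullet> x) * (basis_enum i \<bullet> y))"
   by (subst T_def) (simp add: inner_sum_left gT)
  also have "\<dots> = x \<bullet> y"
   using sum_basis_enum[of "\<lambda>b. (b \<bullet> x) * (b \<bullet> y)"]
   by (simp add: euclidean_inner[of x y] inner_commute)
  finally show ?thesis .
 qed
 moreover have "linear T"
  by (rule linearI) (simp_all add: T_def inner_add_right scaleR_add_left sum.distrib scaleR_sum_right)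
 ultimately have T: "orthogonal_transformation T" by (simp add: orthogonal_transformation_def)
 have fT: "gs_frame w (T x) = x" for x
 proof -
  have "gs_frame w (T x) = (\<Sum>i<?n. (basis_enum i \<bullet> x) *\<^sub>R basis_enum i)"
   by (simp add: gs_frame_def gT)
  also have "\<dots> = x"
   using sum_basis_enum[of "\<lambda>b. (b \<bullet> x) *\<^sub>R b"] by (simp add: inner_commute[of _ x] euclidean_representation)
  finally show ?thesis .
 qed
 have "linear (gs_frame w)"
  by (rule linearI) (simp_all add: gs_frame_def inner_add_right scaleR_add_left sum.distrib scaleR_sum_right)
 moreover have "norm (gs_frame w y) = norm y" for y
 proof -
  obtain x where "y = T x" using orthogonal_transformation_surj[OF T] by (metis surjD)
  then show ?thesis using T by (simp add: fT orthogonal_transformation)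
 qed
 ultimately show ?thesis by (simp add: orthogonal_transformation)
qed

lemma gs_frame_equivariant:
 fixes w :: "nat => 'a::euclidean_space"
 assumes "orthogonal_transformation h" "\<And>i. i < DIM('a) ==> w' i = h (w i)"
 shows "gs_frame w' (h x) = gs_frame w x" "gs_regular w' \<longleftrightarrow> gs_regular w"
proof -
 let ?v = "\<lambda>i. h (w i)"
 have 1: "gram_schmidt w' i = h (gram_schmidt w i)" if "i < DIM('a)" for i
 proof -
  have "gram_schmidt w' i = gram_schmidt ?v i"
   using that assms(2) by (intro gram_schmidt_cong) auto
  then show ?thesis by (simp only: gram_schmidt_orthogonal_transformation[OF assms(1)])
 qed
 have ip: "h a \<bullet> h b = a \<bullet> b" for a b using assms(1) by (simp add: orthogonal_transformation_def)
 show "gs_frame w' (h x) = gs_frame w x"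
  unfolding gs_frame_def by (intro sum.cong) (simp_all add: 1 ip)
 have h0: "h v = 0 \<longleftrightarrow> v = 0" for v
  using assms(1) by (metis norm_eq_zero orthogonal_transformation)
 have "gs_residual w' i = gs_residual ?v i" if "i < DIM('a)" for i
  unfolding gs_residual_def using that assms(2)
  by (simp add: 1 gram_schmidt_orthogonal_transformation[OF assms(1)])
 then have "gs_residual w' i = 0 \<longleftrightarrow> gs_residual w i = 0" if "i < DIM('a)" for i
  using that by (simp add: gs_residual_orthogonal_transformation[OF assms(1)] h0)
 then show "gs_regular w' \<longleftrightarrow> gs_regular w" by (auto simp: gs_regular_def)
qed

text \<open>The linear map sending the basis to the tuple moves every x \<noteq> 0 by less than |x|,
  so it is injective and the tuple is independent. This yields an open set of regular tuples, enough
  for positive probability.\<close>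

lemma gs_regular_near_basis:
 fixes w :: "nat => 'a::euclidean_space"
 assumes "\<And>i. i < DIM('a) ==> norm (w i - basis_enum i) < 1 / DIM('a)"
 shows "gs_regular w"
 unfolding gs_regular_def
proof (intro allI impI notI)
 let ?n = "DIM('a)"
 fix k assume k: "k < ?n" and "gs_residual w k = 0"
 define T where "T x = (\<Sum>i<?n. ((basis_enum i :: 'a) \<bullet> x) *\<^sub>R w i)" for x
 have linT: "linear T"
  by (rule linearI) (simp_all add: T_def inner_add_right scaleR_add_left sum.distrib scaleR_sum_right)
 have Tb: "T (basis_enum i) = w i" if "i < ?n" for i
 proof -
  have "T (basis_enum i) = (\<Sum>j<?n. if j = i then w i else 0)"
   unfolding T_def using that by (intro sum.cong) (auto simp: basis_enum_inner)
  then show ?thesis using that by simp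
 qed
 have injT: "T x = 0 ==> x = 0" for x
 proof (rule ccontr)
  assume T0: "T x = 0" and x: "x \<noteq> 0"
  have "x = (\<Sum>i<?n. (basis_enum i \<bullet> x) *\<^sub>R basis_enum i)"
   using sum_basis_enum[of "\<lambda>b. (b \<bullet> x) *\<^sub>R b"] by (simp add: inner_commute[of _ x] euclidean_representation)
  then have "x = x - T x" using T0 by simp
  also have "x - T x = (\<Sum>i<?n. (basis_enum i \<bullet> x) *\<^sub>R (basis_enum i - w i))"
   by (subst \<open>x = (\<Sum>i<?n. (basis_enum i \<bullet> x) *\<^sub>R basis_enum i)\<close>)
    (simp add: T_def scaleR_diff_right sum_subtractf)
  finally have "norm x \<le> (\<Sum>i<?n. \<bar>basis_enum i \<bullet> x\<bar> * norm (basis_enum i - w i))"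
   by (metis (no_types, lifting) norm_scaleR norm_sum sum.cong order.trans sum_norm_le)
  also have "\<dots> < (\<Sum>i<?n. norm x * (1 / ?n))"
  proof (rule sum_strict_mono)
   fix i assume i: "i \<in> {..<?n}"
   then have "norm (basis_enum i :: 'a) = 1" by (simp add: norm_eq_1 basis_enum_inner)
   then have "\<bar>basis_enum i \<bullet> x\<bar> \<le> norm x" using Cauchy_Schwarz_ineq2[of "basis_enum i" x] by simp
   moreover have "norm (basis_enum i - w i) < 1 / ?n" using assms i by (simp add: norm_minus_commute)
   ultimately show "\<bar>basis_enum i \<bullet> x\<bar> * norm (basis_enum i - w i) < norm x * (1 / ?n)"
    using x by (intro le_less_trans[OF mult_right_mono mult_strict_left_mono]) auto
  qed (auto simp: lessThan_empty_iff)
  also have "\<dots> = norm x" by simp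
  finally show False by simp
 qed
 have inj: "inj T" using injT linT by (simp add: linear_injective_0)
 have "w k = (\<Sum>i<k. (w k \<bullet> gram_schmidt w i) *\<^sub>R gram_schmidt w i)"
  using \<open>gs_residual w k = 0\<close> by (simp add: gs_residual_def)
 moreover have "gram_schmidt w i \<in> span (w ` {..<k})" if "i < k" for i
  using gram_schmidt_in_span[of w i] that
  by (meson atMost_iff image_mono lessThan_iff order_le_less_trans span_mono subsetD subsetI)
 ultimately have "w k \<in> span (w ` {..<k})"
  by (metis (no_types, lifting) lessThan_iff span_scale span_sum)
 also have "w ` {..<k} = T ` basis_enum ` {..<k}"
  using k Tb by (auto simp: image_image intro!: image_cong)
 also have "span \<dots> = T ` span (basis_enum ` {..<k})"
  by (rule linear_span_image[OF linT])
 finally have "basis_enum k \<in> span (basis_enum ` {..<k} :: 'a set)"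
  using Tb[OF k] inj by (metis (no_types, lifting) imageE injD)
 moreover have "basis_enum ` {..<k} \<subseteq> Basis - {basis_enum k :: 'a}"
  using basis_enum[where 'a='a] k by (auto simp: bij_betw_def inj_on_def)
 ultimately have "basis_enum k \<in> span (Basis - {basis_enum k :: 'a})"
  using span_mono by blast
 moreover have "basis_enum k \<in> (Basis :: 'a set)"
  using basis_enum[where 'a='a] k by (auto simp: bij_betw_def)
 ultimately show False
  using independent_Basis[where 'a='a] by (auto simp: dependent_def)
qed

section \<open>Rotation-invariant probability measures and averaging over rotations\<close>

text \<open>The normalised volume will enter through these properties, as a Borel measure on the
  ambient space carried by the unit sphere; the averaging arguments are then free of charts.\<close>

locale rotation_invariant_prob = prob_space P for P :: "'a::euclidean_space measure" +
 assumes sets_P [measurable_cong, simp]: "sets P = sets borel"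
  and AE_norm: "AE x in P. norm x = 1"
  and invariant: "orthogonal_transformation h ==> distr P borel h = P"
  and DIM_ge_2: "DIM('a) \<ge> 2"
begin

lemmas measurable_P = measurable_cong_sets[OF sets_P refl]

abbreviation "PP \<equiv> P \<Otimes>\<^sub>M P"

lemma space_P [simp]: "space P = UNIV"
 using sets_eq_imp_space_eq[OF sets_P] by simp

lemma nn_integral_invariant:
 assumes "orthogonal_transformation h" "f \<in> borel_measurable borel"
 shows "(\<integral>\<^sup>+x. f (h x) \<partial>P) = (\<integral>\<^sup>+x. f x \<partial>P)"
proof -
 have "(\<integral>\<^sup>+x. f x \<partial>P) = (\<integral>\<^sup>+x. f x \<partial>distr P borel h)" using invariant[OF assms(1)] by simp
 also have "\<dots> = (\<integral>\<^sup>+x. f (h x) \<partial>P)"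
  using assms orthogonal_transformation_measurable[OF assms(1)]
  by (subst nn_integral_distr) (auto simp: measurable_P)
 finally show ?thesis by simp
qed

text \<open>By invariance all balls of radius \<open>\<delta>\<close> centred on the sphere have the
  same mass, and finitely many of them cover the sphere, which has mass 1.\<close>

lemma emeasure_ball_pos:
 assumes x: "norm x = 1" and "0 < \<delta>"
 shows "emeasure P (ball x \<delta>) > 0"
proof (rule ccontr)
 assume "\<not> ?thesis"
 then have z: "emeasure P (ball x \<delta>) = 0" by (simp add: zero_less_iff_neq_zero)
 have zz: "ball y \<delta> \<in> null_sets P" if "norm y = 1" for y
 proof -
  define h where "h = reflect (y - x)"
  have h: "orthogonal_transformation h" "h y = x"
   using that x by (simp_all add: h_def orthogonal_transformation_reflect reflect_diff)
  have "emeasure P (ball x \<delta>) = emeasure P (h -` ball x \<delta> \<inter> space P)"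
   using orthogonal_transformation_measurable[OF h(1)]
   by (subst invariant[OF h(1), symmetric]) (auto simp: emeasure_distr measurable_P)
  also have "h -` ball x \<delta> \<inter> space P = ball y \<delta>"
   using h by (auto simp: dist_norm orthogonal_transformation linear_diff[symmetric])
  finally show ?thesis using z by auto
 qed
 obtain T where T: "finite T" "T \<subseteq> sphere 0 1" "sphere 0 (1::real) \<subseteq> (\<Union>y\<in>T. ball (y::'a) \<delta>)"
  using compactE_image[OF compact_sphere[of 0 1], of "sphere 0 1" "\<lambda>y. ball (y::'a) \<delta>"] \<open>0 < \<delta>\<close>
  by (metis UN_I centre_in_ball open_ball subsetI)
 have "(\<Union>y\<in>T. ball y \<delta>) \<in> null_sets P"
  using T zz by (intro null_sets_UN' countable_finite) auto
 then have "AE x in P. x \<notin> (\<Union>y\<in>T. ball y \<delta>)" by (rule AE_not_in)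
 with AE_norm have "AE x in P. False"
  by eventually_elim (use T(3) in auto)
 then show False by simp
qed

definition sample :: "(nat => 'a) measure" where
 "sample = (\<Pi>\<^sub>M i\<in>{..<DIM('a)}. P)"

lemma prob_space_sample: "prob_space sample"
 unfolding sample_def by (intro prob_space_PiM prob_space_axioms)

lemma sample_component [measurable (raw)]:
 "i < DIM('a) ==> (\<lambda>w. w i) \<in> borel_measurable sample"
 unfolding sample_def
 using measurable_component_singleton[of i "{..<DIM('a)}" "\<lambda>_. P"] by (simp add: measurable_cong_sets[OF refl sets_P])

lemma gram_schmidt_sample [measurable (raw)]:
 "k < DIM('a) ==> (\<lambda>w. gram_schmidt w k) \<in> borel_measurable sample"
 by (rule gram_schmidt_measurable[of "DIM('a)" "DIM('a)"]) (auto intro: sample_component)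

lemma gs_residual_sample [measurable (raw)]:
 "k < DIM('a) ==> (\<lambda>w. gs_residual w k) \<in> borel_measurable sample"
 unfolding gs_residual_def
 by (intro borel_measurable_diff borel_measurable_sum borel_measurable_scaleR borel_measurable_inner
   sample_component gram_schmidt_sample) auto

lemma gs_frame_sample [measurable]:
 "(\<lambda>(w, x). gs_frame w x) \<in> borel_measurable (sample \<Otimes>\<^sub>M borel)"
 unfolding gs_frame_def split_beta
 by (intro borel_measurable_sum borel_measurable_scaleR borel_measurable_inner borel_measurable_const
   measurable_compose[OF measurable_fst gram_schmidt_sample] measurable_snd) auto

lemma gs_regular_sample [measurable]: "Measurable.pred sample gs_regular"
proof -
 have "{w \<in> space sample. gs_regular w} = (\<Inter>i\<in>{..<DIM('a)}. {w \<in> space sample. gs_residual w i \<noteq> 0})"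
  using DIM_positive[where 'a='a] by (fastforce simp: gs_regular_def)
 also have "\<dots> \<in> sets sample"
 proof (intro sets.finite_INT)
  fix i assume "i \<in> {..<DIM('a)}"
  then have [measurable]: "(\<lambda>w. gs_residual w i) \<in> borel_measurable sample" by (simp add: gs_residual_sample)
  show "{w \<in> space sample. gs_residual w i \<noteq> 0} \<in> sets sample" by measurable
 qed (auto simp: lessThan_empty_iff)
 finally show ?thesis by (simp add: pred_def)
qed

lemma distr_sample:
 assumes h: "orthogonal_transformation h"
 shows "distr sample sample (compose {..<DIM('a)} h) = sample"
proof -
 have hm: "h \<in> measurable P P"
  using orthogonal_transformation_measurable[OF h] by (simp add: measurable_cong_sets[OF sets_P sets_P])
 have "distr P P h = P" using invariant[OF h] by (metis distr_cong sets_P)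
 then show ?thesis unfolding sample_def
  by (subst distr_PiM_finite_prob_space') (auto simp: hm prob_space_axioms)
qed

lemma emeasure_gs_regular: "emeasure sample {w\<in>space sample. gs_regular w} > 0"
proof -
 interpret product_sigma_finite "\<lambda>_::nat. P"
  by (simp add: product_sigma_finite_def sigma_finite_measure_axioms)
 let ?A = "\<lambda>i. ball (basis_enum i :: 'a) (1 / DIM('a))"
 have "0 < measure P (?A i)" if "i < DIM('a)" for i
  using emeasure_ball_pos[of "basis_enum i :: 'a" "1 / DIM('a)"] that
  by (simp add: norm_eq_1 basis_enum_inner emeasure_eq_measure)
 then have "0 < ennreal (\<Prod>i<DIM('a). measure P (?A i))"
  by (simp add: ennreal_less_zero_iff) (intro prod_pos, simp)
 also have "\<dots> = (\<Prod>i<DIM('a). emeasure P (?A i))"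
  by (simp add: prod_ennreal emeasure_eq_measure)
 also have "\<dots> = emeasure sample (Pi\<^sub>E {..<DIM('a)} ?A)"
  unfolding sample_def by (subst emeasure_PiM) auto
 also have "\<dots> \<le> emeasure sample {w\<in>space sample. gs_regular w}"
 proof (rule emeasure_mono)
  show "Pi\<^sub>E {..<DIM('a)} ?A \<subseteq> {w\<in>space sample. gs_regular w}"
  proof
   fix w assume w: "w \<in> Pi\<^sub>E {..<DIM('a)} ?A"
   have "norm (w i - basis_enum i) < 1 / DIM('a)" if "i < DIM('a)" for i
    using PiE_mem[OF w, of i] that by (simp add: dist_norm norm_minus_commute)
   then have "gs_regular w" by (rule gs_regular_near_basis)
   moreover have "w \<in> space sample"
    using w by (simp add: sample_def space_PiM PiE_iff)
   ultimately show "w \<in> {w\<in>space sample. gs_regular w}" by simp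
  qed
  show "{w\<in>space sample. gs_regular w} \<in> sets sample"
   using gs_regular_sample by (simp add: pred_def)
 qed
 finally show ?thesis .
qed

text \<open>Independent points conditioned to form a regular tuple. The law of
  \<open>gs_frame\<close> under this measure is the Haar measure of the orthogonal group;
  conditioning asks only for positive probability of regularity.\<close>

definition haar :: "(nat => 'a) measure" where
 "haar = uniform_measure sample {w\<in>space sample. gs_regular w}"

lemma gs_regular_set [measurable]: "{w\<in>space sample. gs_regular w} \<in> sets sample"
 using gs_regular_sample by (simp add: pred_def)

lemma sets_haar [measurable_cong, simp]: "sets haar = sets sample"
 by (simp add: haar_def)

lemma prob_space_haar: "prob_space haar"
proof -
 interpret S: prob_space sample by (rule prob_space_sample)
 show ?thesis unfolding haar_def
  using emeasure_gs_regular by (intro prob_space_uniform_measure) auto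
qed

lemma AE_haar: "AE w in haar. orthogonal_transformation (gs_frame w)"
 unfolding haar_def
 by (rule AE_uniform_measureI) (auto intro: orthogonal_transformation_gs_frame)

text \<open>Applying \<open>h\<close> to every sample point preserves the product law and
  regularity, and composes the frame map with the inverse of \<open>h\<close>.
  \<open>compose\<close> keeps the moved tuple extensional, as points of the product space
  are.\<close>

lemma nn_integral_haar_right_invariant:
 assumes h: "orthogonal_transformation h" and [measurable]: "\<Phi> \<in> borel_measurable borel2"
 shows "(\<integral>\<^sup>+w. \<Phi> (gs_frame w (h x), gs_frame w (h y)) \<partial>haar) = (\<integral>\<^sup>+w. \<Phi> (gs_frame w x, gs_frame w y) \<partial>haar)"
proof -
 let ?R = "{w\<in>space sample. gs_regular w}"
 define G where "G w = \<Phi> (gs_frame w (h x), gs_frame w (h y)) * indicator ?R w" for w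
 have [measurable]: "(\<lambda>w. gs_frame w z) \<in> borel_measurable sample" for z
  using measurable_compose[OF measurable_Pair2' gs_frame_sample, of z] by simp
 have cm: "compose {..<DIM('a)} h \<in> measurable sample sample"
  unfolding sample_def compose_def
 proof (intro measurable_restrict)
  fix i assume "i \<in> {..<DIM('a)}"
  then have "(\<lambda>w. w i) \<in> measurable (\<Pi>\<^sub>M i\<in>{..<DIM('a)}. P) P" by simp
  moreover have "h \<in> measurable P P"
   using orthogonal_transformation_measurable[OF h] by (simp add: measurable_cong_sets[OF sets_P sets_P])
  ultimately show "(\<lambda>w. h (w i)) \<in> measurable (\<Pi>\<^sub>M i\<in>{..<DIM('a)}. P) P"
   by (rule measurable_compose)
 qed
 have Gm: "G \<in> borel_measurable sample" unfolding G_def by measurable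
 have "(\<integral>\<^sup>+w. G w \<partial>sample) = (\<integral>\<^sup>+w. G w \<partial>distr sample sample (compose {..<DIM('a)} h))"
  by (simp add: distr_sample[OF h])
 also have "\<dots> = (\<integral>\<^sup>+w. G (compose {..<DIM('a)} h w) \<partial>sample)"
  by (rule nn_integral_distr[OF cm]) (simp add: Gm)
 also have "\<dots> = (\<integral>\<^sup>+w. \<Phi> (gs_frame w x, gs_frame w y) * indicator ?R w \<partial>sample)"
 proof (rule nn_integral_cong)
  fix w assume w: "w \<in> space sample"
  have c: "i < DIM('a) ==> compose {..<DIM('a)} h w i = h (w i)" for i by (simp add: compose_def)
  have "compose {..<DIM('a)} h w \<in> space sample" using measurable_space[OF cm w] .
  then have "indicator ?R (compose {..<DIM('a)} h w) = (indicator ?R w :: ennreal)"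
   using w gs_frame_equivariant(2)[OF h, of "compose {..<DIM('a)} h w" w] c by (simp add: indicator_def)
  then show "G (compose {..<DIM('a)} h w) = \<Phi> (gs_frame w x, gs_frame w y) * indicator ?R w"
   unfolding G_def using gs_frame_equivariant(1)[OF h, of "compose {..<DIM('a)} h w" w] c by simp
 qed
 finally have "(\<integral>\<^sup>+w. \<Phi> (gs_frame w (h x), gs_frame w (h y)) * indicator ?R w \<partial>sample)
  = (\<integral>\<^sup>+w. \<Phi> (gs_frame w x, gs_frame w y) * indicator ?R w \<partial>sample)" by (simp add: G_def)
 then show ?thesis unfolding haar_def
  by (subst (1 2) nn_integral_uniform_measure) (auto simp: mult.commute)
qed

definition e1 :: 'a where "e1 = basis_enum 0"
definition e2 :: 'a where "e2 = basis_enum 1"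

lemma e12: "e1 \<bullet> e1 = 1" "e2 \<bullet> e2 = 1" "e1 \<bullet> e2 = 0" "norm e1 = 1" "norm e2 = 1"
 using DIM_ge_2 by (simp_all add: e1_def e2_def basis_enum_inner norm_eq_1)

text \<open>The law of a random orthonormal pair, that is of a point with a unit tangent vector: the
  normalised Liouville measure of the unit tangent bundle.\<close>

definition \<nu> :: "('a \<times> 'a) measure" where
 "\<nu> = distr haar borel2 (\<lambda>w. (gs_frame w e1, gs_frame w e2))"

lemma gs_frame_haar [measurable]: "(\<lambda>w. gs_frame w z) \<in> borel_measurable haar"
  using measurable_compose[OF measurable_Pair2' gs_frame_sample, of z] by simp

lemma sets_\<nu> [measurable_cong, simp]: "sets \<nu> = sets borel2"
 by (simp add: \<nu>_def)

lemma space_\<nu> [simp]: "space \<nu> = UNIV"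
 by (simp add: \<nu>_def space_pair_measure)

lemma prob_space_\<nu>: "prob_space \<nu>"
 unfolding \<nu>_def by (rule prob_space.prob_space_distr[OF prob_space_haar]) measurable

sublocale N: prob_space \<nu> by (rule prob_space_\<nu>)

lemma nn_integral_\<nu>:
 assumes "f \<in> borel_measurable borel2"
 shows "(\<integral>\<^sup>+z. f z \<partial>\<nu>) = (\<integral>\<^sup>+w. f (gs_frame w e1, gs_frame w e2) \<partial>haar)"
 unfolding \<nu>_def by (rule nn_integral_distr) (use assms in measurable)

lemma AE_\<nu>: "AE z in \<nu>. norm (fst z) = 1 \<and> norm (snd z) = 1 \<and> fst z \<bullet> snd z = 0"
 unfolding \<nu>_def
proof (subst AE_distr_iff)
 show "AE w in haar. norm (fst (gs_frame w e1, gs_frame w e2)) = 1 \<and> norm (snd (gs_frame w e1, gs_frame w e2)) = 1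
   \<and> fst (gs_frame w e1, gs_frame w e2) \<bullet> snd (gs_frame w e1, gs_frame w e2) = 0"
  using AE_haar by eventually_elim (simp add: orthogonal_transformation_norm e12 orthogonal_transformation_def norm_eq_1)
qed measurable

text \<open>The geodesic flow on the unit tangent bundle at time \<open>t\<close>.\<close>

definition rot :: "real => 'a \<times> 'a => 'a \<times> 'a" where
 "rot t z = (cos t *\<^sub>R fst z + sin t *\<^sub>R snd z, cos t *\<^sub>R snd z - sin t *\<^sub>R fst z)"

text \<open>Frame maps are linear, so flowing the image of the pair \<open>e1\<close>,
  \<open>e2\<close> amounts to taking the image of the rotated pair; invariance under the flow is
  thus right invariance of \<open>haar\<close>.\<close>

lemma nn_integral_\<nu>_rot:
 assumes [measurable]: "f \<in> borel_measurable borel2"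
 shows "(\<integral>\<^sup>+z. f (rot t z) \<partial>\<nu>) = (\<integral>\<^sup>+z. f z \<partial>\<nu>)"
proof -
 define x where "x = cos t *\<^sub>R e1 + sin t *\<^sub>R e2"
 define y where "y = cos t *\<^sub>R e2 - sin t *\<^sub>R e1"
 have "x \<bullet> x = 1" "y \<bullet> y = 1" "x \<bullet> y = 0"
  using sin_cos_squared_add[of t]
  by (simp_all add: x_def y_def inner_add_left inner_add_right inner_diff_left inner_diff_right e12
   inner_commute[of e2 e1] power2_eq_square add.commute)
 then obtain h where h: "orthogonal_transformation h" "h e1 = x" "h e2 = y"
  using orthogonal_transformation_pair[of e1 x e2 y] by (auto simp: norm_eq_1 e12)
 have rm: "rot t \<in> measurable borel2 borel2"
  unfolding rot_def by measurable
 have "(\<integral>\<^sup>+z. f (rot t z) \<partial>\<nu>) = (\<integral>\<^sup>+w. f (rot t (gs_frame w e1, gs_frame w e2)) \<partial>haar)"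
  by (rule nn_integral_\<nu>) (use rm in measurable)
 also have "\<dots> = (\<integral>\<^sup>+w. f (gs_frame w (h e1), gs_frame w (h e2)) \<partial>haar)"
 proof (rule nn_integral_cong_AE, use AE_haar in eventually_elim)
  case (elim w)
  then have "linear (gs_frame w)" by (rule orthogonal_transformation_linear)
  then have "rot t (gs_frame w e1, gs_frame w e2) = (gs_frame w (h e1), gs_frame w (h e2))"
   by (simp add: rot_def h x_def y_def linear_add linear_diff linear_scale)
  then show ?case by simp
 qed
 also have "\<dots> = (\<integral>\<^sup>+z. f z \<partial>\<nu>)"
  by (simp add: nn_integral_haar_right_invariant[OF h(1) assms] nn_integral_\<nu>[OF assms])
 finally show ?thesis .
qed

text \<open>Rotate both points by a random frame map: \<open>W\<close> does not change, and the law
  of the rotated pair depends on \<open>x\<close> and \<open>y\<close> only through their inner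
  product. It is the law of a random point together with its partner at the same angle along a
  random geodesic.\<close>

lemma nn_integral_pair_average:
 assumes [measurable]: "\<Phi> \<in> borel_measurable borel2"
  and [measurable]: "(\<lambda>(x, y). W x y) \<in> borel_measurable borel2"
  and W: "\<And>h x y. orthogonal_transformation h ==> norm x = 1 ==> norm y = 1 ==> W (h x) (h y) = W x y"
 shows "(\<integral>\<^sup>+x. \<integral>\<^sup>+y. W x y * \<Phi> (x, y) \<partial>P \<partial>P)
  = (\<integral>\<^sup>+x. \<integral>\<^sup>+y. W x y * (\<integral>\<^sup>+z. \<Phi> (fst z, (x \<bullet> y) *\<^sub>R fst z + sqrt (1 - (x \<bullet> y)\<^sup>2) *\<^sub>R snd z) \<partial>\<nu>) \<partial>P \<partial>P)"
  (is "?L = ?R")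
proof -
 interpret H: prob_space haar by (rule prob_space_haar)
 interpret PH: pair_sigma_finite P haar ..
 have hb: "haar \<Otimes>\<^sub>M P = haar \<Otimes>\<^sub>M P" ..
 have [measurable]: "(\<lambda>z. gs_frame (fst z) (snd z)) \<in> borel_measurable (sample \<Otimes>\<^sub>M borel)"
  using gs_frame_sample by (simp add: split_beta')
 have fr: "(\<lambda>q. gs_frame (u q) (v q)) \<in> borel_measurable M"
  if [measurable]: "u \<in> measurable M sample" "v \<in> borel_measurable M" for u v and M :: "'z measure"
 proof -
  have "(\<lambda>q. (u q, v q)) \<in> measurable M (sample \<Otimes>\<^sub>M borel)" by measurable
  from measurable_compose[OF this gs_frame_sample] show ?thesis by simp
 qed
 have L: "?L = (\<integral>\<^sup>+x. \<integral>\<^sup>+y. W x y * \<Phi> (h x, h y) \<partial>P \<partial>P)" if h: "orthogonal_transformation h" for h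
 proof -
  note [measurable] = orthogonal_transformation_measurable[OF h]
  have "?L = (\<integral>\<^sup>+x. \<integral>\<^sup>+y. W (h x) y * \<Phi> (h x, y) \<partial>P \<partial>P)"
   by (rule nn_integral_invariant[OF h, symmetric]) measurable
  also have "\<dots> = (\<integral>\<^sup>+x. \<integral>\<^sup>+y. W (h x) (h y) * \<Phi> (h x, h y) \<partial>P \<partial>P)"
   by (intro nn_integral_cong nn_integral_invariant[OF h, symmetric]) measurable
  also have "\<dots> = (\<integral>\<^sup>+x. \<integral>\<^sup>+y. W x y * \<Phi> (h x, h y) \<partial>P \<partial>P)"
  proof (rule nn_integral_cong_AE, use AE_norm in eventually_elim)
   case (elim x)
   show ?case
    by (rule nn_integral_cong_AE, use AE_norm in eventually_elim) (simp add: W[OF h] elim)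
  qed
  finally show ?thesis .
 qed
 have "?L = (\<integral>\<^sup>+w. ?L \<partial>haar)" by (simp add: H.emeasure_space_1)
 also have "\<dots> = (\<integral>\<^sup>+w. \<integral>\<^sup>+x. \<integral>\<^sup>+y. W x y * \<Phi> (gs_frame w x, gs_frame w y) \<partial>P \<partial>P \<partial>haar)"
  using AE_haar by (intro nn_integral_cong_AE) (auto elim!: eventually_mono dest: L)
 also have "\<dots> = (\<integral>\<^sup>+x. \<integral>\<^sup>+w. \<integral>\<^sup>+y. W x y * \<Phi> (gs_frame w x, gs_frame w y) \<partial>P \<partial>haar \<partial>P)"
  by (rule PH.Fubini') (use fr in measurable)
 also have "\<dots> = (\<integral>\<^sup>+x. \<integral>\<^sup>+y. \<integral>\<^sup>+w. W x y * \<Phi> (gs_frame w x, gs_frame w y) \<partial>haar \<partial>P \<partial>P)"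
  by (intro nn_integral_cong PH.Fubini') (use fr in measurable)
 also have "\<dots> = (\<integral>\<^sup>+x. \<integral>\<^sup>+y. W x y * (\<integral>\<^sup>+w. \<Phi> (gs_frame w x, gs_frame w y) \<partial>haar) \<partial>P \<partial>P)"
  by (intro nn_integral_cong nn_integral_cmult) measurable
 also have "\<dots> = ?R"
 proof -
  have *: "(\<integral>\<^sup>+w. \<Phi> (gs_frame w x, gs_frame w y) \<partial>haar)
   = (\<integral>\<^sup>+z. \<Phi> (fst z, (x \<bullet> y) *\<^sub>R fst z + sqrt (1 - (x \<bullet> y)\<^sup>2) *\<^sub>R snd z) \<partial>\<nu>)"
   if n: "norm x = 1" "norm y = 1" for x y
  proof -
   define c where "c = x \<bullet> y"
   define s where "s = sqrt (1 - c\<^sup>2)"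
   have "c\<^sup>2 \<le> 1" using Cauchy_Schwarz_ineq2[of x y] n by (simp add: c_def abs_square_le_1)
   then have s2: "s\<^sup>2 = 1 - c\<^sup>2" by (simp add: s_def)
   define y' where "y' = c *\<^sub>R e1 + s *\<^sub>R e2"
   have "y' \<bullet> y' = 1" "e1 \<bullet> y' = c"
    using s2 by (simp_all add: y'_def inner_add_left inner_add_right e12 inner_commute[of e2 e1] power2_eq_square)
   then obtain h where h: "orthogonal_transformation h" "h e1 = x" "h y' = y"
    using orthogonal_transformation_pair[of e1 x y' y] n by (auto simp: norm_eq_1 e12 c_def)
   have "(\<integral>\<^sup>+w. \<Phi> (gs_frame w x, gs_frame w y) \<partial>haar) = (\<integral>\<^sup>+w. \<Phi> (gs_frame w e1, gs_frame w y') \<partial>haar)"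
    using nn_integral_haar_right_invariant[OF h(1) assms(1), of e1 y'] h by simp
   also have "\<dots> = (\<integral>\<^sup>+w. \<Phi> (gs_frame w e1, c *\<^sub>R gs_frame w e1 + s *\<^sub>R gs_frame w e2) \<partial>haar)"
    using AE_haar
    by (intro nn_integral_cong_AE)
     (auto elim!: eventually_mono dest!: orthogonal_transformation_linear simp: y'_def linear_add linear_scale)
   also have "\<dots> = (\<integral>\<^sup>+z. \<Phi> (fst z, c *\<^sub>R fst z + s *\<^sub>R snd z) \<partial>\<nu>)"
    by (subst nn_integral_\<nu>) (auto, measurable)
   finally show ?thesis by (simp add: c_def s_def)
  qed
  show ?thesis
  proof (rule nn_integral_cong_AE, use AE_norm in eventually_elim)
   case (elim x)
   show ?case
    by (rule nn_integral_cong_AE, use AE_norm in eventually_elim) (simp add: * elim)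
  qed
 qed
 finally show ?thesis .
qed

end

subsection \<open>Smooth functions on the sphere\<close>

lemma Ck_on_cong:
 assumes "open S" "\<And>x. x \<in> S ==> f x = g x" "Ck_on k S f"
 shows "Ck_on k S g"
 using assms(2,3)
proof (induction k arbitrary: f g)
 case 0
 then show ?case by (simp cong: continuous_on_cong)
next
 case (Suc k)
 have d: "(g has_derivative f') (at x)" if "(f has_derivative f') (at x)" "x \<in> S" for f' x
  using has_derivative_transform_within_open[OF that(1) assms(1) that(2)] Suc.prems(1) by auto
 have df: "f differentiable at x" if "x \<in> S" for x using Suc.prems(2) that by simp
 have "g differentiable at x" if "x \<in> S" for x
  using df[OF that] d[OF _ that] by (auto simp: differentiable_def)
 moreover have "frechet_derivative f (at x) = frechet_derivative g (at x)" if "x \<in> S" for x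
  using d[OF _ that] df[OF that] by (metis frechet_derivative_at frechet_derivative_works)
 then have "Ck_on k S (\<lambda>x. frechet_derivative g (at x) v)" for v
  using Suc.IH[of "\<lambda>x. frechet_derivative f (at x) v" "\<lambda>x. frechet_derivative g (at x) v"] Suc.prems(2) by simp
 ultimately show ?case by simp
qed

lemma Ck_on_linear:
 assumes "open S" "bounded_linear L" "Ck_on k S f"
 shows "Ck_on k S (\<lambda>x. L (f x))"
 using assms(3)
proof (induction k arbitrary: f)
 case 0
 then show ?case using assms(2) by (simp add: bounded_linear.continuous_on)
next
 case (Suc k)
 have d: "((\<lambda>x. L (f x)) has_derivative (\<lambda>v. L (frechet_derivative f (at x) v))) (at x)" if "x \<in> S" for x
  using Suc.prems that by (intro bounded_linear.has_derivative[OF assms(2)]) (simp add: frechet_derivative_works[symmetric])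
 have "Ck_on k S (\<lambda>x. L (frechet_derivative f (at x) v))" for v
  using Suc by simp
 then have "Ck_on k S (\<lambda>x. frechet_derivative (\<lambda>x. L (f x)) (at x) v)" for v
  by (rule Ck_on_cong[OF assms(1), rotated]) (simp add: frechet_derivative_at[OF d, symmetric])
 then show ?case using d by (auto simp: differentiable_def)
qed

lemma Ck_on_add:
 assumes "open S" "Ck_on k S f" "Ck_on k S g"
 shows "Ck_on k S (\<lambda>x. f x + g x)"
 using assms(2,3)
proof (induction k arbitrary: f g)
 case 0
 then show ?case by (simp add: continuous_on_add)
next
 case (Suc k)
 have d: "((\<lambda>x. f x + g x) has_derivative (\<lambda>v. frechet_derivative f (at x) v + frechet_derivative g (at x) v)) (at x)"
  if "x \<in> S" for x
  using Suc.prems that by (intro has_derivative_add) (simp_all add: frechet_derivative_works[symmetric])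
 have "Ck_on k S (\<lambda>x. frechet_derivative f (at x) v + frechet_derivative g (at x) v)" for v
  using Suc by simp
 then have "Ck_on k S (\<lambda>x. frechet_derivative (\<lambda>x. f x + g x) (at x) v)" for v
  by (rule Ck_on_cong[OF assms(1), rotated]) (simp add: frechet_derivative_at[OF d, symmetric])
 then show ?case using d by (auto simp: differentiable_def)
qed

lemma Ck_on_sum:
 fixes f :: "'i => 'a::real_normed_vector => 'c::real_normed_vector"
 assumes "open S" "finite I" "\<And>i. i \<in> I ==> Ck_on k S (f i)"
 shows "Ck_on k S (\<lambda>x. \<Sum>i\<in>I. f i x)"
 using assms(2,3)
proof (induction I rule: finite_induct)
 case empty
 have "Ck_on k S (\<lambda>x. 0 :: 'c::real_normed_vector)"
  by (induction k) auto
 then show ?case by simp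
next
 case (insert i I)
 then show ?case using Ck_on_add[OF assms(1), of k "f i" "\<lambda>x. \<Sum>i\<in>I. f i x"] by simp
qed

text \<open>An algebra closed under directional derivatives off the origin that contains the radial
  extension of every polynomial; smoothness of polynomials on the sphere then follows by induction
  on the order.\<close>

inductive radial_poly :: "('a::euclidean_space => real) => bool" where
 const: "radial_poly (\<lambda>z. c)"
| inner: "radial_poly (\<lambda>z. z \<bullet> b)"
| inv_norm: "radial_poly (\<lambda>z. inverse (norm z))"
| add: "radial_poly f ==> radial_poly g ==> radial_poly (\<lambda>z. f z + g z)"
| mult: "radial_poly f ==> radial_poly g ==> radial_poly (\<lambda>z. f z * g z)"

lemma radial_poly_derivative:
 "radial_poly f ==> \<exists>f'. (\<forall>v. radial_poly (f' v)) \<and> (\<forall>x. x \<noteq> 0 \<longrightarrow> (f has_derivative (\<lambda>v. f' v x)) (at x))"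
proof (induction rule: radial_poly.induct)
 case (const c)
 show ?case by (rule exI[of _ "\<lambda>v x. 0"]) (auto intro: radial_poly.const)
next
 case (inner b)
 show ?case
  by (rule exI[of _ "\<lambda>v x. v \<bullet> b"]) (auto intro: radial_poly.const intro!: derivative_eq_intros)
next
 case inv_norm
 let ?f' = "\<lambda>v (x::'a). (-1) * ((x \<bullet> v) * (inverse (norm x) * (inverse (norm x) * inverse (norm x))))"
 have A: "radial_poly (?f' v)" for v by (intro radial_poly.intros)
 have B: "((\<lambda>z. inverse (norm z)) has_derivative (\<lambda>v. ?f' v x)) (at x)" if "x \<noteq> 0" for x
  by (rule has_derivative_eq_rhs, rule Deriv.has_derivative_inverse[OF _ has_derivative_norm[OF that]])
   (use that in \<open>auto simp: fun_eq_iff sgn_div_norm field_simps inner_commute\<close>)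
 show ?case by (intro exI[of _ ?f'] conjI allI impI A B)
next
 case (add f g)
 then obtain f' g' where "\<forall>v. radial_poly (f' v)" "\<forall>x. x \<noteq> 0 \<longrightarrow> (f has_derivative (\<lambda>v. f' v x)) (at x)"
  "\<forall>v. radial_poly (g' v)" "\<forall>x. x \<noteq> 0 \<longrightarrow> (g has_derivative (\<lambda>v. g' v x)) (at x)" by blast
 then show ?case
  by (intro exI[of _ "\<lambda>v x. f' v x + g' v x"]) (auto intro: radial_poly.add has_derivative_add)
next
 case (mult f g)
 then obtain f' g' where "\<forall>v. radial_poly (f' v)" "\<forall>x. x \<noteq> 0 \<longrightarrow> (f has_derivative (\<lambda>v. f' v x)) (at x)"
  "\<forall>v. radial_poly (g' v)" "\<forall>x. x \<noteq> 0 \<longrightarrow> (g has_derivative (\<lambda>v. g' v x)) (at x)" by blast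
 then show ?case using mult(1,2)
  by (intro exI[of _ "\<lambda>v x. f x * g' v x + f' v x * g x"])
   (auto intro!: radial_poly.add radial_poly.mult has_derivative_mult)
qed

lemma Ck_on_radial_poly: "radial_poly f ==> Ck_on k (- {0}) f"
proof (induction k arbitrary: f)
 case 0
 then obtain f' where "\<forall>x. x \<noteq> 0 \<longrightarrow> (f has_derivative (\<lambda>v. f' v x)) (at x)"
  using radial_poly_derivative by blast
 then have "isCont f x" if "x \<noteq> 0" for x
  using that has_derivative_continuous[of f] by blast
 then show ?case by (simp add: continuous_at_imp_continuous_on)
next
 case (Suc k)
 then obtain f' where f': "\<forall>v. radial_poly (f' v)" and d: "\<And>x. x \<noteq> 0 ==> (f has_derivative (\<lambda>v. f' v x)) (at x)"
  using radial_poly_derivative by blast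
 have "Ck_on k (- {0}) (f' v)" for v using Suc.IH f' by blast
 then have "Ck_on k (- {0}) (\<lambda>x. frechet_derivative f (at x) v)" for v
 proof (rule Ck_on_cong[rotated 2])
  show "f' v x = frechet_derivative f (at x) v" if "x \<in> - {0}" for x
   using frechet_derivative_at[OF d[of x]] that by (metis ComplD singletonI)
 qed (rule open_Compl, simp)
 then show ?case using d by (auto simp: differentiable_def)
qed

lemma radial_poly_sum: "finite I ==> (\<And>i. i \<in> I ==> radial_poly (f i)) ==> radial_poly (\<lambda>x. \<Sum>i\<in>I. f i x)"
 by (induction I rule: finite_induct) (auto intro: radial_poly.intros)

lemma radial_poly_ext:
 "real_polynomial_function p ==> radial_poly (radial_ext p)"
proof (induction rule: real_polynomial_function.induct)
 case (linear f)
 have "radial_ext f = (\<lambda>z. \<Sum>b\<in>Basis. (z \<bullet> b) * (inverse (norm z) * f b))"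
 proof
  fix z
  have "f z = (\<Sum>b\<in>Basis. (z \<bullet> b) * f b)"
   using linear_sum[OF bounded_linear.linear[OF linear], of "\<lambda>b. (z \<bullet> b) *\<^sub>R b" Basis]
   by (simp add: euclidean_representation linear_scale[OF bounded_linear.linear[OF linear]])
  then show "radial_ext f z = (\<Sum>b\<in>Basis. (z \<bullet> b) * (inverse (norm z) * f b))"
   by (simp add: radial_ext_def linear_scale[OF bounded_linear.linear[OF linear]] sum_distrib_left mult_ac)
 qed
 then show ?case by (simp, intro radial_poly_sum) (auto intro!: radial_poly.intros)
next
 case (const c)
 then show ?case by (simp add: radial_ext_def[abs_def] radial_poly.const)
next
 case (add f g)
 then show ?case using radial_poly.add by (auto simp: radial_ext_def[abs_def])
next
 case (mult f g)
 then show ?case using radial_poly.mult by (auto simp: radial_ext_def[abs_def])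
qed

lemma smooth_sphere_real_polynomial: "real_polynomial_function p ==> smooth_sphere p"
 by (simp add: smooth_sphere_def smooth_on_def Ck_on_radial_poly radial_poly_ext)

lemma smooth_sphere_polynomial:
 fixes X :: "'a::euclidean_space => 'b::euclidean_space"
 assumes "polynomial_function X"
 shows "smooth_sphere X"
 unfolding smooth_sphere_def smooth_on_def
proof
 fix k
 have "real_polynomial_function (\<lambda>x. X x \<bullet> b)" if "b \<in> Basis" for b
  using polynomial_function_iff_Basis_inner[THEN iffD1, OF assms] that by blast
 note c = Ck_on_radial_poly[OF radial_poly_ext[OF this]]
 have o: "open (- {0 :: 'a})" by (rule open_Compl) simp
 have "Ck_on k (- {0}) (\<lambda>x. (radial_ext (\<lambda>x. X x \<bullet> b) x) *\<^sub>R b)" if "b \<in> Basis" for b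
  by (rule Ck_on_linear[OF o bounded_linear_scaleR_left c[OF that]])
 then have "Ck_on k (- {0}) (\<lambda>x. \<Sum>b\<in>Basis. (radial_ext (\<lambda>x. X x \<bullet> b) x) *\<^sub>R b)"
  by (rule Ck_on_sum[OF o finite_Basis])
 also have "(\<lambda>x. \<Sum>b\<in>Basis. (radial_ext (\<lambda>x. X x \<bullet> b) x) *\<^sub>R b) = radial_ext X"
  by (simp add: radial_ext_def fun_eq_iff euclidean_representation)
 finally show "Ck_on k (- {0}) (radial_ext X)" .
qed

text \<open>The differential of z / |z| at a unit vector is the tangential projection.\<close>

lemma has_derivative_radial_ext:
 fixes x :: "'a::euclidean_space"
 assumes "(F has_derivative D) (at x)" "norm x = 1"
 shows "(radial_ext F has_derivative (\<lambda>v. D (v - (v \<bullet> x) *\<^sub>R x))) (at x)"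
proof -
 have x: "x \<noteq> 0" using assms(2) by auto
 have "((\<lambda>z. inverse (norm z)) has_derivative (\<lambda>v. - (v \<bullet> x))) (at x)"
  by (rule has_derivative_eq_rhs, rule Deriv.has_derivative_inverse[OF _ has_derivative_norm[OF x]])
   (use assms x in \<open>auto simp: fun_eq_iff sgn_div_norm inner_commute\<close>)
 from has_derivative_scaleR[OF this has_derivative_ident]
 have "((\<lambda>z. z /\<^sub>R norm z) has_derivative (\<lambda>v. v - (v \<bullet> x) *\<^sub>R x)) (at x)"
  using assms by (simp add: algebra_simps)
 moreover have "(F has_derivative D) (at (x /\<^sub>R norm x))" using assms by simp
 ultimately show ?thesis
  unfolding radial_ext_def[abs_def] by (rule has_derivative_compose)
qed

lemma sphere_deriv_eq:
 fixes x :: "'a::euclidean_space"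
 assumes "(F has_derivative D) (at x)" "norm x = 1"
 shows "sphere_deriv F x v = D (v - (v \<bullet> x) *\<^sub>R x)"
 unfolding sphere_deriv_def frechet_derivative_at[OF has_derivative_radial_ext[OF assms], symmetric] ..

lemma sphere_div_alt:
 "sphere_div X x = (\<Sum>b\<in>Basis. sphere_deriv X x b \<bullet> b) - (\<Sum>b\<in>Basis. (sphere_deriv X x b \<bullet> x) * (x \<bullet> b))"
 by (simp add: sphere_div_def cov_deriv_def inner_diff_left sum_subtractf)

text \<open>The radial extension has derivative 0 in direction \<open>x\<close>, so the normal
  correction in \<open>cov_deriv\<close> sums to 0 and the trace of \<open>D\<close> loses only its
  radial entry.\<close>

lemma sphere_div_eq:
 fixes x :: "'a::euclidean_space"
 assumes "(X has_derivative D) (at x)" "norm x = 1"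
 shows "sphere_div X x = (\<Sum>b\<in>Basis. D b \<bullet> b) - D x \<bullet> x"
proof -
 have lin: "linear D" using assms(1) by (rule has_derivative_linear)
 have Dx: "D x = (\<Sum>b\<in>Basis. (x \<bullet> b) *\<^sub>R D b)"
  by (subst euclidean_representation[of x, symmetric]) (simp add: linear_sum[OF lin] linear_scale[OF lin])
 have xx: "(\<Sum>b\<in>Basis. (x \<bullet> b) * (x \<bullet> b)) = 1"
  using assms(2) by (simp add: norm_eq_1 euclidean_inner[of x x])
 have d: "sphere_deriv X x b = D b - (b \<bullet> x) *\<^sub>R D x" for b
  by (simp add: sphere_deriv_eq[OF assms] linear_diff[OF lin] linear_scale[OF lin])
 have "D x \<bullet> x = (\<Sum>b\<in>Basis. (b \<bullet> x) * (D x \<bullet> b))"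
  by (subst euclidean_inner) (simp add: inner_commute mult.commute)
 then have 1: "(\<Sum>b\<in>Basis. sphere_deriv X x b \<bullet> b) = (\<Sum>b\<in>Basis. D b \<bullet> b) - D x \<bullet> x"
  by (simp add: d inner_diff_left sum_subtractf)
 have "(\<Sum>b\<in>Basis. (sphere_deriv X x b \<bullet> x) * (x \<bullet> b))
   = (\<Sum>b\<in>Basis. (x \<bullet> b) *\<^sub>R D b) \<bullet> x - (D x \<bullet> x) * (\<Sum>b\<in>Basis. (x \<bullet> b) * (x \<bullet> b))"
  by (simp add: d inner_diff_left left_diff_distrib sum_subtractf inner_sum_left sum_distrib_left
    inner_commute[of x] mult_ac right_diff_distrib)
 then have 2: "(\<Sum>b\<in>Basis. (sphere_deriv X x b \<bullet> x) * (x \<bullet> b)) = 0"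
  by (simp add: Dx[symmetric] xx)
 show ?thesis unfolding sphere_div_alt 1 2 by simp
qed

lemma smooth_sphere_differentiable:
 assumes "smooth_sphere X" "x \<noteq> 0"
 shows "radial_ext X differentiable at x"
proof -
 have "Ck_on (Suc 0) (- {0}) (radial_ext X)" using assms(1) unfolding smooth_sphere_def smooth_on_def by blast
 then show ?thesis using assms(2) by simp
qed

lemma smooth_sphere_continuous_deriv:
 assumes "smooth_sphere X"
 shows "continuous_on (- {0}) (\<lambda>x. sphere_deriv X x v)"
proof -
 have "Ck_on (Suc 0) (- {0}) (radial_ext X)" using assms unfolding smooth_sphere_def smooth_on_def by blast
 then show ?thesis by (simp add: sphere_deriv_def)
qed

lemma smooth_sphere_continuous:
 assumes "smooth_sphere X"
 shows "continuous_on (sphere 0 1) X"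
proof -
 have "Ck_on 0 (- {0}) (radial_ext X)" using assms unfolding smooth_sphere_def smooth_on_def by blast
 then have "continuous_on (sphere 0 1) (radial_ext X)"
  by (auto elim!: continuous_on_subset)
 then show ?thesis
  by (rule continuous_on_eq) (simp add: radial_ext_def)
qed

lemma continuous_on_sphere_div:
 assumes "smooth_sphere X"
 shows "continuous_on (sphere 0 1) (sphere_div X)"
proof -
 have "continuous_on (- {0}) (sphere_div X)"
  unfolding sphere_div_alt[abs_def]
  by (intro continuous_intros smooth_sphere_continuous_deriv assms)
 then show ?thesis by (rule continuous_on_subset) auto
qed

lemma smooth_vector_field_combine:
 assumes X: "smooth_vector_field X" and Y: "smooth_vector_field Y"
 shows "smooth_vector_field (\<lambda>x. a *\<^sub>R X x + b *\<^sub>R Y x)"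
  and "x \<noteq> 0 ==> sphere_div (\<lambda>x. a *\<^sub>R X x + b *\<^sub>R Y x) x = a * sphere_div X x + b * sphere_div Y x"
proof -
 have r: "radial_ext (\<lambda>x. a *\<^sub>R X x + b *\<^sub>R Y x) = (\<lambda>x. a *\<^sub>R radial_ext X x + b *\<^sub>R radial_ext Y x)"
  by (simp add: radial_ext_def fun_eq_iff)
 have "Ck_on k (- {0}) (\<lambda>x. a *\<^sub>R radial_ext X x + b *\<^sub>R radial_ext Y x)" for k
 proof -
  have o: "open (- {0 :: 'a})" by (rule open_Compl) simp
  have "Ck_on k (- {0}) (radial_ext X)" "Ck_on k (- {0}) (radial_ext Y)"
   using X Y unfolding smooth_vector_field_def smooth_sphere_def smooth_on_def by blast+
  from this[THEN Ck_on_linear[OF o bounded_linear_scaleR_right]] show ?thesis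
   by (rule Ck_on_add[OF o])
 qed
 then show "smooth_vector_field (\<lambda>x. a *\<^sub>R X x + b *\<^sub>R Y x)"
  using X Y unfolding smooth_vector_field_def smooth_sphere_def smooth_on_def r
  by (auto simp: inner_add_left)
 assume x: "x \<noteq> 0"
 have "(radial_ext X has_derivative sphere_deriv X x) (at x)" "(radial_ext Y has_derivative sphere_deriv Y x) (at x)"
  using X Y smooth_sphere_differentiable[OF _ x, of X] smooth_sphere_differentiable[OF _ x, of Y] unfolding sphere_deriv_def smooth_vector_field_def
  by (simp_all add: frechet_derivative_works)
 then have "((\<lambda>x. a *\<^sub>R radial_ext X x + b *\<^sub>R radial_ext Y x) has_derivative
   (\<lambda>v. a *\<^sub>R sphere_deriv X x v + b *\<^sub>R sphere_deriv Y x v)) (at x)"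
  by (intro derivative_intros)
 then have "sphere_deriv (\<lambda>x. a *\<^sub>R X x + b *\<^sub>R Y x) x = (\<lambda>v. a *\<^sub>R sphere_deriv X x v + b *\<^sub>R sphere_deriv Y x v)"
  unfolding sphere_deriv_def[of "\<lambda>x. a *\<^sub>R X x + b *\<^sub>R Y x"] r
  by (rule frechet_derivative_at[symmetric])
 then show "sphere_div (\<lambda>x. a *\<^sub>R X x + b *\<^sub>R Y x) x = a * sphere_div X x + b * sphere_div Y x"
  by (simp only: sphere_div_alt inner_add_left inner_scaleR_left sum.distrib distrib_right mult.assoc
    sum_distrib_left[symmetric] right_diff_distrib)
qed

subsection \<open>Integration of polynomials along flows\<close>

lemma continuous_on_real_polynomial:
 "real_polynomial_function p ==> continuous_on S p"
 using continuous_on_polymonial_function real_polynomial_function_eq by blast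

lemma borel_measurable_real_polynomial:
 "real_polynomial_function p ==> p \<in> borel_measurable borel"
 by (intro borel_measurable_continuous_onI continuous_on_real_polynomial)

lemma integrable_AE_bounded:
 fixes g :: "'a::euclidean_space => 'b::{banach,second_countable_topology}"
 assumes "finite_measure M" "sets M = sets borel" "AE x in M. norm x \<le> C"
  and "continuous_on UNIV g"
 shows "integrable M g"
proof -
 interpret finite_measure M by fact
 have "compact (g ` cball 0 C)"
  by (intro compact_continuous_image continuous_on_subset[OF assms(4)]) auto
 then obtain B where B: "\<forall>y\<in>g ` cball 0 C. norm y \<le> B"
  using compact_imp_bounded bounded_iff by blast
 have gm: "g \<in> borel_measurable M"
  using borel_measurable_continuous_onI[OF assms(4)] by (simp add: measurable_cong_sets[OF assms(2) refl])
 have "AE x in M. norm (g x) \<le> B"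
  using assms(3) by eventually_elim (use B in auto)
 then show ?thesis by (rule integrable_const_bound[OF _ gm])
qed

definition dird :: "('a::real_normed_vector => real) => 'a => 'a => real" where
 "dird p z v = frechet_derivative p (at z) v"

lemma dird_eq: "(p has_derivative D) (at z) ==> dird p z v = D v"
 unfolding dird_def by (simp add: frechet_derivative_at[symmetric])

lemma has_derivative_dird:
 "real_polynomial_function p ==> (p has_derivative dird p z) (at z)"
 unfolding dird_def using differentiable_at_real_polynomial_function[of p z UNIV]
 by (simp add: frechet_derivative_works[symmetric])

lemma dird_linear: "real_polynomial_function p ==> linear (dird p z)"
 using has_derivative_dird has_derivative_linear by blast

lemma real_polynomial_dird:
 fixes p :: "'a::euclidean_space => real"
 assumes "real_polynomial_function p" and u: "polynomial_function u"
 shows "real_polynomial_function (\<lambda>z. dird p z (u z))"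
 using assms(1)
proof (induction rule: real_polynomial_function.induct)
 case (linear f)
 have "dird f z v = f v" for z v
  by (rule dird_eq) (rule bounded_linear_imp_has_derivative[OF linear])
 then show ?case using u linear unfolding polynomial_function_def by (simp add: o_def)
next
 case (const c)
 have "dird (\<lambda>x. c) z v = 0" for z :: 'a and v by (rule dird_eq) simp
 then show ?case by (simp add: real_polynomial_function.intros(2))
next
 case (add f g)
 have "dird (\<lambda>x. f x + g x) z v = dird f z v + dird g z v" for z v
  by (intro dird_eq has_derivative_add has_derivative_dird add.hyps)
 then show ?case using add.IH by (simp add: real_polynomial_function.intros(3))
next
 case (mult f g)
 have "dird (\<lambda>x. f x * g x) z v = f z * dird g z v + dird f z v * g z" for z v
  by (intro dird_eq has_derivative_mult has_derivative_dird mult.hyps)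
 then show ?case using mult by (simp add: real_polynomial_function.intros)
qed

text \<open>Dominated convergence: \<open>Tn\<close> keeps the orbits in the ball of radius
  \<open>C\<close>, where the polynomial derivative along \<open>Z\<close> is bounded. Only
  \<open>\<eta>\<close> is differentiated, so \<open>f\<close> may be an indicator. Applied to
  rotations of the sphere and to the geodesic flow.\<close>

lemma DERIV_integral_flow:
 fixes T :: "real => 'b::euclidean_space => 'b" and \<eta> f :: "'b => real"
 assumes M: "finite_measure M" "sets M = sets borel" "AE z in M. norm z \<le> C"
  and Tm: "\<And>t. T t \<in> borel_measurable borel"
  and T: "\<And>t z. ((\<lambda>s. T s z) has_vector_derivative Z (T t z)) (at t)"
  and Tn: "\<And>t z. norm (T t z) \<le> norm z"
  and Z: "polynomial_function Z" and \<eta>: "real_polynomial_function \<eta>"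
  and f: "f \<in> borel_measurable borel" "\<And>z. \<bar>f z\<bar> \<le> B"
 shows "((\<lambda>s. (LINT z|M. f z * \<eta> (T s z))) has_real_derivative (LINT z|M. f z * dird \<eta> (T t z) (Z (T t z)))) (at t)"
proof -
 interpret finite_measure M by fact
 define g where "g z = dird \<eta> z (Z z)" for z
 have g: "real_polynomial_function g" unfolding g_def by (rule real_polynomial_dird[OF \<eta> Z])
 have bd: "\<exists>K. \<forall>z. norm z \<le> C \<longrightarrow> \<bar>p z\<bar> \<le> K" if "real_polynomial_function p" for p :: "'b => real"
 proof -
  have "compact (p ` cball 0 C)"
   by (intro compact_continuous_image continuous_on_real_polynomial that compact_cball)
  then obtain K where "\<forall>y\<in>p ` cball 0 C. norm y \<le> K" using compact_imp_bounded bounded_iff by blast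
  then show ?thesis by (intro exI[of _ K]) auto
 qed
 obtain K where K: "\<And>z. norm z \<le> C ==> \<bar>g z\<bar> \<le> K" using bd[OF g] by blast
 obtain K' where K': "\<And>z. norm z \<le> C ==> \<bar>\<eta> z\<bar> \<le> K'" using bd[OF \<eta>] by blast
 have B0: "0 \<le> B" using f(2)[of undefined] by linarith
 have d: "((\<lambda>s. \<eta> (T s z)) has_real_derivative g (T s z)) (at s)" for s z
 proof -
  have "((\<lambda>s. T s z) has_derivative (\<lambda>h. h *\<^sub>R Z (T s z))) (at s)"
   using T[of z s] by (simp add: has_vector_derivative_def)
  from has_derivative_compose[OF this has_derivative_dird[OF \<eta>]]
  have "((\<lambda>s. \<eta> (T s z)) has_derivative (\<lambda>h. dird \<eta> (T s z) (h *\<^sub>R Z (T s z)))) (at s)" .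
  then show ?thesis
   by (simp add: has_field_derivative_def g_def linear_scale[OF dird_linear[OF \<eta>]] mult_commute_abs)
 qed
 have lip: "\<bar>\<eta> (T s z) - \<eta> (T t z)\<bar> \<le> K * \<bar>s - t\<bar>" if z: "norm z \<le> C" for s z
 proof -
  have "norm (g (T r z)) \<le> K" for r
   using K[of "T r z"] Tn[of r z] z by simp
  then show ?thesis
   using field_differentiable_bound[of UNIV "\<lambda>s. \<eta> (T s z)" "\<lambda>s. g (T s z)" K s t] d by simp
 qed
 have Tm': "T s \<in> measurable M borel" for s using Tm[of s] by (simp add: measurable_cong_sets[OF M(2) refl])
 have fm: "f \<in> borel_measurable M" using f(1) by (simp add: measurable_cong_sets[OF M(2) refl])
 have pm: "(\<lambda>z. f z * p (T s z)) \<in> borel_measurable M" if "real_polynomial_function p" for p :: "'b => real" and s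
  by (intro borel_measurable_times fm measurable_compose[OF Tm' borel_measurable_real_polynomial[OF that]])
 have int: "integrable M (\<lambda>z. f z * \<eta> (T s z))" for s
 proof (rule integrable_const_bound[OF _ pm[OF \<eta>]])
  show "AE z in M. norm (f z * \<eta> (T s z)) \<le> B * K'"
   using M(3)
  proof eventually_elim
   case (elim z)
   have "\<bar>\<eta> (T s z)\<bar> \<le> K'" using K'[of "T s z"] Tn[of s z] elim by simp
   then show ?case using f(2)[of z] B0 by (auto simp: abs_mult intro!: mult_mono)
  qed
 qed
 show ?thesis
  unfolding has_field_derivative_iff tendsto_at_iff_sequentially
 proof (intro allI impI)
  fix X :: "nat => real"
  assume X: "\<forall>i. X i \<in> UNIV - {t}" and X': "X \<longlonglongrightarrow> t"
  let ?q = "\<lambda>n z. f z * ((\<eta> (T (X n) z) - \<eta> (T t z)) / (X n - t))"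
  have q: "?q n = (\<lambda>z. (f z * \<eta> (T (X n) z) - f z * \<eta> (T t z)) / (X n - t))" for n
   by (simp add: fun_eq_iff right_diff_distrib)
  have A: "(\<lambda>n. (LINT z|M. ?q n z)) \<longlonglongrightarrow> (LINT z|M. f z * g (T t z))"
  proof (rule integral_dominated_convergence[where w = "\<lambda>_. B * K"])
   show "(\<lambda>z. f z * g (T t z)) \<in> borel_measurable M" by (rule pm[OF g])
   show "?q n \<in> borel_measurable M" for n
    unfolding q by (intro borel_measurable_divide borel_measurable_diff pm[OF \<eta>] borel_measurable_const)
   show "AE z in M. (\<lambda>n. ?q n z) \<longlonglongrightarrow> f z * g (T t z)"
   proof (rule AE_I2, intro tendsto_mult_left)
    fix z
    have "((\<lambda>s. (\<eta> (T s z) - \<eta> (T t z)) / (s - t)) \<longlongrightarrow> g (T t z)) (at t)"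
     using d[of z t] by (simp add: has_field_derivative_iff)
    then show "(\<lambda>n. (\<eta> (T (X n) z) - \<eta> (T t z)) / (X n - t)) \<longlonglongrightarrow> g (T t z)"
     unfolding tendsto_at_iff_sequentially using X X' by (auto simp: o_def)
   qed
   show "AE z in M. norm (?q n z) \<le> B * K" for n
    using M(3)
   proof eventually_elim
    case (elim z)
    have "\<bar>X n - t\<bar> > 0" using X by auto
    then have "\<bar>(\<eta> (T (X n) z) - \<eta> (T t z)) / (X n - t)\<bar> \<le> K"
     using lip[OF elim, of "X n"] by (simp add: abs_divide divide_le_eq)
    from mult_mono[OF f(2)[of z] this B0 abs_ge_zero] show ?case
     by (simp only: real_norm_def abs_mult)
   qed
  qed simp
  have E: "(LINT z|M. ?q n z) = ((LINT z|M. f z * \<eta> (T (X n) z)) - (LINT z|M. f z * \<eta> (T t z))) / (X n - t)" for n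
   unfolding q by (simp add: Bochner_Integration.integral_diff[OF int int])
  show "((\<lambda>s. ((LINT z|M. f z * \<eta> (T s z)) - (LINT z|M. f z * \<eta> (T t z))) / (s - t)) \<circ> X) \<longlonglongrightarrow>
    (LINT z|M. f z * dird \<eta> (T t z) (Z (T t z)))"
   using A unfolding E by (simp only: o_def g_def)
 qed
qed

lemma real_polynomial_inner: "polynomial_function X ==> real_polynomial_function (\<lambda>x. X x \<bullet> b)"
 unfolding polynomial_function_def by (drule spec[of _ "\<lambda>y. y \<bullet> b"]) (simp add: bounded_linear_inner_left o_def)

lemma polynomial_function_scaleR_const:
 "real_polynomial_function p ==> polynomial_function (\<lambda>x. p x *\<^sub>R (v::'b::euclidean_space))"
 by (subst polynomial_function_iff_Basis_inner)
  (auto intro!: real_polynomial_function.intros(4) real_polynomial_function.intros(2))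

lemma real_polynomial_id_inner: "real_polynomial_function (\<lambda>x::'a::euclidean_space. x \<bullet> b)"
 by (intro real_polynomial_function.intros(1) bounded_linear_inner_left)

lemma borel_measurable_sphere_div:
 assumes "smooth_sphere X"
 shows "sphere_div X \<in> borel_measurable borel"
proof (rule borel_measurable_continuous_countable_exceptions)
 show "continuous_on (- {0}) (sphere_div X)"
  unfolding sphere_div_alt[abs_def]
  by (intro continuous_intros smooth_sphere_continuous_deriv assms)
qed simp

context rotation_invariant_prob
begin

lemma AE_norm_le: "AE x in P. norm x \<le> 1"
 using AE_norm by eventually_elim simp

lemma finite_measure_P: "finite_measure P"
 by (rule finite_measure_axioms)

lemma integrable_P_continuous:
 fixes g :: "'a => 'b::{banach,second_countable_topology}"
 shows "continuous_on UNIV g ==> integrable P g"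
 by (rule integrable_AE_bounded[OF finite_measure_P sets_P AE_norm_le])

lemma integrable_P_polynomial: "real_polynomial_function p ==> integrable P p"
 by (intro integrable_P_continuous continuous_on_real_polynomial)

lemma integral_invariant:
 fixes f :: "'a => 'b::{banach,second_countable_topology}"
 assumes "orthogonal_transformation h" "f \<in> borel_measurable borel"
 shows "(LINT x|P. f (h x)) = (LINT x|P. f x)"
proof -
 have "(LINT x|P. f x) = (LINT x|(distr P borel h). f x)" using invariant[OF assms(1)] by simp
 also have "\<dots> = (LINT x|P. f (h x))"
  using assms orthogonal_transformation_measurable[OF assms(1)]
  by (subst integral_distr) (auto simp: measurable_P)
 finally show ?thesis by simp
qed

definition plane_rot :: "'a => 'a => real => 'a => 'a" where
 "plane_rot b c t x = x + ((cos t - 1) * (x \<bullet> b) - sin t * (x \<bullet> c)) *\<^sub>R b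
   + (sin t * (x \<bullet> b) + (cos t - 1) * (x \<bullet> c)) *\<^sub>R c"

lemma plane_rot_inner:
 assumes "b \<in> Basis" "c \<in> Basis" "b \<noteq> c"
 shows "plane_rot b c t x \<bullet> b = cos t * (x \<bullet> b) - sin t * (x \<bullet> c)"
  "plane_rot b c t x \<bullet> c = sin t * (x \<bullet> b) + cos t * (x \<bullet> c)"
 using assms by (simp_all add: plane_rot_def inner_add_left inner_Basis algebra_simps)

lemma orthogonal_transformation_plane_rot:
 assumes "b \<in> Basis" "c \<in> Basis" "b \<noteq> c"
 shows "orthogonal_transformation (plane_rot b c t)"
 unfolding orthogonal_transformation
proof (intro conjI allI)
 show "linear (plane_rot b c t)"
  by (rule linearI) (simp_all add: plane_rot_def inner_add_left algebra_simps)
 fix x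
 define \<alpha> where "\<alpha> = (cos t - 1) * (x \<bullet> b) - sin t * (x \<bullet> c)"
 define \<beta> where "\<beta> = sin t * (x \<bullet> b) + (cos t - 1) * (x \<bullet> c)"
 have o: "b \<bullet> b = 1" "c \<bullet> c = 1" "b \<bullet> c = 0" "c \<bullet> b = 0" "b \<bullet> x = x \<bullet> b" "c \<bullet> x = x \<bullet> c"
  using assms by (auto simp: inner_Basis inner_commute)
 have "plane_rot b c t x \<bullet> plane_rot b c t x = x \<bullet> x + ((x \<bullet> b + \<alpha>)\<^sup>2 - (x \<bullet> b)\<^sup>2) + ((x \<bullet> c + \<beta>)\<^sup>2 - (x \<bullet> c)\<^sup>2)"
  unfolding plane_rot_def \<alpha>_def[symmetric] \<beta>_def[symmetric]
  by (simp only: inner_add_left inner_add_right inner_scaleR_left inner_scaleR_right o) algebra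
 also have "x \<bullet> b + \<alpha> = cos t * (x \<bullet> b) - sin t * (x \<bullet> c)"
  by (simp add: \<alpha>_def algebra_simps)
 also have "x \<bullet> c + \<beta> = sin t * (x \<bullet> b) + cos t * (x \<bullet> c)"
  by (simp add: \<beta>_def algebra_simps)
 also have "x \<bullet> x + ((cos t * (x \<bullet> b) - sin t * (x \<bullet> c))\<^sup>2 - (x \<bullet> b)\<^sup>2) + ((sin t * (x \<bullet> b) + cos t * (x \<bullet> c))\<^sup>2 - (x \<bullet> c)\<^sup>2)
   = x \<bullet> x + ((sin t)\<^sup>2 + (cos t)\<^sup>2 - 1) * ((x \<bullet> b)\<^sup>2 + (x \<bullet> c)\<^sup>2)"
  by (simp only: power2_eq_square) algebra
 finally show "norm (plane_rot b c t x) = norm x" by (simp add: norm_eq)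
qed

text \<open>The mean of \<open>\<eta>\<close> after a rotation is constant in the angle; this is its
  derivative at angle 0.\<close>

lemma rotation_generator:
 assumes \<eta>: "real_polynomial_function \<eta>" and b: "b \<in> Basis" "c \<in> Basis"
 shows "(LINT x|P. dird \<eta> x ((x \<bullet> b) *\<^sub>R c - (x \<bullet> c) *\<^sub>R b)) = 0"
proof (cases "b = c")
 case True
 then show ?thesis by (simp add: linear_0[OF dird_linear[OF \<eta>]])
next
 case False
 note o = orthogonal_transformation_plane_rot[OF b False]
 define Z where "Z x = (x \<bullet> b) *\<^sub>R c - (x \<bullet> c) *\<^sub>R b" for x :: 'a
 have Z: "polynomial_function Z"
  unfolding Z_def by (intro polynomial_function_diff polynomial_function_scaleR_const real_polynomial_id_inner)
 have "((\<lambda>s. plane_rot b c s x) has_vector_derivative Z (plane_rot b c t x)) (at t)" for t x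
  unfolding Z_def plane_rot_inner[OF b False] unfolding plane_rot_def
  by (rule has_vector_derivative_eq_rhs) (auto intro!: derivative_eq_intros simp: algebra_simps)
 moreover have "norm (plane_rot b c t x) \<le> norm x" for t x
  using o[of t] by (simp add: orthogonal_transformation)
 ultimately have "((\<lambda>s. (LINT z|P. 1 * \<eta> (plane_rot b c s z))) has_real_derivative
   (LINT z|P. 1 * dird \<eta> (plane_rot b c 0 z) (Z (plane_rot b c 0 z)))) (at 0)"
  by (intro DERIV_integral_flow[OF finite_measure_P sets_P AE_norm_le, where B = 1] Z \<eta>
    orthogonal_transformation_measurable o) auto
 moreover have "(LINT z|P. \<eta> (plane_rot b c s z)) = (LINT z|P. \<eta> z)" for s
  by (intro integral_invariant o borel_measurable_real_polynomial \<eta>)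
 moreover have "plane_rot b c 0 z = z" for z by (simp add: plane_rot_def)
 ultimately have "((\<lambda>s::real. (LINT z|P. \<eta> z)) has_real_derivative (LINT z|P. dird \<eta> z (Z z))) (at 0)"
  by simp
 then show ?thesis using DERIV_unique[OF _ DERIV_const] unfolding Z_def by blast
qed

lemma sphere_div_polynomial:
 assumes X: "polynomial_function X" and x: "norm x = 1"
 shows "sphere_div X x = (\<Sum>c\<in>Basis. dird (\<lambda>x. X x \<bullet> c) x c) - (\<Sum>c\<in>Basis. dird (\<lambda>x. X x \<bullet> c) x x * (x \<bullet> c))"
proof -
 have "((\<lambda>x. \<Sum>c\<in>Basis. (X x \<bullet> c) *\<^sub>R c) has_derivative (\<lambda>v. \<Sum>c\<in>Basis. dird (\<lambda>x. X x \<bullet> c) x v *\<^sub>R c)) (at x)"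
  by (rule has_derivative_sum)
   (rule has_derivative_scaleR_left[OF has_derivative_dird[OF real_polynomial_inner[OF X]]])
 then have "(X has_derivative (\<lambda>v. \<Sum>c\<in>Basis. dird (\<lambda>x. X x \<bullet> c) x v *\<^sub>R c)) (at x)"
  by (simp add: euclidean_representation)
 from sphere_div_eq[OF this x] show ?thesis
  by (simp add: inner_sum_left inner_sum_right inner_Basis inner_commute[of _ x] if_distrib cong: if_cong)
qed

text \<open>The divergence of a tangent field is the sum over b and c of the rotation generators x_b
  d_c - x_c d_b applied to x_b X_c, and each summand has mean 0. The identity uses |x| = 1 and X
  \<bullet> x = 0.\<close>

lemma divergence_theorem:
 assumes X: "polynomial_function X" and tan: "\<And>x. norm x = 1 ==> X x \<bullet> x = 0"
 shows "(LINT x|P. sphere_div X x) = 0"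
proof -
 let ?X = "\<lambda>c x. X x \<bullet> c"
 define h where "h b c x = (x \<bullet> b) * (X x \<bullet> c)" for b c x
 define A where "A b c x = (x \<bullet> b) *\<^sub>R c - (x \<bullet> c) *\<^sub>R b" for b c x :: 'a
 have rX: "real_polynomial_function (?X c)" for c using X by (rule real_polynomial_inner)
 have rh: "real_polynomial_function (h b c)" for b c
  unfolding h_def by (intro real_polynomial_function.intros(4) real_polynomial_id_inner rX)
 have dh: "dird (h b c) x v = (x \<bullet> b) * dird (?X c) x v + (v \<bullet> b) * (X x \<bullet> c)" for b c x v
  unfolding h_def
  by (rule dird_eq, rule has_derivative_mult[OF has_derivative_inner_left[OF has_derivative_ident] has_derivative_dird[OF rX]])
 have PA: "polynomial_function (A b c)" for b c
  unfolding A_def by (intro polynomial_function_diff polynomial_function_scaleR_const real_polynomial_id_inner)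
 have int: "integrable P (\<lambda>x. dird (h b c) x (A b c x))" for b c
  by (intro integrable_P_polynomial real_polynomial_dird rh PA)
 have key: "sphere_div X x = (\<Sum>b\<in>Basis. \<Sum>c\<in>Basis. dird (h b c) x (A b c x))" if x: "norm x = 1" for x
 proof -
  have lin: "linear (dird (?X c) x)" for c by (rule dird_linear[OF rX])
  have x1: "(\<Sum>b\<in>Basis. (x \<bullet> b) * (x \<bullet> b)) = 1"
   using x by (simp add: norm_eq_1 euclidean_inner[of x x])
  have Xx: "(\<Sum>b\<in>Basis. (x \<bullet> b) * (X x \<bullet> b)) = 0"
   using tan[OF x] by (subst (asm) euclidean_inner) (simp add: mult.commute)
  have dx: "(\<Sum>b\<in>Basis. (x \<bullet> b) * dird (?X c) x b) = dird (?X c) x x" for c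
   using linear_sum[OF lin[of c], of "\<lambda>b. (x \<bullet> b) *\<^sub>R b" Basis]
   by (simp add: euclidean_representation linear_scale[OF lin])
  have e: "dird (h b c) x (A b c x) = (x \<bullet> b) * (x \<bullet> b) * dird (?X c) x c - (x \<bullet> c) * ((x \<bullet> b) * dird (?X c) x b)
    + (x \<bullet> b) * (c \<bullet> b) * (X x \<bullet> c) - (x \<bullet> c) * (X x \<bullet> c) * (b \<bullet> b)" for b c
   by (simp only: dh A_def linear_diff[OF lin] linear_scale[OF lin] inner_diff_left inner_scaleR_left real_scaleR_def) algebra
  have "(\<Sum>b\<in>Basis. \<Sum>c\<in>Basis. dird (h b c) x (A b c x))
   = (\<Sum>b\<in>Basis. \<Sum>c\<in>Basis. (x \<bullet> b) * (x \<bullet> b) * dird (?X c) x c)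
    - (\<Sum>b\<in>Basis. \<Sum>c\<in>Basis. (x \<bullet> c) * ((x \<bullet> b) * dird (?X c) x b))
    + (\<Sum>b\<in>Basis. \<Sum>c\<in>Basis. (x \<bullet> b) * (c \<bullet> b) * (X x \<bullet> c))
    - (\<Sum>b\<in>(Basis::'a set). \<Sum>c\<in>(Basis::'a set). (x \<bullet> c) * (X x \<bullet> c) * (b \<bullet> b))"
   by (simp only: e sum.distrib sum_subtractf)
  also have "(\<Sum>b\<in>Basis. \<Sum>c\<in>Basis. (x \<bullet> b) * (x \<bullet> b) * dird (?X c) x c) = (\<Sum>c\<in>Basis. dird (?X c) x c)"
   by (simp add: sum_product[symmetric] x1)
  also have "(\<Sum>b\<in>Basis. \<Sum>c\<in>Basis. (x \<bullet> c) * ((x \<bullet> b) * dird (?X c) x b)) = (\<Sum>c\<in>Basis. dird (?X c) x x * (x \<bullet> c))"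
   by (subst sum.swap) (simp add: sum_distrib_left[symmetric] dx mult.commute)
  also have "(\<Sum>b\<in>Basis. \<Sum>c\<in>Basis. (x \<bullet> b) * (c \<bullet> b) * (X x \<bullet> c)) = (\<Sum>b\<in>Basis. (x \<bullet> b) * (X x \<bullet> b))"
  proof (intro sum.cong refl)
   fix b :: 'a assume b: "b \<in> Basis"
   have "(\<Sum>c\<in>Basis. (x \<bullet> b) * (c \<bullet> b) * (X x \<bullet> c)) = (\<Sum>c\<in>Basis. if c = b then (x \<bullet> b) * (X x \<bullet> b) else 0)"
    using b by (intro sum.cong) (auto simp: inner_Basis)
   then show "(\<Sum>c\<in>Basis. (x \<bullet> b) * (c \<bullet> b) * (X x \<bullet> c)) = (x \<bullet> b) * (X x \<bullet> b)" using b by simp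
  qed
  also have "(\<Sum>b\<in>(Basis::'a set). \<Sum>c\<in>(Basis::'a set). (x \<bullet> c) * (X x \<bullet> c) * (b \<bullet> b)) = 0"
   by (simp add: sum_distrib_right[symmetric] Xx)
  finally show ?thesis unfolding sphere_div_polynomial[OF X x] Xx by simp
 qed
 have "(LINT x|P. sphere_div X x) = (LINT x|P. (\<Sum>b\<in>Basis. \<Sum>c\<in>Basis. dird (h b c) x (A b c x)))"
 proof (rule integral_cong_AE)
  show "sphere_div X \<in> borel_measurable P"
   using borel_measurable_sphere_div[OF smooth_sphere_polynomial[OF X]]
   by (simp add: measurable_P)
  show "(\<lambda>x. \<Sum>b\<in>Basis. \<Sum>c\<in>Basis. dird (h b c) x (A b c x)) \<in> borel_measurable P"
   by (intro borel_measurable_sum borel_measurable_integrable int)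
  show "AE x in P. sphere_div X x = (\<Sum>b\<in>Basis. \<Sum>c\<in>Basis. dird (h b c) x (A b c x))"
   using AE_norm by eventually_elim (rule key)
 qed
 also have "\<dots> = (\<Sum>b\<in>Basis. \<Sum>c\<in>Basis. (LINT x|P. dird (h b c) x (A b c x)))"
  by (simp add: Bochner_Integration.integral_sum int Bochner_Integration.integrable_sum)
 also have "\<dots> = 0"
  using rotation_generator[OF rh] by (simp add: A_def)
 finally show ?thesis .
qed

end

subsection \<open>Polynomials in two variables\<close>

text \<open>Splits a polynomial of point and direction into terms homogeneous in the direction.
  Homogeneity is what later allows a unit tangent vector to be replaced by the projection of an
  independent point.\<close>

inductive separated_poly :: "('a::euclidean_space \<times> 'a => real) => bool" where
 product: "real_polynomial_function a ==> real_polynomial_function \<mu> ==> (\<And>c y. \<mu> (c *\<^sub>R y) = c ^ k * \<mu> y)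
   ==> separated_poly (\<lambda>z. a (fst z) * \<mu> (snd z))"
| add: "separated_poly f ==> separated_poly g ==> separated_poly (\<lambda>z. f z + g z)"

lemma separated_poly_mult_product:
 assumes a: "real_polynomial_function a" "real_polynomial_function \<mu>" "\<And>c y. \<mu> (c *\<^sub>R y) = c ^ k * \<mu> y"
  and g: "separated_poly g"
 shows "separated_poly (\<lambda>z. (a (fst z) * \<mu> (snd z)) * g z)"
 using g
proof (induction rule: separated_poly.induct)
 case (product a' \<mu>' k')
 have "separated_poly (\<lambda>z. (\<lambda>x. a x * a' x) (fst z) * (\<lambda>y. \<mu> y * \<mu>' y) (snd z))"
  by (rule separated_poly.product[where k = "k + k'"])
   (auto intro: real_polynomial_function.intros(4) a product simp: a(3) product(3) power_add)
 then show ?case by (simp add: mult_ac)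
next
 case (add f g)
 show ?case using separated_poly.add[OF add.IH] by (simp only: distrib_left)
qed

lemma separated_poly_mult:
 assumes "separated_poly f" and g: "separated_poly g"
 shows "separated_poly (\<lambda>z. f z * g z)"
 using assms(1)
proof (induction rule: separated_poly.induct)
 case (product a \<mu> k)
 then show ?case by (rule separated_poly_mult_product[OF _ _ _ g])
next
 case (add f f')
 show ?case using separated_poly.add[OF add.IH] by (simp only: distrib_right)
qed

lemma real_polynomial_separated:
 "real_polynomial_function f ==> separated_poly f"
proof (induction rule: real_polynomial_function.induct)
 case (linear f)
 have one: "real_polynomial_function (\<lambda>_::'a. 1)" by (rule real_polynomial_function.intros(2))
 have "bounded_linear (\<lambda>x::'a. (x, 0::'a))" "bounded_linear (\<lambda>x::'a. (0::'a, x))"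
  by (intro bounded_linear_Pair bounded_linear_ident bounded_linear_zero)+
 then have bl: "bounded_linear (\<lambda>x. f (x, 0))" "bounded_linear (\<lambda>y. f (0, y))"
  using bounded_linear_compose[OF linear] by blast+
 have h: "f (0, c *\<^sub>R y) = c ^ 1 * f (0, y)" for c y
  using linear_scale[OF bounded_linear.linear[OF bl(2)]] by simp
 have 1: "separated_poly (\<lambda>z. f (fst z, 0) * 1)"
  by (rule separated_poly.product[OF real_polynomial_function.intros(1)[OF bl(1)] one, of 0]) simp
 have 2: "separated_poly (\<lambda>z. 1 * f (0, snd z))"
  by (rule separated_poly.product[OF one real_polynomial_function.intros(1)[OF bl(2)] h])
 have "f z = f (fst z, 0) * 1 + 1 * f (0, snd z)" for z
  using linear_add[OF bounded_linear.linear[OF linear], of "(fst z, 0)" "(0, snd z)"] by simp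
 then have "f = (\<lambda>z. f (fst z, 0) * 1 + 1 * f (0, snd z))" by blast
 then show ?case using separated_poly.add[OF 1 2] by simp
next
 case (const c)
 show ?case
  using separated_poly.product[of "\<lambda>x::'a. c" "\<lambda>y. 1" 0] by (simp add: real_polynomial_function.intros(2))
next
 case (add f g)
 then show ?case by (intro separated_poly.add)
next
 case (mult f g)
 then show ?case by (intro separated_poly_mult)
qed

lemma real_polynomial_inner2:
 fixes u v :: "'z::real_normed_vector => 'b::euclidean_space"
 assumes "polynomial_function u" "polynomial_function v"
 shows "real_polynomial_function (\<lambda>z. u z \<bullet> v z)"
proof -
 have "real_polynomial_function (\<lambda>z. \<Sum>b\<in>Basis. (u z \<bullet> b) * (v z \<bullet> b))"
  by (rule real_polynomial_function_sum[OF finite_Basis])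
   (rule real_polynomial_function.intros(4)[OF real_polynomial_inner[OF assms(1)] real_polynomial_inner[OF assms(2)]])
 then show ?thesis by (simp only: euclidean_inner[symmetric])
qed

lemma polynomial_fst: "polynomial_function (fst :: 'a::euclidean_space \<times> 'b::euclidean_space => 'a)"
 by (rule polynomial_function_bounded_linear[OF bounded_linear_fst])

lemma polynomial_snd: "polynomial_function (snd :: 'a::euclidean_space \<times> 'b::euclidean_space => 'b)"
 by (rule polynomial_function_bounded_linear[OF bounded_linear_snd])

lemma polynomial_compose_fst:
 fixes p :: "'a::euclidean_space => real"
 assumes "real_polynomial_function p"
 shows "real_polynomial_function (\<lambda>z :: 'a \<times> 'b::euclidean_space. p (fst z))"
 using real_polynomial_function_compose[OF polynomial_fst assms] by (simp add: o_def)

definition tproj :: "'a::real_inner => 'a => 'a" where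
 "tproj x v = v - (x \<bullet> v) *\<^sub>R x"

lemma tproj_inner: "tproj x u \<bullet> v = u \<bullet> tproj x v"
 by (simp add: tproj_def inner_diff_left inner_diff_right inner_commute)

lemma tproj_orth: "norm x = 1 ==> tproj x v \<bullet> x = 0"
 by (simp add: tproj_def inner_diff_left inner_commute[of v x] norm_eq_1)

lemma norm_tproj_le:
 assumes "norm x = 1" shows "norm (tproj x v) \<le> norm v"
proof -
 have "tproj x v \<bullet> tproj x v = v \<bullet> v - (x \<bullet> v)\<^sup>2"
  using assms by (simp add: tproj_def inner_diff_left inner_diff_right inner_commute norm_eq_1 power2_eq_square)
 then show ?thesis by (simp add: norm_le)
qed

lemma polynomial_tproj: "polynomial_function (\<lambda>z::'a::euclidean_space \<times> 'a. tproj (fst z) (snd z))"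
 unfolding tproj_def
 by (intro polynomial_function_diff polynomial_function_mult polynomial_fst polynomial_snd)
  (simp add: real_polynomial_function_eq[symmetric] real_polynomial_inner2 polynomial_fst polynomial_snd)

subsection \<open>Density of polynomials\<close>

text \<open>Regularity encloses \<open>A\<close> between a compact and an open set, Urysohn
  interpolates, Stone-Weierstrass approximates on the ball. The two-sided bound keeps the sup norm
  of the approximation near 1, as the sharp constant in \<open>chord_var_upper\<close>
  demands.\<close>

lemma polynomial_approx_indicator:
 fixes A :: "'b::euclidean_space set"
 assumes M: "finite_measure M" "sets M = sets borel" "AE z in M. norm z \<le> C" and A: "A \<in> sets borel" and e: "0 < e"
 obtains p where "real_polynomial_function p" "(LINT z|M. \<bar>p z - indicator A z\<bar>) < e"
  "\<And>z. norm z \<le> C ==> - e \<le> p z \<and> p z \<le> 1 + e"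
proof -
 interpret finite_measure M by fact
 have sM: "space M = UNIV" using sets_eq_imp_space_eq[OF M(2)] by simp
 have fin: "emeasure M (space M) \<noteq> \<infinity>" by simp
 define m where "m = measure M UNIV"
 have m: "0 \<le> m" by (simp add: m_def)
 \<comment> \<open>Makes both the uniform error and its integral over the total mass
   \<open>m\<close> at most e / 3; the set \<open>U - K\<close> accounts for the last third.\<close>
 define d where "d = e / (3 * (1 + m))"
 have d: "0 < d" using e m by (simp add: d_def add_pos_nonneg)
 have dle: "d \<le> e / 3" "d * m \<le> e / 3"
  using e m by (simp_all add: d_def field_simps)
 obtain K where K: "K \<subseteq> A" "compact K" "measure M A < measure M K + e / 6"
 proof -
  show thesis
  proof (cases "measure M A < e / 6")
   case True
   then show thesis using that[of "{}"] by simp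
  next
   case False
   then have "ennreal (measure M A - e / 6) < emeasure M A"
    using e by (simp add: emeasure_eq_measure ennreal_less_iff)
   also have "\<dots> = (SUP K \<in> {K. K \<subseteq> A \<and> compact K}. emeasure M K)"
    by (rule inner_regular[OF M(2) fin A])
   finally obtain K where K: "K \<subseteq> A" "compact K" "ennreal (measure M A - e / 6) < emeasure M K"
    unfolding less_SUP_iff by blast
   then have "measure M A - e / 6 < measure M K"
    using False by (simp add: emeasure_eq_measure ennreal_less_iff)
   then show thesis using that[of K] K by simp
  qed
 qed
 obtain U where U: "A \<subseteq> U" "open U" "measure M U < measure M A + e / 6"
 proof -
  have "(INF U \<in> {U. A \<subseteq> U \<and> open U}. emeasure M U) < emeasure M A + ennreal (e/6)"
   unfolding outer_regular[OF M(2) fin A, symmetric] using e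
   by (metis emeasure_eq_measure ennreal_add_left_cancel_less ennreal_less_zero_iff add.right_neutral
     ennreal_neq_top divide_pos_pos zero_less_numeral infinity_ennreal_def)
  then obtain U where "U \<in> {U. A \<subseteq> U \<and> open U}" "emeasure M U < emeasure M A + ennreal (e/6)"
   unfolding INF_less_iff by blast
  then show ?thesis using that[of U] e
   by (simp add: emeasure_eq_measure ennreal_plus[symmetric] ennreal_less_iff del: ennreal_plus)
 qed
 have KUs: "K \<in> sets M" "U \<in> sets M" using K U M(2) by (auto simp: borel_compact)
 have KU: "measure M (U - K) < e / 3"
  using K U KUs finite_measure_Diff[OF KUs(2,1)] by force
 obtain g :: "'b => real" where g: "continuous_on UNIV g" "\<And>x. g x \<in> closed_segment 1 0"
  "\<And>x. x \<in> K ==> g x = 1" "\<And>x. x \<in> - U ==> g x = 0"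
 proof -
  have c: "closed K" "closed (- U)" "K \<inter> - U = {}" using K U by (auto intro: compact_imp_closed)
  show thesis by (rule Urysohn[OF c, of "1::real" 0]) (rule that)
 qed
 have g01: "0 \<le> g x" "g x \<le> 1" for x using g(2)[of x] by (auto simp: closed_segment_eq_real_ivl)
 obtain p where p: "real_polynomial_function p" "\<And>x. x \<in> cball 0 C ==> \<bar>g x - p x\<bar> < d"
  using Stone_Weierstrass_real_polynomial_function[OF compact_cball continuous_on_subset[OF g(1)] d(1)] by blast
 have pg: "norm x \<le> C ==> \<bar>g x - p x\<bar> < d" for x using p(2)[of x] by simp
 show ?thesis
 proof (rule that[OF p(1)])
  show "- e \<le> p z \<and> p z \<le> 1 + e" if "norm z \<le> C" for z
   using pg[OF that] g01[of z] dle e by linarith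
  have "emeasure M (U - K) < \<infinity>" unfolding emeasure_eq_measure by simp
  then have iKU: "integrable M (indicator (U - K) :: 'b => real)"
   using KUs by (intro integrable_real_indicator) auto
  have "(LINT z|M. \<bar>p z - indicator A z\<bar>) \<le> (LINT z|M. d + indicator (U - K) z)"
  proof (rule integral_mono_AE')
   show "integrable M (\<lambda>z. d + indicator (U - K) z)"
    by (intro Bochner_Integration.integrable_add integrable_const iKU)
   show "AE z in M. \<bar>p z - indicator A z\<bar> \<le> d + indicator (U - K) z"
    using M(3)
   proof eventually_elim
    case (elim z)
    have "\<bar>g z - indicator A z\<bar> \<le> indicator (U - K) z"
     using g01[of z] g(3,4)[of z] K(1) U(1) by (auto simp: indicator_def)
    then show ?case using pg[OF elim] by linarith
   qed
   show "AE z in M. 0 \<le> d + (indicator (U - K) z :: real)" using d by (auto simp: indicator_def)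
  qed
  also have "\<dots> = d * m + measure M (U - K)"
   using KUs by (subst Bochner_Integration.integral_add[OF integrable_const iKU])
    (simp add: m_def sM mult.commute)
  also have "\<dots> < e" using dle KU e by linarith
  finally show "(LINT z|M. \<bar>p z - indicator A z\<bar>) < e" .
 qed
qed

subsection \<open>Averages over orthonormal pairs\<close>

context rotation_invariant_prob
begin

lemma finite_measure_\<nu>: "finite_measure \<nu>"
 using prob_space_\<nu> by (simp add: prob_space_def)

lemma sets_\<nu>_borel: "sets \<nu> = sets (borel :: ('a \<times> 'a) measure)"
 by (simp only: sets_\<nu> borel_prod)

lemma AE_\<nu>_le: "AE z in \<nu>. norm z \<le> 2"
 using AE_\<nu>
proof eventually_elim
 case (elim z)
 then show ?case using norm_Pair_le[of "fst z" "snd z"] by simp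
qed

lemma integrable_\<nu>_polynomial: "real_polynomial_function p ==> integrable \<nu> p"
 by (rule integrable_AE_bounded[OF finite_measure_\<nu> sets_\<nu>_borel AE_\<nu>_le continuous_on_real_polynomial])

lemma finite_measure_PP: "finite_measure PP"
 by (intro finite_measure_pair_measure finite_measure_P)

lemma sets_PP: "sets PP = sets (borel :: ('a \<times> 'a) measure)"
 by (simp add: borel_prod[symmetric] cong: sets_pair_measure_cong)

lemma space_PP [simp]: "space PP = UNIV"
 by (simp add: space_pair_measure)

text \<open>Resamples a pair of points: the angle is that of the first pair, the position comes from
  an independent orthonormal pair. The averaging identity shows that this preserves the law of two
  independent points, which separates angle from position.\<close>

definition pair_map :: "('a \<times> 'a) \<times> ('a \<times> 'a) => 'a \<times> 'a" where
 "pair_map w = (fst (snd w), (fst (fst w) \<bullet> snd (fst w)) *\<^sub>R fst (snd w)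
   + sqrt (1 - (fst (fst w) \<bullet> snd (fst w))\<^sup>2) *\<^sub>R snd (snd w))"

lemma pair_map_measurable: "pair_map \<in> measurable (PP \<Otimes>\<^sub>M \<nu>) borel2"
 unfolding pair_map_def by measurable

lemma distr_pair_map: "distr (PP \<Otimes>\<^sub>M \<nu>) borel2 pair_map = PP"
proof (rule measure_eqI)
 fix A assume "A \<in> sets (distr (PP \<Otimes>\<^sub>M \<nu>) borel2 pair_map)"
 then have A [measurable]: "A \<in> sets borel2" by simp
 note [measurable] = pair_map_measurable
 have AP: "A \<in> sets PP" using A by (simp cong: sets_pair_measure_cong)
 have "emeasure PP A = (\<integral>\<^sup>+x. \<integral>\<^sup>+y. 1 * indicator A (x, y) \<partial>P \<partial>P)"
  by (simp add: emeasure_pair_measure[OF AP])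
 also have "\<dots> = (\<integral>\<^sup>+x. \<integral>\<^sup>+y. 1 * (\<integral>\<^sup>+z. indicator A (fst z, (x \<bullet> y) *\<^sub>R fst z + sqrt (1 - (x \<bullet> y)\<^sup>2) *\<^sub>R snd z) \<partial>\<nu>) \<partial>P \<partial>P)"
  by (rule nn_integral_pair_average) auto
 also have "\<dots> = (\<integral>\<^sup>+x. \<integral>\<^sup>+y. (\<integral>\<^sup>+z. indicator A (pair_map ((x, y), z)) \<partial>\<nu>) \<partial>P \<partial>P)"
  by (simp add: pair_map_def)
 also have "\<dots> = (\<integral>\<^sup>+u. (\<integral>\<^sup>+z. indicator A (pair_map (u, z)) \<partial>\<nu>) \<partial>PP)"
  by (rule nn_integral_fst) measurable
 also have "\<dots> = (\<integral>\<^sup>+w. indicator A (pair_map w) \<partial>(PP \<Otimes>\<^sub>M \<nu>))"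
  by (rule N.nn_integral_fst) measurable
 also have "\<dots> = (\<integral>\<^sup>+w. indicator A w \<partial>distr (PP \<Otimes>\<^sub>M \<nu>) borel2 pair_map)"
  by (rule nn_integral_distr[symmetric]) measurable
 also have "\<dots> = emeasure (distr (PP \<Otimes>\<^sub>M \<nu>) borel2 pair_map) A"
  by (rule nn_integral_indicator) simp
 finally show "emeasure (distr (PP \<Otimes>\<^sub>M \<nu>) borel2 pair_map) A = emeasure PP A" ..
qed (simp cong: sets_pair_measure_cong)

definition sine :: "'a \<times> 'a => real" where
 "sine u = sqrt (1 - (fst u \<bullet> snd u)\<^sup>2)"

definition sine_moment :: "nat => real" where
 "sine_moment k = (LINT u|PP. sine u ^ k)"

lemma AE_PP: "AE u in PP. norm (fst u) = 1 \<and> norm (snd u) = 1"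
proof -
 have "AE x in P. AE y in P. norm x = 1 \<and> norm y = 1"
  using AE_norm
 proof eventually_elim
  case (elim x)
  show ?case using AE_norm by eventually_elim (simp add: elim)
 qed
 then have "AE x in P. AE y in P. norm (fst (x, y)) = 1 \<and> norm (snd (x, y)) = 1" by simp
 moreover have "pair_sigma_finite P P" by (simp add: pair_sigma_finite_def sigma_finite_measure_axioms)
 moreover have "Measurable.pred PP (\<lambda>u. norm (fst u) = 1 \<and> norm (snd u) = 1)"
  by measurable
 ultimately show ?thesis by (intro pair_sigma_finite.AE_pair_measure) (simp_all only: pred_def)
qed

lemma sine_bounds:
 assumes "norm (fst u) = 1" "norm (snd u) = 1"
 shows "0 \<le> sine u" "sine u \<le> 1" "(sine u)\<^sup>2 = 1 - (fst u \<bullet> snd u)\<^sup>2"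
proof -
 have "(fst u \<bullet> snd u)\<^sup>2 \<le> 1"
  using Cauchy_Schwarz_ineq2[of "fst u" "snd u"] assms by (simp add: abs_square_le_1)
 then show "0 \<le> sine u" "sine u \<le> 1" "(sine u)\<^sup>2 = 1 - (fst u \<bullet> snd u)\<^sup>2"
  by (auto simp: sine_def)
qed

lemma sine_measurable [measurable]: "sine \<in> borel_measurable borel2"
 unfolding sine_def by measurable

text \<open>Near the pair \<open>e1\<close>, \<open>e2\<close> the inner product is at most 1/2 in
  absolute value, so the sine is positive on a product of balls of positive mass.\<close>

lemma sine_moment_pos: "0 < sine_moment k"
proof -
 interpret PP: finite_measure "PP" by (rule finite_measure_PP)
 have sm: "sine \<in> borel_measurable PP" by measurable
 have int: "integrable PP (\<lambda>u. sine u ^ k)"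
 proof (rule PP.integrable_const_bound)
  show "AE u in PP. norm (sine u ^ k) \<le> 1"
   using AE_PP
  proof eventually_elim
   case (elim u)
   then show ?case using sine_bounds[of u] by (auto simp: power_abs intro!: power_le_one)
  qed
 qed measurable
 have nn: "AE u in PP. 0 \<le> sine u ^ k"
  using AE_PP by eventually_elim (auto dest: sine_bounds)
 have "sine_moment k \<noteq> 0"
 proof
  assume "sine_moment k = 0"
  then have "AE u in PP. sine u ^ k = 0"
   using integral_nonneg_eq_0_iff_AE[OF int nn] by (simp add: sine_moment_def)
  then have "AE u in PP. u \<notin> ball e1 (1/4) \<times> ball e2 (1/4)"
   using AE_PP
  proof eventually_elim
   case (elim u)
   show ?case
   proof
    assume u: "u \<in> ball e1 (1/4) \<times> ball e2 (1/4)"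
    obtain x y where xy: "u = (x, y)" by (cases u)
    have "x \<bullet> y = (x - e1) \<bullet> y + e1 \<bullet> (y - e2)" by (simp add: inner_diff_left inner_diff_right e12)
    moreover have "\<bar>(x - e1) \<bullet> y\<bar> \<le> norm (x - e1) * norm y" "\<bar>e1 \<bullet> (y - e2)\<bar> \<le> norm e1 * norm (y - e2)"
     by (rule Cauchy_Schwarz_ineq2)+
    moreover have "norm (x - e1) < 1/4" "norm (y - e2) < 1/4"
     using u xy by (auto simp: dist_norm norm_minus_commute)
    moreover have "norm y = 1" using elim xy by simp
    ultimately have "\<bar>x \<bullet> y\<bar> \<le> 1/2" by (simp only: e12 mult_1_right mult_1_left)
    then have "(x \<bullet> y)\<^sup>2 \<le> (1/2)\<^sup>2" using power_mono[of "\<bar>x \<bullet> y\<bar>" "1/2" 2] by simp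
    then have "(x \<bullet> y)\<^sup>2 < 1" by (simp add: power2_eq_square)
    then have "0 < sine u" by (simp add: sine_def xy)
    then show False using elim by (cases "k = 0") auto
   qed
  qed
  then have "emeasure PP (ball e1 (1/4) \<times> ball e2 (1/4)) = 0"
   by (subst (asm) AE_iff_measurable[OF _ refl]) auto
  moreover have "emeasure PP (ball e1 (1/4) \<times> ball e2 (1/4)) = emeasure P (ball e1 (1/4)) * emeasure P (ball e2 (1/4))"
   by (rule emeasure_pair_measure_Times) auto
  moreover have "emeasure P (ball e1 (1/4)) > 0" "emeasure P (ball e2 (1/4)) > 0"
   by (intro emeasure_ball_pos; simp add: e12)+
  ultimately show False by auto
 qed
 moreover have "0 \<le> sine_moment k" unfolding sine_moment_def by (rule integral_nonneg_AE[OF nn])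
 ultimately show ?thesis by simp
qed

end

context rotation_invariant_prob
begin

lemma integral_pair_average:
 fixes \<Phi> :: "'a \<times> 'a => real"
 assumes [measurable]: "\<Phi> \<in> borel_measurable borel2"
 shows "(LINT u|PP. \<Phi> u) = (LINT w|(PP \<Otimes>\<^sub>M \<nu>). \<Phi> (pair_map w))"
 by (subst distr_pair_map[symmetric], rule integral_distr[OF pair_map_measurable]) measurable

lemma AE_PP\<nu>: "AE w in PP \<Otimes>\<^sub>M \<nu>. norm (fst (fst w)) = 1 \<and> norm (snd (fst w)) = 1
  \<and> norm (fst (snd w)) = 1 \<and> norm (snd (snd w)) = 1 \<and> fst (snd w) \<bullet> snd (snd w) = 0"
proof -
 have "AE u in PP. AE z in \<nu>. norm (fst (fst (u, z))) = 1 \<and> norm (snd (fst (u, z))) = 1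
  \<and> norm (fst (snd (u, z))) = 1 \<and> norm (snd (snd (u, z))) = 1 \<and> fst (snd (u, z)) \<bullet> snd (snd (u, z)) = 0"
  using AE_PP
 proof eventually_elim
  case (elim u)
  show ?case using AE_\<nu> by eventually_elim (simp add: elim)
 qed
 note 1 = this
 have 2: "pair_sigma_finite PP \<nu>"
  using finite_measure.axioms(1)[OF finite_measure_PP] finite_measure.axioms(1)[OF finite_measure_\<nu>]
  by (simp add: pair_sigma_finite_def)
 have 3: "Measurable.pred (PP \<Otimes>\<^sub>M \<nu>) (\<lambda>w. norm (fst (fst w)) = 1 \<and> norm (snd (fst w)) = 1
  \<and> norm (fst (snd w)) = 1 \<and> norm (snd (snd w)) = 1 \<and> fst (snd w) \<bullet> snd (snd w) = 0)"
  by measurable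
 show ?thesis by (rule pair_sigma_finite.AE_pair_measure[OF 2 3[unfolded pred_def] 1])
qed

lemma tproj_pair_map:
 assumes "norm (fst (snd w)) = 1" "fst (snd w) \<bullet> snd (snd w) = 0"
 shows "tproj (fst (pair_map w)) (snd (pair_map w)) = sine (fst w) *\<^sub>R snd (snd w)"
 using assms by (simp add: tproj_def pair_map_def sine_def inner_add_right norm_eq_1)

lemma integral_product_PP\<nu>:
 fixes g :: "'a \<times> 'a => real" and h :: "'a \<times> 'a => real"
 assumes "integrable PP g" "integrable \<nu> h"
 shows "(LINT w|(PP \<Otimes>\<^sub>M \<nu>). g (fst w) * h (snd w)) = (LINT u|PP. g u) * (LINT z|\<nu>. h z)"
proof -
 interpret pair_sigma_finite "PP" \<nu>
  using finite_measure.axioms(1)[OF finite_measure_PP] finite_measure.axioms(1)[OF finite_measure_\<nu>]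
  by (simp add: pair_sigma_finite_def)
 have "integrable (PP \<Otimes>\<^sub>M \<nu>) (\<lambda>(u, z). g u * h z)"
  using assms by (intro Fubini_integrable) (auto simp: abs_mult)
 then have "integrable (PP \<Otimes>\<^sub>M \<nu>) (\<lambda>w. g (fst w) * h (snd w))" by (simp add: split_beta')
 from integral_fst'[OF this] show ?thesis by simp
qed

lemma integrable_sine_power: "integrable PP (\<lambda>u. sine u ^ k)"
proof -
 interpret PP: finite_measure "PP" by (rule finite_measure_PP)
 show ?thesis
 proof (rule PP.integrable_const_bound)
  show "AE u in PP. norm (sine u ^ k) \<le> 1"
   using AE_PP
  proof eventually_elim
   case (elim u)
   then show ?case using sine_bounds[of u] by (auto simp: power_abs intro!: power_le_one)
  qed
 qed measurable
qed

text \<open>After resampling, the projection of the second point to the tangent space at the first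
  is the sine of the angle times a unit tangent vector independent of that angle; homogeneity takes
  the power of the sine out.\<close>

lemma homogeneous_average:
 fixes \<phi> :: "'a \<times> 'a => real"
 assumes [measurable]: "\<phi> \<in> borel_measurable borel2"
  and hom: "\<And>x c y. 0 \<le> c ==> \<phi> (x, c *\<^sub>R y) = c ^ k * \<phi> (x, y)"
  and bd: "\<And>x y. norm x = 1 ==> norm y = 1 ==> \<bar>\<phi> (x, y)\<bar> \<le> B"
 shows "(LINT u|PP. \<phi> (fst u, tproj (fst u) (snd u))) = sine_moment k * (LINT z|\<nu>. \<phi> z)"
proof -
 have m: "(\<lambda>u. \<phi> (fst u, tproj (fst u) (snd u))) \<in> borel_measurable borel2"
  unfolding tproj_def by measurable
 have i: "integrable \<nu> \<phi>"
 proof (rule N.integrable_const_bound)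
  show "AE z in \<nu>. norm (\<phi> z) \<le> B"
   using AE_\<nu>
  proof eventually_elim
   case (elim z)
   then show ?case using bd[of "fst z" "snd z"] by simp
  qed
 qed measurable
 note pm [measurable] = pair_map_measurable
 have "(LINT u|PP. \<phi> (fst u, tproj (fst u) (snd u)))
  = (LINT w|(PP \<Otimes>\<^sub>M \<nu>). \<phi> (fst (pair_map w), tproj (fst (pair_map w)) (snd (pair_map w))))"
  by (rule integral_pair_average[OF m])
 also have "\<dots> = (LINT w|(PP \<Otimes>\<^sub>M \<nu>). sine (fst w) ^ k * \<phi> (snd w))"
 proof (rule integral_cong_AE)
  show "(\<lambda>w. \<phi> (fst (pair_map w), tproj (fst (pair_map w)) (snd (pair_map w)))) \<in> borel_measurable (PP \<Otimes>\<^sub>M \<nu>)"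
   using measurable_compose[OF pm m] .
  show "AE w in PP \<Otimes>\<^sub>M \<nu>. \<phi> (fst (pair_map w), tproj (fst (pair_map w)) (snd (pair_map w)))
    = sine (fst w) ^ k * \<phi> (snd w)"
   using AE_PP\<nu>
  proof eventually_elim
   case (elim w)
   have "fst (pair_map w) = fst (snd w)" by (simp add: pair_map_def)
   moreover have "tproj (fst (pair_map w)) (snd (pair_map w)) = sine (fst w) *\<^sub>R snd (snd w)"
    using elim by (intro tproj_pair_map) auto
   ultimately show ?case
    using elim sine_bounds(1)[of "fst w"] hom[of "sine (fst w)" "fst (snd w)" "snd (snd w)"] by simp
  qed
 qed measurable
 also have "\<dots> = sine_moment k * (LINT z|\<nu>. \<phi> z)"
  unfolding sine_moment_def by (rule integral_product_PP\<nu>[OF integrable_sine_power i])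
 finally show ?thesis .
qed

text \<open>The mean of \<open>|\<theta> \<bullet> a|\<close> over the unit tangent vectors \<open>\<theta>\<close> at a point, \<open>a\<close> a unit tangent vector there.\<close>

definition \<kappa> :: real where
 "\<kappa> = (LINT y|P. \<bar>e1 \<bullet> y\<bar>) / sine_moment 1"

lemma \<kappa>_nonneg: "0 \<le> \<kappa>"
 unfolding \<kappa>_def using sine_moment_pos[of 1] by (intro divide_nonneg_pos integral_nonneg) auto

lemma integral_abs_inner: "(LINT y|P. \<bar>v \<bullet> y\<bar>) = norm v * (LINT y|P. \<bar>e1 \<bullet> y\<bar>)"
proof (cases "v = 0")
 case False
 define h where "h = reflect (e1 - v /\<^sub>R norm v)"
 have h: "orthogonal_transformation h" "h e1 = v /\<^sub>R norm v"
  using False by (auto simp: h_def orthogonal_transformation_reflect e12 intro!: reflect_diff)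
 have "(LINT y|P. \<bar>v \<bullet> y\<bar>) = (LINT y|P. \<bar>v \<bullet> h y\<bar>)"
  by (rule integral_invariant[OF h(1), symmetric]) measurable
 also have "\<dots> = (LINT y|P. norm v * \<bar>e1 \<bullet> y\<bar>)"
 proof (rule Bochner_Integration.integral_cong[OF refl])
  fix y
  have "v = norm v *\<^sub>R h e1" using h(2) False by simp
  then have "v \<bullet> h y = norm v * (h e1 \<bullet> h y)" by (metis inner_scaleR_left)
  also have "h e1 \<bullet> h y = e1 \<bullet> y" using h(1) by (simp add: orthogonal_transformation_def)
  finally show "\<bar>v \<bullet> h y\<bar> = norm v * \<bar>e1 \<bullet> y\<bar>" by (simp add: abs_mult)
 qed
 finally show ?thesis by simp
qed simp

lemma integral_PP:
 fixes \<phi> :: "'a \<times> 'a => real"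
 assumes [measurable]: "\<phi> \<in> borel_measurable borel2"
  and bd: "\<And>x y. norm x = 1 ==> norm y = 1 ==> \<bar>\<phi> (x, y)\<bar> \<le> B"
 shows "(LINT u|PP. \<phi> u) = (LINT x|P. (LINT y|P. \<phi> (x, y)))"
proof -
 interpret PP: finite_measure "PP" by (rule finite_measure_PP)
 interpret pair_sigma_finite P P by (simp add: pair_sigma_finite_def sigma_finite_measure_axioms)
 have "integrable PP \<phi>"
 proof (rule PP.integrable_const_bound)
  show "AE u in PP. norm (\<phi> u) \<le> B"
   using AE_PP
  proof eventually_elim
   case (elim u)
   then show ?case using bd[of "fst u" "snd u"] by simp
  qed
 qed measurable
 from integral_fst'[OF this] show ?thesis by simp
qed

text \<open>Degree 1 in the direction: replace the direction by a projected independent point, move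
  the projection to \<open>Y\<close>, and use that the mean of |v \<bullet> y| is proportional to
  |v|.\<close>

lemma integral_\<nu>_abs:
 fixes Y :: "'a => 'a"
 assumes [measurable]: "Y \<in> borel_measurable borel" and bd: "\<And>x. norm x = 1 ==> norm (Y x) \<le> B"
 shows "(LINT z|\<nu>. \<bar>Y (fst z) \<bullet> snd z\<bar>) = \<kappa> * (LINT x|P. norm (tproj x (Y x)))"
proof -
 let ?\<phi> = "\<lambda>z :: 'a \<times> 'a. \<bar>Y (fst z) \<bullet> snd z\<bar>"
 have b: "\<bar>?\<phi> (x, y)\<bar> \<le> B" if "norm x = 1" "norm y = 1" for x y
  using Cauchy_Schwarz_ineq2[of "Y x" y] bd[OF that(1)] that by simp
 have "(LINT u|PP. ?\<phi> (fst u, tproj (fst u) (snd u))) = sine_moment 1 * (LINT z|\<nu>. ?\<phi> z)"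
  by (rule homogeneous_average[where \<phi> = ?\<phi> and k = 1 and B = B]) (use b in \<open>auto simp: abs_mult\<close>)
 also have "(LINT u|PP. ?\<phi> (fst u, tproj (fst u) (snd u))) = (LINT x|P. (LINT y|P. \<bar>tproj x (Y x) \<bullet> y\<bar>))"
 proof (subst integral_PP[where B = B])
  show "(\<lambda>u. ?\<phi> (fst u, tproj (fst u) (snd u))) \<in> borel_measurable borel2"
   unfolding tproj_def by measurable
  fix x y :: 'a assume xy: "norm x = 1" "norm y = 1"
  show "\<bar>?\<phi> (fst (x, y), tproj (fst (x, y)) (snd (x, y)))\<bar> \<le> B"
   using Cauchy_Schwarz_ineq2[of "Y x" "tproj x y"] bd[OF xy(1)] norm_tproj_le[OF xy(1), of y] xy(2)
    mult_mono[of "norm (Y x)" B "norm (tproj x y)" 1] order_trans[OF norm_ge_zero bd[OF xy(1)]] by simp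
 qed (simp add: tproj_inner)
 also have "\<dots> = (LINT x|P. norm (tproj x (Y x))) * (LINT y|P. \<bar>e1 \<bullet> y\<bar>)"
  by (subst integral_abs_inner) simp
 finally show ?thesis
  using sine_moment_pos[of 1] by (simp add: \<kappa>_def field_simps)
qed

lemma real_polynomial_integral:
 assumes "separated_poly f"
 shows "real_polynomial_function (\<lambda>x. (LINT y|P. f (x, y))) \<and> (\<forall>x. integrable P (\<lambda>y. f (x, y)))"
 using assms
proof (induction rule: separated_poly.induct)
 case (product a \<mu> k)
 then show ?case
  by (auto intro!: real_polynomial_function.intros(4) real_polynomial_function.intros(2) integrable_P_polynomial)
next
 case (add f g)
 then show ?case by (auto intro!: real_polynomial_function.intros(3))
qed

text \<open>The conditional expectation of \<open>\<zeta>(x, \<theta>) \<theta>\<close> given \<open>x\<close> is a polynomial vector field: for \<open>\<zeta>\<close>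
 homogeneous in \<open>\<theta>\<close> the unit tangent vector \<open>\<theta>\<close> may be replaced by the tangential part of an
 independent point of the sphere, up to a constant factor.\<close>

definition represents :: "('a => 'a) => ('a \<times> 'a => real) => bool" where
 "represents X \<zeta> \<longleftrightarrow> polynomial_function X \<and> (\<forall>x. norm x = 1 \<longrightarrow> X x \<bullet> x = 0) \<and>
   (\<forall>Y B. Y \<in> borel_measurable borel \<longrightarrow> (\<forall>x. norm x = 1 \<longrightarrow> norm (Y x) \<le> B) \<longrightarrow>
    (LINT z|\<nu>. \<zeta> z * (Y (fst z) \<bullet> snd z)) = (LINT x|P. Y x \<bullet> X x))"

lemma representsD:
 assumes "represents X \<zeta>"
 shows "polynomial_function X" "norm x = 1 ==> X x \<bullet> x = 0"
  "Y \<in> borel_measurable borel ==> (\<And>x. norm x = 1 ==> norm (Y x) \<le> B) ==>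
    (LINT z|\<nu>. \<zeta> z * (Y (fst z) \<bullet> snd z)) = (LINT x|P. Y x \<bullet> X x)"
 using assms unfolding represents_def by blast+

lemma polynomial_bounded_on_sphere:
 fixes p :: "'b::euclidean_space => real"
 assumes "real_polynomial_function p"
 obtains B where "0 \<le> B" "\<And>x. norm x \<le> C ==> \<bar>p x\<bar> \<le> B"
proof -
 have "compact (p ` cball 0 C)"
  by (intro compact_continuous_image continuous_on_real_polynomial assms compact_cball)
 then obtain B where B: "\<forall>y\<in>p ` cball 0 C. norm y \<le> B" using compact_imp_bounded bounded_iff by blast
 have "\<bar>p x\<bar> \<le> max 0 B" if "norm x \<le> C" for x using that B by force
 then show thesis using that[of "max 0 B"] by simp
qed

text \<open>Up to the factor \<open>m\<close>, X is the mean over an independent point y of the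
  weighted projection of y. It is polynomial in x because integrating a polynomial over y leaves a
  polynomial.\<close>

lemma represents_product:
 assumes a: "real_polynomial_function a" and \<mu>: "real_polynomial_function \<mu>" and hom: "\<And>c y. \<mu> (c *\<^sub>R y) = c ^ k * \<mu> y"
 shows "\<exists>X. represents X (\<lambda>z. a (fst z) * \<mu> (snd z))"
proof -
 define F where "F b z = a (fst z) * (\<mu> (tproj (fst z) (snd z)) * (tproj (fst z) (snd z) \<bullet> b))" for b and z :: "'a \<times> 'a"
 \<comment> \<open>\<open>Suc k\<close>, because the direction itself adds one degree to that of
   \<open>\<mu>\<close>.\<close>
 define m where "m = sine_moment (Suc k)"
 have m: "m \<noteq> 0" using sine_moment_pos[of "Suc k"] by (simp add: m_def)
 have rF: "real_polynomial_function (F b)" for b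
  unfolding F_def
  using real_polynomial_function_compose[OF polynomial_tproj \<mu>]
  by (intro real_polynomial_function.intros(4) polynomial_compose_fst a real_polynomial_inner[OF polynomial_tproj])
   (simp add: o_def)
 define X where "X x = (\<Sum>b\<in>Basis. ((1 / m) * (LINT y|P. F b (x, y))) *\<^sub>R b)" for x
 have rI: "real_polynomial_function (\<lambda>x. (LINT y|P. F b (x, y)))" "integrable P (\<lambda>y. F b (x, y))" for b x
  using real_polynomial_integral[OF real_polynomial_separated[OF rF]] by auto
 have PX: "polynomial_function X"
  unfolding X_def
  by (intro polynomial_function_sum polynomial_function_scaleR_const finite_Basis real_polynomial_function.intros(4)
    real_polynomial_function.intros(2) rI)
 have X: "X x \<bullet> v = (1 / m) * (LINT y|P. a x * (\<mu> (tproj x y) * (tproj x y \<bullet> v)))" for x v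
 proof -
  have "X x \<bullet> v = (1 / m) * (\<Sum>b\<in>Basis. (LINT y|P. F b (x, y)) * (b \<bullet> v))"
   by (simp add: X_def inner_sum_left sum_distrib_left mult.assoc)
  also have "(\<Sum>b\<in>Basis. (LINT y|P. F b (x, y)) * (b \<bullet> v)) = (LINT y|P. (\<Sum>b\<in>Basis. F b (x, y) * (b \<bullet> v)))"
   by (simp add: Bochner_Integration.integral_sum rI)
  also have "(\<lambda>y. \<Sum>b\<in>Basis. F b (x, y) * (b \<bullet> v)) = (\<lambda>y. a x * (\<mu> (tproj x y) * (tproj x y \<bullet> v)))"
   by (simp add: fun_eq_iff F_def euclidean_inner[of "tproj x _" v] sum_distrib_left mult.assoc inner_commute[of v])
  finally show ?thesis .
 qed
 have tan: "X x \<bullet> x = 0" if "norm x = 1" for x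
  using that by (simp add: X tproj_orth)
 have "(LINT z|\<nu>. a (fst z) * \<mu> (snd z) * (Y (fst z) \<bullet> snd z)) = (LINT x|P. Y x \<bullet> X x)"
  if Y [measurable]: "Y \<in> borel_measurable borel" and bd: "\<And>x. norm x = 1 ==> norm (Y x) \<le> B" for Y B
 proof -
  let ?\<phi> = "\<lambda>z. a (fst z) * \<mu> (snd z) * (Y (fst z) \<bullet> snd z)"
  obtain Ba where Ba: "0 \<le> Ba" "\<And>x. norm x \<le> 1 ==> \<bar>a x\<bar> \<le> Ba" by (rule polynomial_bounded_on_sphere[OF a, of 1]) blast
  obtain Bm where Bm: "0 \<le> Bm" "\<And>x. norm x \<le> 1 ==> \<bar>\<mu> x\<bar> \<le> Bm" by (rule polynomial_bounded_on_sphere[OF \<mu>, of 1]) blast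
  have b: "\<bar>a x * \<mu> y * (Y x \<bullet> y)\<bar> \<le> Ba * Bm * B" if xy: "norm x = 1" "norm y \<le> 1" for x y
  proof -
   have "norm (Y x) * norm y \<le> B * 1"
    using bd[OF xy(1)] xy(2) order_trans[OF norm_ge_zero bd[OF xy(1)]] by (intro mult_mono) auto
   then have "\<bar>Y x \<bullet> y\<bar> \<le> B" using Cauchy_Schwarz_ineq2[of "Y x" y] by simp
   then show ?thesis using Ba(1) Ba(2)[of x] Bm(1) Bm(2)[of y] xy
    by (auto simp: abs_mult intro!: mult_mono)
  qed
  note [measurable] = borel_measurable_real_polynomial[OF a] borel_measurable_real_polynomial[OF \<mu>]
  have "m * (LINT z|\<nu>. ?\<phi> z) = (LINT u|PP. ?\<phi> (fst u, tproj (fst u) (snd u)))"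
   unfolding m_def
   by (rule homogeneous_average[symmetric, where B = "Ba * Bm * B"]) (auto simp: hom intro!: b)
  also have "\<dots> = (LINT x|P. (LINT y|P. ?\<phi> (x, tproj x y)))"
  proof (subst integral_PP[where B = "Ba * Bm * B"])
   show "(\<lambda>u. ?\<phi> (fst u, tproj (fst u) (snd u))) \<in> borel_measurable borel2"
    unfolding tproj_def by measurable
   fix x y :: 'a assume xy: "norm x = 1" "norm y = 1"
   show "\<bar>?\<phi> (fst (x, y), tproj (fst (x, y)) (snd (x, y)))\<bar> \<le> Ba * Bm * B"
    using b[of x "tproj x y"] xy norm_tproj_le[OF xy(1), of y] by simp
  qed simp
  also have "\<dots> = (LINT x|P. m * (Y x \<bullet> X x))"
   using m by (simp add: inner_commute[of "Y _" "X _"] X mult.assoc inner_commute[of "Y _" "tproj _ _"])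
  finally show ?thesis using m by simp
 qed
 then show ?thesis unfolding represents_def using PX tan by blast
qed

lemma represents_add:
 assumes X: "represents X \<zeta>" "represents X' \<zeta>'" and \<zeta>: "real_polynomial_function \<zeta>" "real_polynomial_function \<zeta>'"
 shows "represents (\<lambda>x. X x + X' x) (\<lambda>z. \<zeta> z + \<zeta>' z)"
 unfolding represents_def
proof (intro conjI allI impI)
 show "polynomial_function (\<lambda>x. X x + X' x)"
  using X by (intro polynomial_function_add) (auto simp: represents_def)
 show "(X x + X' x) \<bullet> x = 0" if "norm x = 1" for x
  using X that by (auto simp: represents_def inner_add_left)
 fix Y :: "'a => 'a" and B
 assume Y [measurable]: "Y \<in> borel_measurable borel" and bd: "\<forall>x. norm x = 1 \<longrightarrow> norm (Y x) \<le> B"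
 have i\<nu>: "integrable \<nu> (\<lambda>z. p z * (Y (fst z) \<bullet> snd z))" if p: "real_polynomial_function p" for p
 proof -
  obtain C where C: "0 \<le> C" "\<And>x. norm x \<le> 2 ==> \<bar>p x\<bar> \<le> C" by (rule polynomial_bounded_on_sphere[OF p, of 2]) blast
  note [measurable] = borel_measurable_real_polynomial[OF p, folded borel_prod]
  show ?thesis
  proof (rule N.integrable_const_bound)
   show "AE z in \<nu>. norm (p z * (Y (fst z) \<bullet> snd z)) \<le> C * B"
    using AE_\<nu> AE_\<nu>_le
   proof eventually_elim
    case (elim z)
    then have "\<bar>Y (fst z) \<bullet> snd z\<bar> \<le> B"
     using Cauchy_Schwarz_ineq2[of "Y (fst z)" "snd z"] bd by force
    then show ?case using C(1) C(2)[of z] elim by (auto simp: abs_mult intro!: mult_mono)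
   qed
  qed measurable
 qed
 have iP: "integrable P (\<lambda>x. Y x \<bullet> Z x)" if Z: "polynomial_function Z" for Z
 proof -
  have "continuous_on UNIV Z" by (rule continuous_on_polymonial_function[OF Z])
  then have Zm [measurable]: "Z \<in> borel_measurable borel" by (rule borel_measurable_continuous_onI)
  have "compact (Z ` cball 0 1)"
   by (intro compact_continuous_image continuous_on_polymonial_function Z compact_cball)
  then obtain C where C: "\<forall>y\<in>Z ` cball 0 1. norm y \<le> C" using compact_imp_bounded bounded_iff by blast
  show ?thesis
  proof (rule integrable_const_bound)
   show "AE x in P. norm (Y x \<bullet> Z x) \<le> B * C"
    using AE_norm
   proof eventually_elim
    case (elim x)
    then have "norm (Z x) \<le> C" "norm (Y x) \<le> B" using C bd by auto
    then have "norm (Y x) * norm (Z x) \<le> B * C"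
     by (intro mult_mono) (auto intro: order_trans[OF norm_ge_zero])
    then show ?case using Cauchy_Schwarz_ineq2[of "Y x" "Z x"] by simp
   qed
  qed measurable
 qed
 have "(LINT z|\<nu>. (\<zeta> z + \<zeta>' z) * (Y (fst z) \<bullet> snd z))
   = (LINT z|\<nu>. \<zeta> z * (Y (fst z) \<bullet> snd z)) + (LINT z|\<nu>. \<zeta>' z * (Y (fst z) \<bullet> snd z))"
  by (simp only: distrib_right Bochner_Integration.integral_add[OF i\<nu> i\<nu>] \<zeta>)
 also have "\<dots> = (LINT x|P. Y x \<bullet> X x) + (LINT x|P. Y x \<bullet> X' x)"
  using bd by (simp add: representsD(3)[OF X(1) Y, of B] representsD(3)[OF X(2) Y, of B])
 also have "\<dots> = (LINT x|P. Y x \<bullet> (X x + X' x))"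
  by (simp only: inner_add_right Bochner_Integration.integral_add[OF iP[OF representsD(1)[OF X(1)]] iP[OF representsD(1)[OF X(2)]]])
 finally show "(LINT z|\<nu>. (\<zeta> z + \<zeta>' z) * (Y (fst z) \<bullet> snd z)) = (LINT x|P. Y x \<bullet> (X x + X' x))" .
qed

lemma represents_exists:
 assumes "real_polynomial_function \<zeta>"
 shows "\<exists>X. represents X \<zeta>"
proof -
 have "real_polynomial_function \<zeta> \<and> (\<exists>X. represents X \<zeta>)" if "separated_poly \<zeta>" for \<zeta>
  using that
 proof (induction rule: separated_poly.induct)
  case (product a \<mu> k)
  have "real_polynomial_function (\<lambda>z :: 'a \<times> 'a. \<mu> (snd z))"
   using real_polynomial_function_compose[OF polynomial_snd product(2)] by (simp add: o_def)
  then show ?case using represents_product[OF product]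
   by (auto intro!: real_polynomial_function.intros(4) polynomial_compose_fst product)
 next
  case (add f g)
  then show ?case using represents_add by (blast intro: real_polynomial_function.intros(3))
 qed
 then show ?thesis using real_polynomial_separated[OF assms] by blast
qed

end

context rotation_invariant_prob
begin

text \<open>Duality of the L1 and sup norms: if |Z| exceeds \<open>c\<close> somewhere, it does so
  by a margin on a small cap of positive mass, and testing with \<open>Z\<close> cut off to this cap
  contradicts the hypothesis.\<close>

lemma pointwise_bound:
 fixes Z :: "'a => 'a"
 assumes Z: "continuous_on (sphere 0 1) Z" and c: "0 \<le> c"
  and *: "\<And>Y B. Y \<in> borel_measurable borel ==> (\<And>x. norm x = 1 ==> norm (Y x) \<le> B)
    ==> (LINT x|P. Y x \<bullet> Z x) \<le> c * (LINT x|P. norm (Y x))"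
  and x: "norm x = 1"
 shows "norm (Z x) \<le> c"
proof (rule ccontr)
 assume n: "\<not> norm (Z x) \<le> c"
 define t where "t = (norm (Z x) - c) / 2"
 have t: "t > 0" using n by (simp add: t_def)
 have xs: "x \<in> sphere 0 1" using x by simp
 from Z xs t obtain d where d: "d > 0" "\<And>y. y \<in> sphere 0 1 ==> dist y x < d ==> dist (Z y) (Z x) < t"
  unfolding continuous_on_iff by blast
 define S where "S = ball x d \<inter> sphere 0 1"
 have S: "S \<in> sets borel" by (simp add: S_def)
 have SZ: "c + t \<le> norm (Z y)" if "y \<in> S" for y
 proof -
  have "dist (Z y) (Z x) < t" using that d(2)[of y] by (auto simp: S_def dist_commute)
  then have "norm (Z x) - norm (Z y) < t"
   using norm_triangle_ineq2[of "Z x" "Z y"] by (simp add: dist_norm norm_minus_commute)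
  then show ?thesis by (simp add: t_def field_simps)
 qed
 have ZS: "continuous_on S Z" using Z by (rule continuous_on_subset) (auto simp: S_def)
 define Y where "Y y = indicator S y *\<^sub>R Z y" for y
 have Ym: "Y \<in> borel_measurable borel"
  unfolding Y_def by (rule borel_measurable_continuous_on_indicator[OF S ZS])
 have "compact (Z ` sphere 0 1)" by (intro compact_continuous_image Z compact_sphere)
 then obtain B where "\<forall>v\<in>Z ` sphere 0 1. norm v \<le> B"
  using compact_imp_bounded bounded_iff by blast
 then have B: "\<And>y. norm y = 1 ==> norm (Z y) \<le> B" by simp
 have B0: "0 \<le> B" using B[OF x] norm_ge_zero[of "Z x"] by linarith
 have YB: "norm y = 1 ==> norm (Y y) \<le> B" for y using B[of y] B0 by (auto simp: Y_def indicator_def)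
 have Ymp: "Y \<in> borel_measurable P" using Ym by (simp add: measurable_P)
 have nY: "norm (Y y) * norm (Y y) = Y y \<bullet> Z y" for y
  by (auto simp: Y_def indicator_def power2_eq_square[symmetric] power2_norm_eq_inner)
 have iY: "integrable P (\<lambda>y. norm (Y y))"
  by (rule integrable_const_bound[where B = B]) (use AE_norm YB Ymp in \<open>auto elim!: eventually_mono\<close>)
 have iYZ: "integrable P (\<lambda>y. Y y \<bullet> Z y)"
 proof (subst nY[symmetric], rule integrable_const_bound[where B = "B * B"])
  show "AE y in P. norm (norm (Y y) * norm (Y y)) \<le> B * B"
   using AE_norm by eventually_elim (use YB B0 in \<open>auto intro!: mult_mono\<close>)
 qed (use Ymp in measurable)
 have "(LINT y|P. (c + t) * norm (Y y)) \<le> (LINT y|P. Y y \<bullet> Z y)"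
 proof (rule integral_mono)
  show "(c + t) * norm (Y y) \<le> Y y \<bullet> Z y" for y
  proof (cases "y \<in> S")
   case True
   then show ?thesis using mult_right_mono[OF SZ[OF True] norm_ge_zero[of "Z y"]] nY[of y] by (simp add: Y_def)
  qed (simp add: Y_def)
 qed (use iY iYZ in auto)
 also have "\<dots> \<le> c * (LINT y|P. norm (Y y))" by (rule *[OF Ym YB])
 finally have "(c + t) * (LINT y|P. norm (Y y)) \<le> c * (LINT y|P. norm (Y y))" by simp
 then have "t * (LINT y|P. norm (Y y)) \<le> 0" by (simp add: distrib_right)
 then have "(LINT y|P. norm (Y y)) \<le> 0"
  using t by (simp add: mult_le_0_iff)
 moreover have "(c + t) * measure P S \<le> (LINT y|P. norm (Y y))"
 proof -
  have iS: "integrable P (indicator S :: 'a => real)"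
   by (rule integrable_const_bound[where B = 1])
    (use S in \<open>auto simp: indicator_def measurable_P intro: borel_measurable_indicator\<close>)
  have "(c + t) * measure P S = (LINT y|P. (c + t) * indicator S y)" using S by simp
  also have "\<dots> \<le> (LINT y|P. norm (Y y))"
   by (rule integral_mono[OF integrable_mult_right[OF iS] iY]) (use SZ in \<open>auto simp: Y_def indicator_def\<close>)
  finally show ?thesis .
 qed
 moreover have "measure P S = measure P (ball x d)"
  by (rule measure_eq_AE) (use AE_norm S in \<open>auto simp: S_def elim!: eventually_mono\<close>)
 moreover have "0 < measure P (ball x d)"
  using emeasure_ball_pos[OF x d(1)] by (simp add: emeasure_eq_measure)
 ultimately show False using c t by (smt (verit) mult_pos_pos)
qed

lemma continuous_on_polynomial_field: "polynomial_function (X :: 'a => 'a) ==> continuous_on S X"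
 by (rule continuous_on_polymonial_function)

lemma integral_\<nu>_bound:
 assumes c: "0 \<le> c" "AE z in \<nu>. \<bar>\<zeta> z\<bar> \<le> c"
  and Y [measurable]: "Y \<in> borel_measurable borel" and B: "\<And>x. norm x = 1 ==> norm (Y x) \<le> B"
 shows "(LINT z|\<nu>. \<zeta> z * (Y (fst z) \<bullet> snd z)) \<le> (c * \<kappa>) * (LINT x|P. norm (Y x))"
proof -
 have "0 \<le> B" using B[of e1] norm_ge_zero[of "Y e1"] e12 by linarith
 have YB: "AE z in \<nu>. \<bar>Y (fst z) \<bullet> snd z\<bar> \<le> B"
  using AE_\<nu>
 proof eventually_elim
  case (elim z)
  then show ?case using B[of "fst z"] Cauchy_Schwarz_ineq2[of "Y (fst z)" "snd z"] by simp
 qed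
 have iY: "integrable \<nu> (\<lambda>z. c * \<bar>Y (fst z) \<bullet> snd z\<bar>)"
  by (rule N.integrable_const_bound[where B = "c * B"])
   (use YB c in \<open>auto elim!: eventually_mono intro!: mult_left_mono simp: abs_mult\<close>)
 have "(LINT z|\<nu>. \<zeta> z * (Y (fst z) \<bullet> snd z)) \<le> (LINT z|\<nu>. c * \<bar>Y (fst z) \<bullet> snd z\<bar>)"
 proof (rule integral_mono_AE'[OF iY])
  show "AE z in \<nu>. \<zeta> z * (Y (fst z) \<bullet> snd z) \<le> c * \<bar>Y (fst z) \<bullet> snd z\<bar>"
   using c(2)
  proof eventually_elim
   case (elim z)
   have "\<zeta> z * (Y (fst z) \<bullet> snd z) \<le> \<bar>\<zeta> z\<bar> * \<bar>Y (fst z) \<bullet> snd z\<bar>"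
    by (metis abs_ge_self abs_mult)
   also have "\<dots> \<le> c * \<bar>Y (fst z) \<bullet> snd z\<bar>" using elim by (rule mult_right_mono) simp
   finally show ?case .
  qed
 qed (use c in auto)
 also have "\<dots> = c * \<kappa> * (LINT x|P. norm (tproj x (Y x)))"
  using integral_\<nu>_abs[OF Y B] by simp
 also have "\<dots> \<le> c * \<kappa> * (LINT x|P. norm (Y x))"
 proof (rule mult_left_mono[OF integral_mono_AE'])
  show "integrable P (\<lambda>x. norm (Y x))"
   by (rule integrable_const_bound[where B = B]) (use AE_norm B in \<open>auto elim!: eventually_mono\<close>)
  show "AE x in P. norm (tproj x (Y x)) \<le> norm (Y x)"
   using AE_norm by eventually_elim (rule norm_tproj_le)
 qed (use c \<kappa>_nonneg in auto)
 finally show ?thesis .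
qed

text \<open>The dual form of \<open>integral_\<nu>_bound\<close>. The factor \<open>\<kappa>\<close>
  in place of the trivial factor 1 is what makes the perimeter estimate sharp.\<close>

lemma represents_bound:
 assumes X: "represents X \<zeta>" and \<zeta>: "real_polynomial_function \<zeta>" and c: "0 \<le> c" "AE z in \<nu>. \<bar>\<zeta> z\<bar> \<le> c"
  and x: "norm x = 1"
 shows "norm (X x) \<le> c * \<kappa>"
proof (rule pointwise_bound[OF _ _ _ x])
 show "continuous_on (sphere 0 1) X" by (rule continuous_on_polynomial_field[OF representsD(1)[OF X]])
 show "0 \<le> c * \<kappa>" using c \<kappa>_nonneg by simp
 fix Y :: "'a => 'a" and B
 assume Y: "Y \<in> borel_measurable borel" "\<And>x. norm x = 1 ==> norm (Y x) \<le> B"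
 show "(LINT x|P. Y x \<bullet> X x) \<le> c * \<kappa> * (LINT x|P. norm (Y x))"
  using integral_\<nu>_bound[OF c Y] representsD(3)[OF X Y] by simp
qed

lemma distr_rot: "distr \<nu> borel2 (rot t) = \<nu>"
proof (rule measure_eqI)
 have rm: "rot t \<in> measurable \<nu> borel2" unfolding rot_def by measurable
 fix A assume "A \<in> sets (distr \<nu> borel2 (rot t))"
 then have A [measurable]: "A \<in> sets borel2" by simp
 have "emeasure (distr \<nu> borel2 (rot t)) A = (\<integral>\<^sup>+z. indicator A z \<partial>distr \<nu> borel2 (rot t))"
  by simp
 also have "\<dots> = (\<integral>\<^sup>+z. indicator A (rot t z) \<partial>\<nu>)" by (rule nn_integral_distr[OF rm]) simp
 also have "\<dots> = (\<integral>\<^sup>+z. indicator A z \<partial>\<nu>)" by (rule nn_integral_\<nu>_rot) simp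
 also have "\<dots> = emeasure \<nu> A" by simp
 finally show "emeasure (distr \<nu> borel2 (rot t)) A = emeasure \<nu> A" .
qed simp

lemma integral_\<nu>_rot:
 fixes f :: "'a \<times> 'a => real"
 assumes "f \<in> borel_measurable borel2"
 shows "(LINT z|\<nu>. f (rot t z)) = (LINT z|\<nu>. f z)"
proof -
 have rm: "rot t \<in> measurable \<nu> borel2" unfolding rot_def by measurable
 show ?thesis by (subst (2) distr_rot[of t, symmetric]) (rule integral_distr[OF rm assms, symmetric])
qed

text \<open>The generator of the geodesic flow \<open>rot\<close>.\<close>

definition geo :: "'a \<times> 'a => 'a \<times> 'a" where
 "geo z = (snd z, - fst z)"

lemma bounded_linear_geo: "bounded_linear geo"
 unfolding geo_def[abs_def]
 by (intro bounded_linear_Pair bounded_linear_snd bounded_linear_minus bounded_linear_fst)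

lemma polynomial_geo: "polynomial_function geo"
 by (rule polynomial_function_bounded_linear[OF bounded_linear_geo])

lemma bounded_linear_rot: "bounded_linear (rot t)"
proof -
 have "bounded_linear (\<lambda>z. (cos t *\<^sub>R fst z + sin t *\<^sub>R snd z, cos t *\<^sub>R snd z - sin t *\<^sub>R fst z))"
  by (intro bounded_linear_Pair bounded_linear_add bounded_linear_sub bounded_linear_scaleR_right[THEN bounded_linear_compose]
   bounded_linear_fst bounded_linear_snd)
 then show ?thesis by (simp add: rot_def[abs_def])
qed

lemma rot_vector_derivative: "((\<lambda>s. rot s z) has_vector_derivative geo (rot t z)) (at t)"
proof -
 have "((\<lambda>s. cos s *\<^sub>R fst z + sin s *\<^sub>R snd z) has_vector_derivative (cos t *\<^sub>R snd z - sin t *\<^sub>R fst z)) (at t)"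
  "((\<lambda>s. cos s *\<^sub>R snd z - sin s *\<^sub>R fst z) has_vector_derivative (- (cos t *\<^sub>R fst z + sin t *\<^sub>R snd z))) (at t)"
  by (auto intro!: derivative_eq_intros)
 from has_vector_derivative_Pair[OF this] show ?thesis by (simp add: rot_def geo_def)
qed

lemma norm_rot: "norm (rot t z) = norm z"
proof -
 have "rot t z \<bullet> rot t z = ((sin t)\<^sup>2 + (cos t)\<^sup>2) * (z \<bullet> z)"
  unfolding rot_def inner_prod_def fst_conv snd_conv inner_add_left inner_add_right inner_diff_left inner_diff_right
   inner_scaleR_left inner_scaleR_right inner_commute[of "snd z" "fst z"] power2_eq_square by algebra
 then show ?thesis by (simp add: norm_eq)
qed

lemma rot_measurable_borel: "rot t \<in> borel_measurable borel"
 by (intro borel_measurable_continuous_onI linear_continuous_on bounded_linear_rot)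

lemma DERIV_\<nu>_rot:
 assumes \<zeta>: "real_polynomial_function \<zeta>" and A: "A \<in> sets borel"
 shows "((\<lambda>s. (LINT z|\<nu>. indicator A (fst z) * \<zeta> (rot s z))) has_real_derivative
   (LINT z|\<nu>. indicator A (fst z) * dird \<zeta> (rot t z) (geo (rot t z)))) (at t)"
proof (rule DERIV_integral_flow[OF finite_measure_\<nu> sets_\<nu>_borel AE_\<nu>_le rot_measurable_borel
   rot_vector_derivative _ polynomial_geo \<zeta>])
 show "norm (rot t z) \<le> norm z" for t z by (simp add: norm_rot)
 have "(\<lambda>z :: 'a \<times> 'a. indicator A (fst z) :: real) \<in> borel_measurable borel2" using A by measurable
 then show "(\<lambda>z :: 'a \<times> 'a. indicator A (fst z) :: real) \<in> borel_measurable borel"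
  by (simp add: borel_prod)
 show "\<bar>indicator A (fst z) :: real\<bar> \<le> 1" for z :: "'a \<times> 'a" by (simp add: indicator_def)
qed

text \<open>Invariance of \<open>\<nu>\<close> under the geodesic flow, differentiated at time
  0.\<close>

lemma integral_geo:
 assumes \<eta>: "real_polynomial_function \<eta>"
 shows "(LINT z|\<nu>. dird \<eta> z (geo z)) = 0"
proof -
 have "((\<lambda>s. (LINT z|\<nu>. indicator UNIV (fst z) * \<eta> (rot s z))) has_real_derivative
   (LINT z|\<nu>. indicator UNIV (fst z) * dird \<eta> (rot 0 z) (geo (rot 0 z)))) (at 0)"
  by (rule DERIV_\<nu>_rot[OF \<eta>]) simp
 moreover have "(LINT z|\<nu>. \<eta> (rot s z)) = (LINT z|\<nu>. \<eta> z)" for s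
  by (rule integral_\<nu>_rot) (use borel_measurable_real_polynomial[OF \<eta>] in \<open>simp add: borel_prod\<close>)
 moreover have "rot 0 z = z" for z by (simp add: rot_def)
 ultimately have "((\<lambda>s::real. (LINT z|\<nu>. \<eta> z)) has_real_derivative (LINT z|\<nu>. dird \<eta> z (geo z))) (at 0)"
  by simp
 then show ?thesis using DERIV_unique[OF _ DERIV_const] by blast
qed

text \<open>Two integrations by parts meet. Along the geodesic flow the left side is minus the mean
  of \<open>\<zeta>\<close> times the derivative of \<open>\<phi>\<close> in the direction, which by
  representation is the pairing of X with the gradient \<open>G\<close>; on the sphere the
  divergence theorem gives the same value for the right side.\<close>

lemma represents_div_polynomial:
 assumes X: "represents X \<zeta>" and \<zeta>: "real_polynomial_function \<zeta>" and \<phi>: "real_polynomial_function \<phi>"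
 shows "(LINT z|\<nu>. \<phi> (fst z) * dird \<zeta> z (geo z)) = (LINT x|P. \<phi> x * sphere_div X x)"
proof -
 define G where "G x = (\<Sum>b\<in>Basis. dird \<phi> x b *\<^sub>R b)" for x
 have PG: "polynomial_function G" unfolding G_def
  by (intro polynomial_function_sum polynomial_function_scaleR_const real_polynomial_dird \<phi> polynomial_function_const finite_Basis)
 have Gv: "dird \<phi> x v = G x \<bullet> v" for x v
 proof -
  have "dird \<phi> x v = dird \<phi> x (\<Sum>b\<in>Basis. (v \<bullet> b) *\<^sub>R b)" by (simp add: euclidean_representation)
  also have "\<dots> = (\<Sum>b\<in>Basis. (v \<bullet> b) * dird \<phi> x b)"
   using linear_sum[OF dird_linear[OF \<phi>, of x], of "\<lambda>b. (v \<bullet> b) *\<^sub>R b" Basis] linear_scale[OF dird_linear[OF \<phi>, of x]]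
   by simp
  finally show ?thesis by (simp add: G_def inner_sum_left inner_commute[of v] mult.commute)
 qed
 note PX = representsD(1)[OF X]
 have \<phi>1: "real_polynomial_function (\<lambda>z :: 'a \<times> 'a. \<phi> (fst z))" by (rule polynomial_compose_fst[OF \<phi>])
 have p1: "real_polynomial_function (\<lambda>z. \<phi> (fst z) * dird \<zeta> z (geo z))"
  by (intro real_polynomial_function.intros(4) \<phi>1 real_polynomial_dird \<zeta> polynomial_geo)
 have "polynomial_function (\<lambda>z :: 'a \<times> 'a. G (fst z))"
  using polynomial_function_compose[OF polynomial_fst PG] by (simp add: o_def)
 then have p2: "real_polynomial_function (\<lambda>z. \<zeta> z * (G (fst z) \<bullet> snd z))"
  by (intro real_polynomial_function.intros(4) \<zeta> real_polynomial_inner2 polynomial_snd)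
 have d: "dird (\<lambda>z. \<phi> (fst z) * \<zeta> z) z (geo z) = \<phi> (fst z) * dird \<zeta> z (geo z) + \<zeta> z * (G (fst z) \<bullet> snd z)" for z
 proof -
  have "((\<lambda>z. \<phi> (fst z)) has_derivative (\<lambda>v. dird \<phi> (fst z) (fst v))) (at z)"
   by (rule has_derivative_compose[OF has_derivative_fst[OF has_derivative_ident] has_derivative_dird[OF \<phi>]])
  from has_derivative_mult[OF this has_derivative_dird[OF \<zeta>]]
  show ?thesis by (subst dird_eq) (assumption, simp add: geo_def Gv)
 qed
 have "0 = (LINT z|\<nu>. dird (\<lambda>z. \<phi> (fst z) * \<zeta> z) z (geo z))"
  by (rule integral_geo[symmetric]) (intro real_polynomial_function.intros(4) \<phi>1 \<zeta>)
 also have "\<dots> = (LINT z|\<nu>. \<phi> (fst z) * dird \<zeta> z (geo z)) + (LINT z|\<nu>. \<zeta> z * (G (fst z) \<bullet> snd z))"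
  by (simp only: d Bochner_Integration.integral_add[OF integrable_\<nu>_polynomial[OF p1] integrable_\<nu>_polynomial[OF p2]])
 also have "(LINT z|\<nu>. \<zeta> z * (G (fst z) \<bullet> snd z)) = (LINT x|P. G x \<bullet> X x)"
 proof -
  have "compact (G ` cball 0 1)"
   by (intro compact_continuous_image continuous_on_polynomial_field PG compact_cball)
  then obtain B where "\<forall>y\<in>G ` cball 0 1. norm y \<le> B" using compact_imp_bounded bounded_iff by blast
  then have "norm x = 1 ==> norm (G x) \<le> B" for x by simp
  with representsD(3)[OF X borel_measurable_continuous_onI[OF continuous_on_polynomial_field[OF PG]]]
  show ?thesis by blast
 qed
 finally have 1: "(LINT z|\<nu>. \<phi> (fst z) * dird \<zeta> z (geo z)) = - (LINT x|P. G x \<bullet> X x)" by simp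
 have P\<phi>X: "polynomial_function (\<lambda>x. \<phi> x *\<^sub>R X x)"
  using \<phi> by (intro polynomial_function_mult PX) (simp add: real_polynomial_function_eq)
 have dm: "sphere_div (\<lambda>x. \<phi> x *\<^sub>R X x) x = \<phi> x * sphere_div X x + G x \<bullet> X x" if x: "norm x = 1" for x
 proof -
  have dc: "dird (\<lambda>x. (\<phi> x *\<^sub>R X x) \<bullet> c) x v = \<phi> x * dird (\<lambda>x. X x \<bullet> c) x v + (G x \<bullet> v) * (X x \<bullet> c)" for c v
   using has_derivative_mult[OF has_derivative_dird[OF \<phi>] has_derivative_dird[OF real_polynomial_inner[OF PX]]]
   by (subst dird_eq) (auto simp: Gv)
  have e: "(\<Sum>c\<in>Basis. (G x \<bullet> c) * (X x \<bullet> c)) = G x \<bullet> X x" by (rule euclidean_inner[symmetric])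
  have e': "(\<Sum>c\<in>Basis. (X x \<bullet> c) * (x \<bullet> c)) = 0"
   using representsD(2)[OF X x] by (simp only: euclidean_inner[of "X x" x, symmetric])
  show ?thesis
   unfolding sphere_div_polynomial[OF P\<phi>X x] sphere_div_polynomial[OF PX x] dc
   by (simp only: distrib_right sum.distrib e mult.assoc sum_distrib_left[symmetric] e' mult_zero_right right_diff_distrib)
 qed
 have iGX: "integrable P (\<lambda>x. G x \<bullet> X x)"
  by (intro integrable_P_polynomial real_polynomial_inner2 PG PX)
 note dXm = borel_measurable_sphere_div[OF smooth_sphere_polynomial]
 have i1: "integrable P (\<lambda>x. \<phi> x * sphere_div X x)"
 proof -
  have "continuous_on (sphere 0 1) (\<lambda>x. \<phi> x * sphere_div X x)"
   by (intro continuous_intros continuous_on_real_polynomial \<phi> continuous_on_sphere_div smooth_sphere_polynomial PX)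
  then have "compact ((\<lambda>x. \<phi> x * sphere_div X x) ` sphere 0 1)" by (intro compact_continuous_image compact_sphere)
  then obtain B where B: "\<forall>y\<in>(\<lambda>x. \<phi> x * sphere_div X x) ` sphere 0 1. norm y \<le> B"
   using compact_imp_bounded bounded_iff by blast
  show ?thesis
  proof (rule integrable_const_bound[where B = B])
   show "AE x in P. norm (\<phi> x * sphere_div X x) \<le> B"
    using AE_norm by eventually_elim (use B in auto)
   show "(\<lambda>x. \<phi> x * sphere_div X x) \<in> borel_measurable P"
    using dXm[OF PX] borel_measurable_real_polynomial[OF \<phi>] by (simp add: measurable_P)
  qed
 qed
 have "0 = (LINT x|P. sphere_div (\<lambda>x. \<phi> x *\<^sub>R X x) x)"
  by (rule divergence_theorem[OF P\<phi>X, symmetric]) (simp add: representsD(2)[OF X])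
 also have "\<dots> = (LINT x|P. \<phi> x * sphere_div X x + G x \<bullet> X x)"
 proof (rule integral_cong_AE)
  show "sphere_div (\<lambda>x. \<phi> x *\<^sub>R X x) \<in> borel_measurable P"
   using dXm[OF P\<phi>X] by (simp add: measurable_P)
  show "(\<lambda>x. \<phi> x * sphere_div X x + G x \<bullet> X x) \<in> borel_measurable P"
   using i1 iGX by (intro borel_measurable_add) auto
  show "AE x in P. sphere_div (\<lambda>x. \<phi> x *\<^sub>R X x) x = \<phi> x * sphere_div X x + G x \<bullet> X x"
   using AE_norm by eventually_elim (rule dm)
 qed
 also have "\<dots> = (LINT x|P. \<phi> x * sphere_div X x) + (LINT x|P. G x \<bullet> X x)"
  by (rule Bochner_Integration.integral_add[OF i1 iGX])
 finally show ?thesis using 1 by simp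
qed

end

lemma le_of_all_eps:
 fixes x y :: real
 assumes "\<And>e. 0 < e ==> e \<le> 1 ==> x \<le> y + e * M"
 shows "x \<le> y"
proof (rule field_le_epsilon)
 fix e :: real assume e: "0 < e"
 define d where "d = min 1 (e / (1 + \<bar>M\<bar>))"
 have d: "0 < d" "d \<le> 1" using e by (auto simp: d_def)
 have "d * M \<le> d * (1 + \<bar>M\<bar>)" using d by (intro mult_left_mono) auto
 also have "\<dots> \<le> (e / (1 + \<bar>M\<bar>)) * (1 + \<bar>M\<bar>)" by (intro mult_right_mono) (auto simp: d_def)
 also have "\<dots> = e"
  by simp
 finally show "x \<le> y + e" using assms[OF d] by linarith
qed

context rotation_invariant_prob
begin

text \<open>The degree 0 case of \<open>homogeneous_average\<close>, where the sine moment is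
  1.\<close>

lemma integral_fst_\<nu>:
 fixes f :: "'a => real"
 assumes [measurable]: "f \<in> borel_measurable borel" and bd: "\<And>x. norm x = 1 ==> \<bar>f x\<bar> \<le> B"
 shows "(LINT z|\<nu>. f (fst z)) = (LINT x|P. f x)"
proof -
 interpret PP: prob_space "PP"
  by (intro prob_space_pair prob_space_axioms)
 have s0: "sine_moment 0 = 1" by (simp add: sine_moment_def PP.prob_space[simplified])
 have "(LINT u|PP. f (fst u)) = sine_moment 0 * (LINT z|\<nu>. f (fst z))"
  using homogeneous_average[of "\<lambda>z. f (fst z)" 0 B] bd by simp
 moreover have "(LINT u|PP. f (fst u)) = (LINT x|P. f x)"
  using bd prob_space by (subst integral_PP[where B = B]) auto
 ultimately show ?thesis using s0 by simp
qed

definition orthonormal_pairs :: "('a \<times> 'a) set" where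
 "orthonormal_pairs = {z. norm (fst z) = 1 \<and> norm (snd z) = 1 \<and> fst z \<bullet> snd z = 0}"

lemma AE_orthonormal: "AE z in \<nu>. z \<in> orthonormal_pairs"
 using AE_\<nu> by (simp add: orthonormal_pairs_def)

lemma rot_orthonormal:
 assumes "z \<in> orthonormal_pairs" shows "rot t z \<in> orthonormal_pairs"
proof -
 have z: "fst z \<bullet> fst z = 1" "snd z \<bullet> snd z = 1" "fst z \<bullet> snd z = 0" "snd z \<bullet> fst z = 0"
  using assms by (auto simp: orthonormal_pairs_def norm_eq_1 inner_commute)
 have "sin t * sin t + cos t * cos t = 1" using sin_cos_squared_add[of t] by (simp add: power2_eq_square)
 then show ?thesis
  by (simp add: orthonormal_pairs_def norm_eq_1 rot_def inner_add_left inner_add_right inner_diff_left inner_diff_right z add.commute)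
qed

lemma orthonormal_pairs_norm_le: "z \<in> orthonormal_pairs ==> norm z \<le> 2"
 using norm_Pair_le[of "fst z" "snd z"] by (simp add: orthonormal_pairs_def)

lemma rot_inverse: "rot (- t) (rot t z) = z"
proof -
 have *: "(cos t * cos t) *\<^sub>R x + (sin t * sin t) *\<^sub>R x = x" for x :: 'a
  using sin_cos_squared_add2[of t] by (simp add: scaleR_add_left[symmetric] power2_eq_square add.commute)
 show ?thesis using *[of "fst z"] *[of "snd z"]
  by (simp add: rot_def prod_eq_iff algebra_simps)
qed

definition chord_var :: "'a set => real => real" where
 "chord_var A r = (LINT z|\<nu>. \<bar>indicator A (fst (rot r z)) - indicator A (fst z)\<bar>)"

text \<open>A real upper bound for the variation with respect to \<open>P\<close>, rather than a
  supremum, so that the estimates stay in the reals.\<close>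

definition var_bound :: "'a set => real => bool" where
 "var_bound A V \<longleftrightarrow> 0 \<le> V \<and> (\<forall>X. smooth_vector_field X \<longrightarrow> (\<forall>x\<in>sphere 0 1. norm (X x) \<le> 1) \<longrightarrow>
   (LINT x|P. indicator A x * sphere_div X x) \<le> V)"

lemma represents_smooth: "represents X \<zeta> ==> smooth_vector_field X"
 unfolding smooth_vector_field_def by (auto intro: smooth_sphere_polynomial representsD)

lemma sphere_div_bounded:
 assumes "smooth_sphere X"
 obtains B where "\<And>x. norm x = 1 ==> \<bar>sphere_div X x\<bar> \<le> B"
proof -
 have "compact (sphere_div X ` sphere 0 1)"
  by (intro compact_continuous_image continuous_on_sphere_div assms compact_sphere)
 then obtain B where "\<forall>y\<in>sphere_div X ` sphere 0 1. norm y \<le> B" using compact_imp_bounded bounded_iff by blast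
 then show thesis using that[of B] by simp
qed

lemma integrable_indicator_div:
 assumes "smooth_sphere X" "A \<in> sets borel"
 shows "integrable P (\<lambda>x. indicator A x * sphere_div X x)"
proof -
 obtain B where B: "\<And>x. norm x = 1 ==> \<bar>sphere_div X x\<bar> \<le> B" by (rule sphere_div_bounded[OF assms(1)]) blast
 show ?thesis
 proof (rule integrable_const_bound[where B = B])
  show "AE x in P. norm (indicator A x * sphere_div X x) \<le> B"
   using AE_norm
  proof eventually_elim
   case (elim x)
   then show ?case using B[of x] by (auto simp: indicator_def)
  qed
  show "(\<lambda>x. indicator A x * sphere_div X x) \<in> borel_measurable P"
   using borel_measurable_sphere_div[OF assms(1)] assms(2) by (simp add: measurable_P)
 qed
qed

lemma integral_div_combine:
 assumes X: "smooth_vector_field X" and Y: "smooth_vector_field Y" and A: "A \<in> sets borel"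
 shows "(LINT x|P. indicator A x * sphere_div (\<lambda>x. a *\<^sub>R X x + b *\<^sub>R Y x) x)
   = a * (LINT x|P. indicator A x * sphere_div X x) + b * (LINT x|P. indicator A x * sphere_div Y x)"
proof -
 have s: "smooth_sphere X" "smooth_sphere Y" "smooth_sphere (\<lambda>x. a *\<^sub>R X x + b *\<^sub>R Y x)"
  using X Y smooth_vector_field_combine(1)[OF X Y, of a b] by (auto simp: smooth_vector_field_def)
 note i = integrable_indicator_div[OF _ A]
 have "(LINT x|P. indicator A x * sphere_div (\<lambda>x. a *\<^sub>R X x + b *\<^sub>R Y x) x)
   = (LINT x|P. a * (indicator A x * sphere_div X x) + b * (indicator A x * sphere_div Y x))"
 proof (rule integral_cong_AE)
  show "AE x in P. indicator A x * sphere_div (\<lambda>x. a *\<^sub>R X x + b *\<^sub>R Y x) x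
    = a * (indicator A x * sphere_div X x) + b * (indicator A x * sphere_div Y x)"
   using AE_norm
  proof eventually_elim
   case (elim x)
   then have "x \<noteq> 0" by auto
   then show ?case by (simp add: smooth_vector_field_combine(2)[OF X Y] algebra_simps)
  qed
 qed (use i[OF s(1)] i[OF s(2)] i[OF s(3)] in auto)
 also have "\<dots> = a * (LINT x|P. indicator A x * sphere_div X x) + b * (LINT x|P. indicator A x * sphere_div Y x)"
  using i[OF s(1)] i[OF s(2)] by simp
 finally show ?thesis .
qed

lemma var_bound_scaled:
 assumes V: "var_bound A V" and A: "A \<in> sets borel" and X: "smooth_vector_field X"
  and c: "0 \<le> c" "\<And>x. norm x = 1 ==> norm (X x) \<le> c"
 shows "\<bar>(LINT x|P. indicator A x * sphere_div X x)\<bar> \<le> c * V"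
proof -
 have *: "s * (LINT x|P. indicator A x * sphere_div X x) \<le> c * V" if s: "\<bar>s\<bar> = 1" for s :: real
 proof (rule le_of_all_eps)
  fix e :: real assume e: "0 < e"
  \<comment> \<open>\<open>c\<close> may be 0, so the field is divided by c + e; the sign
    \<open>s\<close> yields both sides of the absolute value.\<close>
  define a where "a = s / (c + e)"
  have ce: "0 < c + e" using c e by simp
  have "norm (a *\<^sub>R X x + 0 *\<^sub>R X x) \<le> 1" if "x \<in> sphere 0 1" for x
   using c(2)[of x] that s e ce by (simp add: a_def abs_mult field_simps)
  then have "(LINT x|P. indicator A x * sphere_div (\<lambda>x. a *\<^sub>R X x + 0 *\<^sub>R X x) x) \<le> V"
   using V smooth_vector_field_combine(1)[OF X X, of a 0] unfolding var_bound_def by blast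
  then have "a * (LINT x|P. indicator A x * sphere_div X x) \<le> V"
   by (simp only: integral_div_combine[OF X X A])
  then show "s * (LINT x|P. indicator A x * sphere_div X x) \<le> c * V + e * V"
   using ce by (simp add: a_def field_simps)
 qed
 show ?thesis using *[of 1] *[of "-1"] by (simp add: abs_le_iff)
qed

text \<open>Density: the first marginal of \<open>\<nu>\<close> is \<open>P\<close>, so one L1
  approximation of the indicator by a polynomial controls both sides of
  \<open>represents_div_polynomial\<close>.\<close>

lemma represents_div:
 assumes X: "represents X \<zeta>" and \<zeta>: "real_polynomial_function \<zeta>" and A [measurable]: "A \<in> sets borel"
 shows "(LINT z|\<nu>. indicator A (fst z) * dird \<zeta> z (geo z)) = (LINT x|P. indicator A x * sphere_div X x)"
proof -
 define g where "g z = dird \<zeta> z (geo z)" for z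
 have g: "real_polynomial_function g" unfolding g_def by (rule real_polynomial_dird[OF \<zeta> polynomial_geo])
 have gm [measurable]: "g \<in> borel_measurable borel2"
  using borel_measurable_real_polynomial[OF g] by (simp add: borel_prod)
 obtain C where C: "0 \<le> C" "\<And>z. norm z \<le> 2 ==> \<bar>g z\<bar> \<le> C"
  by (rule polynomial_bounded_on_sphere[OF g, of 2]) blast
 have sX: "smooth_sphere X" using represents_smooth[OF X] by (simp add: smooth_vector_field_def)
 obtain D where D: "\<And>x. norm x = 1 ==> \<bar>sphere_div X x\<bar> \<le> D" by (rule sphere_div_bounded[OF sX]) blast
 note dm [measurable] = borel_measurable_sphere_div[OF sX]
 have D0: "0 \<le> D" using D[of e1] e12 by force
 let ?L = "LINT z|\<nu>. indicator A (fst z) * g z" and ?R = "LINT x|P. indicator A x * sphere_div X x"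
 have "\<bar>?L - ?R\<bar> \<le> 0 + e * (C + D)" if e: "0 < e" for e
 proof -
  obtain \<phi> where \<phi>: "real_polynomial_function \<phi>" "(LINT x|P. \<bar>\<phi> x - indicator A x\<bar>) < e"
   using polynomial_approx_indicator[OF finite_measure_P sets_P AE_norm_le A e] by blast
  note \<phi>m [measurable] = borel_measurable_real_polynomial[OF \<phi>(1)]
  obtain F where F: "0 \<le> F" "\<And>x. norm x \<le> 1 ==> \<bar>\<phi> x\<bar> \<le> F"
   by (rule polynomial_bounded_on_sphere[OF \<phi>(1), of 1]) blast
  define w where "w x = \<bar>\<phi> x - indicator A x\<bar>" for x
  have wm [measurable]: "w \<in> borel_measurable borel" unfolding w_def by measurable
  have wb: "\<bar>w x\<bar> \<le> F + 1" if "norm x = 1" for x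
   using F(2)[of x] that by (auto simp: w_def indicator_def)
  have w: "(LINT z|\<nu>. w (fst z)) = (LINT x|P. w x)" by (rule integral_fst_\<nu>[OF wm wb])
  have iw: "integrable P w"
   by (rule integrable_const_bound[where B = "F + 1"]) (use AE_norm wb in \<open>auto elim!: eventually_mono simp: measurable_P\<close>)
  have iw\<nu>: "integrable \<nu> (\<lambda>z. w (fst z))"
  proof (rule N.integrable_const_bound[where B = "F + 1"])
   show "AE z in \<nu>. norm (w (fst z)) \<le> F + 1"
    using AE_\<nu> by eventually_elim (use wb in auto)
  qed measurable
  have i1: "integrable \<nu> (\<lambda>z. \<phi> (fst z) * g z)"
   by (intro integrable_\<nu>_polynomial real_polynomial_function.intros(4) polynomial_compose_fst \<phi>(1) g)
  have i2: "integrable \<nu> (\<lambda>z. indicator A (fst z) * g z)"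
  proof (rule N.integrable_const_bound[where B = C])
   show "AE z in \<nu>. norm (indicator A (fst z) * g z) \<le> C"
    using AE_\<nu>_le
   proof eventually_elim
    case (elim z)
    then show ?case using C(1) C(2)[of z] by (auto simp: indicator_def)
   qed
  qed measurable
  have "\<bar>?L - (LINT z|\<nu>. \<phi> (fst z) * g z)\<bar> = \<bar>(LINT z|\<nu>. indicator A (fst z) * g z - \<phi> (fst z) * g z)\<bar>"
   by (simp add: Bochner_Integration.integral_diff[OF i2 i1])
  also have "\<dots> \<le> (LINT z|\<nu>. \<bar>indicator A (fst z) * g z - \<phi> (fst z) * g z\<bar>)"
   by (rule integral_abs_bound)
  also have "\<dots> \<le> (LINT z|\<nu>. C * w (fst z))"
  proof (rule integral_mono_AE')
   show "AE z in \<nu>. \<bar>indicator A (fst z) * g z - \<phi> (fst z) * g z\<bar> \<le> C * w (fst z)"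
    using AE_\<nu>_le
   proof eventually_elim
    case (elim z)
    have "\<bar>indicator A (fst z) * g z - \<phi> (fst z) * g z\<bar> = \<bar>g z\<bar> * w (fst z)"
     unfolding w_def abs_mult[symmetric] by (subst abs_minus_commute) (simp add: algebra_simps)
    also have "\<dots> \<le> C * w (fst z)" using C(2)[OF elim] by (intro mult_right_mono) (simp_all add: w_def)
    finally show ?case .
   qed
  qed (use iw\<nu> C in \<open>auto simp: w_def\<close>)
  also have "\<dots> = C * (LINT x|P. w x)" using w by simp
  also have "\<dots> \<le> C * e" using \<phi>(2) C by (intro mult_left_mono) (simp_all add: w_def)
  finally have 1: "\<bar>?L - (LINT z|\<nu>. \<phi> (fst z) * g z)\<bar> \<le> C * e" .
  have i3: "integrable P (\<lambda>x. \<phi> x * sphere_div X x)"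
  proof (rule integrable_const_bound[where B = "F * D"])
   show "AE x in P. norm (\<phi> x * sphere_div X x) \<le> F * D"
    using AE_norm
   proof eventually_elim
    case (elim x)
    then show ?case using F(1) F(2)[of x] D[of x] by (auto simp: abs_mult intro!: mult_mono)
   qed
  qed (use dm \<phi>m in \<open>simp add: measurable_P\<close>)
  have "\<bar>(LINT x|P. \<phi> x * sphere_div X x) - ?R\<bar> = \<bar>(LINT x|P. \<phi> x * sphere_div X x - indicator A x * sphere_div X x)\<bar>"
   by (simp add: Bochner_Integration.integral_diff[OF i3 integrable_indicator_div[OF sX A]])
  also have "\<dots> \<le> (LINT x|P. \<bar>\<phi> x * sphere_div X x - indicator A x * sphere_div X x\<bar>)"
   by (rule integral_abs_bound)
  also have "\<dots> \<le> (LINT x|P. D * w x)"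
  proof (rule integral_mono_AE')
   show "AE x in P. \<bar>\<phi> x * sphere_div X x - indicator A x * sphere_div X x\<bar> \<le> D * w x"
    using AE_norm
   proof eventually_elim
    case (elim x)
    have "\<bar>\<phi> x * sphere_div X x - indicator A x * sphere_div X x\<bar> = \<bar>sphere_div X x\<bar> * w x"
     unfolding w_def abs_mult[symmetric] by (simp add: algebra_simps)
    also have "\<dots> \<le> D * w x" using D[OF elim] by (intro mult_right_mono) (simp_all add: w_def)
    finally show ?case .
   qed
  qed (use integrable_mult_right[OF iw, of D] D0 in \<open>auto simp: w_def\<close>)
  also have "\<dots> \<le> D * e" using \<phi>(2) D0 by (simp add: w_def mult_left_mono)
  finally have 2: "\<bar>(LINT x|P. \<phi> x * sphere_div X x) - ?R\<bar> \<le> D * e" .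
  have "(LINT z|\<nu>. \<phi> (fst z) * g z) = (LINT x|P. \<phi> x * sphere_div X x)"
   unfolding g_def by (rule represents_div_polynomial[OF X \<zeta> \<phi>(1)])
  with 1 2 show ?thesis by (simp add: algebra_simps)
 qed
 then have "\<bar>?L - ?R\<bar> \<le> 0" by (rule le_of_all_eps)
 then show ?thesis by (simp add: g_def)
qed

text \<open>Invariance of \<open>\<nu>\<close> moves the flow from the set, which cannot be
  differentiated, to the polynomial weight; the time changes sign.\<close>

lemma integral_chord_polynomial:
 assumes \<zeta>: "real_polynomial_function \<zeta>" and A [measurable]: "A \<in> sets borel"
 shows "(LINT z|\<nu>. \<zeta> z * (indicator A (fst (rot r z)) - indicator A (fst z)))
  = (LINT z|\<nu>. indicator A (fst z) * \<zeta> (rot (- r) z)) - (LINT z|\<nu>. indicator A (fst z) * \<zeta> (rot 0 z))"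
proof -
 have [measurable]: "\<zeta> \<in> borel_measurable borel2"
  using borel_measurable_real_polynomial[OF \<zeta>] by (simp add: borel_prod)
 have [measurable]: "rot t \<in> measurable borel2 borel2" for t
  unfolding rot_def by measurable
 obtain C where C: "0 \<le> C" "\<And>z. norm z \<le> 2 ==> \<bar>\<zeta> z\<bar> \<le> C"
  by (rule polynomial_bounded_on_sphere[OF \<zeta>, of 2]) blast
 have i: "integrable \<nu> (\<lambda>z. \<zeta> z * indicator A (fst (rot r z)))" for r
 proof (rule N.integrable_const_bound[where B = C])
  show "AE z in \<nu>. norm (\<zeta> z * indicator A (fst (rot r z))) \<le> C"
   using AE_\<nu>_le
  proof eventually_elim
   case (elim z)
   then show ?case using C(1) C(2)[of z] by (auto simp: indicator_def)
  qed
 qed measurable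
 have r0: "rot 0 z = z" for z by (simp add: rot_def)
 have "(LINT z|\<nu>. \<zeta> z * indicator A (fst (rot r z))) = (LINT z|\<nu>. \<zeta> (rot (- r) (rot r z)) * indicator A (fst (rot r z)))"
  by (simp add: rot_inverse)
 also have "\<dots> = (LINT z|\<nu>. \<zeta> (rot (- r) z) * indicator A (fst z))"
  by (rule integral_\<nu>_rot) measurable
 finally show ?thesis
  using Bochner_Integration.integral_diff[OF i[of r] i[of 0]]
  by (simp add: r0 right_diff_distrib mult.commute)
qed

text \<open>Mean value theorem in time. At each time the derivative is the divergence integral of
  the field represented by the flowed weight. That weight has the same bound \<open>c\<close>, so
  the field has norm at most c \<kappa> and \<open>var_bound\<close> applies.\<close>

lemma chord_polynomial_bound:
 assumes V: "var_bound A V" and A: "A \<in> sets borel" and \<zeta>: "real_polynomial_function \<zeta>"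
  and c: "0 \<le> c" "\<And>z. z \<in> orthonormal_pairs ==> \<bar>\<zeta> z\<bar> \<le> c"
 shows "\<bar>(LINT z|\<nu>. \<zeta> z * (indicator A (fst (rot r z)) - indicator A (fst z)))\<bar> \<le> c * \<kappa> * V * \<bar>r\<bar>"
proof -
 define G where "G t = (LINT z|\<nu>. indicator A (fst z) * \<zeta> (rot t z))" for t
 define G' where "G' t = (LINT z|\<nu>. indicator A (fst z) * dird \<zeta> (rot t z) (geo (rot t z)))" for t
 have d: "(G has_real_derivative G' t) (at t)" for t
  unfolding G_def G'_def by (rule DERIV_\<nu>_rot[OF \<zeta> A])
 have b: "\<bar>G' t\<bar> \<le> c * \<kappa> * V" for t
 proof -
  define \<eta> where "\<eta> z = \<zeta> (rot t z)" for z
  have "\<eta> = \<zeta> \<circ> rot t" by (simp add: fun_eq_iff \<eta>_def)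
  then have \<eta>: "real_polynomial_function \<eta>"
   using real_polynomial_function_compose[OF polynomial_function_bounded_linear[OF bounded_linear_rot] \<zeta>]
   by (simp only:)
  \<comment> \<open>The flow commutes with its generator.\<close>
  have "dird \<eta> z (geo z) = dird \<zeta> (rot t z) (geo (rot t z))" for z
  proof -
   have "(\<eta> has_derivative (\<lambda>v. dird \<zeta> (rot t z) (rot t v))) (at z)"
    unfolding \<eta>_def
    by (rule has_derivative_compose[OF bounded_linear_imp_has_derivative[OF bounded_linear_rot] has_derivative_dird[OF \<zeta>]])
   from dird_eq[OF this, of "geo z"] show ?thesis by (simp add: rot_def geo_def)
  qed
  then have "G' t = (LINT z|\<nu>. indicator A (fst z) * dird \<eta> z (geo z))" by (simp add: G'_def)
  moreover obtain X where X: "represents X \<eta>" using represents_exists[OF \<eta>] by blast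
  ultimately have "G' t = (LINT x|P. indicator A x * sphere_div X x)" by (simp only: represents_div[OF X \<eta> A])
  moreover have "AE z in \<nu>. \<bar>\<eta> z\<bar> \<le> c"
   using AE_orthonormal by eventually_elim (simp add: \<eta>_def c(2) rot_orthonormal)
  then have "norm (X x) \<le> c * \<kappa>" if "norm x = 1" for x
   by (rule represents_bound[OF X \<eta> c(1) _ that])
  ultimately show ?thesis
   using var_bound_scaled[OF V A represents_smooth[OF X], of "c * \<kappa>"] c(1) \<kappa>_nonneg by simp
 qed
 have "\<bar>G (- r) - G 0\<bar> \<le> c * \<kappa> * V * \<bar>- r - 0\<bar>"
  using field_differentiable_bound[of UNIV G G' "c * \<kappa> * V" "- r" 0] d b by simp
 then show ?thesis by (simp add: integral_chord_polynomial[OF \<zeta> A] G_def)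
qed

text \<open>|D| is \<open>D\<close> times its sign, the difference of the indicators of
  \<open>A1\<close> and \<open>A2\<close>. This sign is approximated in L1 by a polynomial weight of
  sup norm at most 1 + 2 e, to which \<open>chord_polynomial_bound\<close> applies.\<close>

theorem chord_var_upper:
 assumes V: "var_bound A V" and A [measurable]: "A \<in> sets borel"
 shows "chord_var A r \<le> \<kappa> * V * \<bar>r\<bar>"
proof (rule le_of_all_eps)
 fix e :: real assume e: "0 < e" "e \<le> 1"
 have rm [measurable]: "rot t \<in> measurable borel2 borel2" for t
  unfolding rot_def by measurable
 define A1 where "A1 = {z. fst (rot r z) \<in> A \<and> fst z \<notin> A}"
 define A2 where "A2 = {z. fst (rot r z) \<notin> A \<and> fst z \<in> A}"
 define D where "D z = (indicator A (fst (rot r z)) - indicator A (fst z) :: real)" for z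
 have [measurable]: "D \<in> borel_measurable borel2" unfolding D_def by measurable
 have "Measurable.pred borel2 (\<lambda>z. fst (rot r z) \<in> A \<and> fst z \<notin> A)"
  "Measurable.pred borel2 (\<lambda>z. fst (rot r z) \<notin> A \<and> fst z \<in> A)"
  by measurable
 then have "A1 \<in> sets borel2" "A2 \<in> sets borel2"
  by (simp_all add: A1_def A2_def pred_def space_pair_measure)
 then have A12: "A1 \<in> sets borel" "A2 \<in> sets borel" by (simp_all only: borel_prod)
 note ap = polynomial_approx_indicator[OF finite_measure_\<nu> sets_\<nu>_borel AE_\<nu>_le _ e(1)]
 obtain p where p: "real_polynomial_function p" "(LINT z|\<nu>. \<bar>p z - indicator A1 z\<bar>) < e"
  "\<And>z. norm z \<le> 2 ==> - e \<le> p z \<and> p z \<le> 1 + e" using ap[OF A12(1)] by blast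
 obtain q where q: "real_polynomial_function q" "(LINT z|\<nu>. \<bar>q z - indicator A2 z\<bar>) < e"
  "\<And>z. norm z \<le> 2 ==> - e \<le> q z \<and> q z \<le> 1 + e" using ap[OF A12(2)] by blast
 have pq: "real_polynomial_function (\<lambda>z. p z - q z)"
  by (rule real_polynomial_function_diff[OF p(1) q(1)])
 have b: "\<bar>p z - q z\<bar> \<le> 1 + 2 * e" if "z \<in> orthonormal_pairs" for z
  using p(3)[of z] q(3)[of z] orthonormal_pairs_norm_le[OF that] by linarith
 have k: "\<bar>(LINT z|\<nu>. (p z - q z) * D z)\<bar> \<le> (1 + 2 * e) * \<kappa> * V * \<bar>r\<bar>"
  unfolding D_def by (rule chord_polynomial_bound[OF V A pq _ b]) (use e in auto)
 have D1: "\<bar>D z\<bar> \<le> 1" for z by (auto simp: D_def indicator_def)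
 have DA: "\<bar>D z\<bar> = (indicator A1 z - indicator A2 z) * D z" for z
  by (auto simp: D_def A1_def A2_def indicator_def)
 have iD: "integrable \<nu> (\<lambda>z. (p z - q z) * D z)"
 proof (rule N.integrable_const_bound[where B = "1 + 2 * e"])
  have [measurable]: "(\<lambda>z. p z - q z) \<in> borel_measurable borel2"
   using borel_measurable_real_polynomial[OF pq] by (simp add: borel_prod)
  show "(\<lambda>z. (p z - q z) * D z) \<in> borel_measurable \<nu>" by measurable
  show "AE z in \<nu>. norm ((p z - q z) * D z) \<le> 1 + 2 * e"
   using AE_orthonormal
  proof eventually_elim
   case (elim z)
   then show ?case using mult_mono[OF b[OF elim] D1[of z]] e by (simp add: abs_mult)
  qed
 qed
 have ind: "integrable \<nu> (\<lambda>z. \<bar>f z - indicator S z\<bar>)" if "real_polynomial_function f" "S \<in> sets borel" for f S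
 proof -
  have "S \<in> sets \<nu>" using that(2) sets_\<nu>_borel by simp
  then have "integrable \<nu> (indicator S :: 'a \<times> 'a => real)"
   by (intro integrable_real_indicator) (auto simp: N.emeasure_eq_measure)
  from Bochner_Integration.integrable_diff[OF integrable_\<nu>_polynomial[OF that(1)] this]
  show ?thesis by (rule integrable_abs)
 qed
 have "chord_var A r = (LINT z|\<nu>. \<bar>D z\<bar>)" by (simp add: chord_var_def D_def)
 also have "\<dots> \<le> (LINT z|\<nu>. (p z - q z) * D z + (\<bar>p z - indicator A1 z\<bar> + \<bar>q z - indicator A2 z\<bar>))"
 proof (rule integral_mono')
  show "integrable \<nu> (\<lambda>z. (p z - q z) * D z + (\<bar>p z - indicator A1 z\<bar> + \<bar>q z - indicator A2 z\<bar>))"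
   by (intro Bochner_Integration.integrable_add iD ind p(1) q(1) A12)
  fix z
  have "(indicator A1 z - p z) * D z \<le> \<bar>p z - indicator A1 z\<bar>"
   "(q z - indicator A2 z) * D z \<le> \<bar>q z - indicator A2 z\<bar>"
   using D1[of z] mult_left_mono[OF D1[of z], of "\<bar>p z - indicator A1 z\<bar>"] mult_left_mono[OF D1[of z], of "\<bar>q z - indicator A2 z\<bar>"]
    abs_ge_self[of "(indicator A1 z - p z) * D z"] abs_ge_self[of "(q z - indicator A2 z) * D z"]
   by (simp_all add: abs_mult abs_minus_commute)
  then show *: "\<bar>D z\<bar> \<le> (p z - q z) * D z + (\<bar>p z - indicator A1 z\<bar> + \<bar>q z - indicator A2 z\<bar>)"
   unfolding DA by (simp only: left_diff_distrib)
  show "0 \<le> (p z - q z) * D z + (\<bar>p z - indicator A1 z\<bar> + \<bar>q z - indicator A2 z\<bar>)"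
   by (rule order_trans[OF abs_ge_zero *])
 qed
 also have "\<dots> = (LINT z|\<nu>. (p z - q z) * D z) + ((LINT z|\<nu>. \<bar>p z - indicator A1 z\<bar>) + (LINT z|\<nu>. \<bar>q z - indicator A2 z\<bar>))"
  by (simp only: Bochner_Integration.integral_add[OF iD Bochner_Integration.integrable_add[OF ind[OF p(1) A12(1)] ind[OF q(1) A12(2)]]]
    Bochner_Integration.integral_add[OF ind[OF p(1) A12(1)] ind[OF q(1) A12(2)]])
 also have "\<dots> \<le> (1 + 2 * e) * \<kappa> * V * \<bar>r\<bar> + (e + e)" using k p(2) q(2) by linarith
 also have "\<dots> = \<kappa> * V * \<bar>r\<bar> + e * (2 * \<kappa> * V * \<bar>r\<bar> + 2)" by (simp add: algebra_simps)
 finally show "chord_var A r \<le> \<kappa> * V * \<bar>r\<bar> + e * (2 * \<kappa> * V * \<bar>r\<bar> + 2)" .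
qed

end

context rotation_invariant_prob
begin

section \<open>Directions between independent points and the lower bound for the chord
  variation\<close>

text \<open>Weights that are not homogeneous in the direction, such as clipped ones, are averaged
  through this unit direction instead of the projection. For unit vectors that are equal or opposite
  \<open>sgn\<close> makes it 0.\<close>

definition dirn :: "'a => 'a => 'a" where
 "dirn x y = sgn (tproj x y)"

lemma dirn_measurable [measurable]:
 "(\<lambda>u. dirn (fst u) (snd u)) \<in> borel_measurable borel2" "dirn x \<in> borel_measurable borel"
 unfolding dirn_def[abs_def] sgn_div_norm tproj_def by measurable

lemma norm_dirn_le: "norm (dirn x y) \<le> 1"
 by (simp add: dirn_def norm_sgn)

lemma dirn_orth: "norm x = 1 ==> x \<bullet> dirn x y = 0"
 using tproj_orth[of x y] by (simp add: dirn_def sgn_div_norm inner_commute)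

lemma dirn_orthogonal_transformation:
 assumes h: "orthogonal_transformation h"
 shows "dirn (h x) (h y) = h (dirn x y)"
proof -
 note l = orthogonal_transformation_linear[OF h]
 have "h x \<bullet> h y = x \<bullet> y" using h by (simp add: orthogonal_transformation_def)
 then have "tproj (h x) (h y) = h (tproj x y)"
  by (simp add: tproj_def linear_diff[OF l] linear_scale[OF l])
 then show ?thesis
  using h by (simp add: dirn_def sgn_div_norm linear_scale[OF l] orthogonal_transformation)
qed

lemma integral_dirn_inner:
 fixes g :: "real => real"
 assumes [measurable]: "g \<in> borel_measurable borel" and x: "norm x = 1" "norm a = 1" "x \<bullet> a = 0"
 shows "(LINT y|P. g (a \<bullet> dirn x y)) = (LINT y|P. g (e2 \<bullet> dirn e1 y))"
proof -
 obtain h where h: "orthogonal_transformation h" "h e1 = x" "h e2 = a"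
  using orthogonal_transformation_pair[of e1 x e2 a] x by (auto simp: e12)
 have "(LINT y|P. g (a \<bullet> dirn x y)) = (LINT y|P. g (a \<bullet> dirn x (h y)))"
  by (rule integral_invariant[OF h(1), symmetric]) measurable
 also have "\<dots> = (LINT y|P. g (h e2 \<bullet> h (dirn e1 y)))"
  using dirn_orthogonal_transformation[OF h(1), of e1] by (simp add: h)
 also have "\<dots> = (LINT y|P. g (e2 \<bullet> dirn e1 y))"
  using h(1) by (simp add: orthogonal_transformation_def)
 finally show ?thesis .
qed

text \<open>The probability that two independent points are neither equal nor opposite. It is
  carried along as a positive factor and cancels.\<close>

definition nonpolar :: real where
 "nonpolar = (LINT u|PP. (if sine u > 0 then 1 else 0))"

lemma integrable_nonpolar: "integrable PP (\<lambda>u. if sine u > 0 then 1 else 0 :: real)"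
proof -
 interpret PP: finite_measure "PP" by (rule finite_measure_PP)
 show ?thesis by (rule PP.integrable_const_bound[where B = 1]) (auto, measurable)
qed

lemma nonpolar_pos: "0 < nonpolar"
proof -
 have "sine_moment 1 \<le> nonpolar"
  unfolding sine_moment_def nonpolar_def
 proof (rule integral_mono_AE[OF integrable_sine_power integrable_nonpolar])
  show "AE u in PP. sine u ^ 1 \<le> (if sine u > 0 then 1 else 0)"
   using AE_PP
  proof eventually_elim
   case (elim u)
   then show ?case using sine_bounds[of u] by auto
  qed
 qed
 then show ?thesis using sine_moment_pos[of 1] by linarith
qed

text \<open>Counterpart of \<open>homogeneous_average\<close> for the unit direction. At equal or
  opposite points the direction is 0, and \<open>F0\<close> makes the integrand vanish
  there.\<close>

lemma integral_dirn:
 fixes F :: "'a \<times> 'a => real"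
 assumes Fm [measurable]: "F \<in> borel_measurable borel2"
  and F0: "\<And>x. F (x, 0) = 0" and bd: "\<And>x y. norm x = 1 ==> norm y \<le> 1 ==> \<bar>F (x, y)\<bar> \<le> B"
 shows "(LINT x|P. (LINT y|P. F (x, dirn x y))) = nonpolar * (LINT z|\<nu>. F z)"
proof -
 have m: "(\<lambda>u. F (fst u, dirn (fst u) (snd u))) \<in> borel_measurable borel2" by measurable
 have i: "integrable \<nu> F"
 proof (rule N.integrable_const_bound)
  show "AE z in \<nu>. norm (F z) \<le> B"
   using AE_\<nu>
  proof eventually_elim
   case (elim z)
   then show ?case using bd[of "fst z" "snd z"] by simp
  qed
 qed measurable
 note pm [measurable] = pair_map_measurable
 have "(LINT x|P. (LINT y|P. F (x, dirn x y))) = (LINT u|PP. F (fst u, dirn (fst u) (snd u)))"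
  using bd norm_dirn_le by (subst integral_PP[OF m, where B = B]) auto
 also have "\<dots> = (LINT w|(PP \<Otimes>\<^sub>M \<nu>). F (fst (pair_map w), dirn (fst (pair_map w)) (snd (pair_map w))))"
  by (rule integral_pair_average[OF m])
 also have "\<dots> = (LINT w|(PP \<Otimes>\<^sub>M \<nu>). (if sine (fst w) > 0 then 1 else 0) * F (snd w))"
 proof (rule integral_cong_AE)
  show "(\<lambda>w. F (fst (pair_map w), dirn (fst (pair_map w)) (snd (pair_map w)))) \<in> borel_measurable (PP \<Otimes>\<^sub>M \<nu>)"
   using measurable_compose[OF pm m] .
  show "AE w in PP \<Otimes>\<^sub>M \<nu>. F (fst (pair_map w), dirn (fst (pair_map w)) (snd (pair_map w)))
    = (if sine (fst w) > 0 then 1 else 0) * F (snd w)"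
   using AE_PP\<nu>
  proof eventually_elim
   case (elim w)
   have 1: "fst (pair_map w) = fst (snd w)" by (simp add: pair_map_def)
   have 2: "tproj (fst (pair_map w)) (snd (pair_map w)) = sine (fst w) *\<^sub>R snd (snd w)"
    using elim by (intro tproj_pair_map) auto
   have 3: "sine (fst w) \<ge> 0" using elim sine_bounds(1)[of "fst w"] by simp
   have 4: "sgn (snd (snd w)) = snd (snd w)" using elim by (simp add: sgn_div_norm)
   show ?case
    unfolding dirn_def 2 unfolding 1 using 3 4 by (auto simp: sgn_scaleR F0)
  qed
 qed measurable
 also have "\<dots> = nonpolar * (LINT z|\<nu>. F z)"
  unfolding nonpolar_def by (rule integral_product_PP\<nu>[OF integrable_nonpolar i])
 finally show ?thesis .
qed

text \<open>The mean over \<open>\<nu>\<close> of the absolute component of the direction along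
  \<open>e1\<close> is computed twice, through unit directions and through projections; the common
  factor \<open>S\<close> is the mean sine, hence not 0.\<close>

lemma integral_dirn_abs: "(LINT y|P. \<bar>e2 \<bullet> dirn e1 y\<bar>) = nonpolar * \<kappa>"
proof -
 define T where "T = (LINT y|P. \<bar>e2 \<bullet> dirn e1 y\<bar>)"
 define S where "S = (LINT x|P. norm (tproj x e1))"
 have "(LINT y|P. \<bar>e1 \<bullet> dirn x y\<bar>) = norm (tproj x e1) * T" if x: "norm x = 1" for x
 proof -
  have e: "e1 \<bullet> dirn x y = tproj x e1 \<bullet> dirn x y" for y
   using dirn_orth[OF x, of y] by (simp add: tproj_def inner_diff_left)
  show ?thesis
  proof (cases "tproj x e1 = 0")
   case False
   define a where "a = tproj x e1 /\<^sub>R norm (tproj x e1)"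
   have a: "norm a = 1" "x \<bullet> a = 0"
    using False tproj_orth[OF x, of e1] by (auto simp: a_def inner_commute)
   have "tproj x e1 = norm (tproj x e1) *\<^sub>R a" using False by (simp add: a_def)
   then have "e1 \<bullet> dirn x y = norm (tproj x e1) * (a \<bullet> dirn x y)" for y
    unfolding e by (metis inner_scaleR_left)
   then have "(LINT y|P. \<bar>e1 \<bullet> dirn x y\<bar>) = norm (tproj x e1) * (LINT y|P. \<bar>a \<bullet> dirn x y\<bar>)"
    by (simp add: abs_mult)
   then show ?thesis using integral_dirn_inner[of abs, OF _ x a] by (simp add: T_def)
  qed (simp add: e)
 qed
 then have "S * T = (LINT x|P. (LINT y|P. \<bar>e1 \<bullet> dirn x y\<bar>))"
  unfolding S_def integral_mult_left_zero[symmetric]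
  by (intro integral_cong_AE) (use AE_norm in \<open>auto elim!: eventually_mono simp: tproj_def\<close>)
 also have "\<dots> = nonpolar * (LINT z|\<nu>. \<bar>e1 \<bullet> snd z\<bar>)"
 proof -
  have b: "\<bar>e1 \<bullet> y\<bar> \<le> 1" if "norm y \<le> 1" for y
   using Cauchy_Schwarz_ineq2[of e1 y] that by (simp add: e12)
  show ?thesis
   using integral_dirn[of "\<lambda>z. \<bar>e1 \<bullet> snd z\<bar>" 1] b by simp
 qed
 also have "(LINT z|\<nu>. \<bar>e1 \<bullet> snd z\<bar>) = \<kappa> * S"
  unfolding S_def using integral_\<nu>_abs[of "\<lambda>_. e1" 1] by (simp add: e12)
 finally have ST: "S * T = S * (nonpolar * \<kappa>)" by simp
 have "S \<noteq> 0"
 proof -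
  have "sine_moment 1 = (LINT x|P. (LINT y|P. sine (x, y)))"
   unfolding sine_moment_def power_one_right
   by (rule integral_PP[where B = 1]) (use sine_bounds in \<open>auto simp: abs_le_iff intro: order_trans[of _ 0]\<close>)
  also have "\<dots> = (LINT x|P. S)"
  proof (rule integral_cong_AE)
   show "AE x in P. (LINT y|P. sine (x, y)) = S"
    using AE_norm
   proof eventually_elim
    case (elim x)
    define h where "h = reflect (e1 - x)"
    have h: "orthogonal_transformation h" "h e1 = x"
     using elim by (auto simp: h_def orthogonal_transformation_reflect e12 intro!: reflect_diff)
    have "(LINT y|P. sine (x, y)) = (LINT y|P. sine (x, h y))"
     by (rule integral_invariant[OF h(1), symmetric]) measurable
    also have "\<dots> = (LINT y|P. norm (tproj y e1))"
    proof (rule integral_cong_AE)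
     show "AE y in P. sine (x, h y) = norm (tproj y e1)"
      using AE_norm
     proof eventually_elim
      case (elim y)
      have "x \<bullet> h y = e1 \<bullet> y" using h by (metis orthogonal_transformation_def)
      moreover have "(norm (tproj y e1))\<^sup>2 = 1 - (e1 \<bullet> y)\<^sup>2"
       unfolding power2_norm_eq_inner unfolding tproj_def power2_eq_square
       using elim by (simp add: inner_diff_left inner_diff_right e12 inner_commute[of y e1] norm_eq_1)
      ultimately show ?case
       by (simp add: sine_def) (metis abs_norm_cancel real_sqrt_abs)
     qed
    qed (use orthogonal_transformation_measurable[OF h(1)] in \<open>auto simp: tproj_def sine_def\<close>)
    finally show ?case by (simp add: S_def)
   qed
  qed measurable
  also have "\<dots> = S" using prob_space by simp
  finally show ?thesis using sine_moment_pos[of 1] by simp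
 qed
 then show ?thesis using ST by (simp add: T_def)
qed

text \<open>A continuous stand-in for the sign function, so that polynomials can approximate it
  uniformly.\<close>

definition clip :: "real => real => real" where
 "clip \<eta> s = max (-1) (min 1 (s / \<eta>))"

lemma clip_measurable [measurable]: "clip \<eta> \<in> borel_measurable borel"
 unfolding clip_def[abs_def] by measurable

lemma clip_bound: "\<bar>clip \<eta> s\<bar> \<le> 1" by (auto simp: clip_def)

text \<open>Takes the place of \<open>\<kappa>\<close> when the sign in |s| = sgn s * s is clipped;
  it tends to \<open>\<kappa>\<close> as \<open>\<eta>\<close> goes to 0.\<close>

definition \<kappa>_clip :: "real => real" where
 "\<kappa>_clip \<eta> = (LINT y|P. clip \<eta> (e2 \<bullet> dirn e1 y) * (e2 \<bullet> dirn e1 y)) / nonpolar"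

lemma inner_dirn_le: "norm v = 1 ==> \<bar>v \<bullet> dirn x y\<bar> \<le> 1"
 using Cauchy_Schwarz_ineq2[of v "dirn x y"] norm_dirn_le[of x y] by simp

lemma integrable_P_bounded:
 fixes f :: "'a => real"
 assumes "f \<in> borel_measurable borel" "\<And>y. \<bar>f y\<bar> \<le> B"
 shows "integrable P f"
 by (rule integrable_const_bound[where B = B]) (use assms in \<open>auto simp: measurable_P\<close>)

lemma \<kappa>_clip_bounds:
 assumes \<eta>: "0 < \<eta>"
 shows "\<kappa> - \<eta> / nonpolar \<le> \<kappa>_clip \<eta>" "\<kappa>_clip \<eta> \<le> \<kappa>"
proof -
 let ?\<tau> = "\<lambda>y. e2 \<bullet> dirn e1 y"
 have t: "\<bar>?\<tau> y\<bar> \<le> 1" for y by (rule inner_dirn_le) (simp add: e12)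
 have ab: "\<bar>s\<bar> - \<eta> \<le> clip \<eta> s * s" "clip \<eta> s * s \<le> \<bar>s\<bar>" for s :: real
 proof -
  have "clip \<eta> s * s \<le> \<bar>clip \<eta> s\<bar> * \<bar>s\<bar>" by (simp add: abs_mult[symmetric])
  also have "\<dots> \<le> 1 * \<bar>s\<bar>" using clip_bound by (rule mult_right_mono) simp
  finally show "clip \<eta> s * s \<le> \<bar>s\<bar>" by simp
  consider "s \<ge> \<eta>" | "s \<le> - \<eta>" | "\<bar>s\<bar> < \<eta>" by linarith
  then show "\<bar>s\<bar> - \<eta> \<le> clip \<eta> s * s"
  proof cases
   case 1
   then have "clip \<eta> s = 1" using \<eta> by (simp add: clip_def min_def)
   then show ?thesis using 1 \<eta> by simp
  next
   case 2
   then have "s / \<eta> \<le> -1" using \<eta> by (simp add: divide_le_eq)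
   then have "clip \<eta> s = -1" by (simp add: clip_def)
   then show ?thesis using 2 \<eta> by simp
  next
   case 3
   then have "-1 \<le> s / \<eta>" "s / \<eta> \<le> 1" using \<eta> by (auto simp: le_divide_eq divide_le_eq)
   then have "clip \<eta> s = s / \<eta>" by (simp add: clip_def)
   then have "clip \<eta> s * s \<ge> 0" using \<eta> by simp
   then show ?thesis using 3 by linarith
  qed
 qed
 have i1: "integrable P (\<lambda>y. clip \<eta> (?\<tau> y) * ?\<tau> y)"
  by (rule integrable_P_bounded[where B = 1]) (measurable, metis ab(2) abs_mult clip_bound t mult_le_one abs_ge_zero)
 have i2: "integrable P (\<lambda>y. \<bar>?\<tau> y\<bar>)"
  by (rule integrable_P_bounded[where B = 1]) (use t in auto)
 have "(LINT y|P. \<bar>?\<tau> y\<bar> - \<eta>) \<le> (LINT y|P. clip \<eta> (?\<tau> y) * ?\<tau> y)"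
  by (rule integral_mono) (use i1 i2 ab in auto)
 then have 1: "nonpolar * \<kappa> - \<eta> \<le> (LINT y|P. clip \<eta> (?\<tau> y) * ?\<tau> y)"
  using i2 prob_space by (simp add: integral_dirn_abs)
 have 2: "(LINT y|P. clip \<eta> (?\<tau> y) * ?\<tau> y) \<le> nonpolar * \<kappa>"
  unfolding integral_dirn_abs[symmetric] by (rule integral_mono[OF i1 i2]) (rule ab)
 have "\<kappa> - \<eta> / nonpolar = (nonpolar * \<kappa> - \<eta>) / nonpolar" "\<kappa> = nonpolar * \<kappa> / nonpolar"
  using nonpolar_pos by (simp_all add: diff_divide_distrib)
 then show "\<kappa> - \<eta> / nonpolar \<le> \<kappa>_clip \<eta>" "\<kappa>_clip \<eta> \<le> \<kappa>"
  using divide_right_mono[OF 1, of nonpolar] divide_right_mono[OF 2, of nonpolar] nonpolar_pos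
  by (simp_all only: \<kappa>_clip_def less_imp_le)
qed

lemma integrable_P_sphere_bounded:
 fixes f :: "'a => real"
 assumes "f \<in> borel_measurable borel" "\<And>y. norm y = 1 ==> \<bar>f y\<bar> \<le> B"
 shows "integrable P f"
 by (rule integrable_const_bound[where B = B])
  (use AE_norm assms in \<open>auto elim!: eventually_mono simp: measurable_P\<close>)

lemma integrable_\<nu>_bounded:
 fixes f :: "'a \<times> 'a => real"
 assumes "f \<in> borel_measurable borel2" "\<And>z. z \<in> orthonormal_pairs ==> \<bar>f z\<bar> \<le> B"
 shows "integrable \<nu> f"
proof -
 show ?thesis
  by (rule N.integrable_const_bound[where B = B])
   (use AE_orthonormal assms in \<open>auto elim!: eventually_mono simp: measurable_cong_sets[OF sets_\<nu> refl]\<close>)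
qed

text \<open>The conditional expectation of the clipped component along a tangent vector is proportional to it,
 by the reflection that fixes the point and this vector and reverses the complement.\<close>

lemma integral_clip_dirn:
 assumes \<eta>: "0 < \<eta>" and x: "norm x = 1" and w: "w \<bullet> x = 0"
 shows "(LINT y|P. max (- norm w) (min (norm w) (w \<bullet> dirn x y / \<eta>)) * (v \<bullet> dirn x y)) = nonpolar * \<kappa>_clip \<eta> * (v \<bullet> w)"
proof (cases "w = 0")
 case False
 define a where "a = w /\<^sub>R norm w"
 have "norm a = 1" "x \<bullet> a = 0" using False w by (auto simp: a_def inner_commute)
 then have a: "norm a = 1" "x \<bullet> a = 0" "a \<bullet> a = 1" by (simp_all add: norm_eq_1)
 have wa: "w = norm w *\<^sub>R a" using False by (simp add: a_def)
 have c: "max (- norm w) (min (norm w) (w \<bullet> \<theta> / \<eta>)) = norm w * clip \<eta> (a \<bullet> \<theta>)" for \<theta>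
 proof -
  have wt: "w \<bullet> \<theta> = norm w * (a \<bullet> \<theta>)" by (subst wa) (simp add: a)
  show ?thesis unfolding clip_def wt max_mult_distrib_left min_mult_distrib_left by simp
 qed
 define I where "I v = (LINT y|P. clip \<eta> (a \<bullet> dirn x y) * (v \<bullet> dirn x y))" for v
 have int: "integrable P (\<lambda>y. clip \<eta> (a \<bullet> dirn x y) * (v \<bullet> dirn x y))" for v
 proof (rule integrable_P_bounded[where B = "norm v"])
  fix y
  have "\<bar>v \<bullet> dirn x y\<bar> \<le> norm v * 1"
   by (rule order_trans[OF Cauchy_Schwarz_ineq2]) (intro mult_left_mono norm_dirn_le norm_ge_zero)
  then show "\<bar>clip \<eta> (a \<bullet> dirn x y) * (v \<bullet> dirn x y)\<bar> \<le> norm v"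
   using mult_mono[OF clip_bound[of \<eta> "a \<bullet> dirn x y"], of "\<bar>v \<bullet> dirn x y\<bar>" "norm v"] by (simp add: abs_mult)
 qed measurable
 define h where "h z = (2 * (z \<bullet> x)) *\<^sub>R x + (2 * (z \<bullet> a)) *\<^sub>R a - z" for z
 have h: "orthogonal_transformation h"
  unfolding orthogonal_transformation_def
 proof (intro conjI allI)
  show "linear h" by (rule linearI) (simp_all add: h_def inner_add_left algebra_simps)
  have xa: "x \<bullet> x = 1" "a \<bullet> x = 0" using x a by (auto simp: norm_eq_1 inner_commute)
  show "h u \<bullet> h v = u \<bullet> v" for u v
   unfolding h_def inner_add_left inner_add_right inner_diff_left inner_diff_right inner_scaleR_left inner_scaleR_right
    xa a inner_commute[of x v] inner_commute[of a v]
   by (simp add: algebra_simps)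
 qed
 have hx: "h x = x" using x a by (simp add: h_def norm_eq_1 scaleR_2)
 have hd: "dirn x (h y) = h (dirn x y)" for y using dirn_orthogonal_transformation[OF h, of x y] hx by simp
 have Iv: "I v = (v \<bullet> a) * I a" for v
 proof -
  have "I v = (LINT y|P. clip \<eta> (a \<bullet> dirn x (h y)) * (v \<bullet> dirn x (h y)))"
   unfolding I_def by (rule integral_invariant[OF h, symmetric]) measurable
  also have "\<dots> = (LINT y|P. (2 * (v \<bullet> a)) * (clip \<eta> (a \<bullet> dirn x y) * (a \<bullet> dirn x y)) - clip \<eta> (a \<bullet> dirn x y) * (v \<bullet> dirn x y))"
  proof (rule Bochner_Integration.integral_cong[OF refl])
   fix y
   let ?\<theta> = "dirn x y"
   have "?\<theta> \<bullet> x = 0" using dirn_orth[OF x, of y] by (simp add: inner_commute)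
   then have hA: "a \<bullet> h ?\<theta> = a \<bullet> ?\<theta>" and hV: "v \<bullet> h ?\<theta> = 2 * (v \<bullet> a) * (a \<bullet> ?\<theta>) - v \<bullet> ?\<theta>"
    using a by (simp_all add: h_def inner_add_right inner_diff_right inner_commute)
   show "clip \<eta> (a \<bullet> dirn x (h y)) * (v \<bullet> dirn x (h y))
    = (2 * (v \<bullet> a)) * (clip \<eta> (a \<bullet> ?\<theta>) * (a \<bullet> ?\<theta>)) - clip \<eta> (a \<bullet> ?\<theta>) * (v \<bullet> ?\<theta>)"
    unfolding hd hA hV by (simp add: algebra_simps)
  qed
  also have "\<dots> = 2 * (v \<bullet> a) * I a - I v"
   unfolding I_def by (subst Bochner_Integration.integral_diff[OF integrable_mult_right[OF int] int]) simp
  finally show ?thesis by simp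
 qed
 have "I a = nonpolar * \<kappa>_clip \<eta>"
  unfolding I_def \<kappa>_clip_def using integral_dirn_inner[of "\<lambda>s. clip \<eta> s * s", OF _ x a(1,2)] nonpolar_pos by simp
 then have "norm w * I v = nonpolar * \<kappa>_clip \<eta> * (v \<bullet> w)"
  by (subst Iv, subst (2) wa) simp
 then show ?thesis unfolding c I_def by (simp add: mult.assoc)
qed simp

text \<open>The divergence integral is the time derivative at 0 of the integral of the flowed
  weight, and the difference quotient at time -r is at most the sup of the weight times the chord
  variation over r.\<close>

lemma chord_var_lower_polynomial:
 assumes \<zeta>: "real_polynomial_function \<zeta>" and X: "represents X \<zeta>" and A [measurable]: "A \<in> sets borel"
  and c: "\<And>z. z \<in> orthonormal_pairs ==> \<bar>\<zeta> z\<bar> \<le> c" and e: "0 < e"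
 shows "eventually (\<lambda>r. (LINT x|P. indicator A x * sphere_div X x) - e \<le> c * (chord_var A r / r)) (at_right 0)"
proof -
 define I where "I = (LINT x|P. indicator A x * sphere_div X x)"
 define G where "G t = (LINT z|\<nu>. indicator A (fst z) * \<zeta> (rot t z))" for t
 have "(G has_real_derivative (LINT z|\<nu>. indicator A (fst z) * dird \<zeta> (rot 0 z) (geo (rot 0 z)))) (at 0)"
  unfolding G_def by (rule DERIV_\<nu>_rot[OF \<zeta> A])
 moreover have "rot 0 z = z" for z by (simp add: rot_def)
 ultimately have "(G has_real_derivative I) (at 0)"
  unfolding I_def represents_div[OF X \<zeta> A, symmetric] by simp
 then have "((\<lambda>h. (G h - G 0) / (h - 0)) \<longlongrightarrow> I) (at 0)" by (simp add: has_field_derivative_iff)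
 then have "eventually (\<lambda>h. dist ((G h - G 0) / (h - 0)) I < e) (at 0)" using e by (rule tendstoD)
 then obtain d where d: "d > 0" "\<And>h. h \<noteq> 0 ==> \<bar>h\<bar> < d ==> \<bar>(G h - G 0) / h - I\<bar> < e"
  unfolding eventually_at by (auto simp: dist_real_def)
 have [measurable]: "rot t \<in> measurable borel2 borel2" for t
  unfolding rot_def by measurable
 have main: "I - e \<le> c * (chord_var A r / r)" if r: "0 < r" "r < d" for r
 proof -
  have D1: "\<bar>indicator A (fst (rot r z)) - indicator A (fst z) :: real\<bar> \<le> 1" for z by (auto simp: indicator_def)
  have "I - e \<le> (G (- r) - G 0) / (- r)" using d(2)[of "- r"] r by linarith
  also have "\<dots> = (- (G (- r) - G 0)) / r" by (simp add: diff_divide_distrib)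
  also have "\<dots> \<le> \<bar>G (- r) - G 0\<bar> / r" by (rule divide_right_mono) (use r in auto)
  also have "\<dots> \<le> (c * chord_var A r) / r"
  proof (rule divide_right_mono)
   have "G (- r) - G 0 = (LINT z|\<nu>. \<zeta> z * (indicator A (fst (rot r z)) - indicator A (fst z)))"
    unfolding G_def by (rule integral_chord_polynomial[OF \<zeta> A, symmetric])
   also have "\<bar>\<dots>\<bar> \<le> (LINT z|\<nu>. \<bar>\<zeta> z * (indicator A (fst (rot r z)) - indicator A (fst z))\<bar>)"
    by (rule integral_abs_bound)
   also have "\<dots> \<le> (LINT z|\<nu>. c * \<bar>indicator A (fst (rot r z)) - indicator A (fst z)\<bar>)"
   proof (rule integral_mono_AE')
    show "integrable \<nu> (\<lambda>z. c * \<bar>indicator A (fst (rot r z)) - indicator A (fst z)\<bar>)"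
     by (intro integrable_mult_right N.integrable_const_bound[where B = 1]) (use D1 in auto)
    show "AE z in \<nu>. \<bar>\<zeta> z * (indicator A (fst (rot r z)) - indicator A (fst z))\<bar>
      \<le> c * \<bar>indicator A (fst (rot r z)) - indicator A (fst z)\<bar>"
     using AE_orthonormal
     by eventually_elim (simp only: abs_mult, intro mult_right_mono c abs_ge_zero)
    show "AE z in \<nu>. 0 \<le> c * \<bar>indicator A (fst (rot r z)) - indicator A (fst z) :: real\<bar>"
     using AE_orthonormal
    proof eventually_elim
     case (elim z)
     then have "0 \<le> c" using c[OF elim] by linarith
     then show ?case by simp
    qed
   qed
   finally show "\<bar>G (- r) - G 0\<bar> \<le> c * chord_var A r" by (simp add: chord_var_def)
  qed (use r in simp)
  finally show ?thesis by simp
 qed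
 show ?thesis
  unfolding I_def[symmetric] eventually_at_right_field
  using d(1) main by (intro exI[of _ d]) auto
qed

text \<open>The ideal weight is the sign of X \<bullet> v, v the direction, whose field is \<kappa>
  X where |X| = 1. It is clipped to be continuous and then replaced by a polynomial weight, whose
  field \<open>Z\<close> is uniformly close to \<open>\<kappa>_clip \<delta>\<close> times X.
  Sup-norm closeness is enough: \<open>var_bound\<close> turns it into closeness of the divergence
  integrals.\<close>

theorem chord_var_lower:
 assumes V: "var_bound A V" and A [measurable]: "A \<in> sets borel"
  and X: "smooth_vector_field X" "\<And>x. norm x = 1 ==> norm (X x) \<le> 1" and e: "0 < e"
 shows "eventually (\<lambda>r. \<kappa> * (LINT x|P. indicator A x * sphere_div X x) - e \<le> chord_var A r / r) (at_right 0)"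
proof -
 define I where "I = (LINT x|P. indicator A x * sphere_div X x)"
 \<comment> \<open>Collects the coefficients of \<open>\<delta>\<close> in the final estimate: the
   loss by clipping, the two uses of the variation bound, and the error of the difference
   quotient.\<close>
 define M where "M = \<bar>I\<bar> / nonpolar + 2 * \<kappa> * V + 1"
 have V0: "0 \<le> V" using V by (simp add: var_bound_def)
 have M: "0 < M" unfolding M_def using V0 \<kappa>_nonneg nonpolar_pos by (intro add_nonneg_pos add_nonneg_nonneg) auto
 define \<delta> where "\<delta> = e / M"
 have \<delta>: "0 < \<delta>" "\<delta> * M = e" using e M by (auto simp: \<delta>_def)
 have Xc: "continuous_on (sphere 0 1) X"
  using X(1) by (intro smooth_sphere_continuous) (simp add: smooth_vector_field_def)
 have Xt: "X x \<bullet> x = 0" if "norm x = 1" for x using X(1) that by (simp add: smooth_vector_field_def)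
 \<comment> \<open>Only the values on the sphere are constrained; the cut-off makes the field Borel
   on the ambient space.\<close>
 define X' where "X' x = indicator (sphere 0 1) x *\<^sub>R X x" for x
 have X'm [measurable]: "X' \<in> borel_measurable borel"
  unfolding X'_def by (rule borel_measurable_continuous_on_indicator[OF _ Xc]) simp
 have X'e: "norm x = 1 ==> X' x = X x" for x by (simp add: X'_def)
 have X'b: "norm (X' x) \<le> 1" for x using X(2)[of x] by (simp add: X'_def indicator_def)
 \<comment> \<open>Equals |Y| times the clipped component along Y / |Y|. In this form it stays
   continuous at the zeros of Y, where Y / |Y| has no limit.\<close>
 define \<zeta>0 where "\<zeta>0 Y z = max (- norm (Y (fst z))) (min (norm (Y (fst z))) (Y (fst z) \<bullet> snd z / \<delta>))"
  for Y :: "'a => 'a" and z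
 have \<zeta>0c: "continuous_on (sphere 0 1 \<times> sphere 0 1) (\<zeta>0 X)"
 proof -
  have "continuous_on (sphere 0 1 \<times> sphere 0 1) (\<lambda>z::'a\<times>'a. X (fst z))"
   by (rule continuous_on_compose2[OF Xc]) (auto intro!: continuous_intros)
  then show ?thesis unfolding \<zeta>0_def using \<delta>(1) by (intro continuous_intros) auto
 qed
 obtain \<zeta> where \<zeta>: "real_polynomial_function \<zeta>"
  and \<zeta>a: "\<And>z. z \<in> sphere 0 1 \<times> sphere 0 1 ==> \<bar>\<zeta>0 X z - \<zeta> z\<bar> < \<delta>"
  using Stone_Weierstrass_real_polynomial_function[OF compact_Times[OF compact_sphere compact_sphere] \<zeta>0c \<delta>(1)]
  by blast
 have "\<bar>max (- m) (min m s)\<bar> \<le> m" if "0 \<le> m" for m s :: real using that by (auto simp: abs_le_iff)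
 then have \<zeta>0b: "\<bar>\<zeta>0 Y z\<bar> \<le> norm (Y (fst z))" for Y z unfolding \<zeta>0_def by simp
 have \<zeta>b: "\<bar>\<zeta> z\<bar> \<le> 1 + \<delta>" if "z \<in> orthonormal_pairs" for z
 proof -
  have z: "norm (fst z) = 1" "norm (snd z) = 1" using that by (auto simp: orthonormal_pairs_def)
  then have "z \<in> sphere 0 1 \<times> sphere 0 1" by (cases z) auto
  from \<zeta>a[OF this] show ?thesis using \<zeta>0b[of X z] X(2)[OF z(1)] by linarith
 qed
 obtain Z where Z: "represents Z \<zeta>" using represents_exists[OF \<zeta>] by blast
 have \<zeta>0X: "(LINT z|\<nu>. \<zeta>0 X' z * (Y (fst z) \<bullet> snd z)) = \<kappa>_clip \<delta> * (LINT x|P. Y x \<bullet> X' x)"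
  and iY: "integrable \<nu> (\<lambda>z. \<zeta>0 X' z * (Y (fst z) \<bullet> snd z))"
  if Y [measurable]: "Y \<in> borel_measurable borel" and B: "\<And>x. norm x = 1 ==> norm (Y x) \<le> B" for Y B
 proof -
  have m: "(\<lambda>z. \<zeta>0 X' z * (Y (fst z) \<bullet> snd z)) \<in> borel_measurable borel2"
   unfolding \<zeta>0_def by measurable
  have b: "\<bar>\<zeta>0 X' (x, y) * (Y x \<bullet> y)\<bar> \<le> B" if xy: "norm x = 1" "norm y \<le> 1" for x y
  proof -
   have "\<bar>\<zeta>0 X' (x, y)\<bar> \<le> 1" using \<zeta>0b[of X' "(x, y)"] X'b[of x] by simp
   moreover have "\<bar>Y x \<bullet> y\<bar> \<le> B"
    using Cauchy_Schwarz_ineq2[of "Y x" y] B[OF xy(1)] xy(2) order_trans[OF norm_ge_zero B[OF xy(1)]]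
     mult_mono[of "norm (Y x)" B "norm y" 1] by simp
   ultimately show ?thesis using mult_mono[of "\<bar>\<zeta>0 X' (x, y)\<bar>" 1 "\<bar>Y x \<bullet> y\<bar>" B] by (simp add: abs_mult)
  qed
  show "integrable \<nu> (\<lambda>z. \<zeta>0 X' z * (Y (fst z) \<bullet> snd z))"
  proof (rule N.integrable_const_bound[where B = B])
   show "AE z in \<nu>. norm (\<zeta>0 X' z * (Y (fst z) \<bullet> snd z)) \<le> B"
    using AE_\<nu>
   proof eventually_elim
    case (elim z)
    then show ?case using b[of "fst z" "snd z"] by simp
   qed
  qed (use m in measurable)
  have "nonpolar * (LINT z|\<nu>. \<zeta>0 X' z * (Y (fst z) \<bullet> snd z))
   = (LINT x|P. (LINT y|P. \<zeta>0 X' (x, dirn x y) * (Y x \<bullet> dirn x y)))"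
   using integral_dirn[OF m, of B] b by simp
  also have "\<dots> = (LINT x|P. nonpolar * \<kappa>_clip \<delta> * (Y x \<bullet> X' x))"
  proof (rule integral_cong_AE)
   show "AE x in P. (LINT y|P. \<zeta>0 X' (x, dirn x y) * (Y x \<bullet> dirn x y)) = nonpolar * \<kappa>_clip \<delta> * (Y x \<bullet> X' x)"
    using AE_norm
   proof eventually_elim
    case (elim x)
    then show ?case using integral_clip_dirn[OF \<delta>(1) elim, of "X' x" "Y x"] Xt[OF elim]
     by (simp add: \<zeta>0_def X'e)
   qed
   have "(\<lambda>(x, y). \<zeta>0 X' (x, dirn x y) * (Y x \<bullet> dirn x y)) \<in> borel_measurable borel2"
    unfolding \<zeta>0_def by measurable
   then show "(\<lambda>x. (LINT y|P. \<zeta>0 X' (x, dirn x y) * (Y x \<bullet> dirn x y))) \<in> borel_measurable P"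
    by measurable
  qed measurable
  also have "\<dots> = nonpolar * (\<kappa>_clip \<delta> * (LINT x|P. Y x \<bullet> X' x))" by simp
  finally show "(LINT z|\<nu>. \<zeta>0 X' z * (Y (fst z) \<bullet> snd z)) = \<kappa>_clip \<delta> * (LINT x|P. Y x \<bullet> X' x)"
   using nonpolar_pos by simp
 qed
 note PZ = representsD(1)[OF Z]
 have Zm [measurable]: "Z \<in> borel_measurable borel"
  by (rule borel_measurable_continuous_onI[OF continuous_on_polynomial_field[OF PZ]])
 obtain BZ where BZ: "\<And>x. norm x = 1 ==> norm (Z x) \<le> BZ"
 proof -
  have "compact (Z ` sphere 0 1)"
   by (intro compact_continuous_image continuous_on_polynomial_field PZ compact_sphere)
  then obtain B where "\<forall>v\<in>Z ` sphere 0 1. norm v \<le> B" using compact_imp_bounded bounded_iff by blast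
  then show thesis using that[of B] by simp
 qed
 have close: "norm (Z x - \<kappa>_clip \<delta> *\<^sub>R X' x) \<le> \<delta> * \<kappa>" if x: "norm x = 1" for x
 proof (rule pointwise_bound[OF _ _ _ x])
  have "continuous_on (sphere 0 1) X'"
   by (rule continuous_on_eq[OF Xc]) (simp add: X'e)
  then show "continuous_on (sphere 0 1) (\<lambda>x. Z x - \<kappa>_clip \<delta> *\<^sub>R X' x)"
   by (intro continuous_on_diff continuous_on_scaleR continuous_on_const continuous_on_polynomial_field[OF PZ])
  show "0 \<le> \<delta> * \<kappa>" using \<delta> \<kappa>_nonneg by simp
  fix Y :: "'a => 'a" and B
  assume Y [measurable]: "Y \<in> borel_measurable borel" and B: "\<And>x. norm x = 1 ==> norm (Y x) \<le> B"
  have i1: "integrable P (\<lambda>x. Y x \<bullet> Z x)"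
  proof (rule integrable_P_sphere_bounded[where B = "B * BZ"])
   fix x :: 'a assume x: "norm x = 1"
   show "\<bar>Y x \<bullet> Z x\<bar> \<le> B * BZ"
    by (rule order_trans[OF Cauchy_Schwarz_ineq2])
     (intro mult_mono B[OF x] BZ[OF x] norm_ge_zero order_trans[OF norm_ge_zero B[OF x]])
  qed measurable
  have i2: "integrable P (\<lambda>x. Y x \<bullet> X' x)"
  proof (rule integrable_P_sphere_bounded[where B = "B * 1"])
   fix x :: 'a assume x: "norm x = 1"
   show "\<bar>Y x \<bullet> X' x\<bar> \<le> B * 1"
    by (rule order_trans[OF Cauchy_Schwarz_ineq2])
     (intro mult_mono B[OF x] X'b norm_ge_zero order_trans[OF norm_ge_zero B[OF x]])
  qed measurable
  have [measurable]: "\<zeta> \<in> borel_measurable borel2"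
   using borel_measurable_real_polynomial[OF \<zeta>] by (simp add: borel_prod)
  have i3: "integrable \<nu> (\<lambda>z. \<zeta> z * (Y (fst z) \<bullet> snd z))"
  proof (rule integrable_\<nu>_bounded[where B = "(1 + \<delta>) * B"])
   fix z assume z: "z \<in> orthonormal_pairs"
   then have "\<bar>Y (fst z) \<bullet> snd z\<bar> \<le> B"
    using Cauchy_Schwarz_ineq2[of "Y (fst z)" "snd z"] B[of "fst z"] by (simp add: orthonormal_pairs_def)
   then show "\<bar>\<zeta> z * (Y (fst z) \<bullet> snd z)\<bar> \<le> (1 + \<delta>) * B"
    unfolding abs_mult using \<zeta>b[OF z] \<delta>(1) by (intro mult_mono) auto
  qed measurable
  have "(LINT x|P. Y x \<bullet> (Z x - \<kappa>_clip \<delta> *\<^sub>R X' x)) = (LINT x|P. Y x \<bullet> Z x) - \<kappa>_clip \<delta> * (LINT x|P. Y x \<bullet> X' x)"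
   using i1 i2 by (simp add: inner_diff_right)
  also have "\<dots> = (LINT z|\<nu>. (\<zeta> z - \<zeta>0 X' z) * (Y (fst z) \<bullet> snd z))"
   using representsD(3)[OF Z Y B] \<zeta>0X[OF Y B] i3 iY[OF Y B] by (simp add: left_diff_distrib)
  also have "\<dots> \<le> (\<delta> * \<kappa>) * (LINT x|P. norm (Y x))"
  proof (rule integral_\<nu>_bound[OF _ _ Y B])
   show "AE z in \<nu>. \<bar>\<zeta> z - \<zeta>0 X' z\<bar> \<le> \<delta>"
    using AE_orthonormal
   proof eventually_elim
    case (elim z)
    then have z: "norm (fst z) = 1" "norm (snd z) = 1" by (auto simp: orthonormal_pairs_def)
    then have "z \<in> sphere 0 1 \<times> sphere 0 1" by (cases z) auto
    from \<zeta>a[OF this] show ?case by (simp add: \<zeta>0_def X'e[OF z(1)] abs_minus_commute)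
   qed
  qed (use \<delta> in auto)
  finally show "(LINT x|P. Y x \<bullet> (Z x - \<kappa>_clip \<delta> *\<^sub>R X' x)) \<le> \<delta> * \<kappa> * (LINT x|P. norm (Y x))" .
 qed
 define J where "J = (LINT x|P. indicator A x * sphere_div Z x)"
 have "\<bar>(LINT x|P. indicator A x * sphere_div (\<lambda>x. 1 *\<^sub>R Z x + (- \<kappa>_clip \<delta>) *\<^sub>R X x) x)\<bar> \<le> (\<delta> * \<kappa>) * V"
  using close X'e \<delta> \<kappa>_nonneg
  by (intro var_bound_scaled[OF V A] smooth_vector_field_combine(1) represents_smooth[OF Z] X(1)) auto
 then have J: "J \<ge> \<kappa>_clip \<delta> * I - \<delta> * \<kappa> * V"
  unfolding integral_div_combine[OF represents_smooth[OF Z] X(1) A] by (simp add: J_def I_def)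
 have kI: "\<kappa>_clip \<delta> * I \<ge> \<kappa> * I - \<delta> * (\<bar>I\<bar> / nonpolar)"
 proof -
  have "\<bar>\<kappa> - \<kappa>_clip \<delta>\<bar> \<le> \<delta> / nonpolar" using \<kappa>_clip_bounds[OF \<delta>(1)] by linarith
  then have "\<bar>\<kappa> - \<kappa>_clip \<delta>\<bar> * \<bar>I\<bar> \<le> \<delta> / nonpolar * \<bar>I\<bar>" by (rule mult_right_mono) simp
  then have "(\<kappa> - \<kappa>_clip \<delta>) * I \<le> \<delta> / nonpolar * \<bar>I\<bar>"
   using abs_ge_self[of "(\<kappa> - \<kappa>_clip \<delta>) * I"] by (simp add: abs_mult)
  then show ?thesis by (simp add: left_diff_distrib)
 qed
 have "eventually (\<lambda>r. J - \<delta> \<le> (1 + \<delta>) * (chord_var A r / r)) (at_right 0)"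
  unfolding J_def by (rule chord_var_lower_polynomial[OF \<zeta> Z A \<zeta>b \<delta>(1)])
 moreover have "eventually (\<lambda>r::real. 0 < r) (at_right 0)" by (rule eventually_at_right_less)
 ultimately show ?thesis
  unfolding I_def[symmetric]
 proof eventually_elim
  case (elim r)
  have "chord_var A r / r \<le> \<kappa> * V"
   using chord_var_upper[OF V A, of r] elim by (simp add: divide_le_eq)
  then have "\<delta> * (chord_var A r / r) \<le> \<delta> * (\<kappa> * V)" using \<delta>(1) by (intro mult_left_mono) auto
  then have "chord_var A r / r \<ge> \<kappa> * I - \<delta> * (\<bar>I\<bar> / nonpolar) - \<delta> * \<kappa> * V - \<delta> - \<delta> * (\<kappa> * V)"
   using elim(1) J kI unfolding distrib_right mult_1_left mult.assoc by linarith
  also have "\<kappa> * I - \<delta> * (\<bar>I\<bar> / nonpolar) - \<delta> * \<kappa> * V - \<delta> - \<delta> * (\<kappa> * V) = \<kappa> * I - \<delta> * M"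
   by (simp add: M_def algebra_simps)
  finally show ?case by (simp add: \<delta>(2))
 qed
qed

end

subsection \<open>Rotation invariance of the volume\<close>

text \<open>The conformal factor of the stereographic chart.\<close>

definition conf :: "real^'n => real" where
 "conf u = 2 / (1 + u \<bullet> u)"

lemma conf_pos: "0 < conf u"
 by (simp add: conf_def add_pos_nonneg)

lemma conf_measurable [measurable]: "conf \<in> borel_measurable borel"
 unfolding conf_def[abs_def] by measurable

definition stereo_deriv :: "real^'n => real^'n => (real^'n) \<times> real" where
 "stereo_deriv u k = (conf u *\<^sub>R k - ((conf u)\<^sup>2 * (u \<bullet> k)) *\<^sub>R u, (conf u)\<^sup>2 * (u \<bullet> k))"

lemma has_derivative_stereo: "(stereo has_derivative stereo_deriv u) (at u)"
proof -
 have c: "1 + u \<bullet> u \<noteq> 0" using conf_pos[of u] by (auto simp: conf_def)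
 have "(stereo has_derivative
   (\<lambda>h. ((2 / (1 + u \<bullet> u)) *\<^sub>R h + (- (2 * (u \<bullet> h + h \<bullet> u)) / (1 + u \<bullet> u)\<^sup>2) *\<^sub>R u,
      ((u \<bullet> h + h \<bullet> u) * (1 + u \<bullet> u) - (u \<bullet> u - 1) * (u \<bullet> h + h \<bullet> u)) / (1 + u \<bullet> u)\<^sup>2))) (at u)"
  unfolding stereo_def[abs_def]
  by (rule has_derivative_eq_rhs)
   (use c in \<open>auto intro!: derivative_eq_intros simp: fun_eq_iff power2_eq_square field_simps\<close>)
 also have "(\<lambda>h. ((2 / (1 + u \<bullet> u)) *\<^sub>R h + (- (2 * (u \<bullet> h + h \<bullet> u)) / (1 + u \<bullet> u)\<^sup>2) *\<^sub>R u,
      ((u \<bullet> h + h \<bullet> u) * (1 + u \<bullet> u) - (u \<bullet> u - 1) * (u \<bullet> h + h \<bullet> u)) / (1 + u \<bullet> u)\<^sup>2)) = stereo_deriv u"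
  by (simp add: stereo_deriv_def conf_def fun_eq_iff inner_commute power_divide algebra_simps)
 finally show ?thesis .
qed

lemma stereo_deriv_inner: "stereo_deriv u h \<bullet> stereo_deriv u k = (conf u)\<^sup>2 * (h \<bullet> k)"
proof -
 define c where "c = conf u"
 have ne: "1 + u \<bullet> u \<noteq> 0" using conf_pos[of u] by (auto simp: conf_def)
 have uu: "c * (1 + u \<bullet> u) = 2"
  by (simp only: c_def conf_def times_divide_eq_left nonzero_mult_div_cancel_right[OF ne])
 have "stereo_deriv u h \<bullet> stereo_deriv u k = c\<^sup>2 * (h \<bullet> k) + c ^ 3 * (u \<bullet> h) * (u \<bullet> k) * (c * (1 + u \<bullet> u) - 2)"
  unfolding stereo_deriv_def c_def[symmetric] inner_prod_def fst_conv snd_conv inner_diff_left inner_diff_right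
   inner_scaleR_left inner_scaleR_right inner_real_def inner_commute[of h u] power2_eq_square power3_eq_cube
  by algebra
 from this[unfolded uu] show ?thesis by (simp add: c_def)
qed

lemma sqrt_det_gram: "sqrt (det (gram stereo (u :: real^'n))) = conf u ^ CARD('n)"
proof -
 have "det (gram stereo u) = ((conf u)\<^sup>2) ^ CARD('n)"
  unfolding gram_stereo by (subst det_diagonal) (auto simp: mat_def conf_def)
 also have "\<dots> = (conf u ^ CARD('n))\<^sup>2" by (simp add: power_mult[symmetric] mult.commute)
 finally show ?thesis using conf_pos[of u] by simp
qed

definition stereo_inv :: "(real^'n) \<times> real => real^'n" where
 "stereo_inv p = (1 / (1 - snd p)) *\<^sub>R fst p"

lemma stereo_inv_stereo: "stereo_inv (stereo u) = u"
proof -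
 have c: "1 + u \<bullet> u \<noteq> 0" using conf_pos[of u] by (auto simp: conf_def)
 then have "1 - (u \<bullet> u - 1) / (1 + u \<bullet> u) = 2 / (1 + u \<bullet> u)" by (simp add: field_simps)
 moreover have "1 / (2 / a) * (2 / a) = 1" if "a \<noteq> 0" for a :: real using that by simp
 note this[OF c]
 ultimately show ?thesis by (simp only: stereo_inv_def stereo_def fst_conv snd_conv scaleR_scaleR scaleR_one)
qed

lemma inj_stereo: "inj stereo"
 by (rule inj_on_inverseI) (rule stereo_inv_stereo)

lemma stereo_stereo_inv:
 "norm p = 1 ==> p \<noteq> (0, 1) ==> stereo (stereo_inv p) = p"
proof -
 assume "norm p = 1" "p \<noteq> (0, 1)"
 then have "p \<in> range stereo" by (simp add: range_stereo)
 then show ?thesis by (auto simp: stereo_inv_stereo)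
qed

lemma norm_stereo: "norm (stereo u) = 1"
 using range_stereo by (metis DiffD1 dist_0_norm mem_sphere rangeI)

lemma stereo_measurable [measurable]: "stereo \<in> borel_measurable borel"
 by (intro borel_measurable_continuous_onI continuous_at_imp_continuous_on ballI
   has_derivative_continuous[OF has_derivative_stereo])

text \<open>The volume as a Borel measure on the ambient space, without completion, so that it can
  be pushed forward by rotations.\<close>

definition chart_vol :: "((real^'n) \<times> real) measure" where
 "chart_vol = distr (density lborel (\<lambda>u. ennreal (conf u ^ CARD('n)))) borel stereo"

lemma sets_chart_vol [simp, measurable_cong]: "sets chart_vol = sets borel"
 by (simp add: chart_vol_def)

lemma nn_integral_chart_vol:
 assumes [measurable]: "f \<in> borel_measurable borel"
 shows "(\<integral>\<^sup>+x. f x \<partial>chart_vol) = (\<integral>\<^sup>+u. ennreal (conf u ^ CARD('n)) * f (stereo u) \<partial>(lborel :: (real^'n) measure))"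
 unfolding chart_vol_def by (subst nn_integral_distr) (auto simp: nn_integral_density)

text \<open>Each of the n factors \<open>conf u\<close> is bounded by a function of one coordinate,
  since (u \<bullet> b)^2 is at most u \<bullet> u. Finiteness of the volume thus reduces to the
  integral of 2 / (1 + x^2) over the line.\<close>

lemma conf_le_prod: "conf u ^ CARD('n) \<le> (\<Prod>b\<in>Basis. 2 * inverse (1 + (u \<bullet> b)\<^sup>2))" for u :: "real^'n"
proof -
 have c: "conf u \<le> 2 * inverse (1 + (u \<bullet> b)\<^sup>2)" if "b \<in> Basis" for b
 proof -
  have "(u \<bullet> b)\<^sup>2 \<le> u \<bullet> u"
   using Cauchy_Schwarz_ineq[of u b] that by simp
  then show ?thesis by (auto simp: conf_def divide_inverse intro!: le_imp_inverse_le add_pos_nonneg)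
 qed
 have "conf u ^ CARD('n) = (\<Prod>b\<in>(Basis :: (real^'n) set). conf u)" by simp
 also have "\<dots> \<le> (\<Prod>b\<in>Basis. 2 * inverse (1 + (u \<bullet> b)\<^sup>2))"
  using c conf_pos[of u] by (intro prod_mono) (auto simp: less_imp_le)
 finally show ?thesis .
qed

lemma nn_integral_conf: "(\<integral>\<^sup>+u. ennreal (conf u ^ CARD('n)) \<partial>(lborel :: (real^'n) measure)) < \<infinity>"
proof -
 have "integrable lborel (\<lambda>x::real. inverse (1 + x\<^sup>2))"
  using integrable_inverse_1_plus_square by (simp add: set_integrable_def einterval_def)
 then have "integrable lborel (\<lambda>x::real. 2 * inverse (1 + x\<^sup>2))" by simp
 then have f: "(\<integral>\<^sup>+x. ennreal (2 * inverse (1 + (x::real)\<^sup>2)) \<partial>lborel) < top"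
  by (subst nn_integral_eq_integral) (auto simp: add_nonneg_nonneg)
 have "(\<integral>\<^sup>+u. ennreal (conf u ^ CARD('n)) \<partial>(lborel :: (real^'n) measure))
   \<le> (\<integral>\<^sup>+u. (\<Prod>b\<in>Basis. ennreal (2 * inverse (1 + (u \<bullet> b)\<^sup>2))) \<partial>(lborel :: (real^'n) measure))"
  by (intro nn_integral_mono) (subst prod_ennreal, auto intro!: ennreal_leI conf_le_prod add_nonneg_nonneg)
 also have "\<dots> = (\<Prod>b\<in>(Basis :: (real^'n) set). \<integral>\<^sup>+x. ennreal (2 * inverse (1 + x\<^sup>2)) \<partial>lborel)"
  by (rule nn_integral_lborel_prod) auto
 also have "\<dots> < \<infinity>"
 proof -
  obtain r where "0 \<le> r" "(\<integral>\<^sup>+x. ennreal (2 * inverse (1 + x\<^sup>2)) \<partial>lborel) = ennreal r"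
   using f less_top_ennreal by blast
  then show ?thesis by (simp only: prod_ennreal) simp
 qed
 finally show ?thesis .
qed

lemma finite_chart_vol: "finite_measure (chart_vol :: ((real^'n) \<times> real) measure)"
proof (rule finite_measureI)
 have "emeasure chart_vol (space (chart_vol :: ((real^'n) \<times> real) measure)) = (\<integral>\<^sup>+x. 1 \<partial>(chart_vol :: ((real^'n) \<times> real) measure))" by simp
 also have "\<dots> < \<infinity>" using nn_integral_conf by (subst nn_integral_chart_vol) auto
 finally show "emeasure chart_vol (space (chart_vol :: ((real^'n) \<times> real) measure)) \<noteq> \<infinity>" by simp
qed

lemma integrable_conf: "integrable lborel (\<lambda>u::real^'n. conf u ^ CARD('n))"
 using nn_integral_conf by (subst integrable_iff_bounded) (simp add: conf_pos less_imp_le)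

text \<open>The chart is conformal and \<open>h\<close> an isometry, so the derivative of the
  transition map is an orthogonal map times the ratio of conformal factors, and its determinant is
  up to sign a power of this ratio.\<close>

lemma transition_jacobian:
 fixes h :: "(real^'m) \<times> real => (real^'m) \<times> real"
 assumes h: "orthogonal_transformation h" and u: "h (stereo u) \<noteq> (0, 1)"
 obtains D where "((\<lambda>u. stereo_inv (h (stereo u))) has_derivative D) (at u)"
  "\<bar>det (matrix D)\<bar> * conf (stereo_inv (h (stereo u))) ^ CARD('m) = conf u ^ CARD('m)"
proof -
 define \<tau> where "\<tau> u = stereo_inv (h (stereo u))" for u
 note l = orthogonal_transformation_linear[OF h]
 have bl: "bounded_linear h" using l by (rule linear_conv_bounded_linear[THEN iffD1])
 have hs: "((\<lambda>u. h (stereo u)) has_derivative (\<lambda>k. h (stereo_deriv u k))) (at u)"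
  by (rule bounded_linear.has_derivative[OF bl has_derivative_stereo])
 have nh: "norm (h (stereo v)) = 1" for v
  by (simp only: orthogonal_transformation_norm[OF h] norm_stereo)
 \<comment> \<open>A unit vector with last coordinate 1 is the pole itself.\<close>
 have s1: "snd (h (stereo u)) \<noteq> 1"
 proof
  assume s: "snd (h (stereo u)) = 1"
  have "(norm (h (stereo u)))\<^sup>2 = (norm (fst (h (stereo u))))\<^sup>2 + 1"
   by (simp add: norm_prod_def s)
  then have "fst (h (stereo u)) = 0" using nh[of u] by simp
  then show False using s u by (simp add: prod_eq_iff)
 qed
 have "stereo_inv differentiable (at (h (stereo u)))"
 proof -
  have "(\<lambda>p. 1 / (1 - snd p)) differentiable (at (h (stereo u)))"
   using s1 unfolding differentiable_def by (auto intro!: derivative_eq_intros exI)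
  then show ?thesis unfolding stereo_inv_def[abs_def]
   by (intro differentiable_scaleR) (auto simp: differentiable_def intro!: derivative_eq_intros exI)
 qed
 then obtain D' where "(stereo_inv has_derivative D') (at (h (stereo u)))" by (auto simp: differentiable_def)
 from has_derivative_compose[OF hs this]
 obtain D where D: "(\<tau> has_derivative D) (at u)" unfolding \<tau>_def by blast
 have "((\<lambda>v. stereo (\<tau> v)) has_derivative (\<lambda>k. stereo_deriv (\<tau> u) (D k))) (at u)"
  by (rule has_derivative_compose[OF D has_derivative_stereo])
 moreover have "((\<lambda>v. stereo (\<tau> v)) has_derivative (\<lambda>k. h (stereo_deriv u k))) (at u)"
 proof (rule has_derivative_transform_within_open[OF hs])
  have c: "continuous_on UNIV (\<lambda>v. h (stereo v))"
   by (intro continuous_at_imp_continuous_on ballI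
    has_derivative_continuous[OF bounded_linear.has_derivative[OF bl has_derivative_stereo]])
  show "open {v. h (stereo v) \<noteq> (0, 1)}"
   using open_vimage[OF _ c, of "- {(0, 1)}"] by (simp add: vimage_def open_Compl)
  show "u \<in> {v. h (stereo v) \<noteq> (0, 1)}" using u by simp
  show "h (stereo v) = stereo (\<tau> v)" if "v \<in> {v. h (stereo v) \<noteq> (0, 1)}" for v
   using stereo_stereo_inv[OF nh] that by (simp add: \<tau>_def)
 qed
 ultimately have eq: "stereo_deriv (\<tau> u) (D k) = h (stereo_deriv u k)" for k
  using has_derivative_unique by metis
 have conf: "(conf (\<tau> u))\<^sup>2 * (D k \<bullet> D k') = (conf u)\<^sup>2 * (k \<bullet> k')" for k k'
 proof -
  have "h a \<bullet> h b = a \<bullet> b" for a b using h unfolding orthogonal_transformation_def by blast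
  then show ?thesis by (simp only: stereo_deriv_inner[symmetric] eq)
 qed
 define c where "c = conf u / conf (\<tau> u)"
 have c: "c > 0" unfolding c_def by (intro divide_pos_pos conf_pos)
 have DD: "D k \<bullet> D k' = c\<^sup>2 * (k \<bullet> k')" for k k'
  using conf[of k k'] conf_pos[of "\<tau> u"] by (simp add: c_def field_simps)
 have "orthogonal_transformation (\<lambda>k. (1/c) *\<^sub>R D k)"
  unfolding orthogonal_transformation_def
  using has_derivative_linear[OF D] c by (auto simp: DD power2_eq_square intro!: linear_compose_scale_right)
 then have "\<bar>det (matrix (\<lambda>k. (1/c) *\<^sub>R D k))\<bar> = 1"
  using orthogonal_transformation_matrix det_orthogonal_matrix by (metis abs_1 abs_minus_cancel)
 moreover have "matrix D = c *\<^sub>R matrix (\<lambda>k. (1/c) *\<^sub>R D k)"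
  using c by (simp add: matrix_def vec_eq_iff)
 moreover have "det (c *\<^sub>R A) = c ^ CARD('m) * det A" for A :: "real^'m^'m"
 proof -
  have "c *\<^sub>R A = (\<chi> i. c *s (A $ i))" by (simp add: vec_eq_iff)
  then show ?thesis by (simp add: det_rows_mul)
 qed
 ultimately have "\<bar>det (matrix D)\<bar> = c ^ CARD('m)"
  using c by (simp add: abs_mult)
 then show thesis
  using D conf_pos[of "\<tau> u"] unfolding \<tau>_def
  by (intro that[of D]) (auto simp: c_def \<tau>_def power_divide)
qed

text \<open>Change of variables under the transition map. \<open>S\<close> and \<open>S'\<close>
  each leave out at most one point, the one sent to the pole, so they have full Lebesgue
  measure.\<close>

lemma chart_vol_invariant_aux:
 fixes h :: "(real^'m::{finite,wellorder}) \<times> real => (real^'m::_) \<times> real"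
 assumes h: "orthogonal_transformation h"
 shows "distr chart_vol borel h = chart_vol"
proof (rule measure_eqI)
 fix A assume "A \<in> sets (distr chart_vol borel h)"
 then have A [measurable]: "A \<in> sets borel" by simp
 have hm [measurable]: "h \<in> borel_measurable borel"
  by (intro borel_measurable_continuous_onI linear_continuous_on linear_conv_bounded_linear[THEN iffD1]
   orthogonal_transformation_linear h)
 define k where "k = inv h"
 have k: "orthogonal_transformation k" unfolding k_def by (rule orthogonal_transformation_inv[OF h])
 have bij: "bij h" by (rule orthogonal_transformation_bij[OF h])
 have kh: "k (h x) = x" "h (k x) = x" for x
  using bij by (simp_all add: k_def bij_is_inj bij_is_surj surj_f_inv_f)
 have nh: "norm (h (stereo v)) = 1" "norm (k (stereo v)) = 1" for v :: "real^'m::_"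
  by (simp_all only: orthogonal_transformation_norm[OF h] orthogonal_transformation_norm[OF k] norm_stereo)
 define \<tau> where "\<tau> u = stereo_inv (h (stereo u))" for u
 define S where "S = {u. h (stereo u) \<noteq> (0, 1)}"
 define S' where "S' = {v. k (stereo v) \<noteq> (0, 1)}"
 have st: "stereo (\<tau> u) = h (stereo u)" if "u \<in> S" for u
  using stereo_stereo_inv[OF nh(1)] that by (simp add: \<tau>_def S_def)
 have img: "\<tau> ` S = S'"
 proof (intro equalityI subsetI)
  fix v assume "v \<in> \<tau> ` S"
  then obtain u where u: "u \<in> S" "v = \<tau> u" by blast
  have "k (stereo v) = stereo u" using st[OF u(1)] u(2) by (simp add: kh)
  moreover have "stereo u \<noteq> (0, 1)" using range_stereo by blast
  ultimately show "v \<in> S'" by (simp add: S'_def)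
 next
  fix v assume v: "v \<in> S'"
  define u where "u = stereo_inv (k (stereo v))"
  have su: "stereo u = k (stereo v)" using stereo_stereo_inv[OF nh(2)] v by (simp add: u_def S'_def)
  have "stereo v \<noteq> (0, 1)" using range_stereo by blast
  then have "u \<in> S" by (simp add: S_def su kh)
  moreover have "\<tau> u = v" by (simp add: \<tau>_def su kh stereo_inv_stereo)
  ultimately show "v \<in> \<tau> ` S" by blast
 qed
 have inj: "inj_on \<tau> S"
 proof (rule inj_onI)
  fix u v assume uv: "u \<in> S" "v \<in> S" "\<tau> u = \<tau> v"
  then have "k (h (stereo u)) = k (h (stereo v))" using st by metis
  then have "stereo u = stereo v" by (simp only: kh)
  then show "u = v" by (rule injD[OF inj_stereo])
 qed
 have null: "{u. h (stereo u) = (0, 1)} \<in> null_sets lborel" "{v. k (stereo v) = (0, 1)} \<in> null_sets lborel"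
 proof -
  have "finite {u. g (stereo u) = p}" if g: "orthogonal_transformation g"
   for g :: "(real^'m::_) \<times> real => (real^'m::_) \<times> real" and p
  proof (cases "\<exists>u. g (stereo u) = p")
   case True
   then obtain u where u: "g (stereo u) = p" by blast
   have "v = u" if "g (stereo v) = p" for v
   proof -
    have "g (stereo v) = g (stereo u)" using that u by simp
    then have "stereo v = stereo u" by (rule injD[OF orthogonal_transformation_inj[OF g]])
    then show ?thesis by (rule injD[OF inj_stereo])
   qed
   then have "{u. g (stereo u) = p} \<subseteq> {u}" by blast
   then show ?thesis by (rule finite_subset) simp
  qed simp
  then show "{u. h (stereo u) = (0, 1)} \<in> null_sets lborel" "{v. k (stereo v) = (0, 1)} \<in> null_sets lborel"
   using h k by (auto intro: finite_imp_null_set_lborel)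
 qed
 have km [measurable]: "k \<in> borel_measurable borel"
  by (intro borel_measurable_continuous_onI linear_continuous_on linear_conv_bounded_linear[THEN iffD1]
   orthogonal_transformation_linear k)
 have SS': "S \<in> sets borel" "S' \<in> sets borel" unfolding S_def S'_def by measurable
 have AES: "AE u in lebesgue. u \<in> S" "AE u in lebesgue. u \<in> S'"
  using AE_completion[OF AE_not_in[OF null(1)]] AE_completion[OF AE_not_in[OF null(2)]]
  by (simp_all add: S_def S'_def)
 define f where "f v = indicator A (stereo v) * conf v ^ CARD('m)" for v :: "real^'m::_"
 define G where "G u = indicator A (h (stereo u)) * conf u ^ CARD('m)" for u :: "real^'m::_"
 have [measurable]: "f \<in> borel_measurable borel" "G \<in> borel_measurable borel" unfolding f_def G_def by measurable
 have bnd: "0 \<le> f v" "0 \<le> G v" "f v \<le> conf v ^ CARD('m)" "G v \<le> conf v ^ CARD('m)" for v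
  using conf_pos[of v] by (auto simp: f_def G_def indicator_def less_imp_le)
 have nb: "norm (f v) \<le> norm (conf v ^ CARD('m))" "norm (G v) \<le> norm (conf v ^ CARD('m))" for v
  using bnd[of v] abs_ge_self[of "conf v ^ CARD('m)"] unfolding real_norm_def by linarith+
 have "integrable lborel f"
  by (rule Bochner_Integration.integrable_bound[OF integrable_conf _ AE_I2[OF nb(1)]]) measurable
 moreover have "integrable lborel G"
  by (rule Bochner_Integration.integrable_bound[OF integrable_conf _ AE_I2[OF nb(2)]]) measurable
 ultimately have int: "integrable lborel f" "integrable lborel G" .
 then have intL: "integrable lebesgue f" "integrable lebesgue G" by (simp_all add: integrable_completion)
 have absf: "f absolutely_integrable_on S'" and absG: "G absolutely_integrable_on S"
  unfolding set_integrable_def by (intro integrable_mult_indicator intL; use SS' in simp)+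
 have int_eq: "integral T F = integral\<^sup>L lborel F"
  if "F absolutely_integrable_on T" "AE u in lebesgue. u \<in> T" "F \<in> borel_measurable borel" "T \<in> sets borel"
  for F :: "real^'m::_ => real" and T
 proof -
  have "integral T F = (LINT x:T|lebesgue. F x)" by (rule set_lebesgue_integral_eq_integral(2)[OF that(1), symmetric])
  also have "\<dots> = integral\<^sup>L lebesgue F"
  proof -
   have "F \<in> borel_measurable lborel" "(\<lambda>x. indicator T x *\<^sub>R F x) \<in> borel_measurable lborel"
    using that(3,4) by measurable
   from this[THEN measurable_completion] show ?thesis
    unfolding set_lebesgue_integral_def using that(2) by (intro integral_cong_AE) (auto elim!: eventually_mono)
  qed
  also have "\<dots> = integral\<^sup>L lborel F" using that(3) by (intro integral_completion) simp
  finally show ?thesis .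
 qed
 \<comment> \<open>A choice of derivative at each point, as the change of variables theorem takes
   the derivative as a function.\<close>
 define \<tau>' where "\<tau>' u = (SOME D. (\<tau> has_derivative D) (at u) \<and>
   \<bar>det (matrix D)\<bar> * conf (\<tau> u) ^ CARD('m) = conf u ^ CARD('m))" for u
 have \<tau>': "(\<tau> has_derivative \<tau>' u) (at u)" "\<bar>det (matrix (\<tau>' u))\<bar> * conf (\<tau> u) ^ CARD('m) = conf u ^ CARD('m)"
  if "u \<in> S" for u
 proof -
  have "\<exists>D. (\<tau> has_derivative D) (at u) \<and> \<bar>det (matrix D)\<bar> * conf (\<tau> u) ^ CARD('m) = conf u ^ CARD('m)"
   using transition_jacobian[OF h, of u] that unfolding \<tau>_def S_def by blast
  from someI_ex[OF this] show "(\<tau> has_derivative \<tau>' u) (at u)"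
   "\<bar>det (matrix (\<tau>' u))\<bar> * conf (\<tau> u) ^ CARD('m) = conf u ^ CARD('m)"
   unfolding \<tau>'_def by blast+
 qed
 \<comment> \<open>The scalar integrand is wrapped in \<open>real^1\<close> to fit the vector-valued
   theorem.\<close>
 let ?V = "\<lambda>v. vec (f v) :: real^1"
 have vabs: "?V absolutely_integrable_on (\<tau> ` S)"
  using absf by (simp add: absolutely_integrable_on_1_iff img)
 have SL: "S \<in> sets lebesgue" using SS' by simp
 have cov: "(\<lambda>x. \<bar>det (matrix (\<tau>' x))\<bar> *\<^sub>R ?V (\<tau> x)) absolutely_integrable_on S \<and>
   integral S (\<lambda>x. \<bar>det (matrix (\<tau>' x))\<bar> *\<^sub>R ?V (\<tau> x)) = integral (\<tau> ` S) ?V"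
  using has_absolute_integral_change_of_variables[OF SL has_derivative_at_withinI[OF \<tau>'(1)] inj, of ?V "integral (\<tau> ` S) ?V"] vabs
  by blast
 have "integral S G = integral S (\<lambda>x. (\<bar>det (matrix (\<tau>' x))\<bar> *\<^sub>R ?V (\<tau> x)) $ 1)"
 proof (rule Henstock_Kurzweil_Integration.integral_cong)
  fix u assume u: "u \<in> S"
  show "G u = (\<bar>det (matrix (\<tau>' u))\<bar> *\<^sub>R ?V (\<tau> u)) $ 1"
   using \<tau>'(2)[OF u] st[OF u] by (simp add: G_def f_def mult.left_commute)
 qed
 also have "\<dots> = integral S' f"
  using conjunct2[OF cov] by (simp add: integral_on_1_eq img vec_eq_iff)
 finally have "integral\<^sup>L lborel G = integral\<^sup>L lborel f"
  using int_eq[OF absf AES(2)] int_eq[OF absG AES(1)] SS' by simp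
 then have *: "(\<integral>\<^sup>+u. ennreal (G u) \<partial>lborel) = (\<integral>\<^sup>+u. ennreal (f u) \<partial>lborel)"
  using bnd by (simp add: nn_integral_eq_integral int)
 have "emeasure (distr chart_vol borel h) A = (\<integral>\<^sup>+x. indicator A x \<partial>distr chart_vol borel h)" by simp
 also have "\<dots> = (\<integral>\<^sup>+x. indicator A (h x) \<partial>chart_vol)" by (rule nn_integral_distr) auto
 also have "\<dots> = (\<integral>\<^sup>+u. ennreal (conf u ^ CARD('m)) * indicator A (h (stereo u)) \<partial>(lborel :: (real^'m::_) measure))"
  by (rule nn_integral_chart_vol) measurable
 also have "\<dots> = (\<integral>\<^sup>+u. ennreal (G u) \<partial>lborel)"
  by (intro nn_integral_cong) (auto simp: G_def indicator_def)
 also have "\<dots> = (\<integral>\<^sup>+u. ennreal (conf u ^ CARD('m)) * indicator A (stereo u) \<partial>(lborel :: (real^'m::_) measure))"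
  unfolding * by (intro nn_integral_cong) (auto simp: f_def indicator_def)
 also have "\<dots> = (\<integral>\<^sup>+x. indicator A x \<partial>chart_vol)"
  by (rule nn_integral_chart_vol[symmetric]) measurable
 finally show "emeasure (distr chart_vol borel h) A = emeasure chart_vol A" by simp
qed simp

text \<open>The change of variables theorem of the library requires a well-ordered index type.\<close>

typedef 'a wo = "UNIV :: 'a set" morphisms of_wo to_wo ..

lemma bij_of_wo: "bij of_wo"
 by (rule bijI') (auto simp: of_wo_inject intro: to_wo_inverse[symmetric])

instance wo :: (finite) finite
proof
 have "finite (range (to_wo :: 'a => 'a wo))" by simp
 moreover have "range (to_wo :: 'a => 'a wo) = UNIV"
  by (metis surjI of_wo_inverse)
 ultimately show "finite (UNIV :: 'a wo set)" by simp
qed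

definition wo_index :: "'a::finite wo => nat" where
 "wo_index = (SOME f. inj f)"

lemma inj_wo_index: "inj (wo_index :: 'a::finite wo => nat)"
 unfolding wo_index_def
proof -
 obtain f :: "'a wo => nat" where "inj f"
  using finite_imp_inj_to_nat_seg[of "UNIV :: 'a wo set"] by auto
 then show "inj (SOME f :: 'a wo => nat. inj f)" by (rule someI[of inj])
qed

instantiation wo :: (finite) wellorder
begin

definition less_eq_wo :: "'a wo => 'a wo => bool" where "x \<le> y \<longleftrightarrow> wo_index x \<le> wo_index y"
definition less_wo :: "'a wo => 'a wo => bool" where "x < y \<longleftrightarrow> wo_index x < wo_index y"

instance
proof
 fix x y :: "'a wo"
 show "x = y" if "x \<le> y" "y \<le> x"
  using that inj_wo_index by (auto simp: less_eq_wo_def inj_def)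
next
 fix P :: "'a wo => bool" and a :: "'a wo"
 assume *: "\<And>x. (\<And>y. y < x ==> P y) ==> P x"
 show "P a"
  by (induction a rule: measure_induct_rule[of wo_index]) (rule *, simp add: less_wo_def)
qed (auto simp: less_eq_wo_def less_wo_def)

end

lemma card_wo: "CARD('a::finite wo) = CARD('a)"
 using bij_betw_same_card[OF bij_of_wo] by simp

definition wo_vec :: "real^'n => real^('n wo)" where
 "wo_vec u = (\<chi> i. u $ of_wo i)"

definition vec_wo :: "real^('n wo) => real^'n" where
 "vec_wo v = (\<chi> i. v $ to_wo i)"

lemma wo_vec_inverse: "vec_wo (wo_vec u) = u" "wo_vec (vec_wo v) = v"
 by (simp_all add: wo_vec_def vec_wo_def to_wo_inverse of_wo_inverse vec_eq_iff)

lemma linear_wo_vec: "linear wo_vec" "linear vec_wo"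
 by (auto intro!: linearI simp: wo_vec_def vec_wo_def vec_eq_iff)

lemma wo_vec_inner: "wo_vec u \<bullet> wo_vec v = u \<bullet> v"
 unfolding wo_vec_def inner_vec_def
 using sum.reindex_bij_betw[OF bij_of_wo, of "\<lambda>i. (u $ i) \<bullet> (v $ i)"] by simp

lemma wo_vec_measurable [measurable]: "wo_vec \<in> borel_measurable borel" "vec_wo \<in> borel_measurable borel"
 by (intro borel_measurable_continuous_onI linear_continuous_on linear_conv_bounded_linear[THEN iffD1] linear_wo_vec)+

lemma wo_vec_axis: "wo_vec (axis i x) = axis (to_wo i) x"
proof -
 have "of_wo j = i \<longleftrightarrow> j = to_wo i" for j
  using of_wo_inverse[of j] to_wo_inverse[of i] by auto
 then show ?thesis by (simp add: wo_vec_def axis_def vec_eq_iff)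
qed

lemma bij_wo_vec_Basis: "bij_betw wo_vec Basis (Basis :: (real^('n::finite wo)) set)"
proof (rule bij_betw_imageI)
 show "inj_on wo_vec (Basis :: (real^'n) set)" by (rule inj_on_inverseI) (rule wo_vec_inverse(1))
 have "axis j (1::real) \<in> wo_vec ` Basis" for j :: "'n wo"
 proof (rule image_eqI)
  show "axis j (1::real) = wo_vec (axis (of_wo j) 1)" by (simp add: wo_vec_axis of_wo_inverse)
 qed (auto simp: Basis_vec_def)
 then show "wo_vec ` (Basis :: (real^'n) set) = Basis"
  by (auto simp: Basis_vec_def wo_vec_axis)
qed

lemma distr_wo_vec: "distr lborel borel wo_vec = (lborel :: (real^('n::finite wo)) measure)"
proof (rule lborel_eqI[symmetric])
 fix l u :: "real^('n wo)" assume lu: "\<And>b. b \<in> Basis ==> l \<bullet> b \<le> u \<bullet> b"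
 have ip: "vec_wo w \<bullet> b = w \<bullet> wo_vec b" for w :: "real^('n wo)" and b
  using wo_vec_inner[of "vec_wo w" b] by (simp add: wo_vec_inverse)
 have bB: "b \<in> Basis ==> wo_vec b \<in> Basis" for b :: "real^'n"
  using bij_wo_vec_Basis by (auto simp: bij_betw_def)
 have "emeasure (distr lborel borel wo_vec) (box l u) = emeasure lborel (wo_vec -` box l u)"
  by (simp add: emeasure_distr)
 also have "wo_vec -` box l u = box (vec_wo l) (vec_wo u)"
 proof -
  have B: "(Basis :: (real^('n wo)) set) = wo_vec ` Basis"
   by (rule bij_betw_imp_surj_on[OF bij_wo_vec_Basis, symmetric])
  show ?thesis unfolding box_def B by (auto simp: wo_vec_inner ip)
 qed
 also have "emeasure lborel (box (vec_wo l) (vec_wo u)) = (\<Prod>b\<in>Basis. (vec_wo u - vec_wo l) \<bullet> b)"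
  by (rule emeasure_lborel_box) (simp add: ip lu bB)
 also have "(\<Prod>b\<in>Basis. (vec_wo u - vec_wo l) \<bullet> b) = (\<Prod>b\<in>Basis. (u - l) \<bullet> wo_vec b)"
  by (simp add: inner_diff_left ip)
 also have "\<dots> = (\<Prod>b\<in>Basis. (u - l) \<bullet> b)"
  by (rule prod.reindex_bij_betw[OF bij_wo_vec_Basis])
 finally show "emeasure (distr lborel borel wo_vec) (box l u) = (\<Prod>b\<in>Basis. (u - l) \<bullet> b)" .
qed simp

text \<open>Conjugation with the renaming of coordinates, which is an isometry and preserves
  Lebesgue measure.\<close>

lemma chart_vol_invariant:
 fixes h :: "(real^'n) \<times> real => (real^'n) \<times> real"
 assumes h: "orthogonal_transformation h"
 shows "distr chart_vol borel h = chart_vol"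
proof (rule measure_eqI)
 define \<Phi> where "\<Phi> p = (wo_vec (fst p), snd p)" for p :: "(real^'n) \<times> real"
 define \<Psi> where "\<Psi> p = (vec_wo (fst p), snd p)" for p :: "(real^('n wo)) \<times> real"
 have inv: "\<Psi> (\<Phi> p) = p" "\<Phi> (\<Psi> q) = q" for p q by (simp_all add: \<Phi>_def \<Psi>_def wo_vec_inverse)
 have m [measurable]: "\<Phi> \<in> borel_measurable borel" "\<Psi> \<in> borel_measurable borel"
  unfolding \<Phi>_def \<Psi>_def borel_prod[symmetric] by measurable
 have hm [measurable]: "h \<in> borel_measurable borel"
  by (intro borel_measurable_continuous_onI linear_continuous_on linear_conv_bounded_linear[THEN iffD1]
   orthogonal_transformation_linear h)
 have \<Phi>l: "linear \<Phi>" "linear \<Psi>"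
  by (auto intro!: linearI simp: \<Phi>_def \<Psi>_def linear_add[OF linear_wo_vec(1)] linear_add[OF linear_wo_vec(2)]
    linear_scale[OF linear_wo_vec(1)] linear_scale[OF linear_wo_vec(2)])
 have \<Phi>i: "\<Phi> p \<bullet> \<Phi> q = p \<bullet> q" for p q by (simp add: \<Phi>_def inner_prod_def wo_vec_inner)
 have \<Psi>i: "\<Psi> p \<bullet> \<Psi> q = p \<bullet> q" for p q using \<Phi>i[of "\<Psi> p" "\<Psi> q"] by (simp add: inv)
 define h' where "h' = \<Phi> \<circ> h \<circ> \<Psi>"
 have h': "orthogonal_transformation h'"
  unfolding orthogonal_transformation_def
 proof (intro conjI allI)
  have "h p \<bullet> h q = p \<bullet> q" for p q using h unfolding orthogonal_transformation_def by blast
  then show "h' p \<bullet> h' q = p \<bullet> q" for p q by (simp only: h'_def o_def \<Phi>i \<Psi>i)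
  show "linear h'" unfolding h'_def
   by (intro linear_compose[OF \<Phi>l(2)] linear_compose[OF orthogonal_transformation_linear[OF h]] \<Phi>l(1))
 qed
 have conf: "conf (wo_vec u) = conf u" for u :: "real^'n" by (simp add: conf_def wo_vec_inner)
 have st: "stereo (wo_vec u) = \<Phi> (stereo u)" for u :: "real^'n"
  by (simp add: stereo_def \<Phi>_def wo_vec_inner linear_scale[OF linear_wo_vec(1)])
 have tr: "(\<integral>\<^sup>+y. f y \<partial>chart_vol) = (\<integral>\<^sup>+x. f (\<Phi> x) \<partial>chart_vol)"
  if [measurable]: "f \<in> borel_measurable borel" for f :: "(real^('n wo)) \<times> real => ennreal"
 proof -
  have "(\<integral>\<^sup>+y. f y \<partial>chart_vol) = (\<integral>\<^sup>+v. ennreal (conf v ^ CARD('n wo)) * f (stereo v) \<partial>distr lborel borel wo_vec)"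
   by (simp add: nn_integral_chart_vol distr_wo_vec)
  also have "\<dots> = (\<integral>\<^sup>+u. ennreal (conf (wo_vec u) ^ CARD('n wo)) * f (stereo (wo_vec u)) \<partial>lborel)"
   by (rule nn_integral_distr) measurable
  also have "\<dots> = (\<integral>\<^sup>+x. f (\<Phi> x) \<partial>chart_vol)"
   by (subst nn_integral_chart_vol) (simp_all add: conf st card_wo)
  finally show ?thesis .
 qed
 fix A assume "A \<in> sets (distr chart_vol borel h)"
 then have A [measurable]: "A \<in> sets borel" by simp
 have hm' [measurable]: "h' \<in> borel_measurable borel"
  by (intro borel_measurable_continuous_onI linear_continuous_on linear_conv_bounded_linear[THEN iffD1]
   orthogonal_transformation_linear h')
 have "emeasure (distr chart_vol borel h) A = (\<integral>\<^sup>+x. indicator A x \<partial>distr chart_vol borel h)" by simp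
 also have "\<dots> = (\<integral>\<^sup>+x. indicator A (h x) \<partial>chart_vol)" by (rule nn_integral_distr) auto
 also have "\<dots> = (\<integral>\<^sup>+x. indicator A (\<Psi> (h' (\<Phi> x))) \<partial>chart_vol)" by (simp add: h'_def inv)
 also have "\<dots> = (\<integral>\<^sup>+y. indicator A (\<Psi> (h' y)) \<partial>chart_vol)" by (rule tr[symmetric]) measurable
 also have "\<dots> = (\<integral>\<^sup>+y. indicator A (\<Psi> y) \<partial>distr chart_vol borel h')"
  by (rule nn_integral_distr[symmetric]) measurable
 also have "\<dots> = (\<integral>\<^sup>+y. indicator A (\<Psi> y) \<partial>chart_vol)" by (simp add: chart_vol_invariant_aux[OF h'])
 also have "\<dots> = (\<integral>\<^sup>+x. indicator A (\<Psi> (\<Phi> x)) \<partial>chart_vol)" by (rule tr) measurable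
 also have "\<dots> = emeasure chart_vol A" by (simp add: inv)
 finally show "emeasure (distr chart_vol borel h) A = emeasure chart_vol A" .
qed simp

section \<open>The constant k_n and the normalised volume\<close>

lemma Beta_half_pos: "Beta (1 / 2) ((real k + 1) / 2) > 0"
 unfolding Beta_def by (intro divide_pos_pos mult_pos_pos Gamma_real_pos) (simp_all add: add_pos_nonneg)

text \<open>By the Gamma formulas the Beta value is the factor between consecutive unit ball
  volumes; geometrically it comes from slicing the ball, as the integral of (1 - t^2)^((n-1)/2) over
  [-1, 1].\<close>

lemma sphere_area_Beta:
 assumes "2 \<le> n"
 shows "2 / (n * Beta (1 / 2) ((real n + 1) / 2)) = k_const n"
proof -
 have p: "pi powr (real (n - 1) / 2) * sqrt pi = pi powr (n / 2)"
  using assms by (simp add: powr_half_sqrt[symmetric] powr_add[symmetric] of_nat_diff diff_divide_distrib)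
 have G: "Gamma ((real n + 1) / 2) \<noteq> 0" "Gamma (n / 2 + 1) \<noteq> 0" by (auto intro!: Gamma_real_pos less_imp_neq[THEN not_sym] add_nonneg_pos)
 have "(1::real) / 2 + (real n + 1) / 2 = n / 2 + 1" by (simp add: add_divide_distrib)
 then have B: "Beta (1 / 2) ((real n + 1) / 2) = sqrt pi * Gamma ((real n + 1) / 2) / Gamma (n / 2 + 1)"
  by (simp add: Beta_def Gamma_one_half_real)
 have "real (n - 1) / 2 + 1 = (real n + 1) / 2" using assms by (simp add: of_nat_diff field_simps)
 then have ub: "unit_ball_vol (real (n - 1)) = pi powr (real (n - 1) / 2) / Gamma ((real n + 1) / 2)"
  by (simp only: unit_ball_vol_def)
 have "unit_ball_vol (real (n - 1)) * Beta (1 / 2) ((real n + 1) / 2) = unit_ball_vol n"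
  unfolding ub B unit_ball_vol_def[of "real n"] p[symmetric] using G by simp
 moreover have "unit_ball_vol (real (n - 1)) \<noteq> 0" by (rule less_imp_neq[THEN not_sym]) simp
 ultimately have "Beta (1 / 2) ((real n + 1) / 2) = unit_ball_vol n / unit_ball_vol (real (n - 1))"
  by (simp add: eq_divide_eq mult.commute)
 moreover have "k_const n = 2 / n * (unit_ball_vol (real (n - 1)) / unit_ball_vol n)"
  using assms by (simp add: k_const_def sphere_area_def of_nat_diff Suc_diff_le numeral_2_eq_2)
 ultimately show ?thesis by simp
qed

context rotation_invariant_prob begin

text \<open>By invariance the mean sine to a fixed point does not depend on that point, so both
  integrals in \<open>\<kappa>\<close> can be taken about one pole and reduced to one
  variable.\<close>

lemma kappa_alt:
 assumes v: "norm v = 1"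
 shows "\<kappa> = (LINT y|P. \<bar>v \<bullet> y\<bar>) / (LINT y|P. sine (v, y))"
proof -
 have sm: "sine \<in> borel_measurable borel2" unfolding sine_def[abs_def] by measurable
 have "sine_moment 1 = (LINT x|P. (LINT y|P. sine (x, y)))"
  unfolding sine_moment_def power_one_right
  by (rule integral_PP[OF sm, of 1]) (use sine_bounds in force)
 also have "\<dots> = (LINT x|P. (LINT y|P. sine (v, y)))"
 proof (rule integral_cong_AE)
  show "AE x in P. (LINT y|P. sine (x, y)) = (LINT y|P. sine (v, y))"
   using AE_norm
  proof eventually_elim
   case (elim x)
   define h where "h = reflect (x - v)"
   have h: "orthogonal_transformation h" "h x = v"
    using elim v by (auto simp: h_def orthogonal_transformation_reflect intro!: reflect_diff)
   then have "sine (v, h y) = sine (x, y)" for y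
    using orthogonal_transformation_def[of h] by (auto simp: sine_def)
   moreover have "(LINT y|P. sine (v, h y)) = (LINT y|P. sine (v, y))"
    by (rule integral_invariant[OF h(1)]) (simp add: sine_def)
   ultimately show ?case by simp
  qed
 qed (use sm in \<open>auto intro!: borel_measurable_lebesgue_integral\<close>)
 also have "\<dots> = (LINT y|P. sine (v, y))" using prob_space by simp
 finally show ?thesis unfolding \<kappa>_def using integral_abs_inner[of v] v by simp
qed

end

definition chart_area :: "'n::finite itself => real" where
 "chart_area _ = measure (chart_vol :: ((real^'n) \<times> real) measure) UNIV"

lemma chart_area: "emeasure (chart_vol :: ((real^'n) \<times> real) measure) UNIV = ennreal (chart_area TYPE('n))"
 using finite_measure.emeasure_eq_measure[OF finite_chart_vol, of UNIV] by (simp add: chart_area_def)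

lemma chart_area_pos: "0 < chart_area TYPE('n::finite)"
proof -
 have "chart_area TYPE('n) \<noteq> 0"
 proof
  assume "chart_area TYPE('n) = 0"
  then have "emeasure (chart_vol :: ((real^'n) \<times> real) measure) UNIV = 0" by (simp add: chart_area)
  then have "(\<integral>\<^sup>+u. ennreal (conf u ^ CARD('n)) * 1 \<partial>(lborel :: (real^'n) measure)) = 0"
   using nn_integral_chart_vol[of "\<lambda>_ :: (real^'n) \<times> real. 1"] by (simp add: chart_vol_def)
  then have "AE u in (lborel :: (real^'n) measure). False"
   using zero_less_power[OF conf_pos] by (subst (asm) nn_integral_0_iff_AE) (auto simp: ennreal_eq_0_iff not_le[symmetric] elim!: eventually_mono)
  then show False
   using AE_iff_null_sets[of "UNIV :: (real^'n) set" lborel] by (simp add: null_sets_def emeasure_lborel_UNIV)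
 qed
 then show ?thesis by (simp add: less_le chart_area_def)
qed

definition sphere_prob :: "((real^'n) \<times> real) measure" where
 "sphere_prob = scale_measure (ennreal (1 / chart_area TYPE('n))) chart_vol"

lemma nn_integral_sphere_prob:
 assumes "f \<in> borel_measurable borel"
 shows "(\<integral>\<^sup>+x. f x \<partial>(sphere_prob :: ((real^'n) \<times> real) measure)) =
  ennreal (1 / chart_area TYPE('n)) * (\<integral>\<^sup>+x. f x \<partial>chart_vol)"
 unfolding sphere_prob_def using assms by (simp add: nn_integral_scale_measure measurable_cong_sets[OF sets_chart_vol refl])

lemma rotation_invariant_sphere_prob: "rotation_invariant_prob (sphere_prob :: ((real^'n) \<times> real) measure)"
proof -
 have sets: "sets (sphere_prob :: ((real^'n) \<times> real) measure) = sets borel" by (simp add: sphere_prob_def)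
 have sc: "space (chart_vol :: ((real^'n) \<times> real) measure) = UNIV" by (simp add: chart_vol_def)
 show ?thesis
 proof (intro rotation_invariant_prob.intro rotation_invariant_prob_axioms.intro prob_spaceI sets)
  have sp: "space (sphere_prob :: ((real^'n) \<times> real) measure) = UNIV" using sets_eq_imp_space_eq[OF sets] by simp
  show "emeasure (sphere_prob :: ((real^'n) \<times> real) measure) (space sphere_prob) = 1"
   unfolding sp unfolding sphere_prob_def
   using chart_area_pos[where 'n='n] by (simp add: chart_area ennreal_mult[symmetric])
  have "AE u in (density lborel (\<lambda>u. ennreal (conf u ^ CARD('n)))). norm (stereo (u::real^'n)) = 1"
   by (simp add: norm_stereo)
  then have "AE x in (chart_vol :: ((real^'n) \<times> real) measure). norm x = 1"
   unfolding chart_vol_def by (subst AE_distr_iff) auto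
  then show "AE x in (sphere_prob :: ((real^'n) \<times> real) measure). norm x = 1"
   unfolding eventually_ae_filter
   by (auto simp: sphere_prob_def null_sets_def sets_eq_imp_space_eq[OF sets_chart_vol])
  show "distr sphere_prob borel h = sphere_prob" if h: "orthogonal_transformation h"
   for h :: "(real^'n) \<times> real => (real^'n) \<times> real"
  proof (rule measure_eqI)
   fix A assume "A \<in> sets (distr sphere_prob borel h)"
   then have A: "A \<in> sets borel" by simp
   have m: "h \<in> measurable sphere_prob borel" "h \<in> measurable chart_vol borel"
    using orthogonal_transformation_measurable[OF h]
    by (simp_all add: measurable_cong_sets[OF sets refl] measurable_cong_sets[OF sets_chart_vol refl])
   have "emeasure (distr chart_vol borel h) A = emeasure chart_vol A" by (simp add: chart_vol_invariant[OF h])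
   then have "emeasure chart_vol (h -` A) = emeasure chart_vol A"
    using m(2) A sc by (simp add: emeasure_distr)
   then show "emeasure (distr sphere_prob borel h) A = emeasure sphere_prob A"
    using m(1) A sp by (simp add: emeasure_distr) (simp add: sphere_prob_def)
  qed (simp add: sets)
  show "2 \<le> DIM((real^'n) \<times> real)"
   using zero_less_card_finite[where 'a='n] by simp
 qed
qed

interpretation sph: rotation_invariant_prob "sphere_prob :: ((real^'n) \<times> real) measure"
 by (rule rotation_invariant_sphere_prob)

section \<open>Zonal functions: the Helmholtz operator and the marginal of the sphere\<close>

text \<open>The radial extension sees only values on the sphere. This matters because the gradient
  of a ridge function is known as a polynomial field only there, and the Laplacian differentiates it
  once more.\<close>

lemma sphere_deriv_cong:
 fixes x :: "'a::euclidean_space"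
 assumes "\<And>y. norm y = 1 ==> f y = g y" and x: "x \<noteq> 0"
 shows "sphere_deriv f x = sphere_deriv g x"
proof -
 have ev: "\<forall>\<^sub>F z in at x. radial_ext f z = radial_ext g z"
  using t1_space_nhds[OF x] by (auto simp: eventually_at_filter radial_ext_def assms(1) elim!: eventually_mono)
 have eq: "radial_ext f x = radial_ext g x" using assms(1)[of "x /\<^sub>R norm x"] x by (simp add: radial_ext_def)
 have "(radial_ext f has_derivative D) (at x) \<longleftrightarrow> (radial_ext g has_derivative D) (at x)" for D
  using ev eq by (intro iffI) (auto elim: has_derivative_transform_eventually simp: eq_commute[of "radial_ext f _"])
 then show ?thesis by (simp add: sphere_deriv_def frechet_derivative_def)
qed

lemma sphere_div_cong:
 fixes x :: "'a::euclidean_space"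
 assumes "\<And>y. norm y = 1 ==> X y = Y y" "x \<noteq> 0"
 shows "sphere_div X x = sphere_div Y x"
 using sphere_deriv_cong[of X Y x] assms by (simp add: sphere_div_def cov_deriv_def)

lemma real_polynomial_poly: "real_polynomial_function f ==> real_polynomial_function (\<lambda>x. poly p (f x))"
 by (induction p) (auto intro: real_polynomial_function.intros)

lemma has_derivative_poly_inner:
 "((\<lambda>x. poly p (x \<bullet> z)) has_derivative (\<lambda>v. poly (pderiv p) (x \<bullet> z) * (v \<bullet> z))) (at x)"
 using has_derivative_compose[OF bounded_linear_imp_has_derivative[OF bounded_linear_inner_left]
   poly_DERIV[of p "x \<bullet> z", unfolded has_field_derivative_def]] by simp

lemma sphere_grad_ridge:
 assumes "norm x = 1"
 shows "sphere_grad (\<lambda>x. poly p (x \<bullet> z)) x = poly (pderiv p) (x \<bullet> z) *\<^sub>R (z - (x \<bullet> z) *\<^sub>R x)"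
proof (rule euclidean_eqI)
 fix b :: 'a assume b: "b \<in> Basis"
 have "sphere_grad (\<lambda>x. poly p (x \<bullet> z)) x \<bullet> b = sphere_deriv (\<lambda>x. poly p (x \<bullet> z)) x b"
  using b by (simp add: sphere_grad_def inner_sum_left inner_Basis if_distrib sum.delta cong: if_cong)
 also have "\<dots> = poly (pderiv p) (x \<bullet> z) * ((b - (b \<bullet> x) *\<^sub>R x) \<bullet> z)"
  by (rule sphere_deriv_eq[OF has_derivative_poly_inner assms])
 finally show "sphere_grad (\<lambda>x. poly p (x \<bullet> z)) x \<bullet> b = (poly (pderiv p) (x \<bullet> z) *\<^sub>R (z - (x \<bullet> z) *\<^sub>R x)) \<bullet> b"
  by (simp add: inner_diff_left inner_diff_right inner_commute algebra_simps)
qed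

lemma real_polynomial_function_poly:
 assumes "real_polynomial_function (f :: real => real)"
 obtains p where "f = poly p"
proof -
 obtain a n where f: "f = (\<lambda>x. \<Sum>i\<le>n. a i * x ^ i)"
  using assms unfolding real_polynomial_function_iff_sum by blast
 then have "f = poly (\<Sum>i\<le>n. monom (a i) i)"
  by (simp add: fun_eq_iff poly_sum poly_monom)
 then show ?thesis by (rule that)
qed

lemma poly_approximation:
 fixes f :: "real => real"
 assumes "continuous_on {-1..1} f" "e > 0"
 obtains p where "\<And>t. -1 \<le> t ==> t \<le> 1 ==> \<bar>f t - poly p t\<bar> < e"
proof -
 obtain g where g: "real_polynomial_function g" "\<And>t. t \<in> {-1..1} ==> \<bar>f t - g t\<bar> < e"
  using Stone_Weierstrass_real_polynomial_function[OF _ assms] by auto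
 obtain p where "g = poly p" using real_polynomial_function_poly[OF g(1)] .
 then show ?thesis using g(2) by (intro that[of p]) auto
qed

lemma has_derivative_ridge_field:
 fixes x z :: "'a::euclidean_space"
 shows "((\<lambda>x. poly q (x \<bullet> z) *\<^sub>R (z - (x \<bullet> z) *\<^sub>R x)) has_derivative
  (\<lambda>v. poly q (x \<bullet> z) *\<^sub>R (- ((x \<bullet> z) *\<^sub>R v + (v \<bullet> z) *\<^sub>R x)) +
   (poly (pderiv q) (x \<bullet> z) * (v \<bullet> z)) *\<^sub>R (z - (x \<bullet> z) *\<^sub>R x))) (at x)"
proof -
 have "((\<lambda>y. (y \<bullet> z) *\<^sub>R y) has_derivative (\<lambda>v. (x \<bullet> z) *\<^sub>R v + (v \<bullet> z) *\<^sub>R x)) (at x)"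
  by (intro has_derivative_scaleR bounded_linear_imp_has_derivative bounded_linear_inner_left has_derivative_ident)
 from has_derivative_diff[OF has_derivative_const[of z] this]
 have "((\<lambda>y. z - (y \<bullet> z) *\<^sub>R y) has_derivative (\<lambda>v. - ((x \<bullet> z) *\<^sub>R v + (v \<bullet> z) *\<^sub>R x))) (at x)" by simp
 from has_derivative_scaleR[OF has_derivative_poly_inner this] show ?thesis .
qed

lemma sphere_div_ridge:
 fixes x z :: "'a::euclidean_space"
 assumes x: "norm x = 1" and z: "norm z = 1"
 shows "sphere_div (\<lambda>x. poly q (x \<bullet> z) *\<^sub>R (z - (x \<bullet> z) *\<^sub>R x)) x =
  (1 - (x \<bullet> z)\<^sup>2) * poly (pderiv q) (x \<bullet> z) - real (DIM('a) - 1) * (x \<bullet> z) * poly q (x \<bullet> z)"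
proof -
 define g where "g = poly q (x \<bullet> z)"
 define g' where "g' = poly (pderiv q) (x \<bullet> z)"
 define t where "t = x \<bullet> z"
 define D where "D v = g *\<^sub>R (- ((x \<bullet> z) *\<^sub>R v + (v \<bullet> z) *\<^sub>R x)) + (g' * (v \<bullet> z)) *\<^sub>R (z - (x \<bullet> z) *\<^sub>R x)" for v
 have s1: "(\<Sum>b\<in>Basis. (b \<bullet> z) * (w \<bullet> b)) = w \<bullet> z" for w :: 'a
  by (simp add: euclidean_inner[of w z] inner_commute mult.commute)
 have zz: "z \<bullet> z = 1" "x \<bullet> x = 1" using x z by (simp_all add: norm_eq_1)
 have "sphere_div (\<lambda>x. poly q (x \<bullet> z) *\<^sub>R (z - (x \<bullet> z) *\<^sub>R x)) x = (\<Sum>b\<in>Basis. D b \<bullet> b) - D x \<bullet> x"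
  unfolding D_def g_def g'_def by (rule sphere_div_eq[OF has_derivative_ridge_field x])
 also have "(\<Sum>b\<in>Basis. D b \<bullet> b) = (\<Sum>b\<in>Basis. g' * ((b \<bullet> z) * (z \<bullet> b)) - g' * t * ((b \<bullet> z) * (x \<bullet> b)) - g * t - g * ((b \<bullet> z) * (x \<bullet> b)))"
  by (intro sum.cong refl) (simp add: D_def t_def inner_add_left inner_diff_left algebra_simps)
 also have "\<dots> = g' - g' * t * t - g * t * DIM('a) - g * t"
  by (simp only: sum_subtractf sum_distrib_left[symmetric] s1 zz sum_constant) (simp add: t_def)
 also have "D x \<bullet> x = - 2 * g * t" by (simp add: D_def inner_add_left inner_diff_left zz t_def inner_commute algebra_simps)
 finally show ?thesis
  using DIM_positive[where 'a='a]
  by (simp add: g_def g'_def t_def power2_eq_square of_nat_diff Suc_le_eq algebra_simps)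
qed

text \<open>On functions of t = x \<bullet> z the Laplacian reduces to the Gegenbauer operator, as
  the divergence of the ridge field computed in \<open>sphere_grad_ridge\<close>.\<close>

lemma laplace_beltrami_ridge:
 fixes x z :: "'a::euclidean_space"
 assumes x: "norm x = 1" and z: "norm z = 1"
 shows "laplace_beltrami (\<lambda>x. poly p (x \<bullet> z)) x =
  (1 - (x \<bullet> z)\<^sup>2) * poly (pderiv (pderiv p)) (x \<bullet> z) - real (DIM('a) - 1) * (x \<bullet> z) * poly (pderiv p) (x \<bullet> z)"
proof -
 have "x \<noteq> 0" using x by auto
 then show ?thesis
  unfolding laplace_beltrami_def sphere_div_ridge[OF x z, symmetric] by (intro sphere_div_cong) (simp_all add: sphere_grad_ridge)
qed

text \<open>The operator 1 - \<epsilon>^2 \<Delta> on polynomials in t = x \<bullet> z;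
  \<open>n\<close> stands for the dimension of the sphere.\<close>

definition helm :: "real => real => real poly => real poly" where
 "helm eps n p = p - smult (eps\<^sup>2) ([:1, 0, -1:] * pderiv (pderiv p) - smult n ([:0, 1:] * pderiv p))"

lemma poly_helm:
 "poly (helm eps n p) t = poly p t - eps\<^sup>2 * ((1 - t\<^sup>2) * poly (pderiv (pderiv p)) t - n * t * poly (pderiv p) t)"
 by (simp add: helm_def power2_eq_square algebra_simps)

lemma helm_add: "helm eps n (p + q) = helm eps n p + helm eps n q"
 by (simp add: helm_def pderiv_add algebra_simps smult_add_right smult_diff_right)

lemma helm_smult: "helm eps n (smult c p) = smult c (helm eps n p)"
 by (simp add: helm_def pderiv_smult algebra_simps smult_add_right smult_diff_right)

text \<open>In the monomial basis the operator is triangular with diagonal entries \<open>c\<close>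
  > 0, and its only other entry lowers the degree by two; hence strong induction.\<close>

lemma helm_power:
 assumes "n \<ge> 0"
 shows "\<exists>p. helm eps n p = monom 1 k"
proof (induction k rule: less_induct)
 case (less k)
 define c where "c = 1 + eps\<^sup>2 * (real k * (real k - 1) + n * real k)"
 have "real k * (real k - 1) \<ge> 0" by (cases k) auto
 then have "0 \<le> eps\<^sup>2 * (real k * (real k - 1) + n * real k)"
  using assms by (intro mult_nonneg_nonneg[OF zero_le_power2] add_nonneg_nonneg[OF _ mult_nonneg_nonneg]) auto
 then have c: "c > 0" by (simp add: c_def)
 define r where "r = smult (eps\<^sup>2 * real k * (real k - 1)) (monom 1 (k - 2))"
 have "helm eps n (monom 1 k) = smult c (monom 1 k) - r"
 proof (rule poly_eqI, goal_cases)
  case (1 m)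
  consider "k = 0" | "k = 1" | j where "k = Suc (Suc j)" by (metis One_nat_def old.nat.exhaust)
  then show ?case
   by cases (auto simp: helm_def c_def r_def pderiv_monom mult_monom smult_monom coeff_monom
    monom_0 monom_Suc[symmetric] coeff_pCons pderiv_pCons algebra_simps split: nat.splits)
 qed
 moreover obtain q where "helm eps n q = r"
 proof (cases "k \<ge> 2")
  case True
  then obtain q where "helm eps n q = monom 1 (k - 2)" using less.IH[of "k - 2"] by auto
  then show ?thesis using that[of "smult (eps\<^sup>2 * real k * (real k - 1)) q"] by (simp add: helm_smult r_def)
 next
  case False
  then have "k = 0 \<or> k = 1" by auto
  then show ?thesis using that[of 0] by (auto simp: r_def helm_def)
 qed
 ultimately have "helm eps n (smult (1 / c) (monom 1 k + q)) = monom 1 k"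
  using c by (simp add: helm_smult helm_add)
 then show ?case by blast
qed

text \<open>Every polynomial is a right-hand side of the one-dimensional equation, so the weak
  equation determines all moments of the kernel against powers of x \<bullet> z.\<close>

lemma helm_surj:
 assumes "n \<ge> 0" shows "\<exists>p. helm eps n p = q"
proof -
 have "\<exists>p. helm eps n p = (\<Sum>i\<in>A. monom (coeff q i) i)" if "finite A" for A
  using that
 proof induction
  case empty
  have "helm eps n 0 = 0" by (simp add: helm_def)
  then show ?case by auto
 next
  case (insert i A)
  then obtain p where p: "helm eps n p = (\<Sum>i\<in>A. monom (coeff q i) i)" by blast
  obtain r where "helm eps n r = monom 1 i" using helm_power[OF assms] by blast
  then have "helm eps n (smult (coeff q i) r + p) = monom (coeff q i) i + (\<Sum>i\<in>A. monom (coeff q i) i)"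
   using p by (simp add: helm_add helm_smult smult_monom)
  also have "\<dots> = (\<Sum>i\<in>insert i A. monom (coeff q i) i)" using insert.hyps by simp
  finally show ?case by blast
 qed
 from this[of "{..degree q}"] show ?thesis by (simp add: poly_as_sum_of_monoms)
qed

lemma smooth_sphere_ridge: "smooth_sphere (\<lambda>x::'a::euclidean_space. poly p (x \<bullet> z))"
 by (intro smooth_sphere_real_polynomial real_polynomial_poly real_polynomial_id_inner)

context rotation_invariant_prob begin

text \<open>The divergence theorem for the tangential part of z multiplied by q (x \<bullet>
  z).\<close>

lemma ridge_mean_zero:
 assumes z: "norm z = 1"
 shows "(LINT x|P. (1 - (x \<bullet> z)\<^sup>2) * poly (pderiv q) (x \<bullet> z) - real (DIM('a) - 1) * (x \<bullet> z) * poly q (x \<bullet> z)) = 0"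
proof -
 define X where "X x = poly q (x \<bullet> z) *\<^sub>R (z - (x \<bullet> z) *\<^sub>R x)" for x
 have "real_polynomial_function (\<lambda>x. X x \<bullet> b)" for b
  unfolding X_def inner_scaleR_left inner_diff_left
  by (intro real_polynomial_function.intros(4) real_polynomial_function_diff real_polynomial_function.intros(2)
    real_polynomial_id_inner real_polynomial_poly)
 then have X: "polynomial_function X" by (subst polynomial_function_iff_Basis_inner) simp
 have "poly p \<in> borel_measurable borel" for p :: "real poly"
  by (intro borel_measurable_continuous_onI continuous_intros)
 note [measurable] = this borel_measurable_sphere_div[OF smooth_sphere_polynomial[OF X]]
 have "(LINT x|P. (1 - (x \<bullet> z)\<^sup>2) * poly (pderiv q) (x \<bullet> z) - real (DIM('a) - 1) * (x \<bullet> z) * poly q (x \<bullet> z)) = (LINT x|P. sphere_div X x)"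
 proof (rule integral_cong_AE)
  show "AE x in P. (1 - (x \<bullet> z)\<^sup>2) * poly (pderiv q) (x \<bullet> z) - real (DIM('a) - 1) * (x \<bullet> z) * poly q (x \<bullet> z) = sphere_div X x"
   using AE_norm by eventually_elim (simp add: X_def[abs_def] sphere_div_ridge z)
 qed measurable
 also have "\<dots> = 0"
  by (rule divergence_theorem[OF X]) (simp add: X_def inner_diff_left inner_diff_right norm_eq_1 inner_commute)
 finally show ?thesis .
qed

text \<open>
 Both functionals vanish on \<open>(1 - t\<^sup>2) q' - n t q\<close> for every polynomial \<open>q\<close>, which fixes all moments
 in terms of the total mass.
\<close>

lemma sphere_marginal:
 fixes f :: "real => real"
 assumes N: "N = DIM('a) - 1" "2 \<le> N" and z: "norm z = 1"
  and f: "continuous_on {-1..1} f" and fm [measurable]: "f \<in> borel_measurable borel"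
 shows "(LINT x|P. f (x \<bullet> z)) * integral {-1..1} (\<lambda>t. sqrt (1 - t\<^sup>2) ^ (N - 2))
  = integral {-1..1} (\<lambda>t. f t * sqrt (1 - t\<^sup>2) ^ (N - 2))"
proof -
 define W where "W t = sqrt (1 - t\<^sup>2) ^ (N - 2)" for t :: real
 define w where "w = integral {-1..1} W"
 define n where "n = real N"
 have cW: "continuous_on A W" for A unfolding W_def by (intro continuous_intros)
 have int: "(\<lambda>t. g t * W t) integrable_on {-1..1}" if "continuous_on {-1..1} g" for g
  by (intro integrable_continuous_interval continuous_intros that cW)
 have W0: "0 \<le> W t" if "t \<in> {-1..1}" for t
 proof -
  have "t\<^sup>2 \<le> 1" using that by (auto simp: abs_square_le_1 abs_le_iff)
  then show ?thesis by (simp add: W_def)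
 qed
 have xz: "x \<bullet> z \<in> {-1..1}" if "norm x = 1" for x
  using Cauchy_Schwarz_ineq2[of x z] that z by (auto simp: abs_le_iff)
 define E where "E k = (LINT x|P. (x \<bullet> z) ^ k) * w" for k
 define I where "I k = integral {-1..1} (\<lambda>t. t ^ k * W t)" for k
 have ip: "integrable P (\<lambda>x. (x \<bullet> z) ^ k)" for k by (intro integrable_P_continuous continuous_intros)
 have B: "(1 - t\<^sup>2) * poly (pderiv (monom 1 j)) t - n * t * poly (monom 1 j) t = real j * t ^ (j - 1) - (real j + n) * t ^ Suc j"
  for j and t :: real
  by (cases j) (simp_all add: pderiv_monom poly_monom power2_eq_square algebra_simps)
 have recE: "real j * E (j - 1) = (real j + n) * E (Suc j)" for j
 proof -
  have "(LINT x|P. real j * (x \<bullet> z) ^ (j - 1) - (real j + n) * (x \<bullet> z) ^ Suc j) = 0"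
   using ridge_mean_zero[OF z, of "monom 1 j"] unfolding N(1)[symmetric] n_def[symmetric] B .
  then have "real j * (LINT x|P. (x \<bullet> z) ^ (j - 1)) = (real j + n) * (LINT x|P. (x \<bullet> z) ^ Suc j)"
   using ip[of "j - 1"] ip[of "Suc j"] by simp
  then show ?thesis by (simp add: E_def mult.assoc[symmetric])
 qed
 have recI: "real j * I (j - 1) = (real j + n) * I (Suc j)" for j
 proof -
  have "((\<lambda>t. (real j * t ^ (j - 1) - (real j + n) * t ^ Suc j) * W t) has_integral 1 ^ j * sqrt (1 - 1\<^sup>2) ^ N - (-1) ^ j * sqrt (1 - (-1)\<^sup>2) ^ N) {-1..1}"
  proof (rule fundamental_theorem_of_calculus_interior)
   show "continuous_on {-1..1} (\<lambda>t::real. t ^ j * sqrt (1 - t\<^sup>2) ^ N)" by (intro continuous_intros)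
   fix t :: real assume "t \<in> {-1<..<1}"
   then have "t\<^sup>2 < 1" by (auto simp: abs_square_less_1 abs_less_iff)
   then have s: "sqrt (1 - t\<^sup>2) > 0" "(sqrt (1 - t\<^sup>2))\<^sup>2 = 1 - t\<^sup>2" by simp_all
   obtain k where k: "N = Suc (Suc k)" using N(2) by (metis Suc_le_D numeral_2_eq_2 Suc_le_mono)
   have "DERIV (\<lambda>t. 1 - t\<^sup>2) t :> - 2 * t" by (auto intro!: derivative_eq_intros)
   from DERIV_chain2[OF DERIV_real_sqrt this] have "DERIV (\<lambda>t. sqrt (1 - t\<^sup>2)) t :> - t / sqrt (1 - t\<^sup>2)"
    using s by (simp add: field_simps)
   from DERIV_mult[OF DERIV_pow DERIV_power[OF this]]
   have "DERIV (\<lambda>t. t ^ j * sqrt (1 - t\<^sup>2) ^ N) t :> real j * t ^ (j - Suc 0) * sqrt (1 - t\<^sup>2) ^ N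
     + (real N * (- t / sqrt (1 - t\<^sup>2) * sqrt (1 - t\<^sup>2) ^ (N - Suc 0))) * t ^ j" by simp
   also have "real j * t ^ (j - Suc 0) * sqrt (1 - t\<^sup>2) ^ N + (real N * (- t / sqrt (1 - t\<^sup>2) * sqrt (1 - t\<^sup>2) ^ (N - Suc 0))) * t ^ j
     = ((1 - t\<^sup>2) * (real j * t ^ (j - 1)) - n * t * t ^ j) * W t"
   proof -
    have "sqrt (1 - t\<^sup>2) ^ N = (sqrt (1 - t\<^sup>2))\<^sup>2 * W t" by (simp add: k W_def power2_eq_square)
    moreover have "- t / sqrt (1 - t\<^sup>2) * sqrt (1 - t\<^sup>2) ^ (N - Suc 0) = - t * W t" using s(1) by (simp add: k W_def)
    ultimately show ?thesis by (simp only: s(2)) (simp add: n_def algebra_simps)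
   qed
   also have "(1 - t\<^sup>2) * (real j * t ^ (j - 1)) - n * t * t ^ j = real j * t ^ (j - 1) - (real j + n) * t ^ Suc j"
    using B[of t j] by (simp add: pderiv_monom poly_monom)
   finally show "((\<lambda>t. t ^ j * sqrt (1 - t\<^sup>2) ^ N) has_vector_derivative (real j * t ^ (j - 1) - (real j + n) * t ^ Suc j) * W t) (at t)"
    by (simp add: has_real_derivative_iff_has_vector_derivative)
  qed simp
  then have "integral {-1..1} (\<lambda>t. real j * (t ^ (j - 1) * W t) - (real j + n) * (t ^ Suc j * W t)) = 0"
   using N(2) zero_power[of N, where 'a=real] by (intro integral_unique) (simp add: left_diff_distrib mult.assoc)
  moreover have "(\<lambda>t. c * (t ^ k * W t)) integrable_on {-1..1}" for c k by (intro integrable_on_mult_right int continuous_intros)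
  ultimately show ?thesis by (simp only: I_def integral_diff integral_mult_right right_minus_eq)
 qed
 have EI: "E k = I k" for k
 proof (induction k rule: less_induct)
  case (less k)
  show ?case
  proof (cases k)
   case 0
   then show ?thesis using prob_space by (simp add: E_def I_def w_def)
  next
   case (Suc j)
   have "real j * E (j - 1) = real j * I (j - 1)" using less[of "j - 1"] Suc by simp
   then have "(real j + n) * E k = (real j + n) * I k" using recE[of j] recI[of j] Suc by (simp only:)
   moreover have "real j + n > 0" using N(2) by (simp add: n_def)
   ultimately show ?thesis by simp
  qed
 qed
 have poly: "(LINT x|P. poly q (x \<bullet> z)) * w = integral {-1..1} (\<lambda>t. poly q t * W t)" for q
 proof -
  have "(LINT x|P. poly q (x \<bullet> z)) * w = (\<Sum>i\<le>degree q. coeff q i * E i)"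
   by (simp add: poly_altdef E_def ip sum_distrib_right mult.assoc)
  also have "\<dots> = integral {-1..1} (\<lambda>t. \<Sum>i\<le>degree q. coeff q i * (t ^ i * W t))"
   by (subst integral_sum) (auto simp: EI I_def intro!: integrable_on_mult_right int continuous_intros)
  also have "\<dots> = integral {-1..1} (\<lambda>t. poly q t * W t)"
   by (simp add: poly_altdef sum_distrib_right mult.assoc)
  finally show ?thesis .
 qed
 obtain C where "\<forall>t\<in>{-1..1}. \<bar>f t\<bar> \<le> C"
  using compact_imp_bounded[OF compact_continuous_image[OF f compact_Icc]] by (auto simp: bounded_iff)
 then have C: "\<bar>f t\<bar> \<le> C" if "t \<in> {-1..1}" for t using that by blast
 have fP: "integrable P (\<lambda>x. f (x \<bullet> z))"
  by (rule integrable_P_sphere_bounded[where B = C]) (measurable, use C xz in blast)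
 have w0: "0 \<le> w" unfolding w_def by (intro integral_nonneg integrable_continuous_interval cW W0)
 have "\<bar>(LINT x|P. f (x \<bullet> z)) * w - integral {-1..1} (\<lambda>t. f t * W t)\<bar> \<le> 0 + e * (2 * w)" if e: "e > 0" for e
 proof -
  obtain q where "\<And>t. -1 \<le> t ==> t \<le> 1 ==> \<bar>f t - poly q t\<bar> < e" using poly_approximation[OF f e] by blast
  then have q: "\<bar>f t - poly q t\<bar> < e" if "t \<in> {-1..1}" for t using that by simp
  have qP: "integrable P (\<lambda>x. poly q (x \<bullet> z))" by (intro integrable_P_continuous continuous_intros)
  have "\<bar>(LINT x|P. f (x \<bullet> z)) - (LINT x|P. poly q (x \<bullet> z))\<bar> \<le> (LINT x|P. \<bar>f (x \<bullet> z) - poly q (x \<bullet> z)\<bar>)"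
   using integral_abs_bound[of P "\<lambda>x. f (x \<bullet> z) - poly q (x \<bullet> z)"] fP qP by simp
  also have "\<dots> \<le> (LINT x|P. e)"
   using fP qP AE_norm by (intro integral_mono_AE) (auto elim!: eventually_mono intro!: less_imp_le q xz)
  finally have "\<bar>(LINT x|P. f (x \<bullet> z)) - (LINT x|P. poly q (x \<bullet> z))\<bar> * w \<le> e * w"
   using w0 prob_space by (intro mult_right_mono) auto
  then have 1: "\<bar>(LINT x|P. f (x \<bullet> z)) * w - (LINT x|P. poly q (x \<bullet> z)) * w\<bar> \<le> e * w"
   using w0 by (simp add: left_diff_distrib[symmetric] abs_mult)
  have "\<bar>integral {-1..1} (\<lambda>t. f t * W t - poly q t * W t)\<bar> \<le> integral {-1..1} (\<lambda>t. e * W t)"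
  proof (rule integral_norm_bound_integral[where 'a=real, unfolded real_norm_def])
   show "\<bar>f t * W t - poly q t * W t\<bar> \<le> e * W t" if "t \<in> {-1..1}" for t
    using q[OF that] W0[OF that] by (simp add: left_diff_distrib[symmetric] abs_mult mult_right_mono)
  qed (intro integrable_diff int f continuous_intros)+
  then have "\<bar>integral {-1..1} (\<lambda>t. f t * W t) - integral {-1..1} (\<lambda>t. poly q t * W t)\<bar> \<le> e * w"
   by (subst integral_diff[symmetric]) (auto simp: w_def intro!: int f continuous_intros)
  with 1 poly[of q] show ?thesis by simp
 qed
 note b = this
 have "\<bar>(LINT x|P. f (x \<bullet> z)) * w - integral {-1..1} (\<lambda>t. f t * W t)\<bar> \<le> 0"
  by (rule le_of_all_eps[where M = "2 * w"]) (rule b)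
 then show ?thesis by (simp add: w_def W_def[abs_def])
qed

text \<open>Both integrals in \<open>\<kappa>\<close> become integrals against the weight sqrt(1 -
  t^2)^(N - 2), whose total mass \<open>w\<close> cancels: |t| gives 2 / N, the sine gives the Beta
  value contained in \<open>k_const\<close>.\<close>

lemma kappa_eq:
 fixes N :: nat
 assumes N: "N = DIM('a) - 1" "2 \<le> N"
 shows "\<kappa> = k_const N"
proof -
 define W where "W t = sqrt (1 - t\<^sup>2) ^ (N - 2)" for t :: real
 define w where "w = integral {-1..1} W"
 note m = sphere_marginal[OF N e12(4), folded W_def, folded w_def]
 have s: "e1 \<bullet> y = y \<bullet> e1" for y :: 'a by (rule inner_commute)
 \<comment> \<open>The antiderivative is sqrt(1 - t^2)^N. It is differentiated in the interior only,
   as the root has no derivative at 1 and -1.\<close>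
 have FTC: "((\<lambda>t. - (real N * (t * W t))) has_integral sqrt (1 - b\<^sup>2) ^ N - sqrt (1 - a\<^sup>2) ^ N) {a..b}"
  if "a \<le> b" "-1 \<le> a" "b \<le> 1" for a b
 proof (rule fundamental_theorem_of_calculus_interior[OF that(1)])
  show "continuous_on {a..b} (\<lambda>t. sqrt (1 - t\<^sup>2) ^ N)" by (intro continuous_intros)
  fix t assume "t \<in> {a<..<b}"
  then have "t\<^sup>2 < 1" using that by (auto simp: abs_square_less_1 abs_less_iff)
  then have p: "sqrt (1 - t\<^sup>2) > 0" by simp
  have k: "N - Suc 0 = Suc (N - 2)" using N(2) by simp
  have "DERIV (\<lambda>t. 1 - t\<^sup>2) t :> - 2 * t" by (auto intro!: derivative_eq_intros)
  from DERIV_chain2[OF DERIV_real_sqrt this] have "DERIV (\<lambda>t. sqrt (1 - t\<^sup>2)) t :> - t / sqrt (1 - t\<^sup>2)"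
   using p by (simp add: field_simps)
  from DERIV_power[OF this, of N] show "((\<lambda>t. sqrt (1 - t\<^sup>2) ^ N) has_vector_derivative - (real N * (t * W t))) (at t)"
   using p by (simp add: has_real_derivative_iff_has_vector_derivative k W_def)
 qed
 have "((\<lambda>t. \<bar>t\<bar> * W t) has_integral 1 / N) {-1..0}"
  using has_integral_mult_right[OF FTC[of "-1" 0], of "1 / N"] N(2)
  by (auto intro: has_integral_eq[rotated] simp: zero_power)
 moreover have "((\<lambda>t. \<bar>t\<bar> * W t) has_integral 1 / N) {0..1}"
  using has_integral_mult_right[OF FTC[of 0 1], of "- 1 / N"] N(2)
  by (auto intro: has_integral_eq[rotated] simp: zero_power)
 ultimately have "((\<lambda>t. \<bar>t\<bar> * W t) has_integral 1 / N + 1 / N) {-1..1}"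
  by (intro has_integral_combine[of "-1" 0 1]) auto
 then have 1: "(LINT y|P. \<bar>e1 \<bullet> y\<bar>) * w = 2 / N"
  unfolding s by (subst m) (auto intro!: continuous_intros integral_unique)
 have "((\<lambda>t. indicator {-1..1} t * sqrt (1 - t\<^sup>2) ^ (N - 1)) has_integral Beta (1 / 2) ((real N + 1) / 2)) UNIV"
 proof (rule nn_integral_has_integral)
  have "real (N - 1) / 2 + 1 = (real N + 1) / 2" using N(2) by (simp add: of_nat_diff field_simps)
  note B = emeasure_cball_aux_integral[of "N - 1", unfolded this]
  show "(\<integral>\<^sup>+t. ennreal (indicator {-1..1} t * sqrt (1 - t\<^sup>2) ^ (N - 1)) \<partial>lborel) = ennreal (Beta (1 / 2) ((real N + 1) / 2))"
   unfolding B[symmetric]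
   by (auto intro!: nn_integral_cong simp: indicator_def ennreal_power power2_eq_square algebra_simps)
  show "0 \<le> Beta (1 / 2) ((real N + 1) / 2)" using Beta_half_pos[of N] by simp
 qed (auto simp: indicator_def abs_square_le_1 abs_le_iff)
 moreover have "N - 1 = Suc (N - 2)" using N(2) by simp
 then have "(\<lambda>t. indicator {-1..1} t * sqrt (1 - t\<^sup>2) ^ (N - 1)) = (\<lambda>t. if t \<in> {-1..1} then sqrt (1 - t\<^sup>2) * W t else 0)"
  by (simp add: fun_eq_iff W_def)
 ultimately have "((\<lambda>t. if t \<in> {-1..1} then sqrt (1 - t\<^sup>2) * W t else 0) has_integral Beta (1 / 2) ((real N + 1) / 2)) UNIV"
  by (simp only:)
 then have "integral {-1..1} (\<lambda>t. sqrt (1 - t\<^sup>2) * W t) = Beta (1 / 2) ((real N + 1) / 2)"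
  unfolding has_integral_restrict_UNIV by (rule integral_unique)
 then have 2: "(LINT y|P. sine (e1, y)) * w = Beta (1 / 2) ((real N + 1) / 2)"
  unfolding sine_def fst_conv snd_conv s by (subst m) (auto intro!: continuous_intros)
 have "w \<noteq> 0" using 1 N(2) by auto
 then have "\<kappa> = ((LINT y|P. \<bar>e1 \<bullet> y\<bar>) * w) / ((LINT y|P. sine (e1, y)) * w)"
  by (simp add: kappa_alt[OF e12(4)])
 also have "\<dots> = k_const N" unfolding 1 2 using sphere_area_Beta[OF N(2)] by simp
 finally show ?thesis .
qed

end

lemma kappa_sphere:
 assumes "2 \<le> CARD('n)"
 shows "rotation_invariant_prob.\<kappa> (sphere_prob :: ((real^'n) \<times> real) measure) = k_const CARD('n)"
 using assms by (intro rotation_invariant_prob.kappa_eq[OF rotation_invariant_sphere_prob]) simp_all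

text \<open>At a minimum s of p the Gegenbauer operator applied to p is nonnegative, so p(s) is at
  least the value of \<open>helm\<close> there. In the interior this is the second derivative test;
  at the end points the second-order term degenerates and the sign of the first derivative
  decides.\<close>

lemma helm_max_principle:
 assumes n: "n \<ge> 0" and nn: "\<And>t. -1 \<le> t ==> t \<le> 1 ==> 0 \<le> poly (helm eps n p) t"
  and t: "-1 \<le> t" "t \<le> 1"
 shows "0 \<le> poly p t"
proof -
 obtain s where s: "s \<in> {-1..1}" and min: "\<And>t. t \<in> {-1..1} ==> poly p s \<le> poly p t"
 proof -
  have "\<exists>s\<in>{-1..1}. \<forall>t\<in>{-1..1}. poly p s \<le> poly p t"
   by (rule continuous_attains_inf) (auto intro!: continuous_intros)
  then show ?thesis using that by blast
 qed
 have h: "0 \<le> poly p s - eps\<^sup>2 * ((1 - s\<^sup>2) * poly (pderiv (pderiv p)) s - n * s * poly (pderiv p) s)"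
  using nn[of s] s by (simp add: poly_helm)
 have "eps\<^sup>2 * ((1 - s\<^sup>2) * poly (pderiv (pderiv p)) s - n * s * poly (pderiv p) s) \<ge> 0"
 proof (rule mult_nonneg_nonneg)
  consider "s = 1" | "s = -1" | "-1 < s" "s < 1" using s by force
  then show "0 \<le> (1 - s\<^sup>2) * poly (pderiv (pderiv p)) s - n * s * poly (pderiv p) s"
  proof cases
   case 1
   have "poly (pderiv p) 1 \<le> 0"
   proof (rule ccontr)
    assume "\<not> ?thesis"
    then have "poly (pderiv p) 1 > 0" by simp
    from DERIV_pos_inc_left[OF poly_DERIV this] obtain d where "d > 0" "\<And>h. h > 0 ==> h < d ==> poly p (1 - h) < poly p 1"
     by blast
    note d = this
    define k where "k = min (d / 2) 1"
    have k: "0 < k" "k < d" "k \<le> 1" using d(1) by (auto simp: k_def)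
    show False using d(2)[OF k(1,2)] min[of "1 - k"] k 1 by simp
   qed
   then show ?thesis using n 1 by (simp add: mult_nonneg_nonpos)
  next
   case 2
   have "poly (pderiv p) (-1) \<ge> 0"
   proof (rule ccontr)
    assume "\<not> ?thesis"
    then have "poly (pderiv p) (-1) < 0" by simp
    from DERIV_neg_dec_right[OF poly_DERIV this] obtain d where "d > 0" "\<And>h. h > 0 ==> h < d ==> poly p (-1 + h) < poly p (-1)"
     by blast
    note d = this
    define k where "k = min (d / 2) 1"
    have k: "0 < k" "k < d" "k \<le> 1" using d(1) by (auto simp: k_def)
    show False using d(2)[OF k(1,2)] min[of "-1 + k"] k 2 by simp
   qed
   then show ?thesis using n 2 by simp
  next
   case 3
   have z: "poly (pderiv p) s = 0"
   proof (rule DERIV_local_min[OF poly_DERIV])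
    show "0 < min (s + 1) (1 - s)" using 3 by simp
    show "\<forall>y. \<bar>s - y\<bar> < min (s + 1) (1 - s) \<longrightarrow> poly p s \<le> poly p y"
     using min 3 by (auto simp: abs_if split: if_splits)
   qed
   have "poly (pderiv (pderiv p)) s \<ge> 0"
   proof (rule ccontr)
    assume "\<not> ?thesis"
    then have "poly (pderiv (pderiv p)) s < 0" by simp
    from DERIV_neg_dec_right[OF poly_DERIV this] obtain d where d: "d > 0" "\<And>h. h > 0 ==> h < d ==> poly (pderiv p) (s + h) < poly (pderiv p) s"
     by blast
    define k where "k = min (d / 2) (1 - s)"
    have k: "0 < k" "k < d" "s + k \<le> 1" using d(1) 3 by (auto simp: k_def)
    obtain r where r: "s < r" "r < s + k" "poly p (s + k) - poly p s = (s + k - s) * poly (pderiv p) r"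
     using MVT2[of s "s + k" "poly p" "\<lambda>r. poly (pderiv p) r"] k by auto
    have "poly (pderiv p) r < 0" using d(2)[of "r - s"] r k z by simp
    then have "k * poly (pderiv p) r < 0" using k by (intro mult_pos_neg) auto
    then have "poly p (s + k) < poly p s" using r(3) by simp
    moreover have "poly p s \<le> poly p (s + k)" using min[of "s + k"] k 3 by simp
    ultimately show False by simp
   qed
   moreover have "s\<^sup>2 \<le> 1" using 3 by (simp add: abs_square_le_1)
   ultimately show ?thesis using z by simp
  qed
 qed simp
 with h min[of t] t show ?thesis by simp
qed

section \<open>Functions determined by their moments\<close>

context rotation_invariant_prob begin

lemma integrable_mult_continuous:
 fixes D f :: "'a => real"
 assumes D: "integrable P D" and f: "continuous_on UNIV f"
 shows "integrable P (\<lambda>x. D x * f x)"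
proof -
 have "bounded (f ` cball 0 1)"
  by (intro compact_imp_bounded compact_continuous_image continuous_on_subset[OF f]) auto
 then obtain B where "\<forall>x\<in>cball 0 1. \<bar>f x\<bar> \<le> B" by (auto simp: bounded_iff)
 then have B: "\<And>x. norm x \<le> 1 ==> \<bar>f x\<bar> \<le> B" by auto
 have [measurable]: "f \<in> borel_measurable P"
  using borel_measurable_continuous_onI[OF f] by (simp add: measurable_P)
 have [measurable]: "D \<in> borel_measurable P" using D by (rule borel_measurable_integrable)
 show ?thesis
 proof (rule Bochner_Integration.integrable_bound)
  show "integrable P (\<lambda>x. B * D x)" using D by simp
  show "AE x in P. norm (D x * f x) \<le> norm (B * D x)"
   using AE_norm_le
  proof eventually_elim
   case (elim x)
   have "\<bar>f x\<bar> \<le> \<bar>B\<bar>" using B[OF elim] by linarith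
   then show ?case using mult_right_mono[of "\<bar>f x\<bar>" "\<bar>B\<bar>" "\<bar>D x\<bar>"] by (simp add: abs_mult mult.commute)
  qed
 qed measurable
qed

text \<open>With a bump function \<open>f\<close> around \<open>x\<close> this localises integral
  identities: a pointwise sign of \<open>D\<close> gives a strict integral inequality, as small
  balls have positive mass.\<close>

lemma integral_mult_negative:
 fixes D f :: "'a => real"
 assumes D: "integrable P D" and f: "continuous_on UNIV f"
  and nn: "\<And>x. f x \<ge> 0" and neg: "\<And>x. norm x = 1 ==> f x > 0 ==> D x < 0"
  and x: "norm x = 1" "f x > 0"
 shows "(LINT x|P. D x * f x) < 0"
proof -
 have i: "integrable P (\<lambda>x. - (D x * f x))" using integrable_mult_continuous[OF D f] by simp
 have np: "AE x in P. 0 \<le> - (D x * f x)"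
  using AE_norm
 proof eventually_elim
  case (elim x)
  then show ?case using neg[of x] nn[of x] by (cases "f x = 0") (auto simp: mult_nonpos_nonneg)
 qed
 have "(LINT x|P. - (D x * f x)) \<noteq> 0"
 proof
  assume "(LINT x|P. - (D x * f x)) = 0"
  then have "AE x in P. - (D x * f x) = 0" using integral_nonneg_eq_0_iff_AE[OF i np] by simp
  then have "AE x in P. \<not> f x > 0"
   using AE_norm
  proof eventually_elim
   case (elim x)
   then show ?case using neg[of x] by auto
  qed
  moreover have "open {x. f x > 0}" using f by (intro open_Collect_less) auto
  then obtain \<delta> where "\<delta> > 0" "ball x \<delta> \<subseteq> {x. f x > 0}" using x(2) by (auto simp: open_contains_ball)
  ultimately have "AE x' in P. x' \<notin> ball x \<delta>" by (auto elim!: eventually_mono)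
  then have "emeasure P (ball x \<delta>) = 0"
   by (subst (asm) AE_iff_measurable[of "ball x \<delta>"]) auto
  then show False using emeasure_ball_pos[OF x(1) \<open>\<delta> > 0\<close>] by simp
 qed
 moreover have "(LINT x|P. - (D x * f x)) \<ge> 0" by (rule integral_nonneg_AE[OF np])
 ultimately show ?thesis by simp
qed

text \<open>Polarisation: \<open>J\<close> consists of the p for which D p has vanishing ridge
  moments. It contains 1 and is closed under multiplication by linear functions, hence contains
  every polynomial.\<close>

lemma ridge_moments_imp_poly:
 fixes D :: "'a => real"
 assumes D: "integrable P D"
  and mom: "\<And>z k. norm z = 1 ==> (LINT x|P. D x * (x \<bullet> z) ^ k) = 0"
  and q: "real_polynomial_function q"
 shows "(LINT x|P. D x * q x) = 0"
proof -
 define J where "J = {p :: 'a => real. continuous_on UNIV p \<and> (\<forall>z k. (LINT x|P. D x * (p x * (x \<bullet> z) ^ k)) = 0)}"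
 have int: "integrable P (\<lambda>x. D x * f x)" if "continuous_on UNIV f" for f :: "'a => real"
  by (rule integrable_mult_continuous[OF D that])
 have "continuous_on UNIV (\<lambda>x::'a. 1::real)" by simp
 have one: "(\<lambda>x. 1) \<in> J"
 proof -
  have "(LINT x|P. D x * (x \<bullet> z) ^ k) = 0" for z k
  proof (cases "z = 0")
   case False
   have "(LINT x|P. D x * (x \<bullet> z) ^ k) = (LINT x|P. norm z ^ k * (D x * (x \<bullet> (z /\<^sub>R norm z)) ^ k))"
    using False by (intro Bochner_Integration.integral_cong refl) (simp add: power_mult_distrib field_simps)
   also have "\<dots> = 0" using mom[of "z /\<^sub>R norm z" k] False by simp
   finally show ?thesis .
  next
   case True
   have "(LINT x|P. D x) = 0" using mom[of e1 0] e12 by simp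
   then show ?thesis using True by (cases k) auto
  qed
  then show ?thesis by (simp add: J_def)
 qed
 have mult: "(\<lambda>x. p x * (x \<bullet> b)) \<in> J" if p: "p \<in> J" for p b
 proof -
  have pc: "continuous_on UNIV p" using p by (simp add: J_def)
  have "(LINT x|P. D x * (p x * (x \<bullet> b) * (x \<bullet> z) ^ k)) = 0" for z k
  proof -
   \<comment> \<open>The coefficients in t of the moment of degree k + 1 in direction t b + z; that
     of t^1 is k + 1 times the moment with the extra linear factor.\<close>
   define c where "c j = real (Suc k choose j) * (LINT x|P. D x * (p x * ((x \<bullet> b) ^ j * (x \<bullet> z) ^ (Suc k - j))))" for j
   have "(\<Sum>j\<le>Suc k. c j * t ^ j) = 0" for t
   proof -
    have "(LINT x|P. D x * (p x * (x \<bullet> (t *\<^sub>R b + z)) ^ Suc k))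
      = (LINT x|P. (\<Sum>j\<le>Suc k. (real (Suc k choose j) * t ^ j) * (D x * (p x * ((x \<bullet> b) ^ j * (x \<bullet> z) ^ (Suc k - j))))))"
     by (intro Bochner_Integration.integral_cong refl)
      (simp only: inner_add_right inner_scaleR_right binomial_ring sum_distrib_left power_mult_distrib mult_ac)
    also have "\<dots> = (\<Sum>j\<le>Suc k. (real (Suc k choose j) * t ^ j) * (LINT x|P. D x * (p x * ((x \<bullet> b) ^ j * (x \<bullet> z) ^ (Suc k - j)))))"
     by (subst Bochner_Integration.integral_sum)
      (auto intro!: integrable_mult_right int continuous_intros pc simp del: sum.atMost_Suc)
    also have "\<dots> = (\<Sum>j\<le>Suc k. c j * t ^ j)" by (intro sum.cong refl) (simp only: c_def mult_ac)
    finally show ?thesis using p by (simp add: J_def del: power_Suc sum.atMost_Suc)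
   qed
   then have "c 1 = 0" using polyfun_eq_0[of c "Suc k"] by simp
   then show ?thesis by (simp add: c_def mult_ac)
  qed
  then show ?thesis using pc by (auto simp: J_def intro!: continuous_intros)
 qed
 have add: "(\<lambda>x. p x + r x) \<in> J" if "p \<in> J" "r \<in> J" for p r
 proof -
  have c: "continuous_on UNIV (\<lambda>x. p x * (x \<bullet> z) ^ k)" "continuous_on UNIV (\<lambda>x. r x * (x \<bullet> z) ^ k)" for z k
   using that by (auto simp: J_def intro!: continuous_intros)
  show ?thesis using that by (auto simp: J_def distrib_right distrib_left Bochner_Integration.integral_add[OF int[OF c(1)] int[OF c(2)]] intro!: continuous_intros)
 qed
 have cmult: "(\<lambda>x. p x * c) \<in> J" if "p \<in> J" for p and c :: real
 proof -
  have "(LINT x|P. D x * (p x * c * (x \<bullet> z) ^ k)) = c * (LINT x|P. D x * (p x * (x \<bullet> z) ^ k))" for z k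
   by (subst integral_mult_right_zero[symmetric]) (simp only: mult_ac)
  then show ?thesis using that by (auto simp: J_def intro!: continuous_intros)
 qed
 have "\<forall>p\<in>J. (\<lambda>x. p x * q x) \<in> J"
  using q
 proof induction
  case (linear f)
  have "linear f" using linear by (rule bounded_linear.linear)
  then have "f x = x \<bullet> adjoint f 1" for x using adjoint_works[of f x 1] by simp
  then show ?case using mult by simp
 next
  case (const c)
  then show ?case using cmult by simp
 next
  case (add f g)
  show ?case
  proof
   fix p assume "p \<in> J"
   then have "(\<lambda>x. p x * f x + p x * g x) \<in> J" using add.IH \<open>\<And>p r. p \<in> J ==> r \<in> J ==> (\<lambda>x. p x + r x) \<in> J\<close> by simp
   then show "(\<lambda>x. p x * (f x + g x)) \<in> J" by (simp add: distrib_left)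
  qed
 next
  case (mult f g)
  show ?case
  proof
   fix p assume "p \<in> J"
   then have "(\<lambda>x. p x * f x * g x) \<in> J" using mult.IH by auto
   then show "(\<lambda>x. p x * (f x * g x)) \<in> J" by (simp add: mult.assoc)
  qed
 qed
 from bspec[OF this one] have "q \<in> J" by simp
 then have "(LINT x|P. D x * (q x * (x \<bullet> e1) ^ 0)) = 0" unfolding J_def by blast
 then show ?thesis by simp
qed

lemma polynomial_moments_imp_continuous:
 fixes D f :: "'a => real"
 assumes D: "integrable P D"
  and mom: "\<And>q. real_polynomial_function q ==> (LINT x|P. D x * q x) = 0"
  and f: "continuous_on UNIV f"
 shows "(LINT x|P. D x * f x) = 0"
proof -
 have "\<bar>(LINT x|P. D x * f x)\<bar> \<le> 0 + e * (LINT x|P. \<bar>D x\<bar>)" if e: "e > 0" for e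
 proof -
  obtain q where q: "real_polynomial_function q" "\<And>x. x \<in> cball 0 1 ==> \<bar>f x - q x\<bar> < e"
   using Stone_Weierstrass_real_polynomial_function[OF compact_cball continuous_on_subset[OF f subset_UNIV] e] by blast
  have i: "integrable P (\<lambda>x. D x * f x)" "integrable P (\<lambda>x. D x * q x)"
   by (intro integrable_mult_continuous[OF D] f continuous_on_real_polynomial q)+
  have "\<bar>(LINT x|P. D x * f x)\<bar> = \<bar>(LINT x|P. D x * f x - D x * q x)\<bar>"
   using i mom[OF q(1)] by simp
  also have "\<dots> \<le> (LINT x|P. \<bar>D x * f x - D x * q x\<bar>)" by (rule integral_abs_bound)
  also have "\<dots> \<le> (LINT x|P. e * \<bar>D x\<bar>)"
  proof (rule integral_mono_AE)
   show "AE x in P. \<bar>D x * f x - D x * q x\<bar> \<le> e * \<bar>D x\<bar>"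
    using AE_norm_le
   proof eventually_elim
    case (elim x)
    then have "\<bar>f x - q x\<bar> \<le> e" using q(2)[of x] by auto
    then have "\<bar>D x\<bar> * \<bar>f x - q x\<bar> \<le> \<bar>D x\<bar> * e" by (intro mult_left_mono) auto
    then show ?case by (simp add: right_diff_distrib[symmetric] abs_mult mult.commute)
   qed
  qed (use i D in auto)
  finally show ?thesis by simp
 qed
 note b = this
 have "\<bar>(LINT x|P. D x * f x)\<bar> \<le> 0"
  by (rule le_of_all_eps[where M = "LINT x|P. \<bar>D x\<bar>"]) (rule b)
 then show ?thesis by simp
qed

end

section \<open>Rotation invariance and positivity of the kernel\<close>

text \<open>The kernel relative to the normalised measure. The weak equation is recorded for ridge
  polynomials, and the value 0 on the diagonal lets invariance and positivity hold at every pair of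
  points.\<close>

locale sphere_green = rotation_invariant_prob P for P :: "'a::euclidean_space measure" +
 fixes G :: "'a => 'a => real" and eps n :: real
 assumes n_eq: "n = real (DIM('a) - 1)"
  and eps_pos: "eps > 0"
  and G_measurable: "(\<lambda>u. G (fst u) (snd u)) \<in> borel_measurable borel2"
  and G_integrable: "norm y = 1 ==> integrable P (\<lambda>x. G x y)"
  and green_ridge: "norm y = 1 ==> norm z = 1 ==>
   (LINT x|P. G x y * poly (helm eps n p) (x \<bullet> z)) = poly p (y \<bullet> z)"
  and G_cont: "continuous_on {u. norm (fst u) = 1 \<and> norm (snd u) = 1 \<and> fst u \<noteq> snd u} (\<lambda>u. G (fst u) (snd u))"
  and G_diag: "norm x = 1 ==> G x x = 0"
begin

lemma n_ge_1: "n \<ge> 1"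
 using DIM_ge_2 by (simp add: n_eq)

lemma n_nonneg: "0 \<le> n"
 using n_ge_1 by simp

lemma G_comp [measurable]:
 assumes "f \<in> borel_measurable M" "g \<in> borel_measurable M"
 shows "(\<lambda>x. G (f x) (g x)) \<in> borel_measurable M"
 using measurable_compose[OF measurable_Pair[OF assms] G_measurable] by simp

lemma integral_G: "norm y = 1 ==> (LINT x|P. G x y) = 1"
 using green_ridge[of y y 1] by (simp add: poly_helm)

text \<open>Write q as \<open>helm eps n p\<close>: both moments are then the value of p at the same
  inner product.\<close>

lemma G_rotation_integral:
 assumes h: "orthogonal_transformation h" and y: "norm y = 1" and z: "norm z = 1"
 shows "(LINT x|P. G (h x) (h y) * poly q (x \<bullet> z)) = (LINT x|P. G x y * poly q (x \<bullet> z))"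
proof -
 obtain p where p: "helm eps n p = q" using helm_surj[OF n_nonneg] by blast
 have hi: "h x \<bullet> h w = x \<bullet> w" for x w using h by (simp add: orthogonal_transformation_def)
 have "poly q \<in> borel_measurable borel"
  by (intro borel_measurable_continuous_onI continuous_intros)
 note [measurable] = this
 have n: "norm (h y) = 1" "norm (h z) = 1" using h y z by (simp_all add: orthogonal_transformation_norm)
 have "(LINT x|P. G (h x) (h y) * poly q (x \<bullet> z)) = (LINT x|P. G (h x) (h y) * poly q (h x \<bullet> h z))"
  by (simp only: hi)
 also have "\<dots> = (LINT x|P. G x (h y) * poly q (x \<bullet> h z))"
  by (rule integral_invariant[OF h, of "\<lambda>x. G x (h y) * poly q (x \<bullet> h z)"]) measurable
 also have "\<dots> = poly p (y \<bullet> z)" using green_ridge[OF n, of p] by (simp only: p hi)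
 also have "\<dots> = (LINT x|P. G x y * poly q (x \<bullet> z))" using green_ridge[OF y z, of p] by (simp only: p)
 finally show ?thesis .
qed

lemma G_fst_continuous:
 assumes y: "norm y = 1" and x: "norm x = 1" "x \<noteq> y" and e: "e > 0"
 obtains r where "r > 0" "\<And>x'. norm x' = 1 ==> dist x' x < r ==> \<bar>G x' y - G x y\<bar> < e"
proof -
 obtain d where d: "d > 0" "\<And>u. norm (fst u) = 1 \<and> norm (snd u) = 1 \<and> fst u \<noteq> snd u ==> dist u (x, y) < d ==>
   \<bar>G (fst u) (snd u) - G x y\<bar> < e"
 proof -
  have "(x, y) \<in> {u. norm (fst u) = 1 \<and> norm (snd u) = 1 \<and> fst u \<noteq> snd u}" using assms by simp
  from G_cont[unfolded continuous_on_iff, rule_format, OF this e] show ?thesis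
   using that by (auto simp: dist_real_def)
 qed
 show ?thesis
 proof (rule that)
  show "min d (dist x y) > 0" using d(1) x by simp
  fix x' assume x': "norm x' = 1" "dist x' x < min d (dist x y)"
  then have "x' \<noteq> y" by (auto simp: dist_commute)
  then show "\<bar>G x' y - G x y\<bar> < e" using d(2)[of "(x', y)"] x' y by (simp add: dist_Pair_Pair)
 qed
qed

text \<open>The difference \<open>D\<close> is orthogonal to all ridge polynomials, hence to all
  continuous functions. It is continuous away from x = y, so a bump at a point where it does not
  vanish gives a contradiction.\<close>

lemma G_rotation:
 assumes h: "orthogonal_transformation h" and x: "norm x = 1" and y: "norm y = 1"
 shows "G (h x) (h y) = G x y"
proof (cases "x = y")
 case True
 then show ?thesis using G_diag[of "h x"] G_diag[of x] x h by (simp add: orthogonal_transformation_norm)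
next
 case False
 have nh: "norm (h w) = norm w" for w using h by (rule orthogonal_transformation_norm)
 have hy: "norm (h y) = 1" using y nh by simp
 have hd: "dist (h a) (h b) = dist a b" for a b
  using nh[of "a - b"] linear_diff[OF orthogonal_transformation_linear[OF h]] by (simp add: dist_norm)
 have [measurable]: "h \<in> borel_measurable borel" by (rule orthogonal_transformation_measurable[OF h])
 define D where "D x = G (h x) (h y) - G x y" for x
 have i1: "integrable P (\<lambda>x. G (h x) (h y))"
 proof -
  have "integrable (distr P borel h) (\<lambda>x. G x (h y))" using G_integrable[OF hy] by (simp add: invariant[OF h])
  then show ?thesis
   by (subst (asm) integrable_distr_eq) (auto simp: measurable_P)
 qed
 have D: "integrable P D" unfolding D_def[abs_def] using i1 G_integrable[OF y] by simp
 have cpoly: "continuous_on UNIV (\<lambda>x::'a. poly q (x \<bullet> z))" for q z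
  by (intro continuous_intros)
 have mom: "(LINT x|P. D x * (x \<bullet> z) ^ k) = 0" if z: "norm z = 1" for z k
 proof -
  have "(LINT x|P. D x * poly (monom 1 k) (x \<bullet> z))
    = (LINT x|P. G (h x) (h y) * poly (monom 1 k) (x \<bullet> z)) - (LINT x|P. G x y * poly (monom 1 k) (x \<bullet> z))"
   unfolding D_def left_diff_distrib
   by (rule Bochner_Integration.integral_diff; intro integrable_mult_continuous i1 G_integrable y cpoly)
  then show ?thesis unfolding G_rotation_integral[OF h y z] by (simp add: poly_monom)
 qed
 have zero: "(LINT x|P. D x * f x) = 0" if "continuous_on UNIV f" for f :: "'a => real"
  by (rule polynomial_moments_imp_continuous[OF D ridge_moments_imp_poly[OF D mom] that])
 show ?thesis
 proof (rule ccontr)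
  assume ne: "G (h x) (h y) \<noteq> G x y"
  define e where "e = \<bar>D x\<bar> / 2"
  have e: "e > 0" using ne by (simp add: e_def D_def)
  obtain r1 where r1: "r1 > 0" "\<And>x'. norm x' = 1 ==> dist x' x < r1 ==> \<bar>G x' y - G x y\<bar> < e"
   using G_fst_continuous[OF y x False e] by blast
  have "h x \<noteq> h y" using hd[of x y] False by auto
  then obtain r2 where r2: "r2 > 0" "\<And>x'. norm x' = 1 ==> dist x' (h x) < r2 ==> \<bar>G x' (h y) - G (h x) (h y)\<bar> < e"
   using G_fst_continuous[OF hy _ _ e, of "h x"] x nh by auto
  define r where "r = min r1 r2"
  have close: "\<bar>D x' - D x\<bar> < \<bar>D x\<bar>" if "norm x' = 1" "dist x' x < r" for x'
  proof -
   have "\<bar>G x' y - G x y\<bar> < e" using that by (intro r1(2)) (auto simp: r_def)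
   moreover have "\<bar>G (h x') (h y) - G (h x) (h y)\<bar> < e" using that nh[of x'] hd[of x' x] by (intro r2(2)) (auto simp: r_def)
   moreover have "2 * e = \<bar>D x\<bar>" by (simp add: e_def)
   ultimately show ?thesis by (simp add: D_def)
  qed
  define f where "f x' = max 0 (r - dist x' x)" for x'
  have f: "continuous_on UNIV f" unfolding f_def by (intro continuous_intros)
  have fpos: "f x' > 0 \<longleftrightarrow> dist x' x < r" for x' by (auto simp: f_def max_def)
  have fx: "f x > 0" using r1 r2 by (simp add: f_def r_def)
  consider "D x < 0" | "D x > 0" using ne by (force simp: D_def)
  then show False
  proof cases
   case 1
   have "(LINT x|P. D x * f x) < 0"
   proof (rule integral_mult_negative[OF D f _ _ x fx])
    show "D x' < 0" if "norm x' = 1" "f x' > 0" for x'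
     using close[OF that(1)] that(2) 1 by (simp add: fpos abs_if split: if_splits)
   qed (simp add: f_def)
   then show False using zero[OF f] by simp
  next
   case 2
   have D': "integrable P (\<lambda>x. - D x)" using D by simp
   have "(LINT x|P. - D x * f x) < 0"
   proof (rule integral_mult_negative[OF D' f _ _ x fx])
    show "- D x' < 0" if "norm x' = 1" "f x' > 0" for x'
     using close[OF that(1)] that(2) 2 by (simp add: fpos abs_if split: if_splits)
   qed (simp add: f_def)
   then show False using zero[OF f] by simp
  qed
 qed
qed

lemma G_zonal:
 assumes "norm x = 1" "norm y = 1" "norm x' = 1" "norm y' = 1" "x \<bullet> y = x' \<bullet> y'"
 shows "G x y = G x' y'"
proof -
 obtain h where "orthogonal_transformation h" "h x = x'" "h y = y'"
  using orthogonal_transformation_pair[of x x' y y'] assms by auto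
 then show ?thesis using G_rotation[of h x y] assms by simp
qed

text \<open>Solve the one-dimensional equation with a polynomial right-hand side close to F; its
  integral is the solution at t = 1, nonnegative by the maximum principle.\<close>

lemma integral_zonal_nonneg:
 assumes y: "norm y = 1" and F: "continuous_on {-1..1} F" and nn: "\<And>t. -1 \<le> t ==> t \<le> 1 ==> 0 \<le> F t"
  and Fm: "F \<in> borel_measurable borel"
 shows "0 \<le> (LINT x|P. G x y * F (x \<bullet> y))"
proof -
 have iG: "integrable P (\<lambda>x. G x y)" by (rule G_integrable[OF y])
 have xy: "-1 \<le> x \<bullet> y" "x \<bullet> y \<le> 1" if "norm x = 1" for x
  using Cauchy_Schwarz_ineq2[of x y] that y by (auto simp: abs_le_iff)
 have "0 \<le> (LINT x|P. G x y * F (x \<bullet> y)) + e * (1 + (LINT x|P. \<bar>G x y\<bar>))" if e: "e > 0" for e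
 proof -
  \<comment> \<open>The shift by \<open>e\<close> makes the approximating polynomial itself
    nonnegative.\<close>
  have "continuous_on {-1..1} (\<lambda>t. F t + e)" by (intro continuous_intros F)
  from poly_approximation[OF this e] obtain q where q: "\<And>t. -1 \<le> t ==> t \<le> 1 ==> \<bar>F t + e - poly q t\<bar> < e"
   by blast
  have q0: "0 \<le> poly q t" if "-1 \<le> t" "t \<le> 1" for t
   using q[OF that] nn[OF that] by linarith
  obtain p where p: "helm eps n p = q" using helm_surj[OF n_nonneg] by blast
  have "0 \<le> poly p 1" using helm_max_principle[OF n_nonneg, of eps p 1] q0 by (simp add: p)
  moreover have "y \<bullet> y = 1" using y by (simp add: norm_eq_1)
  ultimately have pos: "0 \<le> (LINT x|P. G x y * poly q (x \<bullet> y))" using green_ridge[OF y y, of p] by (simp add: p)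
  have [measurable]: "poly q \<in> borel_measurable borel" "F \<in> borel_measurable borel"
   by (intro borel_measurable_continuous_onI continuous_intros) (rule Fm)
  have iq: "integrable P (\<lambda>x. G x y * poly q (x \<bullet> y))"
   by (intro integrable_mult_continuous iG continuous_intros)
  have bound: "AE x in P. \<bar>G x y * poly q (x \<bullet> y) - G x y * F (x \<bullet> y)\<bar> \<le> 2 * e * \<bar>G x y\<bar>"
   using AE_norm
  proof eventually_elim
   case (elim x)
   then have "\<bar>poly q (x \<bullet> y) - F (x \<bullet> y)\<bar> \<le> 2 * e" using q[of "x \<bullet> y"] xy[of x] by auto
   from mult_left_mono[OF this, of "\<bar>G x y\<bar>"]
   show ?case by (simp add: right_diff_distrib[symmetric] abs_mult mult_ac)
  qed
  have id: "integrable P (\<lambda>x. G x y * poly q (x \<bullet> y) - G x y * F (x \<bullet> y))"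
   by (rule Bochner_Integration.integrable_bound[of _ "\<lambda>x. 2 * e * \<bar>G x y\<bar>"])
    (use iG bound e in \<open>auto simp: abs_mult measurable_P\<close>)
  have iF: "integrable P (\<lambda>x. G x y * F (x \<bullet> y))"
   using Bochner_Integration.integrable_diff[OF iq id] by simp
  have bound': "AE x in P. G x y * poly q (x \<bullet> y) \<le> G x y * F (x \<bullet> y) + e * G x y + e * \<bar>G x y\<bar>"
   using AE_norm
  proof eventually_elim
   case (elim x)
   then have "\<bar>poly q (x \<bullet> y) - (F (x \<bullet> y) + e)\<bar> \<le> e" using q[of "x \<bullet> y"] xy[of x] by auto
   from mult_left_mono[OF this, of "\<bar>G x y\<bar>"]
   have "\<bar>G x y * (poly q (x \<bullet> y) - (F (x \<bullet> y) + e))\<bar> \<le> e * \<bar>G x y\<bar>" by (simp add: abs_mult mult_ac)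
   then show ?case by (simp add: algebra_simps abs_le_iff)
  qed
  have "(LINT x|P. G x y * poly q (x \<bullet> y)) \<le> (LINT x|P. G x y * F (x \<bullet> y) + e * G x y + e * \<bar>G x y\<bar>)"
   using iq iF iG bound' by (intro integral_mono_AE) auto
  also have "\<dots> = (LINT x|P. G x y * F (x \<bullet> y)) + e * (LINT x|P. G x y) + e * (LINT x|P. \<bar>G x y\<bar>)"
   using iF iG by simp
  finally show ?thesis using pos integral_G[OF y] by (simp add: algebra_simps)
 qed
 note b = this
 show ?thesis
  by (rule le_of_all_eps[where M = "1 + (LINT x|P. \<bar>G x y\<bar>)"]) (rule b)
qed

text \<open>By zonality and continuity a negative value spreads over a whole band of points with
  nearly the same height over \<open>y\<close>; a bump in the height then contradicts
  \<open>integral_zonal_nonneg\<close>.\<close>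

lemma G_nonneg:
 assumes x: "norm x = 1" and y: "norm y = 1"
 shows "0 \<le> G x y"
proof (rule ccontr)
 assume neg: "\<not> ?thesis"
 then have ne: "x \<noteq> y" using G_diag[OF x] by auto
 define t where "t = x \<bullet> y"
 obtain w where w: "norm w = 1" "w \<bullet> y = 0"
 proof (rule that)
  have o: "orthogonal_transformation (reflect (e1 - y))" by (rule orthogonal_transformation_reflect)
  have "reflect (e1 - y) e1 = y" using y e12 by (intro reflect_diff) simp
  moreover have "reflect (e1 - y) e2 \<bullet> reflect (e1 - y) e1 = e2 \<bullet> e1"
   using o by (simp add: orthogonal_transformation_def)
  ultimately show "reflect (e1 - y) e2 \<bullet> y = 0" using e12 by (simp add: inner_commute)
  show "norm (reflect (e1 - y) e2) = 1" using orthogonal_transformation_norm[OF o] e12 by simp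
 qed
 \<comment> \<open>A meridian through \<open>y\<close> parametrised by height: continuity of the
   kernel is used along it, and zonality carries the result to every other point of the same
   height.\<close>
 define c where "c s = s *\<^sub>R y + sqrt (1 - s\<^sup>2) *\<^sub>R w" for s
 have t: "-1 \<le> t" "t \<le> 1" using Cauchy_Schwarz_ineq2[of x y] x y by (auto simp: t_def abs_le_iff)
 have yy: "y \<bullet> y = 1" "w \<bullet> w = 1" "x \<bullet> x = 1" using x y w by (simp_all add: norm_eq_1)
 have cy: "c s \<bullet> y = s" for s by (simp add: c_def inner_add_left yy w)
 have cn: "norm (c s) = 1" if "\<bar>s\<bar> \<le> 1" for s
 proof -
  have "s\<^sup>2 \<le> 1" using that by (simp add: abs_square_le_1)
  then have "c s \<bullet> c s = 1"
   by (simp add: c_def inner_add_left inner_add_right yy w inner_commute[of y w] power2_eq_square[symmetric])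
  then show ?thesis by (simp add: norm_eq_1)
 qed
 have ct: "norm (c t) = 1" using cn t by (simp add: abs_le_iff)
 have Gct: "G (c t) y = G x y" using ct x y by (intro G_zonal) (simp_all add: cy t_def)
 have "c t \<noteq> y"
 proof
  assume "c t = y"
  then have "t = 1" using cy[of t] yy by simp
  then have "(x - y) \<bullet> (x - y) = 0" by (simp add: t_def inner_diff_left inner_diff_right yy inner_commute)
  then show False using ne by simp
 qed
 moreover have "- G x y > 0" using neg by simp
 ultimately obtain r where r: "r > 0" "\<And>x'. norm x' = 1 ==> dist x' (c t) < r ==> \<bar>G x' y - G (c t) y\<bar> < - G x y"
  using G_fst_continuous[OF y ct] by blast
 have "isCont c t" unfolding c_def by (intro continuous_intros)
 then obtain \<delta> where \<delta>: "\<delta> > 0" "\<And>s. \<bar>s - t\<bar> < \<delta> ==> dist (c s) (c t) < r"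
  using r(1) unfolding continuous_at_eps_delta by (auto simp: dist_real_def dist_norm)
 define F where "F s = max 0 (\<delta> - \<bar>s - t\<bar>)" for s
 have F: "continuous_on A F" for A unfolding F_def by (intro continuous_intros)
 have "0 \<le> (LINT x|P. G x y * F (x \<bullet> y))"
  using borel_measurable_continuous_onI[OF F] by (intro integral_zonal_nonneg[OF y F]) (auto simp: F_def)
 moreover have "(LINT x|P. G x y * F (x \<bullet> y)) < 0"
 proof (rule integral_mult_negative[OF G_integrable[OF y] _ _ _ x])
  show "continuous_on UNIV (\<lambda>x. F (x \<bullet> y))" unfolding F_def by (intro continuous_intros)
  show "F (x \<bullet> y) > 0" using \<delta> by (simp add: F_def t_def)
  show "G x' y < 0" if "norm x' = 1" "F (x' \<bullet> y) > 0" for x'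
  proof -
   have s: "\<bar>x' \<bullet> y\<bar> \<le> 1" using Cauchy_Schwarz_ineq2[of x' y] that y by simp
   have "\<bar>x' \<bullet> y - t\<bar> < \<delta>" using that(2) by (auto simp: F_def)
   then have "\<bar>G (c (x' \<bullet> y)) y - G (c t) y\<bar> < - G x y" by (intro r(2) cn s \<delta>(2))
   moreover have "G (c (x' \<bullet> y)) y = G x' y" using cn[OF s] that y by (intro G_zonal) (simp_all add: cy)
   ultimately show ?thesis using Gct by linarith
  qed
 qed (simp add: F_def)
 ultimately show False by simp
qed

end

section \<open>Moments of the kernel\<close>

lemma poly_antiderivative:
 obtains p :: "real poly" where "pderiv p = q" "poly p 1 = c"
proof -
 have m: "\<exists>p :: real poly. pderiv p = monom b k" for b k
  by (intro exI[of _ "monom (b / real (Suc k)) (Suc k)"]) (simp add: pderiv_monom)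
 have "\<exists>p :: real poly. pderiv p = (\<Sum>i\<in>A. monom (coeff q i) i)" if "finite A" for A
  using that
 proof induction
  case empty
  show ?case by (intro exI[of _ 0]) simp
 next
  case (insert i A)
  obtain p1 p2 where "pderiv p1 = monom (coeff q i) i" "pderiv p2 = (\<Sum>i\<in>A. monom (coeff q i) i)"
   using m insert.IH by blast
  then show ?case using insert.hyps by (intro exI[of _ "p1 + p2"]) (simp add: pderiv_add)
 qed
 from this[of "{..degree q}"] have "\<exists>p :: real poly. pderiv p = q" by (simp add: poly_as_sum_of_monoms)
 then obtain p :: "real poly" where "pderiv p = q" by blast
 then show ?thesis by (intro that[of "p + [:c - poly p 1:]"]) (simp_all add: pderiv_add pderiv_pCons)
qed

lemma deriv_close_imp_close:
 fixes f g :: "real => real"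
 assumes "\<And>t. -1 \<le> t ==> t \<le> 1 ==> DERIV f t :> f' t" "\<And>t. -1 \<le> t ==> t \<le> 1 ==> DERIV g t :> g' t"
  and "\<And>t. -1 \<le> t ==> t \<le> 1 ==> \<bar>f' t - g' t\<bar> \<le> e" "f 1 = g 1" "-1 \<le> t" "t \<le> 1"
 shows "\<bar>f t - g t\<bar> \<le> 2 * e"
proof (cases "t = 1")
 case True
 have "0 \<le> e" using assms(3)[of 1] by simp
 then show ?thesis using True assms by simp
next
 case False
 then have t: "t < 1" using assms by simp
 have "DERIV (\<lambda>t. f t - g t) s :> f' s - g' s" if "t \<le> s" "s \<le> 1" for s
  using assms that by (intro DERIV_diff) auto
 from MVT2[OF t this] obtain s where s: "t < s" "s < 1" "f 1 - g 1 - (f t - g t) = (1 - t) * (f' s - g' s)"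
  by blast
 then have "\<bar>f t - g t\<bar> = \<bar>(1 - t) * (f' s - g' s)\<bar>" using assms(4) by simp
 also have "\<dots> = (1 - t) * \<bar>f' s - g' s\<bar>" using t by (simp add: abs_mult)
 also have "\<dots> \<le> 2 * e" using assms(3)[of s] s assms by (intro mult_mono) auto
 finally show ?thesis .
qed

context sphere_green begin

lemma inner_bounds: "norm x = 1 ==> norm y = 1 ==> -1 \<le> x \<bullet> y \<and> x \<bullet> y \<le> 1"
 using Cauchy_Schwarz_ineq2[of x y] by (auto simp: abs_le_iff)

lemma integrable_G_bounded:
 assumes y: "norm y = 1" and [measurable]: "f \<in> borel_measurable borel"
  and B: "\<And>x. norm x = 1 ==> \<bar>f x\<bar> \<le> B"
 shows "integrable P (\<lambda>x. G x y * f x)"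
proof (rule Bochner_Integration.integrable_bound)
 show "integrable P (\<lambda>x. B * G x y)" using G_integrable[OF y] by simp
 show "AE x in P. norm (G x y * f x) \<le> norm (B * G x y)"
  using AE_norm
 proof eventually_elim
  case (elim x)
  have "\<bar>f x\<bar> \<le> \<bar>B\<bar>" using B[OF elim] by linarith
  from mult_left_mono[OF this, of "\<bar>G x y\<bar>"] show ?case by (simp add: abs_mult mult.commute)
 qed
qed measurable

text \<open>Approximate F'' by a polynomial and integrate twice from t = 1, starting with F' 1 and F
  1; then F, F' and F'' are all uniformly close. This extends the equation to powers of 1 - t +
  \<delta>.\<close>

lemma green_C2:
 fixes F F' F'' :: "real => real"
 assumes y: "norm y = 1"
  and F: "\<And>t. -1 \<le> t ==> t \<le> 1 ==> DERIV F t :> F' t" "\<And>t. -1 \<le> t ==> t \<le> 1 ==> DERIV F' t :> F'' t"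
  and c: "continuous_on {-1..1} F''"
  and [measurable]: "F \<in> borel_measurable borel" "F' \<in> borel_measurable borel" "F'' \<in> borel_measurable borel"
 shows "(LINT x|P. G x y * (F (x \<bullet> y) - eps\<^sup>2 * ((1 - (x \<bullet> y)\<^sup>2) * F'' (x \<bullet> y) - n * (x \<bullet> y) * F' (x \<bullet> y)))) = F 1"
  (is "(LINT x|P. G x y * ?H (x \<bullet> y)) = _")
proof -
 define H where "H = ?H"
 have Hm [measurable]: "H \<in> borel_measurable borel" unfolding H_def by measurable
 have cF: "continuous_on {-1..1} F" "continuous_on {-1..1} F'"
  using F by (auto intro!: DERIV_atLeastAtMost_imp_continuous_on)
 have "continuous_on {-1..1} H" unfolding H_def by (intro continuous_intros cF c)
 then have "bounded (H ` {-1..1})" by (intro compact_imp_bounded compact_continuous_image) auto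
 then obtain B where "\<forall>t\<in>{-1..1}. \<bar>H t\<bar> \<le> B" by (auto simp: bounded_iff)
 then have B: "\<And>x. norm x = 1 ==> \<bar>H (x \<bullet> y)\<bar> \<le> B" using inner_bounds[OF _ y] by auto
 have iH: "integrable P (\<lambda>x. G x y * H (x \<bullet> y))" by (rule integrable_G_bounded[OF y _ B]) measurable
 \<comment> \<open>The interval has length 2, so an error e in F'' becomes 2 e in F' and 4 e in F;
   the bracket bounds the operator, with 1 - t^2 and |t| at most 1.\<close>
 define C where "C = 4 + eps\<^sup>2 * (1 + 2 * n)"
 have yy: "y \<bullet> y = 1" using y by (simp add: norm_eq_1)
 have "\<bar>(LINT x|P. G x y * H (x \<bullet> y)) - F 1\<bar> \<le> 0 + e * C" if e: "e > 0" for e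
 proof -
  obtain q where q: "\<And>t. -1 \<le> t ==> t \<le> 1 ==> \<bar>F'' t - poly q t\<bar> < e"
   using poly_approximation[OF c e] by blast
  obtain p1 where p1: "pderiv p1 = q" "poly p1 1 = F' 1" by (rule poly_antiderivative)
  obtain p where p: "pderiv p = p1" "poly p 1 = F 1" by (rule poly_antiderivative)
  have d1: "\<bar>F' t - poly p1 t\<bar> \<le> 2 * e" if "-1 \<le> t" "t \<le> 1" for t
   by (rule deriv_close_imp_close[of F' F'' "poly p1" "poly q"])
    (use F q p1 that poly_DERIV[of p1] in \<open>auto intro: less_imp_le\<close>)
  have d0: "\<bar>F t - poly p t\<bar> \<le> 2 * (2 * e)" if "-1 \<le> t" "t \<le> 1" for t
   by (rule deriv_close_imp_close[of F F' "poly p" "poly p1"])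
    (use F d1 p that poly_DERIV[of p] in auto)
  have close: "\<bar>H t - poly (helm eps n p) t\<bar> \<le> e * C" if "-1 \<le> t" "t \<le> 1" for t
  proof -
   have "t\<^sup>2 \<le> 1" using that by (simp add: abs_square_le_1 abs_le_iff)
   then have "\<bar>(1 - t\<^sup>2) * (F'' t - poly q t)\<bar> \<le> 1 * e"
    unfolding abs_mult using q[OF that] by (intro mult_mono) auto
   moreover have "\<bar>n * t * (F' t - poly p1 t)\<bar> \<le> (n * 1) * (2 * e)"
    unfolding abs_mult using d1[OF that] that n_nonneg by (intro mult_mono) auto
   ultimately have "\<bar>(1 - t\<^sup>2) * (F'' t - poly q t) - n * t * (F' t - poly p1 t)\<bar> \<le> e + 2 * n * e" by linarith
   from mult_left_mono[OF this, of "eps\<^sup>2"]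
   have "\<bar>eps\<^sup>2 * ((1 - t\<^sup>2) * (F'' t - poly q t) - n * t * (F' t - poly p1 t))\<bar> \<le> eps\<^sup>2 * (e + 2 * n * e)"
    by (simp add: abs_mult)
   moreover have "H t - poly (helm eps n p) t = (F t - poly p t) - eps\<^sup>2 * ((1 - t\<^sup>2) * (F'' t - poly q t) - n * t * (F' t - poly p1 t))"
    by (simp add: H_def poly_helm p p1 algebra_simps)
   ultimately show ?thesis using d0[OF that] by (simp add: C_def algebra_simps)
  qed
  have ip: "integrable P (\<lambda>x. G x y * poly (helm eps n p) (x \<bullet> y))"
   by (intro integrable_mult_continuous G_integrable y continuous_intros)
  have "(LINT x|P. G x y * H (x \<bullet> y)) - F 1 = (LINT x|P. G x y * H (x \<bullet> y) - G x y * poly (helm eps n p) (x \<bullet> y))"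
   using iH ip green_ridge[OF y y, of p] p yy by simp
  also have "\<bar>\<dots>\<bar> \<le> (LINT x|P. \<bar>G x y * H (x \<bullet> y) - G x y * poly (helm eps n p) (x \<bullet> y)\<bar>)" by (rule integral_abs_bound)
  also have "\<dots> \<le> (LINT x|P. e * C * G x y)"
  proof (rule integral_mono_AE)
   show "AE x in P. \<bar>G x y * H (x \<bullet> y) - G x y * poly (helm eps n p) (x \<bullet> y)\<bar> \<le> e * C * G x y"
    using AE_norm
   proof eventually_elim
    case (elim x)
    have "G x y * \<bar>H (x \<bullet> y) - poly (helm eps n p) (x \<bullet> y)\<bar> \<le> G x y * (e * C)"
     using inner_bounds[OF elim y] G_nonneg[OF elim y] by (intro mult_left_mono close) auto
    then show ?case using G_nonneg[OF elim y] by (simp add: right_diff_distrib[symmetric] abs_mult mult.commute)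
   qed
  qed (use iH ip G_integrable[OF y] in auto)
  also have "\<dots> = e * C" using integral_G[OF y] by simp
  finally show ?thesis by simp
 qed
 note b = this
 have "\<bar>(LINT x|P. G x y * H (x \<bullet> y)) - F 1\<bar> \<le> 0"
  by (rule le_of_all_eps[where M = C]) (rule b)
 then show ?thesis by (simp add: H_def)
qed

text \<open>As |x - y|^2 = 2 (1 - x \<bullet> y) on the sphere, this is the moment of order 2 a of
  the chord length, up to the factor 2^a.\<close>

definition mom :: "'a => real => real" where
 "mom y a = (LINT x|P. G x y * (1 - x \<bullet> y) powr a)"

lemma powr_bound:
 assumes "norm x = 1" "norm y = 1" "a \<ge> 0" shows "\<bar>(1 - x \<bullet> y) powr a\<bar> \<le> 2 powr a"
 using inner_bounds[OF assms(1,2)] assms(3) by (auto intro!: powr_mono2)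

lemma integrable_mom:
 assumes y: "norm y = 1" and a: "a \<ge> 0"
 shows "integrable P (\<lambda>x. G x y * (1 - x \<bullet> y) powr a)"
 by (rule integrable_G_bounded[OF y _ powr_bound[OF _ y a]]) measurable

lemma mom_nonneg: "norm y = 1 ==> 0 \<le> mom y a"
 unfolding mom_def
 by (rule integral_nonneg_AE, use AE_norm in eventually_elim) (simp add: G_nonneg)

lemma mom_0: "norm y = 1 ==> mom y 0 = 1"
 and mom_1: "norm y = 1 ==> mom y 1 * (1 + eps\<^sup>2 * n) = eps\<^sup>2 * n"
proof -
 assume y: "norm y = 1"
 have yy: "y \<bullet> y = 1" using y by (simp add: norm_eq_1)
 have "mom y 0 = (LINT x|P. G x y)"
  unfolding mom_def
 proof (rule integral_cong_AE)
  show "AE x in P. G x y * (1 - x \<bullet> y) powr 0 = G x y"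
   using AE_norm
  proof eventually_elim
   case (elim x)
   \<comment> \<open>\<open>0 powr 0\<close> is 0, so at x = y the identity needs the diagonal value
     0 of \<open>G\<close>.\<close>
   have "x = y" if "x \<bullet> y = 1"
   proof -
    have "(x - y) \<bullet> (x - y) = 0" using that elim yy by (simp add: inner_diff_left inner_diff_right inner_commute norm_eq_1)
    then show ?thesis by simp
   qed
   then show ?case using G_diag[OF y] by auto
  qed
 qed measurable
 then show "mom y 0 = 1" by (simp add: integral_G y)
 have i1: "integrable P (\<lambda>x. G x y * (1 - x \<bullet> y))"
  by (intro integrable_mult_continuous G_integrable y continuous_intros)
 have "mom y 1 = (LINT x|P. G x y * (1 - x \<bullet> y))"
  unfolding mom_def
 proof (rule integral_cong_AE)
  show "AE x in P. G x y * (1 - x \<bullet> y) powr 1 = G x y * (1 - x \<bullet> y)"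
   using AE_norm by eventually_elim (use inner_bounds[OF _ y] in simp)
 qed measurable
 moreover have "(LINT x|P. G x y * poly (helm eps n [:1, -1:]) (x \<bullet> y)) = 0"
  using green_ridge[OF y y, of "[:1, -1:]"] yy by simp
 moreover have "(LINT x|P. G x y * poly (helm eps n [:1, -1:]) (x \<bullet> y))
   = (LINT x|P. (1 + eps\<^sup>2 * n) * (G x y * (1 - x \<bullet> y)) - eps\<^sup>2 * n * G x y)"
  by (intro Bochner_Integration.integral_cong refl) (simp add: poly_helm pderiv_pCons algebra_simps)
 moreover have "\<dots> = (1 + eps\<^sup>2 * n) * (LINT x|P. G x y * (1 - x \<bullet> y)) - eps\<^sup>2 * n"
  using i1 G_integrable[OF y] integral_G[OF y] by simp
 ultimately show "mom y 1 * (1 + eps\<^sup>2 * n) = eps\<^sup>2 * n" by (simp add: mult.commute)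
qed

text \<open>Cauchy-Schwarz, read off from the quadratic in l that is the integral of G (1 - x
  \<bullet> y)^a (r - l)^2 with r the square root of 1 - x \<bullet> y.\<close>

lemma mom_log_convex:
 assumes y: "norm y = 1" and a: "a \<ge> 0"
 shows "(mom y (a + 1 / 2))\<^sup>2 \<le> mom y a * mom y (a + 1)"
proof -
 define A where "A = mom y a"
 define B where "B = mom y (a + 1 / 2)"
 define C where "C = mom y (a + 1)"
 have quad: "0 \<le> C - 2 * l * B + l\<^sup>2 * A" for l
 proof -
  have "C - 2 * l * B + l\<^sup>2 * A = (LINT x|P. G x y * (1 - x \<bullet> y) powr (a + 1) - 2 * l * (G x y * (1 - x \<bullet> y) powr (a + 1 / 2)) + l\<^sup>2 * (G x y * (1 - x \<bullet> y) powr a))"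
   using integrable_mom[OF y] a by (simp add: A_def B_def C_def mom_def)
  also have "\<dots> \<ge> 0"
  proof (rule integral_nonneg_AE)
   show "AE x in P. 0 \<le> G x y * (1 - x \<bullet> y) powr (a + 1) - 2 * l * (G x y * (1 - x \<bullet> y) powr (a + 1 / 2)) + l\<^sup>2 * (G x y * (1 - x \<bullet> y) powr a)"
    using AE_norm
   proof eventually_elim
    case (elim x)
    define r where "r = (1 - x \<bullet> y) powr (1 / 2)"
    have "(1 - x \<bullet> y) powr (a + 1) = (1 - x \<bullet> y) powr a * r\<^sup>2"
     using inner_bounds[OF elim y] by (simp add: r_def powr_half_sqrt powr_add)
    moreover have "(1 - x \<bullet> y) powr (a + 1 / 2) = (1 - x \<bullet> y) powr a * r" by (simp add: r_def powr_add)
    ultimately have "G x y * (1 - x \<bullet> y) powr (a + 1) - 2 * l * (G x y * (1 - x \<bullet> y) powr (a + 1 / 2)) + l\<^sup>2 * (G x y * (1 - x \<bullet> y) powr a)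
      = G x y * (1 - x \<bullet> y) powr a * (r - l)\<^sup>2" by (simp add: power2_eq_square algebra_simps)
    then show ?case using G_nonneg[OF elim y] by simp
   qed
  qed
  finally show ?thesis .
 qed
 have A: "A \<ge> 0" by (simp add: A_def mom_nonneg y)
 show ?thesis
 proof (cases "A = 0")
  case True
  have "B = 0"
  proof (rule ccontr)
   assume "B \<noteq> 0"
   \<comment> \<open>This l gives C - 2 l B the value -1.\<close>
   then show False using quad[of "(C + 1) / (2 * B)"] True by simp
  qed
  then show ?thesis using True by (simp add: A_def B_def)
 next
  case False
  then have "A > 0" using A by simp
  then have "0 \<le> (C - 2 * (B / A) * B + (B / A)\<^sup>2 * A) * A" using quad[of "B / A"] by (intro mult_nonneg_nonneg) auto
  also have "\<dots> = A * C - B\<^sup>2" using \<open>A > 0\<close> by (simp add: field_simps power2_eq_square)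
  finally show ?thesis by (simp add: A_def B_def C_def)
 qed
qed

text \<open>The weak equation for (1 - t)^a. For a < 2 this power is not twice differentiable at t =
  1, so it is shifted to (1 - t + \<delta>)^a, with value \<delta>^a at t = 1. The growing second
  derivative is tamed by the factor 1 - t of 1 - t^2, which permits dominated convergence.\<close>

lemma mom_recurrence:
 assumes y: "norm y = 1" and a: "a > 1"
 shows "mom y a * (1 + eps\<^sup>2 * (a * (a - 1 + n))) = eps\<^sup>2 * (a * (2 * a - 2 + n)) * mom y (a - 1)"
proof -
 define \<delta> where "\<delta> m = 1 / (real m + 1)" for m :: nat
 have \<delta>: "0 < \<delta> m" "\<delta> m \<le> 1" for m by (simp_all add: \<delta>_def)
 have \<delta>0: "\<delta> \<longlonglongrightarrow> 0" unfolding \<delta>_def by real_asymp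
 define H where "H d t = (1 - t + d) powr a - eps\<^sup>2 * ((1 - t\<^sup>2) * (a * (a - 1) * (1 - t + d) powr (a - 2)) - n * t * (- (a * (1 - t + d) powr (a - 1))))" for d t
 \<comment> \<open>The limit of \<open>H\<close> as the shift vanishes, expanded by 1 + t = 2 - (1 -
   t) and t = 1 - (1 - t).\<close>
 define H0 where "H0 t = (1 - t) powr a * (1 + eps\<^sup>2 * (a * (a - 1 + n))) - eps\<^sup>2 * (a * (2 * a - 2 + n)) * (1 - t) powr (a - 1)" for t
 define C where "C = 3 powr a + eps\<^sup>2 * (2 * (a * (a - 1) * 3 powr (a - 1)) + n * (a * 3 powr (a - 1)))"
 have int: "(LINT x|P. G x y * H (\<delta> m) (x \<bullet> y)) = \<delta> m powr a" for m
 proof -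
  have "(LINT x|P. G x y * H (\<delta> m) (x \<bullet> y)) = (1 - 1 + \<delta> m) powr a"
   unfolding H_def
  proof (rule green_C2[OF y])
   fix t :: real assume "t \<le> 1"
   then have p: "1 - t + \<delta> m > 0" using \<delta>(1)[of m] by simp
   have d: "DERIV (\<lambda>t. (1 - t + \<delta> m) powr b) t :> - (b * (1 - t + \<delta> m) powr (b - 1))" for b
   proof -
    have "DERIV (\<lambda>t. 1 - t + \<delta> m) t :> -1" by (auto intro!: derivative_eq_intros)
    from DERIV_fun_powr[OF this p, of b] show ?thesis by simp
   qed
   show "DERIV (\<lambda>t. (1 - t + \<delta> m) powr a) t :> - (a * (1 - t + \<delta> m) powr (a - 1))" by (rule d)
   show "DERIV (\<lambda>t. - (a * (1 - t + \<delta> m) powr (a - 1))) t :> a * (a - 1) * (1 - t + \<delta> m) powr (a - 2)"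
    using DERIV_minus[OF DERIV_cmult[OF d[of "a - 1"], of a]] by (simp add: mult.assoc)
  next
   show "continuous_on {- 1..1} (\<lambda>t. a * (a - 1) * (1 - t + \<delta> m) powr (a - 2))"
    using \<delta>(1)[of m] by (intro continuous_intros) auto
  qed measurable
  then show ?thesis by simp
 qed
 have bnd: "\<bar>H d t\<bar> \<le> C" if d: "0 < d" "d \<le> 1" and t: "-1 \<le> t" "t \<le> 1" for d t
 proof -
  define s where "s = 1 - t + d"
  have s: "0 < s" "s \<le> 3" "1 - t \<le> s" using d t by (auto simp: s_def)
  have p1: "s powr a \<le> 3 powr a" "s powr (a - 1) \<le> 3 powr (a - 1)" using s a by (auto intro!: powr_mono2)
  have "(1 - t) * s powr (a - 2) \<le> s * s powr (a - 2)" using s by (intro mult_right_mono) auto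
  also have "\<dots> = s powr (a - 1)" using s by (simp add: powr_diff power2_eq_square)
  finally have p2: "(1 - t) * s powr (a - 2) \<le> 3 powr (a - 1)" using p1 by simp
  have "(1 + t) * (a * (a - 1) * ((1 - t) * s powr (a - 2))) \<le> 2 * (a * (a - 1) * 3 powr (a - 1))"
   using p2 t a by (intro mult_mono) auto
  have q1: "\<bar>(1 - t\<^sup>2) * (a * (a - 1) * s powr (a - 2))\<bar> \<le> 2 * (a * (a - 1) * 3 powr (a - 1))"
  proof -
   have eq: "(1 - t\<^sup>2) * (a * (a - 1) * s powr (a - 2)) = (1 + t) * (a * (a - 1) * ((1 - t) * s powr (a - 2)))"
    by (simp add: power2_eq_square algebra_simps)
   have "0 \<le> (1 + t) * (a * (a - 1) * ((1 - t) * s powr (a - 2)))"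
    using t a by (intro mult_nonneg_nonneg) auto
   with \<open>_ \<le> 2 * (a * (a - 1) * 3 powr (a - 1))\<close> show ?thesis unfolding eq by simp
  qed
  have q2: "\<bar>n * t * (- (a * s powr (a - 1)))\<bar> \<le> (n * 1) * (a * 3 powr (a - 1))"
   unfolding abs_mult abs_minus_cancel using p1 t a n_nonneg by (intro mult_mono) auto
  have "\<bar>eps\<^sup>2 * ((1 - t\<^sup>2) * (a * (a - 1) * s powr (a - 2)) - n * t * (- (a * s powr (a - 1))))\<bar>
    \<le> eps\<^sup>2 * (2 * (a * (a - 1) * 3 powr (a - 1)) + n * (a * 3 powr (a - 1)))"
   unfolding abs_mult[of "eps\<^sup>2"] using q1 q2 by (intro mult_mono) auto
  moreover have "\<bar>s powr a\<bar> \<le> 3 powr a" using p1 by simp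
  ultimately show ?thesis unfolding H_def C_def s_def[symmetric] by linarith
 qed
 have lim: "(\<lambda>m. H (\<delta> m) t) \<longlonglongrightarrow> H0 t" if t: "-1 \<le> t" "t \<le> 1" for t
 proof -
  have l: "(\<lambda>m. 1 - t + \<delta> m) \<longlonglongrightarrow> 1 - t" using tendsto_add[OF tendsto_const \<delta>0, of "1 - t"] by simp
  have pw: "(\<lambda>m. (1 - t + \<delta> m) powr b) \<longlonglongrightarrow> (1 - t) powr b" if "b > 0 \<or> 1 - t \<noteq> 0" for b
   using that t \<delta>(1) by (intro tendsto_powr'[OF l tendsto_const]) (auto intro!: eventuallyI add_nonneg_nonneg less_imp_le)
  have l2: "(\<lambda>m. (1 - t\<^sup>2) * (a * (a - 1) * (1 - t + \<delta> m) powr (a - 2))) \<longlonglongrightarrow> (1 + t) * (a * (a - 1) * (1 - t) powr (a - 1))"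
  proof (cases "t = 1")
   case True
   then show ?thesis by simp
  next
   case False
   have "(\<lambda>m. (1 - t\<^sup>2) * (a * (a - 1) * (1 - t + \<delta> m) powr (a - 2))) \<longlonglongrightarrow> (1 - t\<^sup>2) * (a * (a - 1) * (1 - t) powr (a - 2))"
    using False by (intro tendsto_intros pw) auto
   also have "(1 - t\<^sup>2) * (a * (a - 1) * (1 - t) powr (a - 2)) = (1 + t) * (a * (a - 1) * ((1 - t) * (1 - t) powr (a - 2)))"
    by (simp add: power2_eq_square algebra_simps)
   also have "(1 - t) * (1 - t) powr (a - 2) = (1 - t) powr (a - 1)"
    using t False by (simp add: powr_diff power2_eq_square)
   finally show ?thesis .
  qed
  have "(\<lambda>m. H (\<delta> m) t) \<longlonglongrightarrow> (1 - t) powr a - eps\<^sup>2 * ((1 + t) * (a * (a - 1) * (1 - t) powr (a - 1)) - n * t * (- (a * (1 - t) powr (a - 1))))"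
   unfolding H_def using a by (intro tendsto_intros l2 pw) auto
  also have "(1 - t) powr a - eps\<^sup>2 * ((1 + t) * (a * (a - 1) * (1 - t) powr (a - 1)) - n * t * (- (a * (1 - t) powr (a - 1)))) = H0 t"
  proof -
   have 1: "(1 - t) powr a = (1 - t) * (1 - t) powr (a - 1)" using t by (cases "t = 1") (auto simp: powr_diff)
   define p where "p = (1 - t) powr (a - 1)"
   show ?thesis unfolding H0_def 1 p_def[symmetric] by algebra
  qed
  finally show ?thesis .
 qed
 have [measurable]: "H d \<in> borel_measurable borel" "H0 \<in> borel_measurable borel" for d
  unfolding H_def[abs_def] H0_def[abs_def] by measurable
 have "(\<lambda>m. (LINT x|P. G x y * H (\<delta> m) (x \<bullet> y))) \<longlonglongrightarrow> (LINT x|P. G x y * H0 (x \<bullet> y))"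
 proof (rule integral_dominated_convergence[where w = "\<lambda>x. G x y * C"])
  show "integrable P (\<lambda>x. G x y * C)" using G_integrable[OF y] by simp
  show "AE x in P. (\<lambda>m. G x y * H (\<delta> m) (x \<bullet> y)) \<longlonglongrightarrow> G x y * H0 (x \<bullet> y)"
   using AE_norm by eventually_elim (use inner_bounds[OF _ y] in \<open>auto intro!: tendsto_mult_left lim\<close>)
  show "AE x in P. norm (G x y * H (\<delta> m) (x \<bullet> y)) \<le> G x y * C" for m
   using AE_norm
  proof eventually_elim
   case (elim x)
   show ?case using inner_bounds[OF elim y] G_nonneg[OF elim y] bnd[OF \<delta>, of "x \<bullet> y" m]
    by (simp add: abs_mult mult_left_mono)
  qed
 qed measurable
 moreover have "(\<lambda>m. \<delta> m powr a) \<longlonglongrightarrow> 0 powr a"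
  using a \<delta>(1) by (intro tendsto_powr'[OF \<delta>0 tendsto_const]) (auto intro!: eventuallyI less_imp_le)
 ultimately have "(LINT x|P. G x y * H0 (x \<bullet> y)) = 0"
  unfolding int using LIMSEQ_unique by fastforce
 moreover have "(LINT x|P. G x y * H0 (x \<bullet> y))
   = (LINT x|P. (1 + eps\<^sup>2 * (a * (a - 1 + n))) * (G x y * (1 - x \<bullet> y) powr a) - eps\<^sup>2 * (a * (2 * a - 2 + n)) * (G x y * (1 - x \<bullet> y) powr (a - 1)))"
  by (intro Bochner_Integration.integral_cong refl) (simp only: H0_def right_diff_distrib mult_ac)
 moreover have "\<dots> = (1 + eps\<^sup>2 * (a * (a - 1 + n))) * mom y a - eps\<^sup>2 * (a * (2 * a - 2 + n)) * mom y (a - 1)"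
  unfolding mom_def using integrable_mom[OF y, of a] integrable_mom[OF y, of "a - 1"] a
  by (subst Bochner_Integration.integral_diff) auto
 ultimately show ?thesis by (simp add: mult.commute)
qed

end

section \<open>The limit of the scaled moment of order 1/2\<close>

text \<open>Every lower limit is at most every upper limit, so the supremum L of the lower ones lies
  between; the ratios tending to 1 squeeze f to L.\<close>

lemma tendsto_sandwich_family:
 fixes f :: "'b => real" and lo hi :: "nat => 'b => real"
 assumes F: "F \<noteq> bot"
  and le: "\<And>j. \<forall>\<^sub>F x in F. lo j x \<le> f x" "\<And>j. \<forall>\<^sub>F x in F. f x \<le> hi j x"
  and lim: "\<And>j. (lo j \<longlongrightarrow> l j) F" "\<And>j. (hi j \<longlongrightarrow> h j) F"
  and pos: "\<And>j. l j > 0" and ratio: "(\<lambda>j. h j / l j) \<longlonglongrightarrow> 1"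
 shows "\<exists>L>0. (f \<longlongrightarrow> L) F"
proof -
 have lh: "l i \<le> h j" for i j
  by (rule tendsto_le[OF F lim(2) lim(1)]) (use le(1)[of i] le(2)[of j] in eventually_elim, simp)
 have bdd: "bdd_above (range l)" using lh by (intro bdd_aboveI2)
 define L where "L = (SUP j. l j)"
 have L: "l j \<le> L" for j unfolding L_def by (rule cSUP_upper[OF UNIV_I bdd])
 have Lpos: "L > 0" using pos[of 0] L[of 0] by simp
 have "(f \<longlongrightarrow> L) F"
 proof (rule order_tendstoI)
  fix a assume "a < L"
  then obtain j where "a < l j" unfolding L_def using less_cSUP_iff[OF _ bdd] by auto
  then have "\<forall>\<^sub>F x in F. a < lo j x" using order_tendstoD(1)[OF lim(1)] by blast
  then show "\<forall>\<^sub>F x in F. a < f x" using le(1)[of j] by eventually_elim simp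
 next
  fix a assume a: "L < a"
  have "(\<lambda>j. L * (h j / l j)) \<longlonglongrightarrow> L * 1" by (intro tendsto_intros ratio)
  then have "\<forall>\<^sub>F j in sequentially. L * (h j / l j) < a" using a order_tendstoD(2) by fastforce
  then obtain j where j: "L * (h j / l j) < a" using eventually_happens by fastforce
  have "h j / l j \<ge> 0" using lh[of j j] pos[of j] by simp
  then have "l j * (h j / l j) \<le> L * (h j / l j)" by (intro mult_right_mono L)
  then have "h j < a" using j pos[of j] by simp
  then have "\<forall>\<^sub>F x in F. hi j x < a" using order_tendstoD(2)[OF lim(2)] by blast
  then show "\<forall>\<^sub>F x in F. f x < a" using le(2)[of j] by eventually_elim simp
 qed
 with Lpos show ?thesis by blast
qed

text \<open>The recurrence in steps of 1 gives M(j) exactly and M(j + 1/2) as a multiple of M(1/2).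
  Log-convexity along j, j + 1/2, j + 1 bounds M(1/2) from above, along j + 1/2, j + 1, j + 3/2 from
  below. After division by eps the bounds converge for fixed j as eps goes to 0, and the ratio of
  their limits tends to 1 as j grows, as in the Bohr-Mollerup characterisation of Gamma.\<close>

lemma half_moment_limit:
 fixes M :: "real => real => real"
 assumes n: "n \<ge> 1"
  and nonneg: "\<And>eps a. eps > 0 ==> 0 \<le> M eps a" and zero: "\<And>eps. eps > 0 ==> M eps 0 = 1"
  and rec: "\<And>eps a. eps > 0 ==> a \<ge> 1 ==>
   M eps a * (1 + eps\<^sup>2 * (a * (a - 1 + n))) = eps\<^sup>2 * (a * (2 * a - 2 + n)) * M eps (a - 1)"
  and convex: "\<And>eps a. eps > 0 ==> a \<ge> 0 ==> (M eps (a + 1 / 2))\<^sup>2 \<le> M eps a * M eps (a + 1)"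
 shows "\<exists>L>0. ((\<lambda>eps. M eps (1 / 2) / eps) \<longlongrightarrow> L) (at_right 0)"
proof -
 define R where "R a = a * (2 * a - 2 + n)" for a :: real
 define S where "S a eps = 1 + eps\<^sup>2 * (a * (a - 1 + n))" for a eps :: real
 have R: "R a > 0" if "a \<ge> 1" for a using that n by (simp add: R_def)
 have S: "S a eps > 0" if "a \<ge> 1" for a eps
  unfolding S_def using that n by (intro add_pos_nonneg mult_nonneg_nonneg) auto
 \<comment> \<open>The factors of j recurrence steps starting from a, without the powers of eps;
   \<open>Q\<close> is the limit as eps goes to 0.\<close>
 define q where "q a j eps = (\<Prod>i<j. R (a + real i + 1) / S (a + real i + 1) eps)" for a j eps
 define Q where "Q a j = (\<Prod>i<j. R (a + real i + 1))" for a j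
 have q: "q a j eps > 0" if "a \<ge> 0" for a j eps unfolding q_def using that R S by (intro prod_pos) auto
 have Q: "Q a j > 0" if "a \<ge> 0" for a j unfolding Q_def using that R by (intro prod_pos) auto
 have M: "M eps (a + real j) = (eps\<^sup>2) ^ j * q a j eps * M eps a" if "eps > 0" "a \<ge> 0" for eps a j
 proof (induction j)
  case (Suc j)
  have "M eps (a + real (Suc j)) * S (a + real j + 1) eps = eps\<^sup>2 * R (a + real j + 1) * M eps (a + real j)"
   using rec[OF that(1), of "a + real j + 1"] that by (simp add: S_def R_def algebra_simps)
  then have "M eps (a + real (Suc j)) = eps\<^sup>2 * R (a + real j + 1) * M eps (a + real j) / S (a + real j + 1) eps"
   using S[of "a + real j + 1" eps] that by (simp add: eq_divide_eq)
  then show ?case by (simp add: Suc.IH q_def)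
 qed (simp add: q_def)
 have lim: "((\<lambda>eps. q a j eps) \<longlongrightarrow> Q a j) (at_right 0)" for a j
 proof -
  have "((\<lambda>eps. S b eps) \<longlongrightarrow> 1 + 0\<^sup>2 * (b * (b - 1 + n))) (at_right 0)" for b
   unfolding S_def by (intro tendsto_intros)
  then have "((\<lambda>eps. S b eps) \<longlongrightarrow> 1) (at_right 0)" for b by simp
  then have "((\<lambda>eps. q a j eps) \<longlongrightarrow> (\<Prod>i<j. R (a + real i + 1) / 1)) (at_right 0)"
   unfolding q_def by (intro tendsto_prod tendsto_divide tendsto_const) auto
  then show ?thesis by (simp add: Q_def)
 qed
 \<comment> \<open>Squared, because log-convexity compares products of two moments.\<close>
 define f where "f eps = (M eps (1 / 2) / eps)\<^sup>2" for eps
 define hi where "hi j eps = q 0 j eps * q 0 (Suc j) eps / (q (1 / 2) j eps)\<^sup>2" for j eps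
 define lo where "lo j eps = (q 0 (Suc j) eps)\<^sup>2 / (q (1 / 2) j eps * q (1 / 2) (Suc j) eps)" for j eps
 have fhi: "f eps \<le> hi j eps" if e: "eps > 0" for j eps
 proof -
  have "(M eps (1 / 2 + real j))\<^sup>2 \<le> M eps (0 + real j) * M eps (0 + real (Suc j))"
   using convex[OF e, of "real j"] by (simp add: add.commute)
  then have "((eps\<^sup>2) ^ j * q (1 / 2) j eps * M eps (1 / 2))\<^sup>2 \<le> (eps\<^sup>2) ^ j * q 0 j eps * ((eps\<^sup>2) ^ Suc j * q 0 (Suc j) eps)"
   using e by (simp only: M[OF e] zero order_refl mult_1_right zero_le_divide_1_iff zero_le_numeral)
  then have "((eps\<^sup>2) ^ j)\<^sup>2 * ((q (1 / 2) j eps)\<^sup>2 * (M eps (1 / 2))\<^sup>2) \<le> ((eps\<^sup>2) ^ j)\<^sup>2 * (eps\<^sup>2 * (q 0 j eps * q 0 (Suc j) eps))"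
   by (simp add: power_mult_distrib power2_eq_square mult_ac)
  then have "(q (1 / 2) j eps)\<^sup>2 * (M eps (1 / 2))\<^sup>2 \<le> eps\<^sup>2 * (q 0 j eps * q 0 (Suc j) eps)"
   using e by (subst (asm) mult_le_cancel_left_pos) auto
  then show ?thesis using e q[of "1/2" j eps] by (simp add: f_def hi_def power_divide field_simps)
 qed
 have flo: "lo j eps \<le> f eps" if e: "eps > 0" for j eps
 proof -
  have "(M eps (0 + real (Suc j)))\<^sup>2 \<le> M eps (1 / 2 + real j) * M eps (1 / 2 + real (Suc j))"
   using convex[OF e, of "1 / 2 + real j"] by (simp add: add_ac)
  then have "((eps\<^sup>2) ^ Suc j * q 0 (Suc j) eps)\<^sup>2 \<le>
    (eps\<^sup>2) ^ j * q (1 / 2) j eps * M eps (1 / 2) * ((eps\<^sup>2) ^ Suc j * q (1 / 2) (Suc j) eps * M eps (1 / 2))"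
   using e by (simp only: M[OF e] zero order_refl mult_1_right zero_le_divide_1_iff zero_le_numeral)
  then have "((eps\<^sup>2) ^ Suc j * (eps\<^sup>2) ^ j) * (eps\<^sup>2 * (q 0 (Suc j) eps)\<^sup>2) \<le>
    ((eps\<^sup>2) ^ Suc j * (eps\<^sup>2) ^ j) * (q (1 / 2) j eps * q (1 / 2) (Suc j) eps * (M eps (1 / 2))\<^sup>2)"
   by (simp add: power_mult_distrib power2_eq_square mult_ac)
  then have "eps\<^sup>2 * (q 0 (Suc j) eps)\<^sup>2 \<le> q (1 / 2) j eps * q (1 / 2) (Suc j) eps * (M eps (1 / 2))\<^sup>2"
   using e by (subst (asm) mult_le_cancel_left_pos) auto
  then show ?thesis using e q[of "1/2" j eps] q[of "1/2" "Suc j" eps] by (simp add: f_def lo_def power_divide field_simps)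
 qed
 define h where "h j = Q 0 j * Q 0 (Suc j) / (Q (1 / 2) j)\<^sup>2" for j
 define l where "l j = (Q 0 (Suc j))\<^sup>2 / (Q (1 / 2) j * Q (1 / 2) (Suc j))" for j
 have Qne: "Q a j \<noteq> 0" if "a \<ge> 0" for a j using Q[OF that, of j] by simp
 have "h j / l j = R (1 / 2 + real j + 1) / R (0 + real j + 1)" for j
 proof -
  have "Q 0 (Suc j) = Q 0 j * R (0 + real j + 1)" "Q (1 / 2) (Suc j) = Q (1 / 2) j * R (1 / 2 + real j + 1)"
   by (simp_all add: Q_def)
  moreover have "R (0 + real j + 1) \<noteq> 0" "R (1 / 2 + real j + 1) \<noteq> 0" using R[of "0 + real j + 1"] R[of "1 / 2 + real j + 1"] by auto
  ultimately show ?thesis unfolding h_def l_def using Qne[of 0 j] Qne[of "1/2" j] by (simp add: power2_eq_square)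
 qed
 moreover have "(\<lambda>j. R (1 / 2 + real j + 1) / R (0 + real j + 1)) \<longlonglongrightarrow> 1"
  unfolding R_def using n by real_asymp
 ultimately have ratio: "(\<lambda>j. h j / l j) \<longlonglongrightarrow> 1" by simp
 have "\<exists>L>0. (f \<longlongrightarrow> L) (at_right 0)"
 proof (rule tendsto_sandwich_family[where lo = lo and hi = hi and l = l and h = h, OF _ _ _ _ _ _ ratio])
  show "\<forall>\<^sub>F eps in at_right 0. lo j eps \<le> f eps" for j
   using flo by (auto simp: eventually_at_right_field intro!: exI[of _ 1])
  show "\<forall>\<^sub>F eps in at_right 0. f eps \<le> hi j eps" for j
   using fhi by (auto simp: eventually_at_right_field intro!: exI[of _ 1])
  show "(lo j \<longlongrightarrow> l j) (at_right 0)" for j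
   unfolding lo_def l_def by (intro tendsto_intros lim) (simp add: Qne)
  show "(hi j \<longlongrightarrow> h j) (at_right 0)" for j
   unfolding hi_def h_def by (intro tendsto_intros lim) (simp add: Qne)
  show "l j > 0" for j using Q[of 0 "Suc j"] Q[of "1/2" j] Q[of "1/2" "Suc j"] by (simp add: l_def)
 qed simp
 then obtain L where L: "L > 0" "(f \<longlongrightarrow> L) (at_right 0)" by blast
 have "((\<lambda>eps. sqrt (f eps)) \<longlongrightarrow> sqrt L) (at_right 0)" using L(2) by (rule tendsto_real_sqrt)
 moreover have "\<forall>\<^sub>F eps in at_right 0. sqrt (f eps) = M eps (1 / 2) / eps"
  using nonneg by (auto simp: eventually_at_right_field f_def intro!: exI[of _ 1])
 ultimately have "((\<lambda>eps. M eps (1 / 2) / eps) \<longlongrightarrow> sqrt L) (at_right 0)" by (rule Lim_transform_eventually)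
 then show ?thesis using L(1) by (intro exI[of _ "sqrt L"]) simp
qed

section \<open>Geodesic distance\<close>

text \<open>With t = cos (2 u) the two terms are 2 u and 2 sin u, while 1 - t = 2 (sin u)^2, so the
  cubic Taylor error is controlled by 1 - t. After integration the geodesic distance differs from
  the chord length by a first moment only.\<close>

lemma arccos_sqrt_bound:
 assumes "-1 \<le> t" "t \<le> 1"
 shows "\<bar>arccos t - sqrt 2 * (1 - t) powr (1 / 2)\<bar> \<le> 4 * (1 - t)"
proof -
 define u where "u = arccos t / 2"
 have u: "0 \<le> u" "2 * u \<le> pi" using arccos_lbound[OF assms] arccos_ubound[OF assms] by (simp_all add: u_def)
 have "t = cos (2 * u)" using assms by (simp add: u_def)
 then have t: "1 - t = 2 * (sin u)\<^sup>2" by (simp add: cos_double_sin)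
 have s: "sin u \<ge> 0" using u by (intro sin_ge_zero) auto
 have "\<bar>sin u - (\<Sum>m<3. sin_coeff m * u ^ m)\<bar> \<le> inverse (fact 3) * \<bar>u\<bar> ^ 3" by (rule Maclaurin_sin_bound)
 moreover have "(\<Sum>m<3. sin_coeff m * u ^ m) = u" by (simp add: eval_nat_numeral sin_coeff_def)
 moreover have "inverse (fact 3) * \<bar>u\<bar> ^ 3 = u ^ 3 / 6" using u by (simp add: eval_nat_numeral)
 ultimately have m: "\<bar>sin u - u\<bar> \<le> u ^ 3 / 6" by simp
 \<comment> \<open>pi / 2 < 8 / 5 is sharp enough for u / 2 \<le> sin u on the whole range, which
   converts powers of u into powers of sin u.\<close>
 have u16: "u \<le> 8 / 5" using u pi_less_4 pi_approx by simp
 have "u * u \<le> (8 / 5) * (8 / 5)" using u u16 by (intro mult_mono) auto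
 then have "u * (u * u) \<le> u * 3" using u by (intro mult_left_mono) auto
 moreover have "u - sin u \<le> u * (u * u) / 6" using m unfolding power3_eq_cube mult.assoc abs_le_iff by simp
 ultimately have half: "u / 2 \<le> sin u" by simp
 have "u\<^sup>2 \<le> (2 * sin u)\<^sup>2" using half u by (intro power_mono) auto
 then have u2: "u\<^sup>2 \<le> 4 * (sin u)\<^sup>2" by (simp add: power_mult_distrib)
 have "u ^ 3 \<le> 2 * u\<^sup>2" using mult_right_mono[of u 2 "u\<^sup>2"] u16 by (simp add: power3_eq_cube power2_eq_square)
 then have "\<bar>sin u - u\<bar> \<le> 4 * (sin u)\<^sup>2" using m u2 zero_le_power2[of "sin u"] by linarith
 moreover have "sqrt 2 * (1 - t) powr (1 / 2) = 2 * sin u"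
  using s by (simp add: t powr_half_sqrt real_sqrt_mult)
 moreover have "arccos t = 2 * u" by (simp add: u_def)
 ultimately show ?thesis using t by (simp add: abs_minus_commute)
qed

text \<open>The direction is the normalised tangential part of y. At equal or opposite points any
  orthogonal unit vector serves, and one exists in dimension at least 2.\<close>

lemma geodesic_exists:
 fixes x y :: "'a::euclidean_space"
 assumes D: "2 \<le> DIM('a)" and x: "norm x = 1" and y: "norm y = 1"
 obtains w where "norm w = 1" "x \<bullet> w = 0" "y = cos (arccos (x \<bullet> y)) *\<^sub>R x + sin (arccos (x \<bullet> y)) *\<^sub>R w"
proof -
 define s where "s = x \<bullet> y"
 have s: "\<bar>s\<bar> \<le> 1" using Cauchy_Schwarz_ineq2[of x y] x y by (simp add: s_def)
 then have cs: "cos (arccos s) = s" "sin (arccos s) = sqrt (1 - s\<^sup>2)"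
  by (simp_all add: abs_le_iff cos_arccos_abs sin_arccos_abs)
 have xx: "x \<bullet> x = 1" "y \<bullet> y = 1" using x y by (simp_all add: norm_eq_1)
 define v where "v = y - s *\<^sub>R x"
 have vv: "v \<bullet> v = 1 - s\<^sup>2"
  by (simp add: v_def inner_diff_left inner_diff_right xx s_def inner_commute power2_eq_square)
 then have nv: "norm v = sqrt (1 - s\<^sup>2)" by (simp add: norm_eq_sqrt_inner)
 show ?thesis
 proof (cases "v = 0")
  case True
  obtain w0 where w0: "w0 \<noteq> 0" "orthogonal x w0" using orthogonal_to_vector_exists[OF D] by blast
  show ?thesis
  proof (rule that)
   show "norm (sgn w0) = 1" using w0 by (simp add: norm_sgn)
   show "x \<bullet> sgn w0 = 0" using w0 by (simp add: sgn_div_norm orthogonal_def)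
   show "y = cos (arccos (x \<bullet> y)) *\<^sub>R x + sin (arccos (x \<bullet> y)) *\<^sub>R sgn w0"
   proof -
    have "sin (arccos s) = 0" using True nv cs(2) by simp
    then have "cos (arccos s) *\<^sub>R x + sin (arccos s) *\<^sub>R sgn w0 = s *\<^sub>R x" by (simp only: cs(1)) simp
    moreover have "y = s *\<^sub>R x" using True unfolding v_def by simp
    ultimately show ?thesis unfolding s_def[symmetric] by (simp only:)
   qed
  qed
 next
  case False
  show ?thesis
  proof (rule that)
   show "norm (sgn v) = 1" using False by (simp add: norm_sgn)
   show "x \<bullet> sgn v = 0" by (simp add: sgn_div_norm v_def inner_diff_right xx s_def)
   have "sqrt (1 - s\<^sup>2) *\<^sub>R sgn v = v" using False by (simp add: sgn_div_norm nv[symmetric])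
   then show "y = cos (arccos (x \<bullet> y)) *\<^sub>R x + sin (arccos (x \<bullet> y)) *\<^sub>R sgn v"
    by (simp add: s_def[symmetric] cs v_def)
  qed
 qed
qed

text \<open>The angle to the starting point grows at most at the speed of the curve, by
  Cauchy-Schwarz for the part of x orthogonal to the current point.\<close>

lemma arccos_le_curve_length:
 fixes c :: "real => 'a::euclidean_space"
 assumes c: "c C1_differentiable_on {0..1}" and sph: "path_image c \<subseteq> sphere 0 1"
 shows "arccos (pathstart c \<bullet> pathfinish c) \<le> integral {0..1} (\<lambda>t. norm (vector_derivative c (at t)))"
proof -
 obtain D where D: "\<And>t. t \<in> {0..1} ==> (c has_vector_derivative D t) (at t)" and Dc: "continuous_on {0..1} D"
  using c unfolding C1_differentiable_on_def by blast
 have vd: "vector_derivative c (at t) = D t" if "t \<in> {0..1}" for t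
  using D[OF that] by (rule vector_derivative_at)
 have unit: "norm (c t) = 1" if "t \<in> {0..1}" for t using subsetD[OF sph, of "c t"] that by (simp add: path_image_def)
 have cc: "c t \<bullet> c t = 1" if "t \<in> {0..1}" for t using unit[OF that] by (simp add: norm_eq_1)
 have tang: "c t \<bullet> D t = 0" if t: "t \<in> {0..1}" for t
 proof -
  have d: "(c has_derivative (\<lambda>h. h *\<^sub>R D t)) (at t within {0..1})"
   using D[OF t] by (auto simp: has_vector_derivative_def intro: has_derivative_at_withinI)
  have "((\<lambda>t. c t \<bullet> c t) has_vector_derivative 2 * (c t \<bullet> D t)) (at t within {0..1})"
   unfolding has_vector_derivative_def
   by (rule has_derivative_eq_rhs[OF has_derivative_inner[OF d d]]) (simp add: fun_eq_iff inner_commute[of "D t"])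
  moreover have "((\<lambda>t. c t \<bullet> c t) has_vector_derivative 0) (at t within {0..1})"
   by (rule has_vector_derivative_transform[OF t _ has_vector_derivative_const[of 1]]) (use cc in auto)
  ultimately have "2 * (c t \<bullet> D t) = 0"
   using t by (intro vector_derivative_unique_within_closed_interval[of 0 1 t]) auto
  then show ?thesis by simp
 qed
 define x where "x = pathstart c"
 have x: "norm x = 1" "x = c 0" using unit[of 0] by (auto simp: x_def pathstart_def)
 have xx: "x \<bullet> x = 1" using x by (simp add: norm_eq_1)
 define f where "f t = x \<bullet> c t" for t
 have f1: "\<bar>f t\<bar> \<le> 1" if "t \<in> {0..1}" for t
  using Cauchy_Schwarz_ineq2[of x "c t"] x unit[OF that] by (simp add: f_def)
 have xD: "(x \<bullet> D t)\<^sup>2 \<le> (1 - (f t)\<^sup>2) * (norm (D t))\<^sup>2" if t: "t \<in> {0..1}" for t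
 proof -
  have "x \<bullet> D t = (x - f t *\<^sub>R c t) \<bullet> D t" using tang[OF t] by (simp add: inner_diff_left)
  then have "(x \<bullet> D t)\<^sup>2 \<le> ((x - f t *\<^sub>R c t) \<bullet> (x - f t *\<^sub>R c t)) * (D t \<bullet> D t)"
   using Cauchy_Schwarz_ineq[of "x - f t *\<^sub>R c t" "D t"] by simp
  also have "(x - f t *\<^sub>R c t) \<bullet> (x - f t *\<^sub>R c t) = 1 - (f t)\<^sup>2"
   using cc[OF t] by (simp add: inner_diff_left inner_diff_right xx f_def inner_commute power2_eq_square)
  finally show ?thesis by (simp add: power2_norm_eq_inner)
 qed
 have int: "(\<lambda>t. norm (D t)) integrable_on {0..1}"
  by (intro integrable_continuous_interval continuous_intros Dc)
 \<comment> \<open>\<open>arccos\<close> has no derivative at 1 and -1, so the inner product is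
   scaled by l < 1; l tends to 1 afterwards.\<close>
 have main: "arccos (l * f 1) - arccos l \<le> integral {0..1} (\<lambda>t. norm (D t))" if l: "0 < l" "l < 1" for l
 proof -
  define g where "g t = arccos (l * f t)" for t
  define g' where "g' t = - (l * (x \<bullet> D t)) / sqrt (1 - (l * f t)\<^sup>2)" for t
  have lf: "\<bar>l * f t\<bar> < 1" if "t \<in> {0..1}" for t
  proof -
   have "l * \<bar>f t\<bar> \<le> l * 1" using f1[OF that] l by (intro mult_left_mono) auto
   moreover have "\<bar>l * f t\<bar> = l * \<bar>f t\<bar>" using l by (simp add: abs_mult)
   ultimately show ?thesis using l by linarith
  qed
  have gd: "(g has_vector_derivative g' t) (at t)" if t: "t \<in> {0..1}" for t
  proof -
   have "(f has_real_derivative x \<bullet> D t) (at t)"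
    unfolding f_def has_real_derivative_iff_has_vector_derivative
    using bounded_linear.has_vector_derivative[OF bounded_linear_inner_right D[OF t]] .
   from DERIV_cmult[OF this, of l] have "((\<lambda>t. l * f t) has_real_derivative l * (x \<bullet> D t)) (at t)" .
   from DERIV_chain2[OF DERIV_arccos this] lf[OF t]
   have "(g has_real_derivative inverse (- sqrt (1 - (l * f t)\<^sup>2)) * (l * (x \<bullet> D t))) (at t)"
    unfolding g_def by (simp add: abs_less_iff)
   then show ?thesis unfolding has_real_derivative_iff_has_vector_derivative g'_def by (simp add: divide_inverse mult.commute)
  qed
  have I: "(g' has_integral (g 1 - g 0)) {0..1}"
   by (rule fundamental_theorem_of_calculus, simp) (rule has_vector_derivative_at_within[OF gd])
  have le: "g' t \<le> norm (D t)" if t: "t \<in> {0..1}" for t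
  proof -
   have s1: "(l * f t)\<^sup>2 < 1" using lf[OF t] by (simp only: abs_square_less_1)
   then have sq: "(sqrt (1 - (l * f t)\<^sup>2))\<^sup>2 = 1 - (l * f t)\<^sup>2" by simp
   have l2: "l\<^sup>2 \<le> 1" using l by (simp add: power_le_one)
   have "(l * (x \<bullet> D t))\<^sup>2 \<le> l\<^sup>2 * ((1 - (f t)\<^sup>2) * (norm (D t))\<^sup>2)"
    unfolding power_mult_distrib by (intro mult_left_mono xD t) auto
   also have "\<dots> = (l\<^sup>2 - (l * f t)\<^sup>2) * (norm (D t))\<^sup>2" by (simp add: power_mult_distrib algebra_simps)
   also have "\<dots> \<le> (1 - (l * f t)\<^sup>2) * (norm (D t))\<^sup>2" using l2 by (intro mult_right_mono) auto
   also have "\<dots> = (sqrt (1 - (l * f t)\<^sup>2) * norm (D t))\<^sup>2"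
    unfolding power_mult_distrib[of "sqrt _"] sq ..
   finally have "\<bar>l * (x \<bullet> D t)\<bar> \<le> \<bar>sqrt (1 - (l * f t)\<^sup>2) * norm (D t)\<bar>" unfolding abs_le_square_iff .
   moreover have "0 \<le> sqrt (1 - (l * f t)\<^sup>2) * norm (D t)" using s1 by simp
   ultimately have "\<bar>l * (x \<bullet> D t)\<bar> \<le> sqrt (1 - (l * f t)\<^sup>2) * norm (D t)" by linarith
   moreover have "sqrt (1 - (l * f t)\<^sup>2) > 0" using s1 by simp
   ultimately show ?thesis unfolding g'_def by (subst pos_divide_le_eq) (auto simp: mult.commute abs_le_iff)
  qed
  have "g 1 - g 0 \<le> integral {0..1} (\<lambda>t. norm (D t))"
   by (rule has_integral_le[OF I integrable_integral[OF int]]) (rule le)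
  then show ?thesis using xx by (simp add: g_def f_def x(2))
 qed
 have "((\<lambda>l. arccos (l * f 1) - arccos l) \<longlongrightarrow> arccos (1 * f 1) - arccos 1) (at_left 1)"
 proof (intro tendsto_diff)
  have ac: "continuous_on {-1..1} arccos" by (rule continuous_on_arccos')
  have ev: "\<forall>\<^sub>F l in at_left 1. 0 < l \<and> l < (1::real)"
   using eventually_at_left_real[of 0 1] by simp
  show "(arccos \<longlongrightarrow> arccos 1) (at_left 1)"
   by (rule continuous_on_tendsto_compose[OF ac tendsto_ident_at]) (use ev in \<open>auto elim!: eventually_mono\<close>)
  have "((\<lambda>l. l * f 1) \<longlongrightarrow> 1 * f 1) (at_left 1)" by (intro tendsto_intros)
  then show "((\<lambda>l. arccos (l * f 1)) \<longlongrightarrow> arccos (1 * f 1)) (at_left 1)"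
  proof (rule continuous_on_tendsto_compose[OF ac])
   show "1 * f 1 \<in> {-1..1}" using f1[of 1] by (simp add: abs_le_iff)
   show "\<forall>\<^sub>F l in at_left 1. l * f 1 \<in> {- 1..1}"
    using ev
   proof eventually_elim
    case (elim l)
    have "\<bar>l * f 1\<bar> \<le> 1 * 1" unfolding abs_mult using f1[of 1] elim by (intro mult_mono) auto
    then show ?case by (auto simp: abs_le_iff)
   qed
  qed
 qed
 then have "arccos (1 * f 1) - arccos 1 \<le> integral {0..1} (\<lambda>t. norm (D t))"
  by (rule tendsto_upperbound) (use main eventually_at_left_real[of 0 1] in \<open>auto elim!: eventually_mono\<close>)
 moreover have "integral {0..1} (\<lambda>t. norm (vector_derivative c (at t))) = integral {0..1} (\<lambda>t. norm (D t))"
  by (rule integral_cong) (simp add: vd)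
 ultimately show ?thesis by (simp add: f_def x_def pathfinish_def)
qed

lemma geod_dist_eq:
 fixes x y :: "'a::euclidean_space"
 assumes D: "2 \<le> DIM('a)" and x: "norm x = 1" and y: "norm y = 1"
 shows "geod_dist x y = arccos (x \<bullet> y)"
 unfolding geod_dist_def
proof (rule cInf_eq_minimum)
 define \<theta> where "\<theta> = arccos (x \<bullet> y)"
 have \<theta>: "\<theta> \<ge> 0" unfolding \<theta>_def using Cauchy_Schwarz_ineq2[of x y] x y by (intro arccos_lbound) (auto simp: abs_le_iff)
 obtain w where w: "norm w = 1" "x \<bullet> w = 0" "y = cos \<theta> *\<^sub>R x + sin \<theta> *\<^sub>R w"
  using geodesic_exists[OF D x y] unfolding \<theta>_def by blast
 define c where "c t = cos (t * \<theta>) *\<^sub>R x + sin (t * \<theta>) *\<^sub>R w" for t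
 define D where "D t = (- sin (t * \<theta>) * \<theta>) *\<^sub>R x + (cos (t * \<theta>) * \<theta>) *\<^sub>R w" for t
 have xx: "x \<bullet> x = 1" "w \<bullet> w = 1" "w \<bullet> x = 0" using x w by (simp_all add: norm_eq_1 inner_commute)
 have d: "(c has_vector_derivative D t) (at t)" for t
 proof -
  have "((\<lambda>t. cos (t * \<theta>)) has_vector_derivative - sin (t * \<theta>) * \<theta>) (at t)"
   "((\<lambda>t. sin (t * \<theta>)) has_vector_derivative cos (t * \<theta>) * \<theta>) (at t)"
   unfolding has_real_derivative_iff_has_vector_derivative[symmetric]
   by (auto intro!: derivative_eq_intros)
  from has_vector_derivative_add[OF bounded_linear.has_vector_derivative[OF bounded_linear_scaleR_left this(1)]
   bounded_linear.has_vector_derivative[OF bounded_linear_scaleR_left this(2)]]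
  show ?thesis unfolding c_def D_def .
 qed
 have gen: "(a *\<^sub>R x + b *\<^sub>R w) \<bullet> (a *\<^sub>R x + b *\<^sub>R w) = a\<^sup>2 + b\<^sup>2" for a b
  by (simp add: inner_add_left inner_add_right xx w(2) power2_eq_square)
 have "D t \<bullet> D t = \<theta>\<^sup>2 * ((sin (t * \<theta>))\<^sup>2 + (cos (t * \<theta>))\<^sup>2)" for t
  unfolding D_def gen by (simp only: power_mult_distrib power2_minus distrib_left mult.commute)
 then have nD: "norm (D t) = \<theta>" for t using \<theta> by (simp add: norm_eq_sqrt_inner)
 have nc: "norm (c t) = 1" for t unfolding norm_eq_1 c_def gen by simp
 have "c C1_differentiable_on {0..1}"
  unfolding C1_differentiable_on_def
  by (intro exI[of _ D] conjI ballI d) (auto simp: D_def intro!: continuous_intros)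
 moreover have "path_image c \<subseteq> sphere 0 1" using nc by (auto simp: path_image_def)
 moreover have "pathstart c = x" "pathfinish c = y" using w(3) by (simp_all add: c_def pathstart_def pathfinish_def)
 moreover have "integral {0..1} (\<lambda>t. norm (vector_derivative c (at t))) = \<theta>"
  by (simp add: vector_derivative_at[OF d] nD)
 ultimately show "arccos (x \<bullet> y) \<in> {integral {0..1} (\<lambda>t. norm (vector_derivative c (at t))) | c.
   c C1_differentiable_on {0..1} \<and> path_image c \<subseteq> sphere 0 1 \<and> pathstart c = x \<and> pathfinish c = y}"
  unfolding \<theta>_def by (intro CollectI exI[of _ c]) auto
next
 fix z assume "z \<in> {integral {0..1} (\<lambda>t. norm (vector_derivative c (at t))) | c.
   c C1_differentiable_on {0..1} \<and> path_image c \<subseteq> sphere 0 1 \<and> pathstart c = x \<and> pathfinish c = y}"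
 then show "arccos (x \<bullet> y) \<le> z" using arccos_le_curve_length by blast
qed

section \<open>Transfer between the Riemannian volume and the normalised measure\<close>

definition sphere_borel :: "((real^'n) \<times> real) measure" where
 "sphere_borel = distr (density lborel (\<lambda>u. ennreal (conf u ^ CARD('n)))) (restrict_space borel (sphere 0 1)) stereo"

lemma sphere_vol_eq: "sphere_vol = completion (sphere_borel :: ((real^'n) \<times> real) measure)"
 by (simp add: sphere_vol_def sphere_borel_def sqrt_det_gram)

lemma space_sphere_borel [simp]: "space (sphere_borel :: ((real^'n) \<times> real) measure) = sphere 0 1"
 by (simp add: sphere_borel_def space_restrict_space)

lemma space_sphere_vol [simp]: "space (sphere_vol :: ((real^'n) \<times> real) measure) = sphere 0 1"
 by (simp add: sphere_vol_eq)

lemma stereo_measurable_sphere: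
 "stereo \<in> measurable (density lborel f) (restrict_space borel (sphere (0 :: (real^'n) \<times> real) 1))"
 by (rule measurable_restrict_space2) (auto simp: norm_stereo)

lemma measurable_sphere_borel: "f \<in> measurable borel M ==> f \<in> measurable (sphere_borel :: ((real^'n) \<times> real) measure) M"
 unfolding sphere_borel_def measurable_distr_eq1 by (rule measurable_restrict_space1)

lemma measurable_sphere_vol: "f \<in> measurable borel M ==> f \<in> measurable (sphere_vol :: ((real^'n) \<times> real) measure) M"
 unfolding sphere_vol_eq by (intro measurable_completion measurable_sphere_borel)

lemma nn_integral_sphere_vol:
 fixes f :: "(real^'n) \<times> real => ennreal"
 assumes f [measurable]: "f \<in> borel_measurable borel"
 shows "(\<integral>\<^sup>+x. f x \<partial>sphere_vol) = ennreal (chart_area TYPE('n)) * (\<integral>\<^sup>+x. f x \<partial>sphere_prob)"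
proof -
 have "(\<integral>\<^sup>+x. f x \<partial>sphere_vol) = (\<integral>\<^sup>+x. f x \<partial>sphere_borel)"
  by (simp add: sphere_vol_eq nn_integral_completion)
 also have "\<dots> = (\<integral>\<^sup>+u. f (stereo u) \<partial>density lborel (\<lambda>u. ennreal (conf u ^ CARD('n))))"
  unfolding sphere_borel_def
  by (rule nn_integral_distr[OF stereo_measurable_sphere])
   (unfold measurable_distr_eq1, rule measurable_restrict_space1[OF f])
 also have "\<dots> = (\<integral>\<^sup>+x. f x \<partial>chart_vol)"
  unfolding chart_vol_def by (subst nn_integral_distr) auto
 also have "\<dots> = ennreal (chart_area TYPE('n)) * (\<integral>\<^sup>+x. f x \<partial>sphere_prob)"
  using chart_area_pos[where 'n='n]
  by (simp add: nn_integral_sphere_prob mult.assoc[symmetric] ennreal_mult[symmetric])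
 finally show ?thesis .
qed

lemma integral_sphere_vol:
 fixes f :: "(real^'n) \<times> real => real"
 assumes f [measurable]: "f \<in> borel_measurable borel"
 shows "integrable sphere_vol f \<longleftrightarrow> integrable sphere_prob f"
  and "(LINT x|sphere_vol. f x) = chart_area TYPE('n) * (LINT x|sphere_prob. f x)"
proof -
 have w: "chart_area TYPE('n) > 0" by (rule chart_area_pos)
 have m: "f \<in> borel_measurable sphere_vol" "f \<in> borel_measurable sphere_prob"
  using f by (auto intro: measurable_sphere_vol simp: sph.measurable_P)
 show i: "integrable sphere_vol f \<longleftrightarrow> integrable sphere_prob f"
 proof -
  have "(\<integral>\<^sup>+x. ennreal (norm (f x)) \<partial>sphere_vol) < \<infinity> \<longleftrightarrow> (\<integral>\<^sup>+x. ennreal (norm (f x)) \<partial>sphere_prob) < \<infinity>"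
   using w by (subst nn_integral_sphere_vol) (auto simp: ennreal_mult_less_top less_top ennreal_mult_eq_top_iff)
  then show ?thesis using m unfolding integrable_iff_bounded by blast
 qed
 show "(LINT x|sphere_vol. f x) = chart_area TYPE('n) * (LINT x|sphere_prob. f x)"
 proof (cases "integrable sphere_prob f")
  case True
  then show ?thesis using i w
   by (simp add: real_lebesgue_integral_def nn_integral_sphere_vol enn2real_mult right_diff_distrib)
 next
  case False
  then show ?thesis using i by (simp add: not_integrable_integral_eq)
 qed
qed

lemma finite_sphere_vol: "finite_measure (sphere_vol :: ((real^'n) \<times> real) measure)"
proof (rule finite_measureI)
 have "emeasure (sphere_vol :: ((real^'n) \<times> real) measure) (space sphere_vol) = (\<integral>\<^sup>+x. 1 \<partial>(sphere_vol :: ((real^'n) \<times> real) measure))" by simp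
 also have "\<dots> = ennreal (chart_area TYPE('n)) * 1"
  using sph.emeasure_space_1[where 'n='n] by (subst nn_integral_sphere_vol) simp_all
 finally show "emeasure (sphere_vol :: ((real^'n) \<times> real) measure) (space sphere_vol) \<noteq> \<infinity>" by simp
qed

text \<open>Sets of the completed measure are exchanged for Borel sets up to a null set, so that the
  averaging results apply to them.\<close>

lemma borel_version:
 fixes A :: "((real^'n) \<times> real) set"
 assumes A: "A \<in> sets sphere_vol"
 obtains B where "B \<in> sets borel" "AE x in sphere_vol. x \<in> A \<longleftrightarrow> x \<in> B"
proof
 have A': "A \<in> sets (completion sphere_borel)" using A by (simp add: sphere_vol_eq)
 have "main_part sphere_borel A \<in> sets sphere_borel" using A' by simp
 then show "main_part sphere_borel A \<in> sets borel"
  by (auto simp: sphere_borel_def sets_restrict_space)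
 have "AE x in (sphere_borel :: ((real^'n) \<times> real) measure). x \<notin> null_part sphere_borel A" by (rule AE_notin_null_part[OF A'])
 then have "AE x in (sphere_vol :: ((real^'n) \<times> real) measure). x \<notin> null_part sphere_borel A"
  unfolding sphere_vol_eq AE_completion_iff .
 then show "AE x in sphere_vol. x \<in> A \<longleftrightarrow> x \<in> main_part sphere_borel A"
  by eventually_elim (use main_part_null_part_Un[OF A'] in blast)
qed

lemma AE_sphere_vol_neq: "AE x in (sphere_vol :: ((real^'n) \<times> real) measure). x \<noteq> y"
proof -
 have "stereo -` {y} \<subseteq> {stereo_inv y}"
 proof
  fix u assume "u \<in> stereo -` {y}"
  then have "stereo u = y" by blast
  then show "u \<in> {stereo_inv y}" using stereo_inv_stereo[of u] by simp
 qed
 then have "finite (stereo -` {y})" by (rule finite_subset) simp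
 then have "stereo -` {y} \<in> null_sets lborel" by (intro finite_imp_null_set_lborel)
 then have "AE u in lborel. u \<notin> stereo -` {y}" by (rule AE_not_in)
 then have "AE u in lborel. 0 < ennreal (conf (u::real^'n) ^ CARD('n)) \<longrightarrow> stereo u \<noteq> y" by eventually_elim auto
 then have "AE u in density lborel (\<lambda>u. ennreal (conf (u::real^'n) ^ CARD('n))). stereo u \<noteq> y"
  by (subst AE_density) auto
 then have "AE x in (sphere_borel :: ((real^'n) \<times> real) measure). x \<noteq> y"
  unfolding sphere_borel_def
  by (subst AE_distr_iff[OF stereo_measurable_sphere]) (auto simp: space_restrict_space sets_restrict_space intro!: image_eqI[of _ _ "- {y}"])
 then show ?thesis unfolding sphere_vol_eq AE_completion_iff .
qed

text \<open>Multiplied by the area to pass to the normalised measure, extended radially to be Borel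
  on the ambient space, and set to 0 on the diagonal, where \<open>helmholtz_kernel\<close> leaves
  the values open.\<close>

definition green_of :: "((real^'n) \<times> real => (real^'n) \<times> real => real) => (real^'n) \<times> real => (real^'n) \<times> real => real" where
 "green_of k x y = (if x \<noteq> 0 \<and> y \<noteq> 0 \<and> x /\<^sub>R norm x \<noteq> y /\<^sub>R norm y
  then chart_area TYPE('n) * k (x /\<^sub>R norm x) (y /\<^sub>R norm y) else 0)"

lemma green_of_unit: "norm x = 1 ==> norm y = 1 ==> green_of k x y =
  (if x \<noteq> y then chart_area TYPE('n) * k x y else 0)" for x y :: "(real^'n) \<times> real"
 by (cases "x = 0"; cases "y = 0") (simp_all add: green_of_def)

lemma sphere_green_helmholtz:
 fixes k :: "(real^'n) \<times> real => (real^'n) \<times> real => real"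
 assumes e: "eps > 0" and k: "helmholtz_kernel eps k"
 shows "sphere_green sphere_prob (green_of k) eps (real CARD('n))"
proof -
 define U where "U = {(x, y). x \<noteq> (0 :: (real^'n) \<times> real) \<and> y \<noteq> (0 :: (real^'n) \<times> real) \<and> x /\<^sub>R norm x \<noteq> y /\<^sub>R norm y}"
 define \<omega> where "\<omega> = chart_area TYPE('n)"
 have \<omega>: "\<omega> > 0" unfolding \<omega>_def by (rule chart_area_pos)
 have U: "open U"
 proof -
  have "continuous_on ((- {0}) \<times> (- {0})) (\<lambda>u :: ((real^'n) \<times> real) \<times> ((real^'n) \<times> real). fst u /\<^sub>R norm (fst u) - snd u /\<^sub>R norm (snd u))"
   by (intro continuous_intros) auto
  moreover have "open ((- {0 :: (real^'n) \<times> real}) \<times> (- {0 :: (real^'n) \<times> real}))"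
   by (intro open_Times open_Compl) auto
  ultimately have "open (((- {0}) \<times> (- {0})) \<inter> (\<lambda>u :: ((real^'n) \<times> real) \<times> ((real^'n) \<times> real). fst u /\<^sub>R norm (fst u) - snd u /\<^sub>R norm (snd u)) -` (- {0}))"
   by (intro continuous_open_preimage open_Compl) auto
  also have "\<dots> = U" by (rule set_eqI) (simp add: U_def mem_Times_iff case_prod_beta')
  finally show ?thesis .
 qed
 have "smooth_on U (\<lambda>(x, y). k (x /\<^sub>R norm x) (y /\<^sub>R norm y))"
  using k unfolding helmholtz_kernel_def U_def by blast
 then have "Ck_on 0 U (\<lambda>(x, y). k (x /\<^sub>R norm x) (y /\<^sub>R norm y))" unfolding smooth_on_def by blast
 then have kc: "continuous_on U (\<lambda>u. k (fst u /\<^sub>R norm (fst u)) (snd u /\<^sub>R norm (snd u)))"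
  by (simp add: case_prod_beta')
 have gU: "green_of k (fst u) (snd u) = (if u \<in> U then \<omega> * k (fst u /\<^sub>R norm (fst u)) (snd u /\<^sub>R norm (snd u)) else 0)" for u
  by (simp add: green_of_def U_def \<omega>_def case_prod_beta')
 have cU: "continuous_on U (\<lambda>u. green_of k (fst u) (snd u))"
  by (rule continuous_on_eq[of U "\<lambda>u. \<omega> * k (fst u /\<^sub>R norm (fst u)) (snd u /\<^sub>R norm (snd u))"])
   (intro continuous_intros kc, simp add: gU)
 have meas: "(\<lambda>u. green_of k (fst u) (snd u)) \<in> borel_measurable borel2"
 proof -
  have "(\<lambda>u. indicator U u *\<^sub>R green_of k (fst u) (snd u)) \<in> borel_measurable borel"
   by (rule borel_measurable_continuous_on_indicator[OF borel_open[OF U] cU])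
  moreover have "(\<lambda>u. indicator U u *\<^sub>R green_of k (fst u) (snd u)) = (\<lambda>u. green_of k (fst u) (snd u))"
   by (simp add: fun_eq_iff gU indicator_def del: split_paired_All)
  ultimately show ?thesis by (simp add: borel_prod)
 qed
 have meas1: "(\<lambda>x. green_of k x y) \<in> borel_measurable borel" for y
  using measurable_compose[OF _ meas, of "\<lambda>x. (x, y)" borel] by simp
 \<comment> \<open>Points are null sets, so changing the kernel at x = y leaves the integrals in x
   alone.\<close>
 have AEk: "AE x in sphere_vol. green_of k x y * g x = \<omega> * (k x y * g x)" if "norm y = 1" for y g
  using AE_sphere_vol_neq[of y] AE_space[of sphere_vol]
  by eventually_elim (use that in \<open>simp add: green_of_unit \<omega>_def\<close>)
 have ky: "integrable sphere_vol (\<lambda>x. k x y)" if "norm y = 1" for y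
  using k that unfolding helmholtz_kernel_def by auto
 have kw: "(LINT x|sphere_vol. k x y * (\<phi> x - eps\<^sup>2 * laplace_beltrami \<phi> x)) = \<phi> y" if "norm y = 1" "smooth_sphere \<phi>" for \<phi> y
  using k that unfolding helmholtz_kernel_def by auto
 show ?thesis
 proof (intro sphere_green.intro rotation_invariant_sphere_prob sphere_green_axioms.intro e meas)
  show "real CARD('n) = real (DIM((real^'n) \<times> real) - 1)" by simp
  show int: "integrable sphere_prob (\<lambda>x. green_of k x y)" if y: "norm y = 1" for y
  proof -
   have "integrable sphere_vol (\<lambda>x. \<omega> * k x y)" using ky[OF y] by simp
   then have "integrable sphere_vol (\<lambda>x. green_of k x y)"
    by (rule integrable_cong_AE_imp[OF _ measurable_sphere_vol[OF meas1]])
     (use AEk[OF y, of "\<lambda>_. 1"] in \<open>eventually_elim, simp\<close>)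
   then show ?thesis by (simp add: integral_sphere_vol(1)[OF meas1])
  qed
  show "(LINT x|sphere_prob. green_of k x y * poly (helm eps (real CARD('n)) p) (x \<bullet> z)) = poly p (y \<bullet> z)"
   if y: "norm y = 1" and z: "norm z = 1" for y z p
  proof -
   let ?h = "\<lambda>x. poly (helm eps (real CARD('n)) p) (x \<bullet> z)"
   have hm: "?h \<in> borel_measurable borel" by (intro borel_measurable_continuous_onI continuous_intros)
   have "\<omega> * (LINT x|sphere_prob. green_of k x y * ?h x) = (LINT x|sphere_vol. green_of k x y * ?h x)"
    unfolding \<omega>_def by (rule integral_sphere_vol(2)[symmetric]) (intro borel_measurable_times meas1 hm)
   also have "\<dots> = (LINT x|sphere_vol. \<omega> * (k x y * ?h x))"
    by (rule integral_cong_AE)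
     (intro AEk[OF y] borel_measurable_times borel_measurable_const borel_measurable_integrable[OF ky[OF y]] measurable_sphere_vol meas1 hm)+
   also have "\<dots> = \<omega> * (LINT x|sphere_vol. k x y * ?h x)" by simp
   also have "(LINT x|sphere_vol. k x y * ?h x) = (LINT x|sphere_vol. k x y * (poly p (x \<bullet> z) - eps\<^sup>2 * laplace_beltrami (\<lambda>x. poly p (x \<bullet> z)) x))"
    by (intro Bochner_Integration.integral_cong refl) (simp add: laplace_beltrami_ridge z poly_helm)
   also have "\<dots> = poly p (y \<bullet> z)" by (rule kw[OF y smooth_sphere_ridge])
   finally show ?thesis using \<omega> by simp
  qed
  show "continuous_on {u. norm (fst u) = 1 \<and> norm (snd u) = 1 \<and> fst u \<noteq> snd u} (\<lambda>u. green_of k (fst u) (snd u))"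
   by (rule continuous_on_subset[OF cU], rule subsetI) (auto simp: U_def case_prod_beta' simp del: split_paired_All)
  show "green_of k x x = 0" for x by (simp add: green_of_def)
 qed
qed

section \<open>The nonlocal term as an average of chord variations\<close>

text \<open>Truncation makes the angle a continuous bounded function on all reals; at the inner
  product of two unit vectors it is their geodesic distance.\<close>

definition clip_arccos :: "real => real" where
 "clip_arccos t = arccos (max (-1) (min 1 t))"

lemma clip_arccos_eq: "\<bar>t\<bar> \<le> 1 ==> clip_arccos t = arccos t"
 by (auto simp: clip_arccos_def abs_le_iff max_def min_def)

lemma clip_arccos_bounds: "0 \<le> clip_arccos t" "clip_arccos t \<le> pi"
 unfolding clip_arccos_def by (auto intro!: arccos_lbound arccos_ubound)

lemma clip_arccos_measurable [measurable]: "clip_arccos \<in> borel_measurable borel"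
proof (rule borel_measurable_continuous_onI)
 show "continuous_on UNIV clip_arccos"
  unfolding clip_arccos_def
  by (rule continuous_on_compose2[OF continuous_on_arccos', of UNIV "\<lambda>t. max (-1) (min 1 t)"])
   (auto intro!: continuous_intros)
qed

lemma ennreal_integral_le_nn_integral:
 fixes f :: "'a => real"
 assumes "integrable M f"
 shows "ennreal (LINT x|M. f x) \<le> (\<integral>\<^sup>+x. ennreal (f x) \<partial>M)"
proof -
 have "(\<integral>\<^sup>+x. ennreal (f x) \<partial>M) \<le> (\<integral>\<^sup>+x. ennreal (norm (f x)) \<partial>M)"
  by (intro nn_integral_mono ennreal_leI) auto
 then have fin: "(\<integral>\<^sup>+x. ennreal (f x) \<partial>M) < top"
  using assms unfolding integrable_iff_bounded by (metis infinity_ennreal_def order_le_less_trans)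
 have "(LINT x|M. f x) \<le> enn2real (\<integral>\<^sup>+x. ennreal (f x) \<partial>M)"
  unfolding real_lebesgue_integral_def[OF assms] by simp
 then have "ennreal (LINT x|M. f x) \<le> ennreal (enn2real (\<integral>\<^sup>+x. ennreal (f x) \<partial>M))" by (rule ennreal_leI)
 also have "\<dots> = (\<integral>\<^sup>+x. ennreal (f x) \<partial>M)" using fin by simp
 finally show ?thesis .
qed

context rotation_invariant_prob begin

lemma chord_nonneg: "0 \<le> chord_var A r"
 unfolding chord_var_def by (rule Bochner_Integration.integral_nonneg) simp

text \<open>The chord variation as a function of the cosine of the distance; in this form
  measurability in \<open>c\<close> comes from Tonelli.\<close>

definition chord_ennreal :: "'a set => real => ennreal" where
 "chord_ennreal A c = (\<integral>\<^sup>+z. ennreal \<bar>indicator A (c *\<^sub>R fst z + sqrt (1 - c\<^sup>2) *\<^sub>R snd z) - indicator A (fst z)\<bar> \<partial>\<nu>)"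

lemma chord_ennreal_measurable:
 assumes [measurable]: "A \<in> sets borel"
 shows "chord_ennreal A \<in> borel_measurable borel"
proof -
 show ?thesis
  unfolding chord_ennreal_def[abs_def]
  by (rule N.borel_measurable_nn_integral) measurable
qed

lemma chord_ennreal_eq:
 assumes [measurable]: "A \<in> sets borel" and c: "\<bar>c\<bar> \<le> 1"
 shows "chord_ennreal A c = ennreal (chord_var A (arccos c))"
proof -
 have r: "fst (rot (arccos c) z) = c *\<^sub>R fst z + sqrt (1 - c\<^sup>2) *\<^sub>R snd z" for z
  using c by (simp add: rot_def cos_arccos_abs sin_arccos_abs)
 have "integrable \<nu> (\<lambda>z. \<bar>indicator A (c *\<^sub>R fst z + sqrt (1 - c\<^sup>2) *\<^sub>R snd z) - indicator A (fst z) :: real\<bar>)"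
 proof (rule integrable_\<nu>_bounded[where B = 1])
  show "(\<lambda>z. \<bar>indicator A (c *\<^sub>R fst z + sqrt (1 - c\<^sup>2) *\<^sub>R snd z) - indicator A (fst z) :: real\<bar>) \<in> borel_measurable borel2"
   by measurable
 qed (simp add: indicator_def)
 then show ?thesis
  unfolding chord_ennreal_def chord_var_def r by (rule nn_integral_eq_integral) simp
qed

end

context sphere_green begin

lemma G_sym: "norm x = 1 ==> norm y = 1 ==> G x y = G y x"
 by (intro G_zonal) (simp_all add: inner_commute)

lemma zonal_nn_integral:
 assumes [measurable]: "f \<in> borel_measurable borel" and x: "norm x = 1" and y: "norm y = 1"
 shows "(\<integral>\<^sup>+z. ennreal (G x z) * f (x \<bullet> z) \<partial>P) = (\<integral>\<^sup>+z. ennreal (G z y) * f (z \<bullet> y) \<partial>P)"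
proof -
 define h where "h = reflect (x - y)"
 have h: "orthogonal_transformation h" "h x = y"
  using x y by (auto simp: h_def orthogonal_transformation_reflect intro!: reflect_diff)
 have "(\<integral>\<^sup>+z. ennreal (G z y) * f (z \<bullet> y) \<partial>P) = (\<integral>\<^sup>+z. ennreal (G (h z) y) * f (h z \<bullet> y) \<partial>P)"
  by (rule nn_integral_invariant[OF h(1), symmetric]) measurable
 also have "\<dots> = (\<integral>\<^sup>+z. ennreal (G x z) * f (x \<bullet> z) \<partial>P)"
 proof (rule nn_integral_cong_AE)
  show "AE z in P. ennreal (G (h z) y) * f (h z \<bullet> y) = ennreal (G x z) * f (x \<bullet> z)"
   using AE_norm
  proof eventually_elim
   case (elim z)
   have "h z \<bullet> h x = z \<bullet> x" using h(1) by (simp add: orthogonal_transformation_def)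
   moreover have "G (h z) (h x) = G z x" by (rule G_rotation[OF h(1) elim x])
   ultimately show ?case using h(2) G_sym[OF elim x] by (simp add: inner_commute)
  qed
 qed
 finally show ?thesis by simp
qed

text \<open>\<open>G\<close> is invariant, so \<open>nn_integral_pair_average\<close> applies with
  \<open>G\<close> as the weight. The new integrand depends on the inner product only, so the inner
  integral is the same for every x and one point can be fixed at \<open>y0\<close>.\<close>

lemma double_integral_chord:
 assumes A [measurable]: "A \<in> sets borel" and y0: "norm y0 = 1"
 shows "(\<integral>\<^sup>+x. \<integral>\<^sup>+y. ennreal (G x y) * ennreal \<bar>indicator A x - indicator A y\<bar> \<partial>P \<partial>P)
  = (\<integral>\<^sup>+x. ennreal (G x y0) * ennreal (chord_var A (clip_arccos (x \<bullet> y0))) \<partial>P)"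
proof -
 note [measurable] = chord_ennreal_measurable[OF A]
 define \<Phi> where "\<Phi> u = ennreal \<bar>indicator A (snd u) - indicator A (fst u)\<bar>" for u :: "'a \<times> 'a"
 have [measurable]: "\<Phi> \<in> borel_measurable borel2" unfolding \<Phi>_def[abs_def] by measurable
 have "(\<integral>\<^sup>+x. \<integral>\<^sup>+y. ennreal (G x y) * ennreal \<bar>indicator A x - indicator A y\<bar> \<partial>P \<partial>P)
   = (\<integral>\<^sup>+x. \<integral>\<^sup>+y. ennreal (G x y) * \<Phi> (x, y) \<partial>P \<partial>P)"
  by (simp add: \<Phi>_def abs_minus_commute)
 also have "\<dots> = (\<integral>\<^sup>+x. \<integral>\<^sup>+y. ennreal (G x y) *
   (\<integral>\<^sup>+z. \<Phi> (fst z, (x \<bullet> y) *\<^sub>R fst z + sqrt (1 - (x \<bullet> y)\<^sup>2) *\<^sub>R snd z) \<partial>\<nu>) \<partial>P \<partial>P)"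
  by (rule nn_integral_pair_average) (simp_all add: G_rotation case_prod_beta')
 also have "\<dots> = (\<integral>\<^sup>+x. \<integral>\<^sup>+y. ennreal (G x y) * chord_ennreal A (x \<bullet> y) \<partial>P \<partial>P)"
  by (simp add: \<Phi>_def chord_ennreal_def)
 also have "\<dots> = (\<integral>\<^sup>+x. (\<integral>\<^sup>+z. ennreal (G z y0) * chord_ennreal A (z \<bullet> y0) \<partial>P) \<partial>P)"
  by (rule nn_integral_cong_AE, use AE_norm in eventually_elim)
   (rule zonal_nn_integral[OF chord_ennreal_measurable[OF A] _ y0])
 also have "\<dots> = (\<integral>\<^sup>+z. ennreal (G z y0) * chord_ennreal A (z \<bullet> y0) \<partial>P)"
  using emeasure_space_1 by simp
 also have "\<dots> = (\<integral>\<^sup>+x. ennreal (G x y0) * ennreal (chord_var A (clip_arccos (x \<bullet> y0))) \<partial>P)"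
 proof (rule nn_integral_cong_AE, use AE_norm in eventually_elim)
  case (elim x)
  have "\<bar>x \<bullet> y0\<bar> \<le> 1" using inner_bounds[OF elim y0] by (simp add: abs_le_iff)
  then show ?case by (simp add: chord_ennreal_eq clip_arccos_eq)
 qed
 finally show ?thesis .
qed

definition gdist :: "'a => real" where
 "gdist y = (LINT x|P. G x y * clip_arccos (x \<bullet> y))"

lemma integrable_gdist: "norm y = 1 ==> integrable P (\<lambda>x. G x y * clip_arccos (x \<bullet> y))"
 using clip_arccos_bounds by (intro integrable_G_bounded[where B = pi]) auto

lemma integrable_mom1: "norm y = 1 ==> integrable P (\<lambda>x. G x y * (1 - x \<bullet> y))"
 by (intro integrable_mult_continuous G_integrable continuous_intros)

lemma mom_1_eq: assumes y: "norm y = 1" shows "mom y 1 = (LINT x|P. G x y * (1 - x \<bullet> y))"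
 unfolding mom_def
proof (rule integral_cong_AE)
 show "AE x in P. G x y * (1 - x \<bullet> y) powr 1 = G x y * (1 - x \<bullet> y)"
  using AE_norm by eventually_elim (use inner_bounds[OF _ y] in simp)
qed measurable

lemma mom_1_le:
 assumes y: "norm y = 1" shows "mom y 1 \<le> eps\<^sup>2 * n"
proof -
 have "mom y 1 * 1 \<le> mom y 1 * (1 + eps\<^sup>2 * n)"
  using mom_nonneg[OF y] n_nonneg by (intro mult_left_mono) auto
 then show ?thesis using mom_1[OF y] by simp
qed

text \<open>\<open>arccos_sqrt_bound\<close> integrated against the nonnegative kernel. By
  \<open>mom_1_le\<close> the error is of order eps^2.\<close>

lemma gdist_moment:
 assumes y: "norm y = 1"
 shows "\<bar>gdist y - sqrt 2 * mom y (1 / 2)\<bar> \<le> 4 * mom y 1"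
proof -
 have i: "integrable P (\<lambda>x. sqrt 2 * (G x y * (1 - x \<bullet> y) powr (1 / 2)))" using integrable_mom[OF y, of "1/2"] by simp
 have "gdist y - sqrt 2 * mom y (1 / 2) = (LINT x|P. G x y * clip_arccos (x \<bullet> y) - sqrt 2 * (G x y * (1 - x \<bullet> y) powr (1 / 2)))"
  unfolding gdist_def mom_def using integrable_gdist[OF y] i by simp
 also have "\<bar>\<dots>\<bar> \<le> (LINT x|P. \<bar>G x y * clip_arccos (x \<bullet> y) - sqrt 2 * (G x y * (1 - x \<bullet> y) powr (1 / 2))\<bar>)"
  by (rule integral_abs_bound)
 also have "\<dots> \<le> (LINT x|P. 4 * (G x y * (1 - x \<bullet> y)))"
 proof (rule integral_mono_AE)
  show "AE x in P. \<bar>G x y * clip_arccos (x \<bullet> y) - sqrt 2 * (G x y * (1 - x \<bullet> y) powr (1 / 2))\<bar> \<le> 4 * (G x y * (1 - x \<bullet> y))"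
   using AE_norm
  proof eventually_elim
   case (elim x)
   have b: "-1 \<le> x \<bullet> y" "x \<bullet> y \<le> 1" using inner_bounds[OF elim y] by auto
   have "G x y * \<bar>clip_arccos (x \<bullet> y) - sqrt 2 * (1 - x \<bullet> y) powr (1 / 2)\<bar> \<le> G x y * (4 * (1 - x \<bullet> y))"
    using arccos_sqrt_bound[OF b] b G_nonneg[OF elim y] by (intro mult_left_mono) (auto simp: clip_arccos_eq abs_le_iff)
   moreover have "G x y * clip_arccos (x \<bullet> y) - sqrt 2 * (G x y * (1 - x \<bullet> y) powr (1 / 2))
     = G x y * (clip_arccos (x \<bullet> y) - sqrt 2 * (1 - x \<bullet> y) powr (1 / 2))" by (simp add: algebra_simps)
   ultimately show ?case using G_nonneg[OF elim y] by (simp only: abs_mult abs_of_nonneg)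
  qed
 qed (use integrable_gdist[OF y] i integrable_mom1[OF y] in auto)
 also have "\<dots> = 4 * mom y 1" by (simp add: mom_1_eq[OF y])
 finally show ?thesis .
qed

lemma double_integral_upper:
 assumes V: "var_bound A V" and A: "A \<in> sets borel" and y: "norm y = 1"
 shows "(\<integral>\<^sup>+x. \<integral>\<^sup>+y. ennreal (G x y) * ennreal \<bar>indicator A x - indicator A y\<bar> \<partial>P \<partial>P) \<le> ennreal (\<kappa> * V * gdist y)"
proof -
 have "(\<integral>\<^sup>+x. ennreal (G x y) * ennreal (chord_var A (clip_arccos (x \<bullet> y))) \<partial>P)
   \<le> (\<integral>\<^sup>+x. ennreal (\<kappa> * V * (G x y * clip_arccos (x \<bullet> y))) \<partial>P)"
 proof (rule nn_integral_mono_AE, use AE_norm in eventually_elim)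
  case (elim x)
  have "G x y * chord_var A (clip_arccos (x \<bullet> y)) \<le> G x y * (\<kappa> * V * \<bar>clip_arccos (x \<bullet> y)\<bar>)"
   using chord_var_upper[OF V A] G_nonneg[OF elim y] by (intro mult_left_mono) auto
  then show ?case
   using G_nonneg[OF elim y] clip_arccos_bounds[of "x \<bullet> y"] chord_nonneg
   by (simp add: ennreal_mult[symmetric] mult_ac ennreal_leI)
 qed
 also have "\<dots> = ennreal (LINT x|P. \<kappa> * V * (G x y * clip_arccos (x \<bullet> y)))"
 proof (rule nn_integral_eq_integral)
  show "integrable P (\<lambda>x. \<kappa> * V * (G x y * clip_arccos (x \<bullet> y)))" using integrable_gdist[OF y] by simp
  have "V \<ge> 0" using V by (simp add: var_bound_def)
  then show "AE x in P. 0 \<le> \<kappa> * V * (G x y * clip_arccos (x \<bullet> y))"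
   using AE_norm by (auto elim!: eventually_mono intro!: mult_nonneg_nonneg \<kappa>_nonneg G_nonneg y clip_arccos_bounds)
 qed
 finally show ?thesis by (simp add: double_integral_chord[OF A y] gdist_def)
qed

text \<open>Below distance \<rho> the hypothesis applies. Beyond it m d is at most |m| pi and 1 - x
  \<bullet> y at least 1 - cos \<rho>, so the far part is paid for by the first moment. The slope m
  may be negative.\<close>

lemma double_integral_lower:
 assumes A: "A \<in> sets borel" and y: "norm y = 1" and \<rho>: "0 < \<rho>" "\<rho> \<le> pi"
  and m: "\<And>r. 0 < r ==> r < \<rho> ==> m * r \<le> chord_var A r"
 shows "ennreal (m * gdist y - \<bar>m\<bar> * pi / (1 - cos \<rho>) * mom y 1)
  \<le> (\<integral>\<^sup>+x. \<integral>\<^sup>+y. ennreal (G x y) * ennreal \<bar>indicator A x - indicator A y\<bar> \<partial>P \<partial>P)"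
proof -
 define C where "C = \<bar>m\<bar> * pi / (1 - cos \<rho>)"
 have cr: "cos \<rho> < 1" using cos_monotone_0_pi[of 0 \<rho>] \<rho> by simp
 have C: "C \<ge> 0" unfolding C_def using cr by (intro divide_nonneg_nonneg mult_nonneg_nonneg) auto
 have i: "integrable P (\<lambda>x. m * (G x y * clip_arccos (x \<bullet> y)) - C * (G x y * (1 - x \<bullet> y)))"
  using integrable_gdist[OF y] integrable_mom1[OF y] by simp
 have "m * gdist y - C * mom y 1 = (LINT x|P. m * (G x y * clip_arccos (x \<bullet> y)) - C * (G x y * (1 - x \<bullet> y)))"
  using integrable_gdist[OF y] integrable_mom1[OF y] by (simp add: gdist_def mom_1_eq[OF y])
 then have "ennreal (m * gdist y - C * mom y 1) \<le> (\<integral>\<^sup>+x. ennreal (m * (G x y * clip_arccos (x \<bullet> y)) - C * (G x y * (1 - x \<bullet> y))) \<partial>P)"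
  using ennreal_integral_le_nn_integral[OF i] by simp
 also have "\<dots> \<le> (\<integral>\<^sup>+x. ennreal (G x y) * ennreal (chord_var A (clip_arccos (x \<bullet> y))) \<partial>P)"
 proof (rule nn_integral_mono_AE, use AE_norm in eventually_elim)
  case (elim x)
  define c where "c = x \<bullet> y"
  define d where "d = clip_arccos c"
  have c: "\<bar>c\<bar> \<le> 1" using inner_bounds[OF elim y] by (simp add: c_def abs_le_iff)
  then have dc: "cos d = c" by (simp add: d_def clip_arccos_eq cos_arccos_abs)
  have d: "0 \<le> d" "d \<le> pi" unfolding d_def by (rule clip_arccos_bounds)+
  have c1: "0 \<le> 1 - c" using c by (simp add: abs_le_iff)
  have "m * d - C * (1 - c) \<le> chord_var A d"
  proof (cases "d < \<rho>")
   case True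
   have "m * d \<le> chord_var A d" using m[of d] True d chord_nonneg[of A d] by (cases "d = 0") auto
   moreover have "0 \<le> C * (1 - c)" using C c1 by simp
   ultimately show ?thesis by simp
  next
   case False
   then have "c \<le> cos \<rho>" using cos_monotone_0_pi_le[of \<rho> d] \<rho> d dc by simp
   then have "1 \<le> (1 - c) / (1 - cos \<rho>)" using cr by (simp add: le_divide_eq)
   from mult_left_mono[OF this, of "\<bar>m\<bar> * pi"] have "\<bar>m\<bar> * pi \<le> C * (1 - c)" by (simp add: C_def)
   moreover have "m * d \<le> \<bar>m\<bar> * pi" using d by (intro mult_mono) auto
   ultimately show ?thesis using chord_nonneg[of A d] by linarith
  qed
  from mult_left_mono[OF this G_nonneg[OF elim y]]
  have "m * (G x y * d) - C * (G x y * (1 - c)) \<le> G x y * chord_var A d" by (simp add: algebra_simps)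
  then show ?case
   unfolding c_def[symmetric] d_def[symmetric]
   using G_nonneg[OF elim y] chord_nonneg[of A d] by (simp add: ennreal_mult[symmetric] ennreal_leI)
 qed
 finally show ?thesis by (simp add: double_integral_chord[OF A y] C_def)
qed

end

section \<open>Perimeter and variation bounds\<close>

text \<open>The base point selected in \<open>gamma_eps\<close>.\<close>

definition sphere_pole :: "(real^'n) \<times> real" where
 "sphere_pole = (SOME y. y \<in> sphere 0 1)"

lemma norm_sphere_pole: "norm (sphere_pole :: (real^'n) \<times> real) = 1"
proof -
 have "(0, 1) \<in> sphere (0 :: (real^'n) \<times> real) 1" by (simp add: norm_prod_def)
 then have "sphere_pole \<in> sphere (0 :: (real^'n) \<times> real) 1" unfolding sphere_pole_def by (rule someI)
 then show ?thesis by simp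
qed

lemma integral_indicator_cong_borel:
 fixes g :: "(real^'n) \<times> real => real"
 assumes A: "A \<in> sets sphere_vol" and B [measurable]: "B \<in> sets borel"
  and AB: "AE x in sphere_vol. x \<in> A \<longleftrightarrow> x \<in> B" and g [measurable]: "g \<in> borel_measurable borel"
 shows "(LINT x|sphere_vol. indicator A x * g x) = chart_area TYPE('n) * (LINT x|sphere_prob. indicator B x * g x)"
proof -
 have gm: "g \<in> borel_measurable sphere_vol" by (rule measurable_sphere_vol[OF g])
 have "(LINT x|sphere_vol. indicator A x * g x) = (LINT x|sphere_vol. indicator B x * g x)"
 proof (rule integral_cong_AE)
  show "AE x in sphere_vol. indicator A x * g x = indicator B x * g x"
   using AB by eventually_elim (auto simp: indicator_def)
  show "(\<lambda>x. indicator A x * g x) \<in> borel_measurable sphere_vol" using A gm by measurable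
  show "(\<lambda>x. indicator B x * g x) \<in> borel_measurable sphere_vol" by (rule measurable_sphere_vol) measurable
 qed
 also have "\<dots> = chart_area TYPE('n) * (LINT x|sphere_prob. indicator B x * g x)"
  by (rule integral_sphere_vol(2)) measurable
 finally show ?thesis .
qed

lemma Per_eq:
 fixes \<Omega> :: "((real^'n) \<times> real) set"
 assumes A: "\<Omega> \<in> sets sphere_vol" and B: "B \<in> sets borel" and AB: "AE x in sphere_vol. x \<in> \<Omega> \<longleftrightarrow> x \<in> B"
  and X: "smooth_vector_field X"
 shows "(LINT x|sphere_vol. indicator \<Omega> x * sphere_div X x) = chart_area TYPE('n) * (LINT x|sphere_prob. indicator B x * sphere_div X x)"
 by (rule integral_indicator_cong_borel[OF A B AB borel_measurable_sphere_div])
  (use X in \<open>simp add: smooth_vector_field_def\<close>)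

lemma le_Per:
 assumes "smooth_vector_field X" "\<And>x. norm x = 1 ==> norm (X x) \<le> 1"
 shows "ereal (LINT x|sphere_vol. indicator \<Omega> x * sphere_div X x) \<le> Per \<Omega>"
 unfolding Per_def variation_def by (rule SUP_upper) (use assms in simp)

lemma Per_nonneg: "0 \<le> Per (\<Omega> :: ((real^'n) \<times> real) set)"
proof -
 have p: "polynomial_function (\<lambda>x :: (real^'n) \<times> real. 0 :: (real^'n) \<times> real)" by simp
 have X: "smooth_vector_field (\<lambda>x :: (real^'n) \<times> real. 0)"
  unfolding smooth_vector_field_def using smooth_sphere_polynomial[OF p] by simp
 have "sphere_div (\<lambda>x :: (real^'n) \<times> real. 0) x = 0" if "norm x = 1" for x
  using sphere_div_eq[OF has_derivative_const[of "0 :: (real^'n) \<times> real"] that] by simp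
 then have "(LINT x|sphere_vol. indicator \<Omega> x * sphere_div (\<lambda>x :: (real^'n) \<times> real. 0) x) = (LINT x|(sphere_vol :: ((real^'n) \<times> real) measure). 0)"
  by (intro Bochner_Integration.integral_cong refl) simp
 then show ?thesis using le_Per[OF X, of \<Omega>] by (simp add: zero_ereal_def)
qed

lemma var_bound_Per:
 fixes \<Omega> :: "((real^'n) \<times> real) set"
 assumes A: "\<Omega> \<in> sets sphere_vol" and B: "B \<in> sets borel" and AB: "AE x in sphere_vol. x \<in> \<Omega> \<longleftrightarrow> x \<in> B"
  and p: "Per \<Omega> = ereal p"
 shows "sph.var_bound B (p / chart_area TYPE('n))"
proof -
 have w: "chart_area TYPE('n) > 0" by (rule chart_area_pos)
 have "p \<ge> 0" using Per_nonneg[of \<Omega>] p by simp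
 moreover have "(LINT x|sphere_prob. indicator B x * sphere_div X x) \<le> p / chart_area TYPE('n)"
  if X: "smooth_vector_field X" "\<forall>x\<in>sphere 0 1. norm (X x) \<le> 1" for X
  using le_Per[of X \<Omega>] X Per_eq[OF A B AB X(1)] w by (simp add: p field_simps)
 ultimately show ?thesis using w unfolding sph.var_bound_def by simp
qed

section \<open>Limits of the energies\<close>

locale helmholtz_family =
 fixes K :: "real => (real^'n) \<times> real => (real^'n) \<times> real => real"
 assumes card: "2 \<le> CARD('n)" and kernel: "\<And>eps. 0 < eps ==> helmholtz_kernel eps (K eps)"
begin

lemma green: "0 < eps ==> sphere_green sphere_prob (green_of (K eps)) eps (real CARD('n))"
 by (rule sphere_green_helmholtz[OF _ kernel])

definition mean_dist :: "real => real" where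
 "mean_dist eps = (LINT x|sphere_prob. green_of (K eps) x sphere_pole * clip_arccos (x \<bullet> sphere_pole))"

lemma gdist_eq: "0 < eps ==> sphere_green.gdist sphere_prob (green_of (K eps)) sphere_pole = mean_dist eps"
 by (simp add: sphere_green.gdist_def[OF green] mean_dist_def)

text \<open>By \<open>gdist_moment\<close> the mean distance is sqrt 2 times the moment of order 1/2
  up to an error of order eps^2, so \<open>half_moment_limit\<close> supplies the limit.\<close>

lemma mean_dist_limit: "\<exists>L>0. ((\<lambda>eps. mean_dist eps / eps) \<longlongrightarrow> L) (at_right 0)"
proof -
 define M where "M eps a = sphere_green.mom sphere_prob (green_of (K eps)) sphere_pole a" for eps a
 note np = norm_sphere_pole
 have "\<exists>L>0. ((\<lambda>eps. M eps (1 / 2) / eps) \<longlongrightarrow> L) (at_right 0)"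
 proof (rule half_moment_limit[where n = "real CARD('n)"])
  show "1 \<le> real CARD('n)" using card by simp
  fix eps a :: real assume e: "0 < eps"
  show "0 \<le> M eps a" unfolding M_def by (rule sphere_green.mom_nonneg[OF green[OF e] np])
  show "M eps 0 = 1" unfolding M_def by (rule sphere_green.mom_0[OF green[OF e] np])
  show "M eps a * (1 + eps\<^sup>2 * (a * (a - 1 + real CARD('n)))) = eps\<^sup>2 * (a * (2 * a - 2 + real CARD('n))) * M eps (a - 1)" if "1 \<le> a"
  proof (cases "a = 1")
   case True
   then show ?thesis unfolding M_def
    using sphere_green.mom_1[OF green[OF e] np] sphere_green.mom_0[OF green[OF e] np] by simp
  next
   case False
   then show ?thesis unfolding M_def using that by (intro sphere_green.mom_recurrence[OF green[OF e] np]) simp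
  qed
  show "(M eps (a + 1 / 2))\<^sup>2 \<le> M eps a * M eps (a + 1)" if "0 \<le> a"
   unfolding M_def by (rule sphere_green.mom_log_convex[OF green[OF e] np that])
 qed
 then obtain L where L: "L > 0" "((\<lambda>eps. M eps (1 / 2) / eps) \<longlongrightarrow> L) (at_right 0)" by blast
 have "((\<lambda>eps. mean_dist eps / eps - sqrt 2 * (M eps (1 / 2) / eps)) \<longlongrightarrow> 0) (at_right 0)"
 proof (rule Lim_null_comparison)
  have "((\<lambda>eps. 4 * (eps * real CARD('n))) \<longlongrightarrow> 4 * (0 * real CARD('n))) (at_right 0)" by (intro tendsto_intros)
  then show "((\<lambda>eps. 4 * (eps * real CARD('n))) \<longlongrightarrow> 0) (at_right 0)" by simp
  have "norm (mean_dist eps / eps - sqrt 2 * (M eps (1 / 2) / eps)) \<le> 4 * (eps * real CARD('n))" if e: "0 < eps" for eps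
  proof -
   have "\<bar>mean_dist eps - sqrt 2 * M eps (1 / 2)\<bar> \<le> 4 * (eps\<^sup>2 * real CARD('n))"
    using sphere_green.gdist_moment[OF green[OF e] np] sphere_green.mom_1_le[OF green[OF e] np]
    by (simp add: gdist_eq[OF e] M_def)
   then have "\<bar>mean_dist eps - sqrt 2 * M eps (1 / 2)\<bar> / eps \<le> 4 * (eps\<^sup>2 * real CARD('n)) / eps"
    using e by (intro divide_right_mono) auto
   then show ?thesis using e by (simp add: power2_eq_square diff_divide_distrib[symmetric] abs_divide)
  qed
  then show "\<forall>\<^sub>F eps in at_right 0. norm (mean_dist eps / eps - sqrt 2 * (M eps (1 / 2) / eps)) \<le> 4 * (eps * real CARD('n))"
   by (auto simp: eventually_at_right_field intro!: exI[of _ 1])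
 qed
 from tendsto_add[OF this tendsto_mult_left[OF L(2), of "sqrt 2"]]
 have "((\<lambda>eps. mean_dist eps / eps) \<longlongrightarrow> sqrt 2 * L) (at_right 0)" by simp
 then show ?thesis using L(1) by (intro exI[of _ "sqrt 2 * L"]) simp
qed

lemma k_const_pos: "0 < k_const CARD('n)"
proof -
 have "0 < sphere_area (CARD('n) - 2)" "0 < sphere_area (CARD('n) - 1)"
  unfolding sphere_area_def by (auto intro!: mult_pos_pos)
 then show ?thesis using card unfolding k_const_def by (intro mult_pos_pos divide_pos_pos) auto
qed

lemma gamma_eps_eq: "0 < eps ==> gamma_eps K eps = 1 / (k_const CARD('n) * (mean_dist eps / eps))"
proof -
 assume e: "0 < eps"
 let ?y = "sphere_pole :: (real^'n) \<times> real"
 define \<omega> where "\<omega> = chart_area TYPE('n)"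
 have w: "\<omega> > 0" unfolding \<omega>_def by (rule chart_area_pos)
 interpret sg: sphere_green sphere_prob "green_of (K eps)" eps "real CARD('n)" by (rule green[OF e])
 have Gm: "(\<lambda>x. green_of (K eps) x ?y * clip_arccos (x \<bullet> ?y)) \<in> borel_measurable borel" by measurable
 have "(LINT x|sphere_vol. geod_dist x ?y / eps * K eps x ?y) = (LINT x|sphere_vol. 1 / (eps * \<omega>) * (green_of (K eps) x ?y * clip_arccos (x \<bullet> ?y)))"
 proof (intro Bochner_Integration.integral_cong refl)
  fix x :: "(real^'n) \<times> real" assume "x \<in> space sphere_vol"
  then have x: "norm x = 1" by simp
  have d: "\<bar>x \<bullet> ?y\<bar> \<le> 1" using Cauchy_Schwarz_ineq2[of x ?y] x norm_sphere_pole[where 'n='n] by simp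
  have "geod_dist x ?y = arccos (x \<bullet> ?y)" using card by (intro geod_dist_eq x norm_sphere_pole) simp
  \<comment> \<open>At the base point the open diagonal value of \<open>K\<close> is multiplied by
    the distance 0.\<close>
  moreover have "arccos (x \<bullet> ?y) = 0" if "x = ?y" using norm_sphere_pole[where 'n='n] that by (simp add: norm_eq_1)
  ultimately show "geod_dist x ?y / eps * K eps x ?y = 1 / (eps * \<omega>) * (green_of (K eps) x ?y * clip_arccos (x \<bullet> ?y))"
   using w e by (simp add: clip_arccos_eq[OF d] green_of_unit[OF x norm_sphere_pole] \<omega>_def)
 qed
 also have "\<dots> = 1 / (eps * \<omega>) * (\<omega> * mean_dist eps)"
  by (simp only: integral_mult_right_zero integral_sphere_vol(2)[OF Gm] mean_dist_def \<omega>_def)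
 also have "\<dots> = mean_dist eps / eps" using w by simp
 finally have I: "(LINT x|sphere_vol. geod_dist x ?y / eps * K eps x ?y) = mean_dist eps / eps" .
 show ?thesis unfolding gamma_eps_def sphere_pole_def[symmetric] I ..
qed

lemma gamma_eps_tendsto:
 obtains L where "L > 0" "((\<lambda>eps. mean_dist eps / eps) \<longlongrightarrow> L) (at_right 0)"
  "gamma_crit K = 1 / (k_const CARD('n) * L)" "(gamma_eps K \<longlongrightarrow> gamma_crit K) (at_right 0)"
proof -
 obtain L where L: "L > 0" "((\<lambda>eps. mean_dist eps / eps) \<longlongrightarrow> L) (at_right 0)" using mean_dist_limit by blast
 have "((\<lambda>eps. 1 / (k_const CARD('n) * (mean_dist eps / eps))) \<longlongrightarrow> 1 / (k_const CARD('n) * L)) (at_right 0)"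
  using k_const_pos L by (intro tendsto_intros) auto
 moreover have "\<forall>\<^sub>F eps in at_right 0. 1 / (k_const CARD('n) * (mean_dist eps / eps)) = gamma_eps K eps"
  using gamma_eps_eq by (auto simp: eventually_at_right_field intro!: exI[of _ 1])
 ultimately have t: "(gamma_eps K \<longlongrightarrow> 1 / (k_const CARD('n) * L)) (at_right 0)" by (rule Lim_transform_eventually)
 then have "gamma_crit K = 1 / (k_const CARD('n) * L)" unfolding gamma_crit_def by (intro tendsto_Lim) simp
 with t L show ?thesis by (intro that) auto
qed

definition nonlocal :: "real => ((real^'n) \<times> real) set => real" where
 "nonlocal eps \<Omega> = (LINT (x, y)|(sphere_vol \<Otimes>\<^sub>M sphere_vol). K eps x y * \<bar>indicator \<Omega> x - indicator \<Omega> y\<bar>)"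

text \<open>The difference of indicators vanishes on the diagonal, so \<open>green_of\<close> can
  replace \<open>K\<close>, and its positivity allows Tonelli. The two measures contribute two
  factors of the area, and \<open>green_of\<close> absorbs one.\<close>

lemma nonlocal_eq:
 assumes e: "0 < eps" and A: "\<Omega> \<in> sets sphere_vol" and B [measurable]: "B \<in> sets borel"
  and AB: "AE x in sphere_vol. x \<in> \<Omega> \<longleftrightarrow> x \<in> B"
 shows "nonlocal eps \<Omega> = chart_area TYPE('n) *
  enn2real (\<integral>\<^sup>+x. \<integral>\<^sup>+y. ennreal (green_of (K eps) x y) * ennreal \<bar>indicator B x - indicator B y\<bar> \<partial>sphere_prob \<partial>sphere_prob)"
proof -
 define \<omega> where "\<omega> = chart_area TYPE('n)"
 have w: "\<omega> > 0" unfolding \<omega>_def by (rule chart_area_pos)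
 define G where "G = green_of (K eps)"
 interpret sg: sphere_green sphere_prob G eps "real CARD('n)" unfolding G_def by (rule green[OF e])
 interpret sv: finite_measure "sphere_vol :: ((real^'n) \<times> real) measure" by (rule finite_sphere_vol)
 define f where "f u = 1 / \<omega> * (G (fst u) (snd u) * \<bar>indicator \<Omega> (fst u) - indicator \<Omega> (snd u)\<bar>)" for u
 have idm: "(\<lambda>x. x) \<in> measurable (sphere_vol :: ((real^'n) \<times> real) measure) borel"
  by (rule measurable_sphere_vol) simp
 have Gs: "(\<lambda>u. G (fst u) (snd u)) \<in> borel_measurable (sphere_vol \<Otimes>\<^sub>M sphere_vol)"
  by (rule sg.G_comp; rule measurable_compose[OF _ idm]; measurable)
 have fm: "f \<in> borel_measurable (sphere_vol \<Otimes>\<^sub>M sphere_vol)"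
  unfolding f_def using Gs A by measurable
 have "nonlocal eps \<Omega> = (LINT u|(sphere_vol \<Otimes>\<^sub>M sphere_vol). f u)"
  unfolding nonlocal_def
 proof (intro Bochner_Integration.integral_cong refl)
  fix u :: "((real^'n) \<times> real) \<times> ((real^'n) \<times> real)" assume "u \<in> space (sphere_vol \<Otimes>\<^sub>M sphere_vol)"
  then have u: "norm (fst u) = 1" "norm (snd u) = 1" by (auto simp: space_pair_measure)
  show "(case u of (x, y) => K eps x y * \<bar>indicator \<Omega> x - indicator \<Omega> y\<bar>) = f u"
   using w by (simp add: case_prod_beta' f_def G_def green_of_unit[OF u] \<omega>_def)
 qed
 also have "\<dots> = enn2real (\<integral>\<^sup>+u. ennreal (f u) \<partial>(sphere_vol \<Otimes>\<^sub>M sphere_vol))"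
 proof (rule integral_eq_nn_integral[OF fm], rule AE_I2)
  fix u :: "((real^'n) \<times> real) \<times> ((real^'n) \<times> real)" assume "u \<in> space (sphere_vol \<Otimes>\<^sub>M sphere_vol)"
  then have u: "norm (fst u) = 1" "norm (snd u) = 1" by (auto simp: space_pair_measure)
  show "0 \<le> f u" using w sg.G_nonneg[OF u] by (simp add: f_def)
 qed
 also have "(\<integral>\<^sup>+u. ennreal (f u) \<partial>(sphere_vol \<Otimes>\<^sub>M sphere_vol)) = (\<integral>\<^sup>+x. \<integral>\<^sup>+y. ennreal (f (x, y)) \<partial>sphere_vol \<partial>sphere_vol)"
  by (rule sv.nn_integral_fst[symmetric]) (use fm in measurable)
 also have "\<dots> = (\<integral>\<^sup>+x. \<integral>\<^sup>+y. ennreal (1 / \<omega>) * (ennreal (G x y) * ennreal \<bar>indicator B x - indicator B y\<bar>) \<partial>sphere_vol \<partial>sphere_vol)"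
 proof (rule nn_integral_cong_AE)
  show "AE x in sphere_vol. (\<integral>\<^sup>+y. ennreal (f (x, y)) \<partial>sphere_vol)
    = (\<integral>\<^sup>+y. ennreal (1 / \<omega>) * (ennreal (G x y) * ennreal \<bar>indicator B x - indicator B y\<bar>) \<partial>sphere_vol)"
   using AB AE_space[of sphere_vol]
  proof eventually_elim
   case x: (elim x)
   show ?case
   proof (rule nn_integral_cong_AE, use AB AE_space[of sphere_vol] in eventually_elim)
    case (elim y)
    have "0 \<le> G x y" using x elim by (intro sg.G_nonneg) auto
    moreover have "indicator \<Omega> x = (indicator B x :: real)" "indicator \<Omega> y = (indicator B y :: real)"
     using x elim by (auto simp: indicator_def)
    ultimately show ?case using w by (simp add: f_def ennreal_mult[symmetric])
   qed
  qed
 qed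
 also have "\<dots> = (\<integral>\<^sup>+x. (\<integral>\<^sup>+y. ennreal (G x y) * ennreal \<bar>indicator B x - indicator B y\<bar> \<partial>sphere_prob) \<partial>sphere_vol)"
 proof (rule nn_integral_cong)
  fix x :: "(real^'n) \<times> real"
  have "(\<integral>\<^sup>+y. ennreal (1 / \<omega>) * (ennreal (G x y) * ennreal \<bar>indicator B x - indicator B y\<bar>) \<partial>sphere_vol)
    = ennreal \<omega> * (\<integral>\<^sup>+y. ennreal (1 / \<omega>) * (ennreal (G x y) * ennreal \<bar>indicator B x - indicator B y\<bar>) \<partial>sphere_prob)"
   unfolding \<omega>_def by (rule nn_integral_sphere_vol) measurable
  also have "\<dots> = ennreal \<omega> * (ennreal (1 / \<omega>) * (\<integral>\<^sup>+y. ennreal (G x y) * ennreal \<bar>indicator B x - indicator B y\<bar> \<partial>sphere_prob))"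
   by (subst nn_integral_cmult) (auto simp: sph.measurable_P)
  also have "\<dots> = (\<integral>\<^sup>+y. ennreal (G x y) * ennreal \<bar>indicator B x - indicator B y\<bar> \<partial>sphere_prob)"
   using w by (simp add: mult.assoc[symmetric] ennreal_mult[symmetric])
  finally show "(\<integral>\<^sup>+y. ennreal (1 / \<omega>) * (ennreal (G x y) * ennreal \<bar>indicator B x - indicator B y\<bar>) \<partial>sphere_vol)
    = (\<integral>\<^sup>+y. ennreal (G x y) * ennreal \<bar>indicator B x - indicator B y\<bar> \<partial>sphere_prob)" .
 qed
 also have "\<dots> = ennreal \<omega> * (\<integral>\<^sup>+x. (\<integral>\<^sup>+y. ennreal (G x y) * ennreal \<bar>indicator B x - indicator B y\<bar> \<partial>sphere_prob) \<partial>sphere_prob)"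
  unfolding \<omega>_def by (rule nn_integral_sphere_vol) (rule sph.borel_measurable_nn_integral, measurable)
 finally show ?thesis using w by (simp add: enn2real_mult G_def \<omega>_def)
qed

lemma nonlocal_upper:
 assumes e: "0 < eps" and A: "\<Omega> \<in> sets sphere_vol" and p: "Per \<Omega> = ereal p"
 shows "nonlocal eps \<Omega> \<le> k_const CARD('n) * p * mean_dist eps"
proof -
 define \<omega> where "\<omega> = chart_area TYPE('n)"
 have w: "\<omega> > 0" unfolding \<omega>_def by (rule chart_area_pos)
 obtain B where B: "B \<in> sets borel" "AE x in sphere_vol. x \<in> \<Omega> \<longleftrightarrow> x \<in> B" using borel_version[OF A] .
 note vb = var_bound_Per[OF A B p]
 have p0: "0 \<le> p" using Per_nonneg[of \<Omega>] p by simp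
 have m0: "0 \<le> mean_dist eps"
  unfolding mean_dist_def
  by (rule integral_nonneg_AE, use sph.AE_norm in eventually_elim)
   (intro mult_nonneg_nonneg clip_arccos_bounds sphere_green.G_nonneg[OF green[OF e]] norm_sphere_pole)
 have "enn2real (\<integral>\<^sup>+x. \<integral>\<^sup>+y. ennreal (green_of (K eps) x y) * ennreal \<bar>indicator B x - indicator B y\<bar> \<partial>sphere_prob \<partial>sphere_prob)
   \<le> enn2real (ennreal (rotation_invariant_prob.\<kappa> (sphere_prob :: ((real^'n) \<times> real) measure) * (p / \<omega>) * mean_dist eps))"
  using sphere_green.double_integral_upper[OF green[OF e] vb B(1) norm_sphere_pole]
  by (intro enn2real_mono) (simp_all add: gdist_eq[OF e] \<omega>_def)
 also have "\<dots> = k_const CARD('n) * (p / \<omega>) * mean_dist eps"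
  using p0 m0 w k_const_pos by (simp add: kappa_sphere[OF card])
 finally have "\<omega> * enn2real (\<integral>\<^sup>+x. \<integral>\<^sup>+y. ennreal (green_of (K eps) x y) * ennreal \<bar>indicator B x - indicator B y\<bar> \<partial>sphere_prob \<partial>sphere_prob)
   \<le> \<omega> * (k_const CARD('n) * (p / \<omega>) * mean_dist eps)" using w by (intro mult_left_mono) auto
 then show ?thesis using w by (simp add: nonlocal_eq[OF e A B] \<omega>_def)
qed

text \<open>\<open>chord_var_lower\<close> is effective near distance 0; \<open>C\<close> collects
  the far part, a first moment bounded by eps^2 times the dimension.\<close>

lemma nonlocal_lower:
 assumes A: "\<Omega> \<in> sets sphere_vol" and p: "Per \<Omega> = ereal p"
  and X: "smooth_vector_field X" "\<And>x. norm x = 1 ==> norm (X x) \<le> 1" and \<eta>: "0 < \<eta>"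
 obtains C where "\<And>eps. 0 < eps ==>
  (k_const CARD('n) * (LINT x|sphere_vol. indicator \<Omega> x * sphere_div X x) - \<eta>) * mean_dist eps - C * eps\<^sup>2 \<le> nonlocal eps \<Omega>"
proof -
 define \<omega> where "\<omega> = chart_area TYPE('n)"
 have w: "\<omega> > 0" unfolding \<omega>_def by (rule chart_area_pos)
 obtain B where B: "B \<in> sets borel" "AE x in sphere_vol. x \<in> \<Omega> \<longleftrightarrow> x \<in> B" using borel_version[OF A] .
 note vb = var_bound_Per[OF A B p]
 define I where "I = (LINT x|sphere_prob. indicator B x * sphere_div X x)"
 define m where "m = k_const CARD('n) * I - \<eta> / \<omega>"
 have "\<eta> / \<omega> > 0" using \<eta> w by simp
 from sph.chord_var_lower[OF vb B(1) X this]
 have "\<forall>\<^sub>F r in at_right 0. m \<le> sph.chord_var B r / r" by (simp add: kappa_sphere[OF card] I_def m_def)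
 then obtain b where b: "b > 0" "\<And>r. 0 < r ==> r < b ==> m \<le> sph.chord_var B r / r"
  unfolding eventually_at_right_field by auto
 define \<rho> where "\<rho> = min b pi"
 have \<rho>: "0 < \<rho>" "\<rho> \<le> pi" using b(1) by (auto simp: \<rho>_def)
 have mr: "m * r \<le> sph.chord_var B r" if "0 < r" "r < \<rho>" for r
  using b(2)[of r] that by (simp add: \<rho>_def le_divide_eq)
 define C where "C = \<omega> * (\<bar>m\<bar> * pi / (1 - cos \<rho>) * real CARD('n))"
 have C0: "0 \<le> \<bar>m\<bar> * pi / (1 - cos \<rho>)" by (intro divide_nonneg_nonneg mult_nonneg_nonneg) auto
 show ?thesis
 proof (rule that)
  fix eps :: real assume e: "0 < eps"
  define J where "J = (\<integral>\<^sup>+x. \<integral>\<^sup>+y. ennreal (green_of (K eps) x y) * ennreal \<bar>indicator B x - indicator B y\<bar> \<partial>sphere_prob \<partial>sphere_prob)"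
  have fin: "J \<noteq> top"
   using sphere_green.double_integral_upper[OF green[OF e] vb B(1) norm_sphere_pole]
   unfolding J_def by (metis ennreal_neq_top neq_top_trans)
  define q where "q = m * mean_dist eps - \<bar>m\<bar> * pi / (1 - cos \<rho>) * sphere_green.mom sphere_prob (green_of (K eps)) sphere_pole 1"
  have "ennreal q \<le> J"
   using sphere_green.double_integral_lower[OF green[OF e] B(1) norm_sphere_pole \<rho> mr] unfolding J_def q_def gdist_eq[OF e] .
  then have "enn2real (ennreal q) \<le> enn2real J" using fin by (intro enn2real_mono) (auto simp: less_top)
  then have "q \<le> enn2real J" using order_trans[of q 0, OF _ enn2real_nonneg[of J]] by (cases "q \<ge> 0") auto
  moreover have "m * mean_dist eps - \<bar>m\<bar> * pi / (1 - cos \<rho>) * (eps\<^sup>2 * real CARD('n)) \<le> q"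
   unfolding q_def by (intro diff_left_mono mult_left_mono C0 sphere_green.mom_1_le[OF green[OF e] norm_sphere_pole])
  ultimately have "\<omega> * (m * mean_dist eps - \<bar>m\<bar> * pi / (1 - cos \<rho>) * (eps\<^sup>2 * real CARD('n))) \<le> \<omega> * enn2real J"
   using w by (intro mult_left_mono) auto
  moreover have "\<omega> * enn2real J = nonlocal eps \<Omega>" unfolding J_def \<omega>_def by (rule nonlocal_eq[OF e A B, symmetric])
  moreover have "\<omega> * m = k_const CARD('n) * (LINT x|sphere_vol. indicator \<Omega> x * sphere_div X x) - \<eta>"
   using w unfolding Per_eq[OF A B X(1)] by (simp add: m_def I_def \<omega>_def right_diff_distrib)
  moreover have "\<omega> * (m * mean_dist eps - \<bar>m\<bar> * pi / (1 - cos \<rho>) * (eps\<^sup>2 * real CARD('n)))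
    = (\<omega> * m) * mean_dist eps - C * eps\<^sup>2" by (simp add: C_def algebra_simps)
  ultimately show "(k_const CARD('n) * (LINT x|sphere_vol. indicator \<Omega> x * sphere_div X x) - \<eta>) * mean_dist eps - C * eps\<^sup>2 \<le> nonlocal eps \<Omega>" by simp
 qed
qed

end

lemma integral_sym_diff_bound:
 fixes g :: "(real^'n) \<times> real => real"
 assumes A: "A \<in> sets sphere_vol" and B: "B \<in> sets sphere_vol" and g: "g \<in> borel_measurable borel"
  and C: "\<And>x. norm x = 1 ==> \<bar>g x\<bar> \<le> C"
 shows "\<bar>(LINT x|sphere_vol. indicator A x * g x) - (LINT x|sphere_vol. indicator B x * g x)\<bar> \<le> C * measure sphere_vol (sym_diff A B)"
proof -
 interpret sv: finite_measure "sphere_vol :: ((real^'n) \<times> real) measure" by (rule finite_sphere_vol)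
 have gm [measurable]: "g \<in> borel_measurable sphere_vol" by (rule measurable_sphere_vol[OF g])
 note [measurable] = A B
 have i: "integrable sphere_vol (\<lambda>x. indicator D x * g x)" if [measurable]: "D \<in> sets sphere_vol" for D
 proof (rule sv.integrable_const_bound[where B = C])
  show "AE x in sphere_vol. norm (indicator D x * g x) \<le> C"
   using AE_space
  proof eventually_elim
   case (elim x)
   then have "\<bar>g x\<bar> \<le> C" by (intro C) simp
   then show ?case by (auto simp: indicator_def)
  qed
 qed measurable
 have S: "sym_diff A B \<in> sets sphere_vol" by measurable
 have "\<bar>(LINT x|sphere_vol. indicator A x * g x) - (LINT x|sphere_vol. indicator B x * g x)\<bar>
   = \<bar>(LINT x|sphere_vol. indicator A x * g x - indicator B x * g x)\<bar>"
  using i[OF A] i[OF B] by simp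
 also have "\<dots> \<le> (LINT x|sphere_vol. \<bar>indicator A x * g x - indicator B x * g x\<bar>)" by (rule integral_abs_bound)
 also have "\<dots> \<le> (LINT x|sphere_vol. C * indicator (sym_diff A B) x)"
 proof (rule integral_mono)
  fix x :: "(real^'n) \<times> real" assume "x \<in> space sphere_vol"
  then have "\<bar>g x\<bar> \<le> C" by (intro C) simp
  then show "\<bar>indicator A x * g x - indicator B x * g x\<bar> \<le> C * indicator (sym_diff A B) x"
   by (auto simp: indicator_def)
 qed (use i[OF A] i[OF B] S in \<open>auto simp: sv.emeasure_finite less_top[symmetric]\<close>)
 also have "\<dots> = C * measure sphere_vol (sym_diff A B \<inter> sphere 0 1)" using S by simp
 also have "sym_diff A B \<inter> sphere 0 1 = sym_diff A B"
  using sets.sets_into_space[OF S] unfolding space_sphere_vol by (rule Int_absorb2)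
 finally show ?thesis .
qed

lemma tendsto_integral_sym_diff:
 fixes g :: "(real^'n) \<times> real => real"
 assumes A: "A \<in> sets sphere_vol" and S: "\<And>eps. 0 < eps ==> S eps \<in> sets sphere_vol"
  and lim: "((\<lambda>eps. measure sphere_vol (sym_diff A (S eps))) \<longlongrightarrow> 0) (at_right 0)"
  and g: "g \<in> borel_measurable borel" and C: "\<And>x. norm x = 1 ==> \<bar>g x\<bar> \<le> C"
 shows "((\<lambda>eps. (LINT x|sphere_vol. indicator (S eps) x * g x)) \<longlongrightarrow> (LINT x|sphere_vol. indicator A x * g x)) (at_right (0::real))"
proof (rule Lim_transform[OF tendsto_const], rule Lim_null_comparison)
 have "norm ((LINT x|sphere_vol. indicator (S eps) x * g x) - (LINT x|sphere_vol. indicator A x * g x))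
   \<le> C * measure sphere_vol (sym_diff A (S eps))" if "0 < eps" for eps
  using integral_sym_diff_bound[OF A S[OF that] g C] by (simp add: abs_minus_commute)
 then show "\<forall>\<^sub>F eps in at_right 0. norm ((LINT x|sphere_vol. indicator (S eps) x * g x) - (LINT x|sphere_vol. indicator A x * g x))
   \<le> C * measure sphere_vol (sym_diff A (S eps))"
  by (auto simp: eventually_at_right_field intro!: exI[of _ 1])
 show "((\<lambda>eps. C * measure sphere_vol (sym_diff A (S eps))) \<longlongrightarrow> 0) (at_right 0)"
  using tendsto_mult_left[OF lim, of C] by simp
qed

lemma admissible_Per:
 assumes "\<Omega> \<in> admissible \<theta>"
 obtains p where "Per \<Omega> = ereal p" "0 \<le> p"
proof -
 have "Per \<Omega> < \<infinity>" using assms by (simp add: admissible_def BV_def Per_def)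
 then show ?thesis using Per_nonneg[of \<Omega>] that by (cases "Per \<Omega>") auto
qed

lemma admissible_iff:
 assumes "\<Omega> \<in> sets (sphere_vol :: ((real^'n) \<times> real) measure)"
 shows "\<Omega> \<in> admissible \<theta> \<longleftrightarrow> Per \<Omega> < \<infinity> \<and> measure sphere_vol \<Omega> = \<theta>"
proof -
 interpret sv: finite_measure "sphere_vol :: ((real^'n) \<times> real) measure" by (rule finite_sphere_vol)
 have "integrable sphere_vol (indicator \<Omega> :: _ => real)"
  using assms by (simp add: sv.emeasure_finite less_top[symmetric])
 moreover have "\<Omega> \<subseteq> sphere 0 1" using sets.sets_into_space[OF assms] by simp
 ultimately show ?thesis by (simp add: admissible_def BV_def Per_def)
qed

context helmholtz_family begin

lemma energy_eq:
 assumes "\<Omega> \<in> admissible \<theta>" "Per \<Omega> = ereal p"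
 shows "energy K \<theta> \<gamma> eps \<Omega> = ereal (p - \<gamma> / eps * nonlocal eps \<Omega>)"
 using assms by (simp add: energy_def nonlocal_def)

text \<open>Because \<kappa> = k_n, the bound in \<open>nonlocal_upper\<close> is exactly \<gamma> /
  \<open>gamma_eps\<close> times the perimeter, without error term. The perimeter is then weakened
  to the pairing with a single field, which is continuous under L1 convergence.\<close>

lemma energy_lower:
 assumes e: "0 < eps" and A: "\<Omega> \<in> sets sphere_vol" and g: "0 < \<gamma>" "\<gamma> < gamma_eps K eps"
  and X: "smooth_vector_field X" "\<And>x. norm x = 1 ==> norm (X x) \<le> 1"
 shows "ereal ((1 - \<gamma> / gamma_eps K eps) * (LINT x|sphere_vol. indicator \<Omega> x * sphere_div X x)) \<le> energy K \<theta> \<gamma> eps \<Omega>"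
proof (cases "\<Omega> \<in> admissible \<theta>")
 case True
 obtain p where p: "Per \<Omega> = ereal p" "0 \<le> p" using admissible_Per[OF True] .
 have "\<gamma> / eps * nonlocal eps \<Omega> \<le> \<gamma> / eps * (k_const CARD('n) * p * mean_dist eps)"
  using g e by (intro mult_left_mono nonlocal_upper[OF e A p(1)]) auto
 also have "\<dots> = \<gamma> / gamma_eps K eps * p" by (simp add: gamma_eps_eq[OF e])
 finally have "(1 - \<gamma> / gamma_eps K eps) * p \<le> p - \<gamma> / eps * nonlocal eps \<Omega>" by (simp add: left_diff_distrib)
 moreover have "(1 - \<gamma> / gamma_eps K eps) * (LINT x|sphere_vol. indicator \<Omega> x * sphere_div X x) \<le> (1 - \<gamma> / gamma_eps K eps) * p"
  using le_Per[OF X, of \<Omega>] p g by (intro mult_left_mono) auto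
 ultimately show ?thesis by (simp add: energy_eq[OF True p(1)])
next
 case False
 then show ?thesis by (simp add: energy_def)
qed

text \<open>For a fixed field the lower bound converges; the supremum over fields is taken last,
  which contains the lower semicontinuity of the perimeter. Sets that are not admissible are covered
  too: infinite perimeter by the same bound, wrong volume because the approximating sets eventually
  have wrong volume.\<close>

lemma liminf_inequality:
 assumes \<gamma>: "0 < \<gamma>" "\<gamma> < gamma_crit K" and A: "\<Omega> \<in> sets sphere_vol"
  and S: "\<And>eps. 0 < eps ==> S eps \<in> sets sphere_vol"
  and lim: "((\<lambda>eps. measure sphere_vol (sym_diff \<Omega> (S eps))) \<longlongrightarrow> 0) (at_right 0)"
 shows "limit_energy K \<theta> \<gamma> \<Omega> \<le> Liminf (at_right 0) (\<lambda>eps. energy K \<theta> \<gamma> eps (S eps))" (is "_ \<le> ?Z")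
proof -
 define c where "c = 1 - \<gamma> / gamma_crit K"
 have c: "0 < c" using \<gamma> by (simp add: c_def)
 have gl: "(gamma_eps K \<longlongrightarrow> gamma_crit K) (at_right 0)" by (rule gamma_eps_tendsto)
 have pos: "\<forall>\<^sub>F eps in at_right (0::real). 0 < eps" by (simp add: eventually_at_right_less)
 have field: "ereal c * ereal (LINT x|sphere_vol. indicator \<Omega> x * sphere_div X x) \<le> ?Z"
  if X: "smooth_vector_field X" "\<And>x. norm x = 1 ==> norm (X x) \<le> 1" for X
 proof -
  have sX: "smooth_sphere X" using X(1) by (simp add: smooth_vector_field_def)
  obtain C where C: "\<And>x. norm x = 1 ==> \<bar>sphere_div X x\<bar> \<le> C" using sph.sphere_div_bounded[OF sX] by blast
  have J: "((\<lambda>eps. (LINT x|sphere_vol. indicator (S eps) x * sphere_div X x)) \<longlongrightarrow> (LINT x|sphere_vol. indicator \<Omega> x * sphere_div X x)) (at_right 0)"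
   by (rule tendsto_integral_sym_diff[OF A S lim borel_measurable_sphere_div[OF sX] C])
  have h: "((\<lambda>eps. (1 - \<gamma> / gamma_eps K eps) * (LINT x|sphere_vol. indicator (S eps) x * sphere_div X x))
    \<longlongrightarrow> c * (LINT x|sphere_vol. indicator \<Omega> x * sphere_div X x)) (at_right 0)"
   unfolding c_def using \<gamma> by (intro tendsto_intros gl J) auto
  have "ereal (c * (LINT x|sphere_vol. indicator \<Omega> x * sphere_div X x))
    = Liminf (at_right 0) (\<lambda>eps. ereal ((1 - \<gamma> / gamma_eps K eps) * (LINT x|sphere_vol. indicator (S eps) x * sphere_div X x)))"
   by (rule lim_imp_Liminf[symmetric]) (use tendsto_ereal[OF h] in auto)
  also have "\<dots> \<le> ?Z"
  proof (rule Liminf_mono)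
   have "\<forall>\<^sub>F eps in at_right 0. \<gamma> < gamma_eps K eps" by (rule order_tendstoD(1)[OF gl \<gamma>(2)])
   then show "\<forall>\<^sub>F eps in at_right 0. ereal ((1 - \<gamma> / gamma_eps K eps) * (LINT x|sphere_vol. indicator (S eps) x * sphere_div X x)) \<le> energy K \<theta> \<gamma> eps (S eps)"
    using pos by eventually_elim (rule energy_lower[OF _ S \<gamma>(1) _ X])
  qed
  finally show ?thesis by simp
 qed
 have "Per \<Omega> \<le> ?Z / ereal c"
  unfolding Per_def variation_def
  by (rule SUP_least, subst ereal_le_divide_pos) (use c field in auto)
 then have per: "ereal c * Per \<Omega> \<le> ?Z" using c by (subst (asm) ereal_le_divide_pos) auto
 consider "\<Omega> \<in> admissible \<theta>" | "Per \<Omega> = \<infinity>" | "measure sphere_vol \<Omega> \<noteq> \<theta>"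
  using admissible_iff[OF A] by fastforce
 then show ?thesis
 proof cases
  case 1
  then show ?thesis using per by (simp add: limit_energy_def c_def)
 next
  case 2
  then show ?thesis using per c by simp
 next
  case 3
  have "((\<lambda>eps. (LINT x|sphere_vol. indicator (S eps) x * (1::real))) \<longlongrightarrow> (LINT x|sphere_vol. indicator \<Omega> x * (1::real))) (at_right 0)"
   by (rule tendsto_integral_sym_diff[OF A S lim, of "\<lambda>_. 1" 1]) auto
  then have "((\<lambda>eps. measure sphere_vol (S eps \<inter> sphere 0 1)) \<longlongrightarrow> measure sphere_vol (\<Omega> \<inter> sphere 0 1)) (at_right 0)" by simp
  moreover have "\<Omega> \<inter> sphere 0 1 = \<Omega>" using sets.sets_into_space[OF A] by auto
  ultimately have "\<forall>\<^sub>F eps in at_right 0. measure sphere_vol (S eps \<inter> sphere 0 1) \<noteq> \<theta>"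
   using 3 by (intro tendsto_imp_eventually_ne) auto
  then have "\<forall>\<^sub>F eps in at_right 0. energy K \<theta> \<gamma> eps (S eps) = \<infinity>"
   using pos
  proof eventually_elim
   case (elim eps)
   have "S eps \<inter> sphere 0 1 = S eps" using sets.sets_into_space[OF S[OF elim(2)]] by auto
   then show ?case using elim admissible_iff[OF S[OF elim(2)], of \<theta>] by (simp add: energy_def)
  qed
  then have "Liminf (at_right (0::real)) (\<lambda>_. \<infinity> :: ereal) \<le> ?Z"
   by (intro Liminf_mono) (auto elim: eventually_mono)
  then show ?thesis by (simp add: Liminf_const)
 qed
qed

text \<open>A field almost optimal for the perimeter makes the nonlocal term almost as large as
  \<open>nonlocal_upper\<close> allows, already for the constant sequence.\<close>

lemma limsup_inequality:
 assumes \<gamma>: "0 < \<gamma>" "\<gamma> < gamma_crit K" and A: "\<Omega> \<in> sets sphere_vol"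
 shows "Limsup (at_right 0) (\<lambda>eps. energy K \<theta> \<gamma> eps \<Omega>) \<le> limit_energy K \<theta> \<gamma> \<Omega>"
proof (cases "\<Omega> \<in> admissible \<theta>")
 case True
 define k where "k = k_const CARD('n)"
 have k: "k > 0" unfolding k_def by (rule k_const_pos)
 obtain p where p: "Per \<Omega> = ereal p" "0 \<le> p" using admissible_Per[OF True] .
 obtain L where L: "L > 0" "((\<lambda>eps. mean_dist eps / eps) \<longlongrightarrow> L) (at_right 0)" "gamma_crit K = 1 / (k * L)"
  unfolding k_def by (rule gamma_eps_tendsto)
 define b where "b = \<gamma> / gamma_crit K"
 have b: "b = \<gamma> * k * L" using L(3) by (simp add: b_def)
 have b01: "0 < b" "b < 1" using \<gamma> by (simp_all add: b_def)
 have "Limsup (at_right 0) (\<lambda>eps. energy K \<theta> \<gamma> eps \<Omega>) \<le> ereal ((1 - b) * p) + ereal \<eta>" if \<eta>: "0 < \<eta>" for \<eta>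
 proof -
  have "ereal (p - \<eta> / 2) < Per \<Omega>" using p \<eta> by simp
  then obtain X where X: "smooth_vector_field X" "\<And>x. norm x = 1 ==> norm (X x) \<le> 1"
   and I: "p - \<eta> / 2 < (LINT x|sphere_vol. indicator \<Omega> x * sphere_div X x)"
   unfolding Per_def variation_def less_SUP_iff by auto
  define I' where "I' = (LINT x|sphere_vol. indicator \<Omega> x * sphere_div X x)"
  \<comment> \<open>Makes \<gamma> e L = \<eta> / 2; the other half of \<open>\<eta>\<close> pays
    for the choice of the field.\<close>
  define e where "e = \<eta> / (2 * \<gamma> * L)"
  have e: "e > 0" using \<eta> \<gamma> L by (simp add: e_def)
  obtain C where C: "\<And>eps. 0 < eps ==> (k * I' - e) * mean_dist eps - C * eps\<^sup>2 \<le> nonlocal eps \<Omega>"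
   using nonlocal_lower[OF A p(1) X e] unfolding k_def I'_def by blast
  have u: "((\<lambda>eps. p - \<gamma> * ((k * I' - e) * (mean_dist eps / eps) - C * eps)) \<longlongrightarrow> p - \<gamma> * ((k * I' - e) * L - C * 0)) (at_right 0)"
   by (intro tendsto_intros L)
  have "Limsup (at_right 0) (\<lambda>eps. energy K \<theta> \<gamma> eps \<Omega>)
    \<le> Limsup (at_right 0) (\<lambda>eps. ereal (p - \<gamma> * ((k * I' - e) * (mean_dist eps / eps) - C * eps)))"
  proof (rule Limsup_mono)
   have "energy K \<theta> \<gamma> eps \<Omega> \<le> ereal (p - \<gamma> * ((k * I' - e) * (mean_dist eps / eps) - C * eps))" if "0 < eps" for eps
   proof -
    have "\<gamma> / eps * ((k * I' - e) * mean_dist eps - C * eps\<^sup>2) \<le> \<gamma> / eps * nonlocal eps \<Omega>"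
     using that \<gamma> by (intro mult_left_mono C) auto
    moreover have "\<gamma> / eps * ((k * I' - e) * mean_dist eps - C * eps\<^sup>2) = \<gamma> * ((k * I' - e) * (mean_dist eps / eps) - C * eps)"
     using that by (simp add: field_simps power2_eq_square)
    ultimately show ?thesis by (simp add: energy_eq[OF True p(1)])
   qed
   then show "\<forall>\<^sub>F eps in at_right 0. energy K \<theta> \<gamma> eps \<Omega> \<le> ereal (p - \<gamma> * ((k * I' - e) * (mean_dist eps / eps) - C * eps))"
    by (auto simp: eventually_at_right_field intro!: exI[of _ 1])
  qed
  also have "\<dots> = ereal (p - \<gamma> * ((k * I' - e) * L - C * 0))"
   by (rule lim_imp_Limsup) (use tendsto_ereal[OF u] in auto)
  also have "p - \<gamma> * ((k * I' - e) * L - C * 0) \<le> (1 - b) * p + \<eta>"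
  proof -
   have "\<gamma> * e * L = \<eta> / 2" using \<gamma> L by (simp add: e_def)
   then have "p - \<gamma> * ((k * I' - e) * L - C * 0) = p - b * I' + \<eta> / 2" by (simp add: b algebra_simps)
   moreover have "b * (p - \<eta> / 2) \<le> b * I'" using b01 I by (intro mult_left_mono) (auto simp: I'_def)
   moreover have "b * (\<eta> / 2) \<le> 1 * (\<eta> / 2)" using b01 \<eta> by (intro mult_right_mono) auto
   ultimately show ?thesis by (simp add: algebra_simps)
  qed
  finally show ?thesis by simp
 qed
 then have "Limsup (at_right 0) (\<lambda>eps. energy K \<theta> \<gamma> eps \<Omega>) \<le> ereal ((1 - b) * p)"
  by (rule ereal_le_epsilon2[rule_format])
 then show ?thesis using True p by (simp add: limit_energy_def b_def)
next
 case False
 then show ?thesis by (simp add: limit_energy_def)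
qed

end

theorem theorem5p1:
  fixes K :: "real \<Rightarrow> (real^'n) \<times> real \<Rightarrow> (real^'n) \<times> real \<Rightarrow> real"
    and \<theta> \<gamma> :: real
  assumes "2 \<le> CARD('n)"
    and "\<And>\<epsilon>. 0 < \<epsilon> \<Longrightarrow> helmholtz_kernel \<epsilon> (K \<epsilon>)"
    and "0 < \<theta>" and "\<theta> < measure sphere_vol (sphere (0 :: (real^'n) \<times> real) 1)"
    and "0 < \<gamma>" and "\<gamma> < gamma_crit K"
  shows "(\<forall>\<Omega> \<in> sets sphere_vol. \<forall>\<Omega>\<epsilon>.
            (\<forall>\<epsilon>>0. \<Omega>\<epsilon> \<epsilon> \<in> sets sphere_vol) \<longrightarrow>
            ((\<lambda>\<epsilon>. measure sphere_vol (sym_diff \<Omega> (\<Omega>\<epsilon> \<epsilon>))) \<longlongrightarrow> 0) (at_right 0) \<longrightarrow>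
            limit_energy K \<theta> \<gamma> \<Omega> \<le> Liminf (at_right 0) (\<lambda>\<epsilon>. energy K \<theta> \<gamma> \<epsilon> (\<Omega>\<epsilon> \<epsilon>))) \<and>
         (\<forall>\<Omega> \<in> sets sphere_vol. \<exists>\<Omega>\<epsilon>.
            (\<forall>\<epsilon>>0. \<Omega>\<epsilon> \<epsilon> \<in> sets sphere_vol) \<and>
            ((\<lambda>\<epsilon>. measure sphere_vol (sym_diff \<Omega> (\<Omega>\<epsilon> \<epsilon>))) \<longlongrightarrow> 0) (at_right 0) \<and>
            Limsup (at_right 0) (\<lambda>\<epsilon>. energy K \<theta> \<gamma> \<epsilon> (\<Omega>\<epsilon> \<epsilon>)) \<le> limit_energy K \<theta> \<gamma> \<Omega>)"
proof -
 interpret helmholtz_family K by (rule helmholtz_family.intro) (use assms in auto)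
 show ?thesis
 proof (intro conjI ballI allI impI)
  fix \<Omega> :: "((real^'n) \<times> real) set" assume A: "\<Omega> \<in> sets sphere_vol"
  show "limit_energy K \<theta> \<gamma> \<Omega> \<le> Liminf (at_right 0) (\<lambda>\<epsilon>. energy K \<theta> \<gamma> \<epsilon> (S \<epsilon>))"
   if "\<forall>\<epsilon>>0. S \<epsilon> \<in> sets sphere_vol" "((\<lambda>\<epsilon>. measure sphere_vol (sym_diff \<Omega> (S \<epsilon>))) \<longlongrightarrow> 0) (at_right 0)" for S
   using that by (intro liminf_inequality[OF assms(5,6) A]) auto
  show "\<exists>\<Omega>\<epsilon>. (\<forall>\<epsilon>>0. \<Omega>\<epsilon> \<epsilon> \<in> sets sphere_vol) \<and>
    ((\<lambda>\<epsilon>. measure sphere_vol (sym_diff \<Omega> (\<Omega>\<epsilon> \<epsilon>))) \<longlongrightarrow> 0) (at_right 0) \<and>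
    Limsup (at_right 0) (\<lambda>\<epsilon>. energy K \<theta> \<gamma> \<epsilon> (\<Omega>\<epsilon> \<epsilon>)) \<le> limit_energy K \<theta> \<gamma> \<Omega>"
   using A limsup_inequality[OF assms(5,6) A] by (intro exI[of _ "\<lambda>_. \<Omega>"]) simp
 qed
qed

end
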